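(* Let $m,n\in\mathbb{N}$ with $m\le n$, let $\mathcal{O}$ be the ring of integers of a number field, let $\mathfrak p$ be a non-zero prime ideal of $\mathcal{O}$ and let $q$ be its residue field cardinality. Put $\delta_{n,m}=n-m$ and $\overline{a}_{m,n}(i)=(m-i)(n+i)+2i+\delta_{n,m}$. For $w\in B_m$, let $\chi_{m,n}(w)=(-1)^{\mathrm{neg}(w)}$ and $h_{m,n}(w)=\ell(w)+\delta_{n,m}\,\mathrm{neg}(w)$. Then $$\mathcal{Z}^{\mathrm{irr}}_{G_{m,n}(\mathcal{O}_{\mathfrak p})}(s_1,s_2)=\frac{\sum_{w\in B_m}\chi_{m,n}(w)\,q^{-h_{m,n}(w)}\prod_{i\in D(w)}q^{\overline{a}_{m,n}(i)-(m-i)s_1-s_2}}{\prod_{i=0}^{m}\left(1-q^{\overline{a}_{m,n}(i)-(m-i)s_1-s_2}\right)}.$$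
   Context: $\mathbb{N}$ is the set of positive integers; $\mathcal{O}_{\mathfrak p}$ is the completion of $\mathcal{O}$ at $\mathfrak p$. The group scheme $G_{m,n}$: let $\Lambda_{m,n}$ be the $\mathbb{Z}$-Lie lattice with $\mathbb{Z}$-basis $x_1,\dots,x_{m+n}$, $z_{ij}$ ($1\le i\le m$, $1\le j\le n$) and brackets $[x_i,x_{m+j}]=z_{ij}$, all brackets not following formally from these being zero. $G_{m,n}$ is the unipotent group scheme associated with the class-2 nilpotent Lie lattice $\Lambda_{m,n}$. Concretely, for a commutative ring $R$, $G_{m,n}(R)$ is the set $R^m\times R^n\times \mathrm{Mat}_{m\times n}(R)$ with multiplication $(a,b,c)(a',b',c')=(a+a',\,b+b',\,c+c'+a\,(b')^{T})$, where $a,b$ are column vectors. Bivariate representation zeta function: for a finite group $H$, let $r_k(H)$ be the number of irreducible complex characters of $H$ of degree $k$ and $\zeta^{\mathrm{irr}}_H(s)=\sum_{k\ge1}r_k(H)k^{-s}$. Then $\mathcal{Z}^{\mathrm{irr}}_{G_{m,n}(\mathcal{O}_{\mathfrak p})}(s_1,s_2)=\sum_{N\ge0}\zeta^{\mathrm{irr}}_{G_{m,n}(\mathcal{O}/\mathfrak p^N)}(s_1)\,q^{-Ns_2}$. The identity is one of power series in $q^{-s_2}$ with coefficients in $\mathbb{Q}[q^{-s_1}]$ (equivalently, of functions where the series converges). Weyl group of type $B$: $B_m$ is the group of permutations $w$ of $\{-m,\dots,0,\dots,m\}$ with $w(-i)=-w(i)$ for all $i$. Its Coxeter generators are $s_0=(-1,1)$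 and $s_i=(-i-1,-i)(i,i+1)$ for $1\le i\le m-1$. $\ell(w)$ is the Coxeter length of $w$ with respect to these generators. $D(w)$ is the (right) descent set, $D(w)=\{s_i\mid \ell(ws_i)<\ell(w)\}$, identified with the set of indices $\{i\in\{0,\dots,m-1\}\mid \ell(ws_i)<\ell(w)\}$. $\mathrm{neg}(w)=\#\{i\in\{1,\dots,m\}\mid w(i)<0\}$. *)

theory Defs
  imports
    "HOL-Analysis.Complex_Transcendental"
    "HOL-Algebra.Algebra"
    "HOL-Computational_Algebra.Formal_Power_Series"
    "HOL-Combinatorics.Permutations"
    "Jordan_Normal_Form.VS_Connect"
begin

text \<open>The subfield generated by the empty set is the prime field; in characteristic zero it is a copy of the rationals.\<close>

definition number_field :: "('a, 'b) ring_scheme \<Rightarrow> bool" where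
  "number_field K \<longleftrightarrow>
     field K \<and> (\<forall>k::nat. k > 0 \<longrightarrow> add_pow K k \<one>\<^bsub>K\<^esub> \<noteq> \<zero>\<^bsub>K\<^esub>) \<and>
     ring.finite_dimension K (generate_field K {}) (carrier K)"

text \<open>Polynomials are coefficient lists with the leading coefficient first.\<close>

definition integral_element :: "('a, 'b) ring_scheme \<Rightarrow> 'a \<Rightarrow> bool" where
  "integral_element K x \<longleftrightarrow>
     (\<exists>p. p \<noteq> [] \<and> hd p = \<one>\<^bsub>K\<^esub> \<and> set p \<subseteq> range (\<lambda>k::int. add_pow K k \<one>\<^bsub>K\<^esub>) \<and>
          ring.eval K p x = \<zero>\<^bsub>K\<^esub>)"

definition ring_of_integers :: "('a, 'b) ring_scheme \<Rightarrow> ('a, 'b) ring_scheme" where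
  "ring_of_integers K = K\<lparr>carrier := {x \<in> carrier K. integral_element K x}\<rparr>"

text \<open>The power with exponent zero is the unit ideal, so the quotient is then the zero ring.\<close>

definition ideal_power :: "('a, 'b) ring_scheme \<Rightarrow> 'a set \<Rightarrow> nat \<Rightarrow> 'a set" where
  "ideal_power R I N = I [^]\<^bsub>ideals_set R\<^esub> N"


text \<open>The points of the group scheme over \<open>R\<close>: triples \<open>(a, b, c)\<close> of two vectors and a matrix,
  encoded as extensional functions on index sets starting at 1.\<close>

definition group_G ::
  "nat \<Rightarrow> nat \<Rightarrow> ('a, 'b) ring_scheme \<Rightarrow> ((nat \<Rightarrow> 'a) \<times> (nat \<Rightarrow> 'a) \<times> (nat \<times> nat \<Rightarrow> 'a)) monoid" where
  "group_G m n R =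
    \<lparr> carrier = ({1..m} \<rightarrow>\<^sub>E carrier R) \<times> ({1..n} \<rightarrow>\<^sub>E carrier R) \<times>
                ({1..m} \<times> {1..n} \<rightarrow>\<^sub>E carrier R),
      monoid.mult = (\<lambda>(a, b, c) (a', b', c').
        (\<lambda>i\<in>{1..m}. a i \<oplus>\<^bsub>R\<^esub> a' i,
         \<lambda>j\<in>{1..n}. b j \<oplus>\<^bsub>R\<^esub> b' j,
         \<lambda>(i, j)\<in>{1..m} \<times> {1..n}. c (i, j) \<oplus>\<^bsub>R\<^esub> c' (i, j) \<oplus>\<^bsub>R\<^esub> a i \<otimes>\<^bsub>R\<^esub> b' j)),
      monoid.one = (\<lambda>i\<in>{1..m}. \<zero>\<^bsub>R\<^esub>, \<lambda>j\<in>{1..n}. \<zero>\<^bsub>R\<^esub>, \<lambda>ij\<in>{1..m} \<times> {1..n}. \<zero>\<^bsub>R\<^esub>) \<rparr>"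


definition GL :: "nat \<Rightarrow> complex mat monoid" where
  "GL k = units_of (ring_mat TYPE(complex) k ())"

definition irreducible_rep :: "('g, 'b) monoid_scheme \<Rightarrow> nat \<Rightarrow> ('g \<Rightarrow> complex mat) \<Rightarrow> bool" where
  "irreducible_rep H k \<rho> \<longleftrightarrow>
     k > 0 \<and> \<rho> \<in> hom H (GL k) \<and>
     (\<forall>W. VectorSpace.subspace class_ring W (module_vec TYPE(complex) k) \<and>
          (\<forall>g\<in>carrier H. \<forall>v\<in>W. \<rho> g *\<^sub>v v \<in> W)
        \<longrightarrow> W = {0\<^sub>v k} \<or> W = carrier_vec k)"

definition mat_trace :: "complex mat \<Rightarrow> complex" where
  "mat_trace A = (\<Sum>i<dim_row A. A $$ (i, i))"

text \<open>Characters are restricted to the carrier, so that they are counted as functions on the group.\<close>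

definition irr_characters :: "('g, 'b) monoid_scheme \<Rightarrow> nat \<Rightarrow> ('g \<Rightarrow> complex) set" where
  "irr_characters H k = {(\<lambda>g\<in>carrier H. mat_trace (\<rho> g)) | \<rho>. irreducible_rep H k \<rho>}"

definition num_irr :: "('g, 'b) monoid_scheme \<Rightarrow> nat \<Rightarrow> nat" where
  "num_irr H k = card (irr_characters H k)"

definition zeta_irr :: "('g, 'b) monoid_scheme \<Rightarrow> complex \<Rightarrow> complex" where
  "zeta_irr H s = suminf (\<lambda>k. of_nat (num_irr H (Suc k)) * complex_of_nat (Suc k) powr (- s))"

text \<open>The bivariate zeta function of \<open>G\<close> over the completion of \<open>R\<close> at \<open>P\<close>, as a power series in
  the variable \<open>q\<close> to the power \<open>-s\<^sub>2\<close>, for a given value of the first variable.\<close>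

definition bivariate_zeta_irr ::
  "nat \<Rightarrow> nat \<Rightarrow> ('a, 'b) ring_scheme \<Rightarrow> 'a set \<Rightarrow> complex \<Rightarrow> complex fps" where
  "bivariate_zeta_irr m n R P s\<^sub>1 =
     Abs_fps (\<lambda>N. zeta_irr (group_G m n (R Quot (ideal_power R P N))) s\<^sub>1)"


text \<open>The Weyl group of type B, as permutations of the integers that are the identity outside the
  interval from \<open>-m\<close> to \<open>m\<close>.\<close>

definition weyl_B :: "nat \<Rightarrow> (int \<Rightarrow> int) set" where
  "weyl_B m = {w. w permutes {- int m..int m} \<and> (\<forall>i. w (- i) = - w i)}"

definition cox_gen :: "nat \<Rightarrow> int \<Rightarrow> int" where
  "cox_gen i =
     (if i = 0 then Transposition.transpose (- 1) 1
      else Transposition.transpose (- int i - 1) (- int i) \<circ> Transposition.transpose (int i) (int i + 1))"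

definition cox_length :: "nat \<Rightarrow> (int \<Rightarrow> int) \<Rightarrow> nat" where
  "cox_length m w =
     (LEAST l. \<exists>is. length is = l \<and> set is \<subseteq> {0..<m} \<and> w = foldr (\<circ>) (map cox_gen is) id)"

definition descents :: "nat \<Rightarrow> (int \<Rightarrow> int) \<Rightarrow> nat set" where
  "descents m w = {i \<in> {0..<m}. cox_length m (w \<circ> cox_gen i) < cox_length m w}"

definition neg :: "nat \<Rightarrow> (int \<Rightarrow> int) \<Rightarrow> nat" where
  "neg m w = card {i \<in> {1..int m}. w i < 0}"

definition delta :: "nat \<Rightarrow> nat \<Rightarrow> int" where
  "delta n m = int n - int m"

definition abar :: "nat \<Rightarrow> nat \<Rightarrow> nat \<Rightarrow> int" where
  "abar m n i = (int m - int i) * (int n + int i) + 2 * int i + delta n m"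

definition chi :: "nat \<Rightarrow> (int \<Rightarrow> int) \<Rightarrow> int" where
  "chi m w = (- 1) ^ neg m w"

definition h_stat :: "nat \<Rightarrow> nat \<Rightarrow> (int \<Rightarrow> int) \<Rightarrow> int" where
  "h_stat m n w = int (cox_length m w) + delta n m * int (neg m w)"

text \<open>\<open>q\<close> to the power \<open>abar m n i - (m - i) * s\<^sub>1 - s\<^sub>2\<close>, with \<open>fps_X\<close> standing for \<open>q\<close> to the
  power \<open>-s\<^sub>2\<close>.\<close>

definition q_monomial :: "nat \<Rightarrow> nat \<Rightarrow> nat \<Rightarrow> complex \<Rightarrow> nat \<Rightarrow> complex fps" where
  "q_monomial m n q s\<^sub>1 i =
     fps_const (complex_of_nat q powr (of_int (abar m n i) - of_int (int m - int i) * s\<^sub>1)) * fps_X"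

end

theory Submission
  imports
    Defs
    "Jordan_Normal_Form.Char_Poly"
    "HOL-Computational_Algebra.Fundamental_Theorem_Algebra"
begin

text \<open>For \<open>R = \<O>/\<pp>\<^sup>N\<close> choose a generating additive character \<open>\<psi>\<close> of \<open>R\<close>. An irreducible character of
  \<open>G(R)\<close> has a central character \<open>c \<mapsto> \<psi>(tr (Y\<^sup>T c))\<close> for a unique matrix \<open>Y\<close> over \<open>R\<close>, vanishes outside
  the kernels of \<open>Y\<close> on the two abelian blocks, and is determined by \<open>Y\<close> and by characters of these
  two kernels; its degree is the size of the row span of \<open>Y\<close>. Counting the characters of the kernels
  turns the zeta function of \<open>G(R)\<close> at \<open>s\<close> into \<open>q\<^sup>N\<^sup>(\<^sup>m\<^sup>+\<^sup>n\<^sup>)\<close> times the sum of \<open>card (row span Y)\<close> to the power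
  \<open>- s - 2\<close> over all \<open>Y\<close>.

  Splitting off the rank \<open>m - i\<close> of \<open>Y\<close> modulo \<open>\<pp>\<close> reduces this sum over \<open>\<O>/\<pp>\<^sup>N\<close> to \<open>i \<times> (i + n - m)\<close>
  matrices over \<open>\<O>/\<pp>\<^sup>N\<^sup>-\<^sup>1\<close>, and up to a power of \<open>q\<close> the coefficient is a quotient of \<open>q\<close>-factorials. On
  the other side, sorting \<open>w \<in> B\<^sub>m\<close> by its largest descent \<open>i\<close> and factoring it through the parabolic subgroup \<open>B\<^sub>i\<close> gives
  a recursion for the numerator whose coefficient is the signed length generating function of the
  minimal coset representatives, and this is the same quotient. Both generating functions are
  therefore equal.

  That \<open>\<O>/\<pp>\<^sup>N\<close> is a chain ring is shown without unique factorisation of ideals: \<open>\<O>/p\<O>\<close> is finite, so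
  some \<open>b \<notin> p\<O>\<close> satisfies \<open>b \<pp> \<subseteq> p\<O>\<close>, and \<open>\<gamma> = b/p\<close> is not integral, which forces \<open>\<gamma> \<pi> \<notin> \<pp>\<close> for
  some \<open>\<pi> \<in> \<pp>\<close>; then \<open>\<pi>\<close> generates \<open>\<pp>\<close> locally.\<close>

text \<open>Each side is determined by the same triangular linear system of power series in X =
  q^(-s_2), with one unknown for each pair of sizes (i, i + n - m), i \<le> m. On the matrix side
  the system is hidden: when the level N drops by one, powers of q and of q^(-s-2) appear whose
  exponents grow with N. They are N-th powers of ratios of numbers \<open>mu i\<close>, so scaling
  by powers of \<open>mu\<close> makes the coefficients independent of N, and the monomials of the
  statement are the scaled factors. On the group side the system appears only after the product over
  descents is written as a telescoping sum: whether i is a descent of a product is not decided by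
  one of the parabolic factors alone, whereas the absence of descents beyond i is compatible with
  the factorisation. The character theory rests on one identity: if commutators act by scalars, the
  squared degree times the number of group elements acting by scalars is the group order. It yields
  both the degree for given Y and the number of characters.\<close>

section \<open>The Weyl group of type B\<close>

text \<open>The positive roots: for \<open>0 < i < j\<close> the pair \<open>(i, j)\<close> stands for \<open>e\<^sub>j - e\<^sub>i\<close> and \<open>(- i, j)\<close> for
  \<open>e\<^sub>j + e\<^sub>i\<close>, and \<open>(- j, j)\<close> is the short root \<open>e\<^sub>j\<close>.\<close>

definition proots :: "nat \<Rightarrow> (int \<times> int) set" where
  "proots m = {(i, j). 1 \<le> j \<and> j \<le> int m \<and> - j \<le> i \<and> i < j \<and> i \<noteq> 0}"

definition inversions :: "nat \<Rightarrow> (int \<Rightarrow> int) \<Rightarrow> (int \<times> int) set" where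
  "inversions m w = {(i, j) \<in> proots m. w j < w i}"

text \<open>The inversion count stands in for \<open>cox_length\<close>: it changes by exactly one
  under each generator, while a minimum over words allows no such direct computation.\<close>

definition blen :: "nat \<Rightarrow> (int \<Rightarrow> int) \<Rightarrow> nat" where
  "blen m w = card (inversions m w)"

lemma finite_proots: "finite (proots m)"
  by (rule finite_subset[of _ "{- int m..int m} \<times> {- int m..int m}"]) (auto simp: proots_def)

lemma finite_inversions: "finite (inversions m w)"
  by (rule finite_subset[OF _ finite_proots[of m]]) (auto simp: inversions_def)

lemma weyl_B_minus: "w \<in> weyl_B m \<Longrightarrow> w (- x) = - w x"
  by (simp add: weyl_B_def)

lemma weyl_B_zero: "w \<in> weyl_B m \<Longrightarrow> w 0 = 0"
  using weyl_B_minus[of w m 0] by simp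

lemma weyl_B_permutes: "w \<in> weyl_B m \<Longrightarrow> w permutes {- int m..int m}"
  by (simp add: weyl_B_def)

lemma weyl_B_range: "w \<in> weyl_B m \<Longrightarrow> \<bar>x\<bar> \<le> int m \<Longrightarrow> \<bar>w x\<bar> \<le> int m"
  using permutes_in_image[OF weyl_B_permutes, of w m x] by (simp add: abs_le_iff)

lemma weyl_B_outside: "w \<in> weyl_B m \<Longrightarrow> \<bar>x\<bar> > int m \<Longrightarrow> w x = x"
  using permutes_not_in[OF weyl_B_permutes, of w m x] by fastforce

lemma weyl_B_comp: "v \<in> weyl_B m \<Longrightarrow> w \<in> weyl_B m \<Longrightarrow> v \<circ> w \<in> weyl_B m"
  by (auto simp: weyl_B_def intro: permutes_compose)

lemma weyl_B_id: "id \<in> weyl_B m"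
  by (auto simp: weyl_B_def permutes_id)

lemma weyl_B_mono: "i \<le> m \<Longrightarrow> weyl_B i \<subseteq> weyl_B m"
  by (auto simp: weyl_B_def intro: permutes_subset)

lemma finite_weyl_B: "finite (weyl_B m)"
  by (rule finite_subset[OF _ finite_permutations[of "{- int m..int m}"]]) (auto simp: weyl_B_def)

lemma weyl_B_inv: "w \<in> weyl_B m \<Longrightarrow> inv_into UNIV w \<in> weyl_B m"
proof -
  assume w: "w \<in> weyl_B m"
  have b: "bij w" using weyl_B_permutes[OF w] permutes_bij by blast
  have "inv_into UNIV w (- i) = - inv_into UNIV w i" for i
  proof -
    have "w (- inv_into UNIV w i) = - i" using weyl_B_minus[OF w] b by (simp add: bij_is_surj surj_f_inv_f)
    thus ?thesis using b by (metis bij_inv_eq_iff)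
  qed
  thus ?thesis using permutes_inv[OF weyl_B_permutes[OF w]] by (auto simp: weyl_B_def)
qed

lemma cox_gen_apply:
  "cox_gen k x = (if k = 0 then if x = 1 then - 1 else if x = - 1 then 1 else x
     else if x = int k then int k + 1 else if x = int k + 1 then int k
     else if x = - int k then - int k - 1 else if x = - int k - 1 then - int k else x)"
  by (auto simp: cox_gen_def transpose_def)

lemma cox_gen_involutory [simp]: "cox_gen k (cox_gen k x) = x"
  by (auto simp: cox_gen_apply)

lemma cox_gen_comp_self: "w \<circ> cox_gen k \<circ> cox_gen k = w"
  by (rule ext) simp

lemma cox_gen_weyl_B: assumes "k < m" shows "cox_gen k \<in> weyl_B m"
proof -
  have "cox_gen k permutes {- int m..int m}"
    unfolding permutes_def
  proof (intro conjI allI impI)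
    fix x assume "x \<notin> {- int m..int m}"
    thus "cox_gen k x = x" using assms by (auto simp: cox_gen_apply)
  next
    fix y show "\<exists>!x. cox_gen k x = y"
      by (metis cox_gen_involutory)
  qed
  thus ?thesis by (auto simp: weyl_B_def cox_gen_apply)
qed

text \<open>A simple reflection permutes the positive roots other than its own root
  \<open>r\<close>, so only \<open>r\<close> changes its inversion status. Since
  \<open>w 0 = 0\<close>, the assumption for \<open>k = 0\<close> reads \<open>0 < w 1\<close>, and
  one statement covers all generators.\<close>

lemma blen_ascent:
  assumes w: "w \<in> weyl_B m" and k: "k < m" and asc: "w (int k) < w (int k + 1)"
  shows "blen m (w \<circ> cox_gen k) = Suc (blen m w)"
proof -
  define s where "s = cox_gen k"
  define r where "r = (if k = 0 then (- 1, 1) else (int k, int k + 1))"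
  \<comment> \<open>The root \<open>e_(k+1) + e_k\<close> is fixed by the reflection, but applying
    \<open>s\<close> to its code \<open>(- k, k + 1)\<close> gives \<open>(- k - 1, k)\<close>,
    which is not a code in \<open>proots\<close>; hence the exception.\<close>
  define f where "f = (\<lambda>(i, j). if (i, j) = (- int k, int k + 1) then (i, j) else (s i, s j))"
  have f: "f p \<in> proots m - {r} \<and> f (f p) = p" if "p \<in> proots m - {r}" for p
  proof (cases "k = 0")
    case True thus ?thesis using that k
      by (cases p) (auto simp: f_def r_def s_def proots_def cox_gen_apply)
  next
    case False thus ?thesis using that k
      by (cases p) (auto simp: f_def r_def s_def proots_def cox_gen_apply split: if_splits)
  qed
  have inv: "f p \<in> inversions m w \<longleftrightarrow> p \<in> inversions m (w \<circ> s)" if "p \<in> proots m - {r}" for p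
  proof -
    obtain i j where p: "p = (i, j)" by (cases p)
    show ?thesis
    proof (cases "p = (- int k, int k + 1)")
      case True
      hence k0: "k \<noteq> 0" using that by (auto simp: proots_def p)
      show ?thesis using True that k0 weyl_B_minus[OF w, of "int k"] weyl_B_minus[OF w, of "int k + 1"]
        by (auto simp: inversions_def f_def p s_def cox_gen_apply)
    next
      case False
      thus ?thesis using f[OF that] that by (auto simp: inversions_def f_def p)
    qed
  qed
  have "bij_betw f (inversions m (w \<circ> s) - {r}) (inversions m w - {r})"
  proof (rule bij_betw_byWitness[where f' = f])
    show "\<forall>a\<in>inversions m (w \<circ> s) - {r}. f (f a) = a" "\<forall>a'\<in>inversions m w - {r}. f (f a') = a'"
      using f by (auto simp: inversions_def)
    show "f ` (inversions m (w \<circ> s) - {r}) \<subseteq> inversions m w - {r}"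
      using f inv by (fastforce simp: inversions_def)
    show "f ` (inversions m w - {r}) \<subseteq> inversions m (w \<circ> s) - {r}"
    proof
      fix y assume "y \<in> f ` (inversions m w - {r})"
      then obtain p where p: "p \<in> inversions m w" "p \<noteq> r" "y = f p" by auto
      hence "p \<in> proots m - {r}" by (auto simp: inversions_def)
      thus "y \<in> inversions m (w \<circ> s) - {r}" using f[of p] inv[of "f p"] p by auto
    qed
  qed
  hence e: "card (inversions m (w \<circ> s) - {r}) = card (inversions m w - {r})" by (rule bij_betw_same_card)
  have "r \<notin> inversions m w" "r \<in> inversions m (w \<circ> s)"
    using asc k weyl_B_zero[OF w] weyl_B_minus[OF w, of 1]
    by (auto simp: r_def inversions_def proots_def s_def cox_gen_apply)
  hence "card (inversions m w - {r}) = blen m w" "blen m (w \<circ> s) = Suc (card (inversions m (w \<circ> s) - {r}))"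
    using card.remove[OF finite_inversions, of r m "w \<circ> s"] by (simp_all add: blen_def)
  thus ?thesis using e by (simp add: s_def)
qed

lemma blen_descent:
  assumes w: "w \<in> weyl_B m" and k: "k < m" and d: "w (int k + 1) < w (int k)"
  shows "blen m w = Suc (blen m (w \<circ> cox_gen k))"
    and "(w \<circ> cox_gen k) (int k) < (w \<circ> cox_gen k) (int k + 1)"
proof -
  show a: "(w \<circ> cox_gen k) (int k) < (w \<circ> cox_gen k) (int k + 1)"
    using d weyl_B_zero[OF w] weyl_B_minus[OF w, of 1] by (auto simp: cox_gen_apply)
  show "blen m w = Suc (blen m (w \<circ> cox_gen k))"
    using blen_ascent[OF weyl_B_comp[OF w cox_gen_weyl_B[OF k]] k a] unfolding cox_gen_comp_self .
qed

lemma weyl_B_neq: "w \<in> weyl_B m \<Longrightarrow> x \<noteq> y \<Longrightarrow> w x \<noteq> w y"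
  using permutes_inj[OF weyl_B_permutes] by (auto dest: injD)

lemma weyl_B_increasing:
  assumes w: "w \<in> weyl_B m" and asc: "\<And>k. k < i \<Longrightarrow> w (int k) < w (int k + 1)"
    and xy: "- int i \<le> x" "x < y" "y \<le> int i"
  shows "w x < w y"
proof -
  have step: "w z < w (z + 1)" if "- int i \<le> z" "z < int i" for z
  proof (cases "z \<ge> 0")
    case True thus ?thesis using asc[of "nat z"] that by simp
  next
    case False thus ?thesis using asc[of "nat (- z - 1)"] that weyl_B_minus[OF w, of z]
        weyl_B_minus[OF w, of "z + 1"] by simp
  qed
  have "x + int d \<le> int i \<Longrightarrow> d > 0 \<Longrightarrow> w x < w (x + int d)" for d
  proof (induction d)
    case (Suc d)
    have "w (x + int d) < w (x + int d + 1)" using Suc.prems xy by (intro step) auto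
    moreover have "d > 0 \<Longrightarrow> w x < w (x + int d)" using Suc by simp
    ultimately have "w x < w (x + int d + 1)" by (cases "d = 0") auto
    thus ?case by (simp add: algebra_simps)
  qed simp
  from this[of "nat (y - x)"] show ?thesis using xy by simp
qed

text \<open>Strict growth from \<open>w 0 = 0\<close> gives \<open>k \<le> w k\<close>, strict
  growth up to \<open>w m \<le> m\<close> gives the opposite bound, so all values are
  forced.\<close>

lemma weyl_B_no_descent:
  assumes w: "w \<in> weyl_B m" and asc: "\<And>k. k < m \<Longrightarrow> w (int k) < w (int k + 1)"
  shows "w = id"
proof -
  have lo: "k \<le> m \<Longrightarrow> int k \<le> w (int k)" for k
  proof (induction k)
    case (Suc k) thus ?case using asc[of k] by (simp add: add.commute)
  qed (simp add: weyl_B_zero[OF w])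
  have hi: "k \<le> m \<Longrightarrow> w (int (m - k)) \<le> int (m - k)" for k
  proof (induction k)
    case 0 thus ?case using weyl_B_range[OF w, of "int m"] by simp
  next
    case (Suc k) 
    have "int (m - Suc k) + 1 = int (m - k)" using Suc by simp
    thus ?case using asc[of "m - Suc k"] Suc by simp
  qed
  have pos: "w (int k) = int k" if "k \<le> m" for k
    using lo[of k] hi[of "m - k"] that by simp
  have "w x = x" for x
  proof (cases "\<bar>x\<bar> \<le> int m")
    case True
    show ?thesis
    proof (cases "x \<ge> 0")
      case True thus ?thesis using pos[of "nat x"] \<open>\<bar>x\<bar> \<le> int m\<close> by simp
    next
      case False thus ?thesis using pos[of "nat (- x)"] \<open>\<bar>x\<bar> \<le> int m\<close> weyl_B_minus[OF w, of x] by simp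
    qed
  qed (use weyl_B_outside[OF w] in auto)
  thus ?thesis by (simp add: fun_eq_iff)
qed

lemma blen_id [simp]: "blen m id = 0"
proof -
  have "inversions m id = {}" by (auto simp: inversions_def proots_def)
  thus ?thesis by (simp add: blen_def)
qed

lemma weyl_B_descent_cases:
  assumes w: "w \<in> weyl_B m"
  obtains "w = id" | k where "k < m" "w (int k + 1) < w (int k)"
proof (cases "\<exists>k<m. w (int k + 1) < w (int k)")
  case False
  have "w (int k) < w (int k + 1)" if "k < m" for k
    using False that weyl_B_neq[OF w, of "int k" "int k + 1"] by force
  thus ?thesis using weyl_B_no_descent[OF w] that by blast
qed (use that in blast)

section \<open>Words in the generators and the Coxeter length\<close>

definition wprod :: "nat list \<Rightarrow> int \<Rightarrow> int" where
  "wprod ks = foldr (\<circ>) (map cox_gen ks) id"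

lemma wprod_Nil [simp]: "wprod [] = id"
  by (simp add: wprod_def)

lemma wprod_Cons: "wprod (k # ks) = cox_gen k \<circ> wprod ks"
  by (simp add: wprod_def)

lemma wprod_snoc: "wprod (ks @ [k]) = wprod ks \<circ> cox_gen k"
  by (induction ks) (simp_all add: wprod_Cons o_assoc)

lemma wprod_weyl_B: "set ks \<subseteq> {0..<m} \<Longrightarrow> wprod ks \<in> weyl_B m"
proof (induction ks)
  case (Cons k ks)
  hence "cox_gen k \<circ> wprod ks \<in> weyl_B m" by (intro weyl_B_comp cox_gen_weyl_B) auto
  thus ?case by (simp only: wprod_Cons)
qed (simp add: weyl_B_id)

lemma blen_wprod_le: "set ks \<subseteq> {0..<m} \<Longrightarrow> blen m (wprod ks) \<le> length ks"
proof (induction ks rule: rev_induct)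
  case (snoc k ks)
  hence w: "wprod ks \<in> weyl_B m" and k: "k < m" using wprod_weyl_B[of ks m] by auto
  consider "wprod ks (int k) < wprod ks (int k + 1)" | "wprod ks (int k + 1) < wprod ks (int k)"
    using weyl_B_neq[OF w, of "int k" "int k + 1"] by fastforce
  hence "blen m (wprod ks \<circ> cox_gen k) \<le> Suc (blen m (wprod ks))"
    using blen_ascent[OF w k] blen_descent(1)[OF w k] by cases linarith+
  moreover have "blen m (wprod ks) \<le> length ks" using snoc by simp
  ultimately have "blen m (wprod ks \<circ> cox_gen k) \<le> Suc (length ks)" by linarith
  thus ?case by (simp only: wprod_snoc length_append_singleton)
qed simp

text \<open>Each descent removed on the right lowers the inversion count by one, so the word read
  off has exactly \<open>blen m w\<close> letters. By \<open>blen_wprod_le\<close> no word is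
  shorter.\<close>

lemma wprod_exists: "w \<in> weyl_B m \<Longrightarrow> \<exists>ks. length ks = blen m w \<and> set ks \<subseteq> {0..<m} \<and> w = wprod ks"
proof (induction "blen m w" arbitrary: w rule: less_induct)
  case less
  from less.prems show ?case
  proof (cases rule: weyl_B_descent_cases)
    case 1 thus ?thesis by (intro exI[of _ "[]"]) simp
  next
    case (2 k)
    note d = blen_descent[OF less.prems 2]
    obtain ks where ks: "length ks = blen m (w \<circ> cox_gen k)" "set ks \<subseteq> {0..<m}" "w \<circ> cox_gen k = wprod ks"
      using less.hyps[of "w \<circ> cox_gen k"] d(1) weyl_B_comp[OF less.prems cox_gen_weyl_B[OF 2(1)]] by auto
    have "w = wprod (ks @ [k])" unfolding wprod_snoc ks(3)[symmetric] by (simp add: cox_gen_comp_self)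
    thus ?thesis using ks d(1) 2 by (intro exI[of _ "ks @ [k]"]) auto
  qed
qed

lemma cox_length_eq: assumes "w \<in> weyl_B m" shows "cox_length m w = blen m w"
  unfolding cox_length_def wprod_def[symmetric]
proof (rule Least_equality)
  show "\<exists>is. length is = blen m w \<and> set is \<subseteq> {0..<m} \<and> w = wprod is"
    using wprod_exists[OF assms] .
qed (use blen_wprod_le in blast)

lemma descents_eq:
  assumes w: "w \<in> weyl_B m" shows "descents m w = {k \<in> {0..<m}. w (int k + 1) < w (int k)}"
proof -
  have "cox_length m (w \<circ> cox_gen k) < cox_length m w \<longleftrightarrow> w (int k + 1) < w (int k)" if k: "k < m" for k
  proof -
    consider "w (int k) < w (int k + 1)" | "w (int k + 1) < w (int k)"
      using weyl_B_neq[OF w, of "int k" "int k + 1"] by fastforce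
    thus ?thesis
      using blen_ascent[OF w k] blen_descent(1)[OF w k]
      unfolding cox_length_eq[OF w] cox_length_eq[OF weyl_B_comp[OF w cox_gen_weyl_B[OF k]]]
      by cases simp_all
  qed
  hence "k \<in> descents m w \<longleftrightarrow> k \<in> {k \<in> {0..<m}. w (int k + 1) < w (int k)}" for k
    unfolding descents_def mem_Collect_eq atLeastLessThan_iff by blast
  thus ?thesis by (rule Set.set_eqI)
qed

section \<open>Factorisation through parabolic subgroups\<close>

definition min_reps :: "nat \<Rightarrow> nat \<Rightarrow> (int \<Rightarrow> int) set" where
  "min_reps m i = {u \<in> weyl_B m. \<forall>k<m. k \<noteq> i \<longrightarrow> u (int k) < u (int k + 1)}"

text \<open>\<open>min_reps m i\<close> are the minimal coset representatives for the parabolic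
  subgroup generated by all \<open>s_k\<close> with \<open>k \<noteq> i\<close>. Here descents below
  \<open>i\<close> are allowed as well; sorting the entries up to position \<open>i\<close>, with
  signs, by an element of \<open>weyl_B i\<close> removes them.\<close>

definition tail_increasing :: "nat \<Rightarrow> nat \<Rightarrow> (int \<Rightarrow> int) set" where
  "tail_increasing m i = {w \<in> weyl_B m. \<forall>k. i < k \<and> k < m \<longrightarrow> w (int k) < w (int k + 1)}"

lemma min_reps_increasing:
  assumes "u \<in> min_reps m i" "i \<le> m" "- int i \<le> x" "x < y" "y \<le> int i"
  shows "u x < u y"
  by (rule weyl_B_increasing[of u m i]) (use assms in \<open>auto simp: min_reps_def\<close>)

text \<open>\<open>u\<close> is increasing on \<open>- i..i\<close>, which \<open>v\<close>
  preserves, so \<open>u \<circ> v\<close> and \<open>v\<close> have the same descents below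
  \<open>i\<close>. Taking descents off \<open>v\<close> one by one shortens both in step.\<close>

lemma blen_min_reps_comp:
  assumes u: "u \<in> min_reps m i" and i: "i \<le> m" and v: "v \<in> weyl_B i"
  shows "blen m (u \<circ> v) = blen m u + blen i v"
  using v
proof (induction "blen i v" arbitrary: v rule: less_induct)
  case less
  from less.prems show ?case
  proof (cases rule: weyl_B_descent_cases)
    case (2 k)
    define v' where "v' = v \<circ> cox_gen k"
    have v': "v' \<in> weyl_B i" using less.prems 2 cox_gen_weyl_B weyl_B_comp v'_def by blast
    note d = blen_descent[OF less.prems 2, folded v'_def]
    have uv': "u \<circ> v' \<in> weyl_B m" 
      using u v' weyl_B_mono[OF i] weyl_B_comp unfolding min_reps_def by blast
    have "(u \<circ> v') (int k) < (u \<circ> v') (int k + 1)"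
      using min_reps_increasing[OF u i _ d(2)] weyl_B_range[OF v', of "int k"] 
        weyl_B_range[OF v', of "int k + 1"] 2 by auto
    hence "blen m (u \<circ> v' \<circ> cox_gen k) = Suc (blen m (u \<circ> v'))"
      using blen_ascent[OF uv'] 2 i by auto
    moreover have "u \<circ> v' \<circ> cox_gen k = u \<circ> v" by (auto simp: v'_def)
    ultimately show ?thesis using less.hyps[OF _ v'] d(1) by simp
  qed simp
qed

lemma min_reps_neg_iff:
  assumes u: "u \<in> min_reps m i" and i: "i \<le> m" and x: "\<bar>x\<bar> \<le> int i"
  shows "u x < 0 \<longleftrightarrow> x < 0"
proof -
  have "u 0 = 0" using u weyl_B_zero by (auto simp: min_reps_def)
  thus ?thesis using min_reps_increasing[OF u i, of x 0] min_reps_increasing[OF u i, of 0 x] x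
    by (cases "x < 0"; cases "x = 0") auto
qed

text \<open>\<open>u\<close> is positive on \<open>1..i\<close>, so there the sign of
  \<open>u (v j)\<close> is that of \<open>v j\<close>; beyond \<open>i\<close> the element
  \<open>v\<close> is the identity and \<open>u\<close> alone decides.\<close>

lemma neg_min_reps_comp:
  assumes u: "u \<in> min_reps m i" and i: "i \<le> m" and v: "v \<in> weyl_B i"
  shows "neg m (u \<circ> v) = neg m u + neg i v"
proof -
  have "{j \<in> {1..int m}. (u \<circ> v) j < 0} = {j \<in> {1..int m}. u j < 0} \<union> {j \<in> {1..int i}. v j < 0}"
  proof (rule Set.set_eqI)
    fix j
    show "j \<in> {j \<in> {1..int m}. (u \<circ> v) j < 0} \<longleftrightarrow> j \<in> {j \<in> {1..int m}. u j < 0} \<union> {j \<in> {1..int i}. v j < 0}"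
    proof (cases "\<bar>j\<bar> \<le> int i")
      case True
      thus ?thesis using min_reps_neg_iff[OF u i weyl_B_range[OF v True]] min_reps_neg_iff[OF u i True] i
        by auto
    qed (use weyl_B_outside[OF v, of j] in auto)
  qed
  moreover have "{j \<in> {1..int m}. u j < 0} \<inter> {j \<in> {1..int i}. v j < 0} = {}"
  proof -
    have "\<not> u j < 0" if "1 \<le> j" "j \<le> int i" for j
      using that min_reps_neg_iff[OF u i, of j] by simp
    thus ?thesis by auto
  qed
  moreover have "finite {j \<in> {1..int m}. u j < 0}" "finite {j \<in> {1..int i}. v j < 0}"
    by (rule finite_subset[OF Collect_restrict], simp)+
  ultimately show ?thesis unfolding neg_def by (simp only: card_Un_disjoint)
qed

lemma descents_min_reps_comp:
  assumes u: "u \<in> min_reps m i" and i: "i \<le> m" and v: "v \<in> weyl_B i"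
  shows "descents m (u \<circ> v) \<inter> {0..<i} = descents i v"
proof -
  have uv: "u \<circ> v \<in> weyl_B m" using u v weyl_B_mono[OF i] weyl_B_comp unfolding min_reps_def by blast
  have "u (v (int k + 1)) < u (v (int k)) \<longleftrightarrow> v (int k + 1) < v (int k)" if k: "k < i" for k
  proof -
    have b: "\<bar>v (int k)\<bar> \<le> int i" "\<bar>v (int k + 1)\<bar> \<le> int i" "v (int k) \<noteq> v (int k + 1)"
      using weyl_B_range[OF v, of "int k"] weyl_B_range[OF v, of "int k + 1"] k
        weyl_B_neq[OF v, of "int k" "int k + 1"] by auto
    show ?thesis using min_reps_increasing[OF u i, of "v (int k)" "v (int k + 1)"]
        min_reps_increasing[OF u i, of "v (int k + 1)" "v (int k)"] b by force
  qed
  hence "k \<in> descents m (u \<circ> v) \<inter> {0..<i} \<longleftrightarrow> k \<in> descents i v" for k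
    unfolding descents_eq[OF uv] descents_eq[OF v] mem_Collect_eq atLeastLessThan_iff Int_iff o_apply
    using i by (cases "k < i") auto
  thus ?thesis by (rule Set.set_eqI)
qed

lemma parabolic_bij:
  assumes i: "i \<le> m"
  shows "bij_betw (\<lambda>(u, v). u \<circ> v) (min_reps m i \<times> weyl_B i) (tail_increasing m i)"
  unfolding bij_betw_def
proof
  show "inj_on (\<lambda>(u, v). u \<circ> v) (min_reps m i \<times> weyl_B i)"
  proof (rule inj_onI, clarify)
    fix u v u' v'
    assume *: "u \<in> min_reps m i" "u' \<in> min_reps m i" "v \<in> weyl_B i" "v' \<in> weyl_B i" "u \<circ> v = u' \<circ> v'"
    \<comment> \<open>\<open>t\<close> lies in \<open>weyl_B i\<close> and
      \<open>u = u' \<circ> t\<close>. A descent of \<open>t\<close> would survive under the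
      increasing \<open>u'\<close> and become a descent of \<open>u\<close> below
      \<open>i\<close>.\<close>
    define t where "t = v' \<circ> inv_into UNIV v"
    have t: "t \<in> weyl_B i" using * weyl_B_inv weyl_B_comp t_def by blast
    have vv: "v \<circ> inv_into UNIV v = id" using permutes_inv_o(1)[OF weyl_B_permutes[OF *(3)]] .
    have ut: "u = u' \<circ> t" 
      unfolding t_def o_assoc *(5)[symmetric] using vv by (simp add: o_assoc[symmetric])
    have "t = id" using t
    proof (cases rule: weyl_B_descent_cases)
      case (2 k)
      hence "u' (t (int k + 1)) < u' (t (int k))"
        using min_reps_increasing[OF *(2) i, of "t (int k + 1)" "t (int k)"] weyl_B_range[OF t, of "int k"]
          weyl_B_range[OF t, of "int k + 1"] by auto
      moreover have "u (int k) < u (int k + 1)" using *(1) 2 i by (auto simp: min_reps_def)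
      ultimately show ?thesis using ut by simp
    qed
    hence uu: "u = u'" using ut by simp
    have "inj u" using *(1) permutes_inj[OF weyl_B_permutes] by (auto simp: min_reps_def)
    hence "v = v'" using *(5) uu by (metis fun.inj_map_strong inj_compose injD comp_apply ext)
    thus "u = u' \<and> v = v'" using uu by simp
  qed
  have sub: "u \<circ> v \<in> tail_increasing m i" if "u \<in> min_reps m i" "v \<in> weyl_B i" for u v
  proof -
    have "u \<circ> v \<in> weyl_B m" using that weyl_B_mono[OF i] weyl_B_comp unfolding min_reps_def by blast
    moreover have "(u \<circ> v) (int k) < (u \<circ> v) (int k + 1)" if "i < k" "k < m" for k
      using that \<open>u \<in> min_reps m i\<close> weyl_B_outside[OF \<open>v \<in> weyl_B i\<close>, of "int k"]
        weyl_B_outside[OF \<open>v \<in> weyl_B i\<close>, of "int k + 1"] by (auto simp: min_reps_def)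
    ultimately show ?thesis by (auto simp: tail_increasing_def)
  qed
  \<comment> \<open>Induction on the length: a descent below \<open>i\<close> is moved from
    \<open>w\<close> into \<open>v\<close>; when none is left, \<open>w\<close> itself is a minimal
    representative.\<close>
  have sup: "\<exists>u\<in>min_reps m i. \<exists>v\<in>weyl_B i. w = u \<circ> v" if "w \<in> tail_increasing m i" for w
    using that
  proof (induction "blen m w" arbitrary: w rule: less_induct)
    case less
    have w: "w \<in> weyl_B m" using less.prems by (auto simp: tail_increasing_def)
    show ?case
    proof (cases "\<exists>k<i. w (int k + 1) < w (int k)")
      case False
      have "w \<in> min_reps m i"
      proof -
        have "w (int k) < w (int k + 1)" if "k < m" "k \<noteq> i" for k
        proof (cases "k < i")
          case True
          have "w (int k) \<noteq> w (int k + 1)" using weyl_B_neq[OF w] by simp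
          thus ?thesis using False True linorder_cases by blast
        next
          case False
          thus ?thesis using less.prems that by (simp add: tail_increasing_def)
        qed
        thus ?thesis using w by (simp add: min_reps_def)
      qed
      thus ?thesis using weyl_B_id[of i] by (intro bexI[of _ w] bexI[of _ id]) simp_all
    next
      case True
      then obtain k where k: "k < i" "w (int k + 1) < w (int k)" by blast
      define w' where "w' = w \<circ> cox_gen k"
      have km: "k < m" using k i by simp
      have "w' \<in> tail_increasing m i"
        using less.prems weyl_B_comp[OF w cox_gen_weyl_B[OF km]] k
        by (auto simp: tail_increasing_def w'_def cox_gen_apply)
      then obtain u v where uv: "u \<in> min_reps m i" "v \<in> weyl_B i" "w' = u \<circ> v"
        using less.hyps[of w'] blen_descent(1)[OF w km k(2)] unfolding w'_def by auto
      have "w = u \<circ> (v \<circ> cox_gen k)" using uv(3) unfolding w'_def o_assoc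
        by (metis cox_gen_comp_self)
      thus ?thesis using uv weyl_B_comp[OF uv(2) cox_gen_weyl_B[OF k(1)]] by blast
    qed
  qed
  show "(\<lambda>(u, v). u \<circ> v) ` (min_reps m i \<times> weyl_B i) = tail_increasing m i"
    using sub sup by (auto simp: image_iff)
qed

section \<open>Weighted sums over the group and their recursion\<close>

definition wt :: "'r::comm_ring_1 \<Rightarrow> nat \<Rightarrow> nat \<Rightarrow> (int \<Rightarrow> int) \<Rightarrow> 'r" where
  "wt T d m w = (- 1) ^ neg m w * T ^ (blen m w + d * neg m w)"

definition rep_sum :: "'r::comm_ring_1 \<Rightarrow> nat \<Rightarrow> nat \<Rightarrow> nat \<Rightarrow> 'r" where
  "rep_sum T d m i = (\<Sum>u\<in>min_reps m i. wt T d m u)"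

text \<open>For \<open>T = 1/q\<close> and \<open>d = n - m\<close> the weight \<open>wt\<close> is
  \<open>chi\<close> times q to the power \<open>- h_stat\<close>. The ring is left open because the
  closed form of \<open>rep_sum\<close> is computed over a field, while this sum is taken over power
  series.\<close>

definition weyl_sum :: "'r::comm_ring_1 \<Rightarrow> nat \<Rightarrow> nat \<Rightarrow> (nat \<Rightarrow> 'r) \<Rightarrow> 'r" where
  "weyl_sum T d m M = (\<Sum>w\<in>weyl_B m. wt T d m w * (\<Prod>k\<in>descents m w. M k))"

lemma finite_min_reps: "finite (min_reps m i)"
  by (rule finite_subset[OF _ finite_weyl_B[of m]]) (auto simp: min_reps_def)

lemma wt_min_reps_comp:
  assumes "u \<in> min_reps m i" "i \<le> m" "v \<in> weyl_B i"
  shows "wt T d m (u \<circ> v) = wt T d m u * wt T d i v"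
  unfolding wt_def blen_min_reps_comp[OF assms] neg_min_reps_comp[OF assms]
  by (simp add: power_add algebra_simps)

lemma descents_subset: "descents m w \<subseteq> {0..<m}"
  by (auto simp: descents_def)

lemma descents_empty_iff: assumes "w \<in> weyl_B m" shows "descents m w = {} \<longleftrightarrow> w = id"
proof
  assume e: "descents m w = {}"
  show "w = id" using assms
  proof (cases rule: weyl_B_descent_cases)
    case (2 k)
    hence "k \<in> descents m w" using descents_eq[OF assms] by simp
    thus ?thesis using e by simp
  qed
next
  assume "w = id"
  thus "descents m w = {}" using descents_eq[OF assms] by simp
qed

lemma tail_increasing_eq: "tail_increasing m i = {w \<in> weyl_B m. descents m w \<inter> {i<..<m} = {}}"
proof (rule Set.set_eqI)
  fix w
  show "w \<in> tail_increasing m i \<longleftrightarrow> w \<in> {w \<in> weyl_B m. descents m w \<inter> {i<..<m} = {}}"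
  proof (cases "w \<in> weyl_B m")
    case True
    have "w (int k) < w (int k + 1) \<longleftrightarrow> \<not> w (int k + 1) < w (int k)" for k
      using weyl_B_neq[OF True, of "int k" "int k + 1"] by linarith
    thus ?thesis unfolding tail_increasing_def mem_Collect_eq descents_eq[OF True] using True by auto
  qed (simp add: tail_increasing_def)
qed

lemma neg_id: "neg m id = 0"
proof -
  have "{i \<in> {1..int m}. id i < 0} = {}" by auto
  thus ?thesis by (simp only: neg_def card.empty)
qed

lemma wt_id: "wt T d m id = 1"
  by (simp add: wt_def neg_id)

text \<open>Term \<open>i\<close> only asks that no element of \<open>D\<close> exceeds
  \<open>i\<close>, not that \<open>i\<close> lies in \<open>D\<close>, so that later it runs over
  all of \<open>tail_increasing\<close>. The overlap telescopes: over the indices beyond the largest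
  element of \<open>D\<close>, the numbers \<open>M i * (\<Prod>j>i. 1 - M j)\<close> and the
  product of all \<open>1 - M j\<close> add up to 1.\<close>

lemma descent_telescope:
  fixes M :: "nat \<Rightarrow> 'r::comm_ring_1"
  assumes "D \<subseteq> {0..<m}"
  shows "(\<Sum>i<m. if D \<inter> {i<..<m} = {} then (\<Prod>k\<in>D \<inter> {0..<i}. M k) * (M i * (\<Prod>j\<in>{i<..<m}. 1 - M j)) else 0)
     + (if D = {} then \<Prod>j<m. 1 - M j else 0) = (\<Prod>k\<in>D. M k)"
  using assms
proof (induction m)
  case (Suc m)
  let ?g = "\<lambda>m i. if D \<inter> {i<..<m} = {} then (\<Prod>k\<in>D \<inter> {0..<i}. M k) * (M i * (\<Prod>j\<in>{i<..<m}. 1 - M j)) else 0"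
  have fin: "finite D" using Suc.prems finite_subset by blast
  have top: "{m<..<Suc m} = {}" by auto
  show ?case
  proof (cases "m \<in> D")
    case True
    have "?g (Suc m) i = 0" if "i < m" for i
    proof -
      have "m \<in> D \<inter> {i<..<Suc m}" using True that by simp
      thus ?thesis by (metis (no_types, lifting) empty_iff)
    qed
    hence "(\<Sum>i<m. ?g (Suc m) i) = 0" by (intro sum.neutral) blast
    moreover have "D \<inter> {0..<m} = D - {m}" using Suc.prems by auto
    ultimately show ?thesis using True fin top prod.remove[OF fin True, of M] by (auto simp: mult.commute)
  next
    case False
    have sub: "D \<subseteq> {0..<m}" using Suc.prems False by (auto simp: less_Suc_eq)
    have "?g (Suc m) i = (1 - M m) * ?g m i" if "i < m" for i
    proof -
      have "{i<..<Suc m} = insert m {i<..<m}" using that by auto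
      hence "D \<inter> {i<..<Suc m} = D \<inter> {i<..<m}" "(\<Prod>j\<in>{i<..<Suc m}. 1 - M j) = (1 - M m) * (\<Prod>j\<in>{i<..<m}. 1 - M j)"
        using False by auto
      thus ?thesis by (simp add: mult_ac)
    qed
    hence "(\<Sum>i<m. ?g (Suc m) i) = (1 - M m) * (\<Sum>i<m. ?g m i)"
      unfolding sum_distrib_left by (intro sum.cong) auto
    moreover have "(\<Sum>i<m. ?g m i) = (\<Prod>k\<in>D. M k) - (if D = {} then \<Prod>j<m. 1 - M j else 0)"
      using Suc.IH[OF sub] by (simp only: eq_diff_eq)
    moreover have "?g (Suc m) m = (\<Prod>k\<in>D. M k) * M m"
      using sub top by (simp add: Int_absorb2)
    moreover have "(if D = {} then \<Prod>j<Suc m. 1 - M j else 0) = (1 - M m) * (if D = {} then \<Prod>j<m. 1 - M j else 0)"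
      by (simp add: mult.commute)
    ultimately show ?thesis by (simp only: sum.lessThan_Suc right_diff_distrib left_diff_distrib) (simp only: algebra_simps mult_1)
  qed
qed auto

text \<open>\<open>descent_telescope\<close> is put in place of the product over descents. For fixed
  \<open>i\<close> the sum then runs over \<open>tail_increasing m i\<close>, where length,
  \<open>neg\<close> and the descents below \<open>i\<close> split along
  \<open>parabolic_bij\<close>.\<close>

theorem weyl_sum_recursion:
  fixes M :: "nat \<Rightarrow> 'r::comm_ring_1"
  shows "weyl_sum T d m M = (\<Prod>j<m. 1 - M j) +
    (\<Sum>i<m. rep_sum T d m i * weyl_sum T d i M * (M i * (\<Prod>j\<in>{i<..<m}. 1 - M j)))"
proof -
  let ?c = "\<lambda>i. M i * (\<Prod>j\<in>{i<..<m}. 1 - M j)"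
  let ?p = "\<lambda>i w. \<Prod>k\<in>descents m w \<inter> {0..<i}. M k"
  have inner: "(\<Sum>w\<in>tail_increasing m i. wt T d m w * ?p i w) = rep_sum T d m i * weyl_sum T d i M" if "i < m" for i
  proof -
    have i: "i \<le> m" using that by simp
    have "(\<Sum>w\<in>tail_increasing m i. wt T d m w * ?p i w) =
        (\<Sum>x\<in>min_reps m i \<times> weyl_B i. case x of (u, v) \<Rightarrow> wt T d m (u \<circ> v) * ?p i (u \<circ> v))"
      using sum.reindex_bij_betw[OF parabolic_bij[OF i], of "\<lambda>w. wt T d m w * ?p i w"]
      by (simp add: case_prod_unfold)
    also have "\<dots> = (\<Sum>u\<in>min_reps m i. \<Sum>v\<in>weyl_B i. wt T d m (u \<circ> v) * ?p i (u \<circ> v))"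
      by (simp add: sum.cartesian_product)
    also have "\<dots> = (\<Sum>u\<in>min_reps m i. \<Sum>v\<in>weyl_B i. wt T d m u * (wt T d i v * (\<Prod>k\<in>descents i v. M k)))"
      by (intro sum.cong refl) (simp add: wt_min_reps_comp[OF _ i] descents_min_reps_comp[OF _ i] mult.assoc)
    also have "\<dots> = rep_sum T d m i * weyl_sum T d i M"
      by (simp add: rep_sum_def weyl_sum_def sum_product)
    finally show ?thesis .
  qed
  have "weyl_sum T d m M = (\<Sum>w\<in>weyl_B m. wt T d m w * ((\<Sum>i<m. if descents m w \<inter> {i<..<m} = {} then ?p i w * ?c i else 0)
     + (if descents m w = {} then \<Prod>j<m. 1 - M j else 0)))"
    unfolding weyl_sum_def descent_telescope[OF descents_subset] ..
  also have "\<dots> = (\<Sum>w\<in>weyl_B m. \<Sum>i<m. if descents m w \<inter> {i<..<m} = {} then wt T d m w * ?p i w * ?c i else 0)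
     + (\<Sum>w\<in>weyl_B m. if w = id then \<Prod>j<m. 1 - M j else 0)"
    unfolding distrib_left sum.distrib sum_distrib_left
    by (intro arg_cong2[where f = "(+)"] sum.cong refl) (auto simp: mult.assoc descents_empty_iff wt_id)
  also have "(\<Sum>w\<in>weyl_B m. if w = id then \<Prod>j<m. 1 - M j else 0) = (\<Prod>j<m. 1 - M j)"
    using finite_weyl_B[of m] weyl_B_id[of m] by simp
  also have "(\<Sum>w\<in>weyl_B m. \<Sum>i<m. if descents m w \<inter> {i<..<m} = {} then wt T d m w * ?p i w * ?c i else 0) =
     (\<Sum>i<m. \<Sum>w\<in>weyl_B m. if descents m w \<inter> {i<..<m} = {} then wt T d m w * ?p i w * ?c i else 0)"
    by (rule sum.swap)
  also have "\<dots> = (\<Sum>i<m. (\<Sum>w\<in>tail_increasing m i. wt T d m w * ?p i w) * ?c i)"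
    unfolding tail_increasing_eq sum_distrib_right
    by (intro sum.cong refl sum.inter_filter[symmetric] finite_weyl_B)
  also have "\<dots> = (\<Sum>i<m. rep_sum T d m i * weyl_sum T d i M * ?c i)"
    using inner by (intro sum.cong refl) simp
  finally show ?thesis by (simp add: add.commute)
qed

section \<open>Minimal representatives by insertion of the largest value\<close>

text \<open>For \<open>v \<in> B\<^sub>m\<^sub>-\<^sub>1\<close> the product \<open>v \<circ> insert_top m p e\<close> has the value \<open>e * m\<close> at position \<open>p\<close> and the
  values of \<open>v\<close>, in their order, at the other positions.\<close>

definition insert_top :: "nat \<Rightarrow> nat \<Rightarrow> int \<Rightarrow> int \<Rightarrow> int" where
  "insert_top m p e x =
     (if x = int p then e * int m else if x = - int p then - (e * int m)
      else if int p < x \<and> x \<le> int m then x - 1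
      else if - int m \<le> x \<and> x < - int p then x + 1 else x)"

text \<open>The largest value walks from position \<open>m\<close> down to position 1, changes its
  sign there by \<open>cox_gen 0\<close> and walks back up. Every step is one generator and, as
  shown below, one unit of length.\<close>

lemma insert_top_steps:
  shows "m \<ge> 1 \<Longrightarrow> insert_top m m 1 = id"
    and "1 \<le> p \<Longrightarrow> p < m \<Longrightarrow> insert_top m p 1 = insert_top m (Suc p) 1 \<circ> cox_gen p"
    and "m \<ge> 1 \<Longrightarrow> insert_top m 1 (- 1) = insert_top m 1 1 \<circ> cox_gen 0"
    and "1 \<le> p \<Longrightarrow> p < m \<Longrightarrow> insert_top m (Suc p) (- 1) = insert_top m p (- 1) \<circ> cox_gen p"
  by (rule ext, simp add: insert_top_def cox_gen_apply; linarith?)+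

lemma neg_cox_gen:
  assumes k: "1 \<le> k" "k < m" shows "neg m (w \<circ> cox_gen k) = neg m w"
proof -
  have "bij_betw (cox_gen k) {j \<in> {1..int m}. (w \<circ> cox_gen k) j < 0} {j \<in> {1..int m}. w j < 0}"
    by (rule bij_betw_byWitness[where f' = "cox_gen k"]) (use k in \<open>auto simp: cox_gen_apply\<close>)
  thus ?thesis unfolding neg_def by (rule bij_betw_same_card)
qed

lemma neg_cox_gen_0:
  assumes w: "w \<in> weyl_B m" and m: "m \<ge> 1" and p: "w 1 > 0"
  shows "neg m (w \<circ> cox_gen 0) = Suc (neg m w)"
proof -
  have e: "{j \<in> {1..int m}. (w \<circ> cox_gen 0) j < 0} = insert 1 {j \<in> {1..int m}. w j < 0}"
    using m p weyl_B_minus[OF w, of 1] by (auto simp: cox_gen_apply)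
  have "finite {j \<in> {1..int m}. w j < 0}" by (rule finite_subset[OF Collect_restrict]) simp
  thus ?thesis unfolding neg_def e using p by simp
qed

lemma insert_top_comp_apply:
  assumes v: "v \<in> weyl_B m" and p: "1 \<le> p" "p \<le> Suc m" and e: "e = 1 \<or> e = - 1" and k: "k \<le> Suc m"
  shows "(v \<circ> insert_top (Suc m) p e) (int k) =
     (if k < p then v (int k) else if k = p then e * int (Suc m) else v (int k - 1))"
  using p e k weyl_B_outside[OF v, of "int (Suc m)"] weyl_B_outside[OF v, of "- int (Suc m)"]
  by (auto simp: insert_top_def)

text \<open>All values of \<open>v\<close> on \<open>0..m\<close> have absolute value at most
  \<open>m\<close>, so at the inserted position only the sign \<open>e\<close> decides; to the right
  of it the sequence of \<open>v\<close> is shifted by one.\<close>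

lemma ascent_insert_top:
  assumes v: "v \<in> weyl_B m" and p: "1 \<le> p" "p \<le> Suc m" and e: "e = 1 \<or> e = - 1" and k: "k < Suc m"
  shows "(v \<circ> insert_top (Suc m) p e) (int k) < (v \<circ> insert_top (Suc m) p e) (int k + 1) \<longleftrightarrow>
     (if Suc k < p then v (int k) < v (int k + 1) else if Suc k = p then e = 1 else if k = p then e = - 1
      else v (int k - 1) < v (int k))"
proof -
  have 1: "int k + 1 = int (Suc k)" by simp
  have b: "\<bar>v (int k)\<bar> \<le> int m" using weyl_B_range[OF v, of "int k"] k by simp
  show ?thesis
    unfolding 1 insert_top_comp_apply[OF v p e less_imp_le[OF k]] insert_top_comp_apply[OF v p e Suc_leI[OF k]]
    using b k e by (cases "Suc k < p"; cases "Suc k = p"; cases "k = p") auto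
qed

lemma id_min_reps: "id \<in> min_reps (Suc m) i"
  using weyl_B_id by (simp add: min_reps_def)

text \<open>The identity is a minimal representative, so additivity along \<open>min_reps\<close>
  compares \<open>blen\<close> in two consecutive groups.\<close>

lemma blen_Suc: "v \<in> weyl_B m \<Longrightarrow> blen (Suc m) v = blen m v"
  using blen_min_reps_comp[OF id_min_reps, of m m v] by simp

lemma neg_Suc: "v \<in> weyl_B m \<Longrightarrow> neg (Suc m) v = neg m v"
  using neg_min_reps_comp[OF id_min_reps, of m m v] by (simp add: neg_id)

lemma insert_top_pos:
  assumes v: "v \<in> weyl_B m" and "j \<le> m"
  shows "v \<circ> insert_top (Suc m) (Suc m - j) 1 \<in> weyl_B (Suc m) \<and>
    blen (Suc m) (v \<circ> insert_top (Suc m) (Suc m - j) 1) = blen m v + j \<and>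
    neg (Suc m) (v \<circ> insert_top (Suc m) (Suc m - j) 1) = neg m v"
  using assms(2)
proof (induction j)
  case 0
  have "v \<in> weyl_B (Suc m)" using v weyl_B_mono[of m "Suc m"] by auto
  thus ?case by (simp add: insert_top_steps(1) blen_Suc[OF v] neg_Suc[OF v])
next
  case (Suc j)
  define p where "p = Suc m - Suc j"
  define u where "u = v \<circ> insert_top (Suc m) (Suc m - j) 1"
  have p: "1 \<le> p" "p < Suc m" "Suc m - j = Suc p" using Suc.prems by (auto simp: p_def)
  have st: "v \<circ> insert_top (Suc m) p 1 = u \<circ> cox_gen p"
    unfolding u_def p(3) o_assoc[symmetric] insert_top_steps(2)[OF p(1,2)] ..
  have IH: "u \<in> weyl_B (Suc m)" "blen (Suc m) u = blen m v + j" "neg (Suc m) u = neg m v"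
    using Suc.IH[OF Suc_leD[OF Suc.prems]] unfolding u_def by blast+
  have "u (int p) < u (int p + 1)"
    unfolding u_def p(3) by (subst ascent_insert_top[OF v]) (use p in auto)
  hence "blen (Suc m) (u \<circ> cox_gen p) = blen m v + Suc j"
    using blen_ascent[OF IH(1) p(2)] IH(2) by linarith
  moreover have "neg (Suc m) (u \<circ> cox_gen p) = neg m v"
    using neg_cox_gen[OF p(1,2), of u] IH(3) by (rule trans)
  ultimately show ?case unfolding p_def[symmetric] st
    using weyl_B_comp[OF IH(1) cox_gen_weyl_B[OF p(2)]] by blast
qed

lemma insert_top_neg:
  assumes v: "v \<in> weyl_B m" and "j \<le> m"
  shows "v \<circ> insert_top (Suc m) (Suc j) (- 1) \<in> weyl_B (Suc m) \<and>
    blen (Suc m) (v \<circ> insert_top (Suc m) (Suc j) (- 1)) = blen m v + Suc m + j \<and>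
    neg (Suc m) (v \<circ> insert_top (Suc m) (Suc j) (- 1)) = Suc (neg m v)"
  using assms(2)
proof (induction j)
  case 0
  define u where "u = v \<circ> insert_top (Suc m) 1 1"
  have u: "u \<in> weyl_B (Suc m)" "blen (Suc m) u = blen m v + m" "neg (Suc m) u = neg m v"
    using insert_top_pos[OF v order.refl] unfolding u_def by simp_all
  have u1: "u 1 = int (Suc m)"
    using insert_top_comp_apply[OF v, of 1 1 1] by (simp add: u_def)
  have st: "v \<circ> insert_top (Suc m) 1 (- 1) = u \<circ> cox_gen 0"
    unfolding u_def o_assoc[symmetric] by (subst insert_top_steps(3)) auto
  have "u (int 0) < u (int 0 + 1)" using u1 weyl_B_zero[OF u(1)] by simp
  hence "blen (Suc m) (u \<circ> cox_gen 0) = blen m v + Suc m + 0"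
    using blen_ascent[OF u(1), of 0] u(2) by linarith
  moreover have "neg (Suc m) (u \<circ> cox_gen 0) = Suc (neg m v)"
    using neg_cox_gen_0[OF u(1)] u1 u(3) by simp
  moreover have "u \<circ> cox_gen 0 \<in> weyl_B (Suc m)"
    by (intro weyl_B_comp u cox_gen_weyl_B) simp
  ultimately show ?case unfolding One_nat_def[symmetric] st by blast
next
  case (Suc j)
  define u where "u = v \<circ> insert_top (Suc m) (Suc j) (- 1)"
  have IH: "u \<in> weyl_B (Suc m)" "blen (Suc m) u = blen m v + Suc m + j" "neg (Suc m) u = Suc (neg m v)"
    using Suc.IH[OF Suc_leD[OF Suc.prems]] unfolding u_def by blast+
  have p: "1 \<le> Suc j" "Suc j < Suc m" using Suc.prems by auto
  have st: "v \<circ> insert_top (Suc m) (Suc (Suc j)) (- 1) = u \<circ> cox_gen (Suc j)"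
    unfolding u_def o_assoc[symmetric] insert_top_steps(4)[OF p] ..
  have "u (int (Suc j)) < u (int (Suc j) + 1)"
    unfolding u_def by (subst ascent_insert_top[OF v]) (use p in auto)
  hence "blen (Suc m) (u \<circ> cox_gen (Suc j)) = blen m v + Suc m + Suc j"
    using blen_ascent[OF IH(1) p(2)] IH(2) by linarith
  moreover have "neg (Suc m) (u \<circ> cox_gen (Suc j)) = Suc (neg m v)"
    using neg_cox_gen[OF p, of u] IH(3) by (rule trans)
  ultimately show ?case unfolding st
    using weyl_B_comp[OF IH(1) cox_gen_weyl_B[OF p(2)]] by blast
qed

lemma insert_top_weyl_B:
  assumes v: "v \<in> weyl_B m" and p: "1 \<le> p" "p \<le> Suc m" and e: "e = 1 \<or> e = - 1"
  shows "v \<circ> insert_top (Suc m) p e \<in> weyl_B (Suc m)"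
  using e insert_top_pos[OF v, of "Suc m - p"] insert_top_neg[OF v, of "p - 1"] p by auto

text \<open>Cancelling the insertion leaves an element that fixes the two extreme values, hence lies
  in the smaller group.\<close>

lemma insert_top_surj:
  assumes u: "u \<in> weyl_B (Suc m)" and p: "1 \<le> p" "p \<le> Suc m" and e: "e = 1 \<or> e = - 1"
    and up: "u (int p) = e * int (Suc m)"
  shows "\<exists>v\<in>weyl_B m. u = v \<circ> insert_top (Suc m) p e"
proof -
  define c where "c = insert_top (Suc m) p e"
  have c: "c \<in> weyl_B (Suc m)" using insert_top_weyl_B[OF weyl_B_id p e] by (simp add: c_def)
  define v where "v = u \<circ> inv_into UNIV c"
  have v: "v \<in> weyl_B (Suc m)" unfolding v_def by (intro weyl_B_comp u weyl_B_inv c)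
  have cc: "inv_into UNIV c \<circ> c = id" using permutes_inv_o(2)[OF weyl_B_permutes[OF c]] .
  have uv: "u = v \<circ> c" unfolding v_def o_assoc[symmetric] cc by simp
  have "c (int p) = e * int (Suc m)" using p by (simp add: c_def insert_top_def)
  hence top: "v (int (Suc m)) = int (Suc m)"
    using up uv e weyl_B_minus[OF v, of "int (Suc m)"] by auto
  have "v permutes {- int m..int m}"
  proof (rule permutes_superset[OF weyl_B_permutes[OF v]])
    fix x assume "x \<in> {- int (Suc m)..int (Suc m)} - {- int m..int m}"
    hence "x = int (Suc m) \<or> x = - int (Suc m)" by auto
    thus "v x = x" using top weyl_B_minus[OF v, of "int (Suc m)"] by auto
  qed
  hence "v \<in> weyl_B m" using v by (simp add: weyl_B_def)
  thus ?thesis using uv c_def by blast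
qed

text \<open>Deleting the top value from the last position or from position \<open>i + 1\<close>
  leaves the allowed descent at \<open>i\<close>. Deleting it from position \<open>i\<close> moves
  that descent to \<open>i - 1\<close>.\<close>

lemma min_reps_insert_iff:
  assumes v: "v \<in> weyl_B m" and i: "i \<le> m"
  shows "v \<circ> insert_top (Suc m) (Suc m) 1 \<in> min_reps (Suc m) i \<longleftrightarrow> v \<in> min_reps m i"
    and "1 \<le> i \<Longrightarrow> v \<circ> insert_top (Suc m) i 1 \<in> min_reps (Suc m) i \<longleftrightarrow> v \<in> min_reps m (i - 1)"
    and "v \<circ> insert_top (Suc m) (Suc i) (- 1) \<in> min_reps (Suc m) i \<longleftrightarrow> v \<in> min_reps m i"
proof -
  have iff: "v \<circ> insert_top (Suc m) p e \<in> min_reps (Suc m) i \<longleftrightarrow>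
     (\<forall>k<Suc m. k \<noteq> i \<longrightarrow> (if Suc k < p then v (int k) < v (int k + 1) else if Suc k = p then e = 1 else if k = p then e = - 1
      else v (int k - 1) < v (int k)))" if "1 \<le> p" "p \<le> Suc m" "e = 1 \<or> e = - 1" for p e
    using insert_top_weyl_B[OF v that] ascent_insert_top[OF v that]
    unfolding min_reps_def by blast
  have v': "v \<in> min_reps m j \<longleftrightarrow> (\<forall>k<m. k \<noteq> j \<longrightarrow> v (int k) < v (int k + 1))" for j
    using v by (simp add: min_reps_def)
  show "v \<circ> insert_top (Suc m) (Suc m) 1 \<in> min_reps (Suc m) i \<longleftrightarrow> v \<in> min_reps m i"
    unfolding v' by (subst iff) (use i in auto)
  show "v \<circ> insert_top (Suc m) i 1 \<in> min_reps (Suc m) i \<longleftrightarrow> v \<in> min_reps m (i - 1)" if i1: "1 \<le> i"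
  proof -
    have "(\<forall>k<Suc m. k \<noteq> i \<longrightarrow> (if Suc k < i then v (int k) < v (int k + 1) else if Suc k = i then True else if k = i then False
      else v (int k - 1) < v (int k))) \<longleftrightarrow> (\<forall>k<m. k \<noteq> i - 1 \<longrightarrow> v (int k) < v (int k + 1))" (is "?L \<longleftrightarrow> ?R")
    proof
      assume L: ?L
      show ?R
      proof (intro allI impI)
        fix k assume k: "k < m" "k \<noteq> i - 1"
        show "v (int k) < v (int k + 1)"
        proof (cases "Suc k < i")
          case True thus ?thesis using L[rule_format, of k] k by auto
        next
          case False thus ?thesis using L[rule_format, of "Suc k"] k i1 by (auto simp: add.commute split: if_splits)
        qed
      qed
    next
      assume R: ?R
      show ?L
      proof (intro allI impI)
        fix k assume k: "k < Suc m" "k \<noteq> i"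
        show "if Suc k < i then v (int k) < v (int k + 1) else if Suc k = i then True else if k = i then False
          else v (int k - 1) < v (int k)"
          using R[rule_format, of k] R[rule_format, of "k - 1"] k i i1 by (auto simp: of_nat_diff)
      qed
    qed
    moreover have "((1::int) = - 1) = False" by simp
    note iff[OF i1 le_SucI[OF i] disjI1[OF refl], unfolded this simp_thms(6)]
    ultimately
    show ?thesis unfolding v' by (simp only:)
  qed
  show "v \<circ> insert_top (Suc m) (Suc i) (- 1) \<in> min_reps (Suc m) i \<longleftrightarrow> v \<in> min_reps m i"
  proof -
    have "(\<forall>k<Suc m. k \<noteq> i \<longrightarrow> (if Suc k < Suc i then v (int k) < v (int k + 1) else if Suc k = Suc i then False else if k = Suc i then True
      else v (int k - 1) < v (int k))) \<longleftrightarrow> (\<forall>k<m. k \<noteq> i \<longrightarrow> v (int k) < v (int k + 1))" (is "?L \<longleftrightarrow> ?R")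
    proof
      assume L: ?L
      show ?R
      proof (intro allI impI)
        fix k assume k: "k < m" "k \<noteq> i"
        show "v (int k) < v (int k + 1)"
        proof (cases "k < i")
          case True thus ?thesis using L[rule_format, of k] k by auto
        next
          case False thus ?thesis using L[rule_format, of "Suc k"] k by (auto simp: add.commute split: if_splits)
        qed
      qed
    next
      assume R: ?R
      show ?L
      proof (intro allI impI)
        fix k assume k: "k < Suc m" "k \<noteq> i"
        show "if Suc k < Suc i then v (int k) < v (int k + 1) else if Suc k = Suc i then False else if k = Suc i then True
          else v (int k - 1) < v (int k)"
          using R[rule_format, of k] R[rule_format, of "k - 1"] k i by (auto simp: of_nat_diff)
      qed
    qed
    moreover have 1: "1 \<le> Suc i" and 2: "Suc i \<le> Suc m" using i by auto
    have "((- 1::int) = 1) = False" by simp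
    note iff[OF 1 2 disjI2[OF refl], unfolded this simp_thms(6)]
    ultimately show ?thesis unfolding v' by (simp only:)
  qed
qed

text \<open>A positive top value produces a descent to its right unless it stands last, and a
  negative one produces a descent to its left, where position 0 counts with value 0. As only a
  descent at \<open>i\<close> is allowed, three places remain.\<close>

lemma min_reps_cases:
  assumes u: "u \<in> min_reps (Suc m) i"
  obtains p e where "(p, e) \<in> {(Suc m, 1), (i, 1), (Suc i, - 1)}" "1 \<le> p" "p \<le> Suc m" "u (int p) = e * int (Suc m)"
proof -
  have uB: "u \<in> weyl_B (Suc m)" using u by (simp add: min_reps_def)
  obtain x where x: "u x = int (Suc m)" using permutes_surj[OF weyl_B_permutes[OF uB]] by (metis surjD)
  have x0: "x \<noteq> 0" using x weyl_B_zero[OF uB] by auto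
  have xr: "\<bar>x\<bar> \<le> int (Suc m)" using weyl_B_outside[OF uB, of x] x by force
  define p where "p = nat \<bar>x\<bar>"
  define e :: int where "e = sgn x"
  have p: "1 \<le> p" "p \<le> Suc m" using x0 xr by (auto simp: p_def)
  have e: "e = 1 \<or> e = - 1" using x0 by (auto simp: e_def sgn_if)
  have up: "u (int p) = e * int (Suc m)"
    using x x0 weyl_B_minus[OF uB, of x] by (auto simp: p_def e_def sgn_if)
  obtain v where v: "v \<in> weyl_B m" "u = v \<circ> insert_top (Suc m) p e"
    using insert_top_surj[OF uB p e up] by blast
  have asc: "k < Suc m \<Longrightarrow> k \<noteq> i \<Longrightarrow> (if Suc k < p then v (int k) < v (int k + 1) else if Suc k = p then e = 1 else if k = p then e = - 1
      else v (int k - 1) < v (int k))" for k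
    using ascent_insert_top[OF v(1) p e, of k] u unfolding min_reps_def v(2) by blast
  have "(p, e) \<in> {(Suc m, 1), (i, 1), (Suc i, - 1)}"
    using e
  proof
    assume e1: "e = 1"
    have "p = Suc m \<or> p = i"
    proof (rule ccontr)
      assume "\<not> ?thesis"
      hence "p < Suc m" "p \<noteq> i" using p by auto
      from asc[OF this] show False using e1 by simp
    qed
    thus ?thesis using e1 by auto
  next
    assume e1: "e = - 1"
    have "p - 1 = i"
    proof (rule ccontr)
      assume *: "p - 1 \<noteq> i"
      have "p - 1 < Suc m" using p by simp
      from asc[OF this *] show False using e1 p by simp
    qed
    thus ?thesis using e1 p by auto
  qed
  thus ?thesis using that p up by blast
qed

lemma min_reps_Suc:
  assumes i: "i \<le> m"
  shows "min_reps (Suc m) i = min_reps m i \<union>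
     (if i = 0 then {} else (\<lambda>v. v \<circ> insert_top (Suc m) i 1) ` min_reps m (i - 1)) \<union>
     (\<lambda>v. v \<circ> insert_top (Suc m) (Suc i) (- 1)) ` min_reps m i" (is "_ = ?A \<union> ?B \<union> ?C")
proof
  note [simp] = insert_top_steps(1)
  show "min_reps (Suc m) i \<subseteq> ?A \<union> ?B \<union> ?C"
  proof
    fix u assume u: "u \<in> min_reps (Suc m) i"
    from u obtain p e where pe: "(p, e) \<in> {(Suc m, 1), (i, 1), (Suc i, - 1)}" "1 \<le> p" "p \<le> Suc m" "u (int p) = e * int (Suc m)"
      by (rule min_reps_cases)
    have "u \<in> weyl_B (Suc m)" using u by (simp add: min_reps_def)
    then obtain v where v: "v \<in> weyl_B m" "u = v \<circ> insert_top (Suc m) p e"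
      using insert_top_surj[of u m p e] pe by auto
    consider "p = Suc m" "e = 1" | "p = i" "e = 1" | "p = Suc i" "e = - 1" using pe by auto
    thus "u \<in> ?A \<union> ?B \<union> ?C"
    proof cases
      case 1
      have "v \<in> min_reps m i" using u min_reps_insert_iff(1)[OF v(1) i] unfolding v(2) 1 by blast
      thus ?thesis using v 1 by simp
    next
      case 2
      have "1 \<le> i" using 2 pe by simp
      hence "v \<in> min_reps m (i - 1)" using u min_reps_insert_iff(2)[OF v(1) i] unfolding v(2) 2 by blast
      thus ?thesis using v 2 pe by auto
    next
      case 3
      have "v \<in> min_reps m i" using u min_reps_insert_iff(3)[OF v(1) i] unfolding v(2) 3 by blast
      thus ?thesis using v 3 by auto
    qed
  qed
  have B: "v \<in> min_reps m j \<Longrightarrow> v \<in> weyl_B m" for v j by (simp add: min_reps_def)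
  have "?A \<subseteq> min_reps (Suc m) i" using min_reps_insert_iff(1)[OF B i] by auto
  moreover have "?B \<subseteq> min_reps (Suc m) i" using min_reps_insert_iff(2)[OF B i] by auto
  moreover have "?C \<subseteq> min_reps (Suc m) i" using min_reps_insert_iff(3)[OF B i] by auto
  ultimately show "?A \<union> ?B \<union> ?C \<subseteq> min_reps (Suc m) i" by blast
qed

lemma wt_insert:
  assumes v: "v \<in> weyl_B m" and i: "i \<le> m"
  shows "wt T d (Suc m) v = wt T d m v"
    and "1 \<le> i \<Longrightarrow> wt T d (Suc m) (v \<circ> insert_top (Suc m) i 1) = T ^ (Suc m - i) * wt T d m v"
    and "wt T d (Suc m) (v \<circ> insert_top (Suc m) (Suc i) (- 1)) = - (T ^ (Suc m + i + d)) * wt T d m v"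
proof -
  show "wt T d (Suc m) v = wt T d m v" by (simp add: wt_def blen_Suc[OF v] neg_Suc[OF v])
  show "wt T d (Suc m) (v \<circ> insert_top (Suc m) i 1) = T ^ (Suc m - i) * wt T d m v" if i1: "1 \<le> i"
  proof -
    have "Suc m - i \<le> m" "Suc m - (Suc m - i) = i" using i i1 by auto
    hence e: "blen (Suc m) (v \<circ> insert_top (Suc m) i 1) = blen m v + (Suc m - i)"
       "neg (Suc m) (v \<circ> insert_top (Suc m) i 1) = neg m v"
      using insert_top_pos[OF v, of "Suc m - i"] by simp_all
    show ?thesis unfolding wt_def e by (simp only: power_add mult_ac)
  qed
  show "wt T d (Suc m) (v \<circ> insert_top (Suc m) (Suc i) (- 1)) = - (T ^ (Suc m + i + d)) * wt T d m v"
    using insert_top_neg[OF v i] by (simp add: wt_def power_add algebra_simps)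
qed

lemma inj_insert_top:
  assumes p: "1 \<le> p" "p \<le> Suc m" and e: "e = 1 \<or> e = - 1"
  shows "inj_on (\<lambda>v. v \<circ> insert_top (Suc m) p e) (A :: (int \<Rightarrow> int) set)"
proof (rule inj_onI)
  fix v v' :: "int \<Rightarrow> int" assume *: "v \<circ> insert_top (Suc m) p e = v' \<circ> insert_top (Suc m) p e"
  have "insert_top (Suc m) p e \<in> weyl_B (Suc m)" using insert_top_weyl_B[OF weyl_B_id p e] by simp
  hence "surj (insert_top (Suc m) p e)" using permutes_surj[OF weyl_B_permutes] by blast
  thus "v = v'" using * by (metis (no_types, opaque_lifting) comp_apply surjD ext)
qed

text \<open>The three places contribute the weights \<open>1\<close>, \<open>T ^ (Suc m - i)\<close>
  and \<open>- (T ^ (Suc m + i + d))\<close>. The first and the third leave an element of the same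
  set \<open>min_reps m i\<close>, so they merge into one factor.\<close>

lemma rep_sum_Suc:
  assumes i: "i \<le> m"
  shows "rep_sum T d (Suc m) i = (1 - T ^ (Suc m + i + d)) * rep_sum T d m i +
     (if i = 0 then 0 else T ^ (Suc m - i) * rep_sum T d m (i - 1))"
proof -
  let ?A = "min_reps m i"
  let ?B = "if i = 0 then {} else (\<lambda>v. v \<circ> insert_top (Suc m) i 1) ` min_reps m (i - 1)"
  let ?C = "(\<lambda>v. v \<circ> insert_top (Suc m) (Suc i) (- 1)) ` min_reps m i"
  have B: "v \<in> min_reps m j \<Longrightarrow> v \<in> weyl_B m" for v j by (simp add: min_reps_def)
  have A_top: "u (int (Suc m)) = int (Suc m)" if "u \<in> ?A" for u
    using weyl_B_outside[OF B[OF that], of "int (Suc m)"] by simp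
  have B_top: "u (int i) = int (Suc m)" if "u \<in> ?B" for u
  proof -
    obtain v where "v \<in> weyl_B m" "u = v \<circ> insert_top (Suc m) i 1" "i \<noteq> 0"
      using \<open>u \<in> ?B\<close> B by (auto split: if_splits)
    thus ?thesis using insert_top_comp_apply[of v m i 1 i] i by simp
  qed
  have C_top: "u (int (Suc i)) = - int (Suc m)" if "u \<in> ?C" for u
  proof -
    obtain v where "v \<in> weyl_B m" "u = v \<circ> insert_top (Suc m) (Suc i) (- 1)"
      using \<open>u \<in> ?C\<close> B by blast
    thus ?thesis using insert_top_comp_apply[of v m "Suc i" "- 1" "Suc i"] i by simp
  qed
  have U: "u \<in> weyl_B (Suc m)" if "u \<in> ?A \<union> ?B \<union> ?C" for u
    using that min_reps_Suc[OF i] by (auto simp: min_reps_def)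
  have AB: "?A \<inter> ?B = {}"
  proof -
    have False if u: "u \<in> ?A" "u \<in> ?B" for u
      using A_top[OF u(1)] B_top[OF u(2)] weyl_B_neq[OF U, of u "int (Suc m)" "int i"] u i by auto
    thus ?thesis by blast
  qed
  have ABC: "(?A \<union> ?B) \<inter> ?C = {}"
  proof -
    have False if u: "u \<in> ?A \<union> ?B" "u \<in> ?C" for u
    proof -
      have uB: "u \<in> weyl_B (Suc m)" using U u by blast
      have "u (int (Suc m)) = int (Suc m) \<or> u (int i) = int (Suc m)" using u A_top B_top by blast
      moreover have "u (- int (Suc i)) = int (Suc m)" using C_top[OF u(2)] weyl_B_minus[OF uB, of "int (Suc i)"] by simp
      ultimately show False
        using weyl_B_neq[OF uB, of "int (Suc m)" "- int (Suc i)"] weyl_B_neq[OF uB, of "int i" "- int (Suc i)"] by auto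
    qed
    thus ?thesis by blast
  qed
  have fin: "finite ?A" "finite ?B" "finite ?C" using finite_min_reps by auto
  have sB: "sum (wt T d (Suc m)) ?B = (if i = 0 then 0 else T ^ (Suc m - i) * rep_sum T d m (i - 1))"
  proof (cases "i = 0")
    case False
    hence "sum (wt T d (Suc m)) ?B = (\<Sum>v\<in>min_reps m (i - 1). wt T d (Suc m) (v \<circ> insert_top (Suc m) i 1))"
      using i by (simp add: sum.reindex inj_insert_top o_def[of "wt T d (Suc m)"])
    also have "\<dots> = (\<Sum>v\<in>min_reps m (i - 1). T ^ (Suc m - i) * wt T d m v)"
      using False i by (intro sum.cong refl wt_insert(2) B) auto
    finally show ?thesis using False by (simp add: rep_sum_def sum_distrib_left)
  qed simp
  have sC: "sum (wt T d (Suc m)) ?C = - (T ^ (Suc m + i + d)) * rep_sum T d m i"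
  proof -
    have "sum (wt T d (Suc m)) ?C = (\<Sum>v\<in>min_reps m i. wt T d (Suc m) (v \<circ> insert_top (Suc m) (Suc i) (- 1)))"
      using i by (simp add: sum.reindex inj_insert_top o_def[of "wt T d (Suc m)"])
    also have "\<dots> = (\<Sum>v\<in>min_reps m i. - (T ^ (Suc m + i + d)) * wt T d m v)"
      using i by (intro sum.cong refl wt_insert(3) B) auto
    finally show ?thesis by (simp only: rep_sum_def sum_distrib_left)
  qed
  have sA: "sum (wt T d (Suc m)) ?A = rep_sum T d m i"
    unfolding rep_sum_def using i by (intro sum.cong refl wt_insert(1)[of _ m i] B)
  have "rep_sum T d (Suc m) i = sum (wt T d (Suc m)) ?A + sum (wt T d (Suc m)) ?B + sum (wt T d (Suc m)) ?C"
    unfolding rep_sum_def[of T d "Suc m"] min_reps_Suc[OF i]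
    using sum.union_disjoint[OF finite_UnI[OF fin(1,2)] fin(3) ABC, of "wt T d (Suc m)"]
      sum.union_disjoint[OF fin(1,2) AB, of "wt T d (Suc m)"] by (simp only:)
  thus ?thesis unfolding sA sB sC by (simp add: algebra_simps)
qed

lemma rep_sum_self: "rep_sum T d m m = 1"
proof -
  have "min_reps m m = {id}"
  proof -
    have "u = id" if "u \<in> min_reps m m" for u
      using that by (intro weyl_B_no_descent[of u m]) (auto simp: min_reps_def)
    thus ?thesis using weyl_B_id by (auto simp: min_reps_def)
  qed
  thus ?thesis by (simp add: rep_sum_def wt_id)
qed

section \<open>Closed form of the sum over representatives\<close>

definition qpoch :: "'r::comm_ring_1 \<Rightarrow> nat \<Rightarrow> 'r" where
  "qpoch T k = (\<Prod>j=1..k. 1 - T ^ j)"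

text \<open>A Gaussian binomial coefficient in \<open>T\<close> times a product depending on
  \<open>d\<close>. It reappears in \<open>rk_closed\<close> as the normalised number of matrices of
  given rank, and there the two sides meet.\<close>

definition rep_quot :: "'r::field \<Rightarrow> nat \<Rightarrow> nat \<Rightarrow> nat \<Rightarrow> 'r" where
  "rep_quot T d m i = qpoch T m / (qpoch T i * qpoch T (m - i)) * (\<Prod>j=Suc i..m. 1 - T ^ (d + j))"

lemma qpoch_0: "qpoch T 0 = 1"
  by (simp add: qpoch_def)

lemma qpoch_Suc: "qpoch T (Suc k) = qpoch T k * (1 - T ^ Suc k)"
  by (simp add: qpoch_def)

lemma rep_sum_closed:
  fixes T :: "'r::field"
  assumes T: "\<And>j. j \<ge> 1 \<Longrightarrow> T ^ j \<noteq> 1" and "i \<le> m"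
  shows "rep_sum T d m i = rep_quot T d m i"
  using assms(2)
proof (induction m arbitrary: i)
  case 0
  thus ?case using rep_sum_self[of T d 0] by (simp add: rep_quot_def qpoch_def)
next
  case (Suc m)
  have nz: "qpoch T k \<noteq> 0" for k using T by (auto simp: qpoch_def)
  show ?case
  proof (cases "i = Suc m")
    case True
    thus ?thesis using rep_sum_self[of T d "Suc m"] nz[of "Suc m"] qpoch_0[of T] by (simp add: rep_quot_def)
  next
    case False
    hence i: "i \<le> m" using Suc.prems by simp
    define P where "P = (\<Prod>j=Suc i..m. 1 - T ^ (d + j))"
    have P1: "(\<Prod>j=Suc i..Suc m. 1 - T ^ (d + j)) = P * (1 - T ^ (d + Suc m))" using i by (simp add: P_def)
    have s: "Suc m - i = Suc (m - i)" using i by simp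
    show ?thesis
    proof (cases i)
      case 0
      have "rep_sum T d (Suc m) i = (1 - T ^ (Suc m + d)) * rep_quot T d m 0"
        using rep_sum_Suc[OF i, of T d] Suc.IH[OF i] 0 by simp
      also have "\<dots> = rep_quot T d (Suc m) i"
        using nz P1 0 by (simp add: rep_quot_def P_def[symmetric] add.commute) 
      finally show ?thesis .
    next
      case (Suc i')
      have P2: "(\<Prod>j=Suc i'..m. 1 - T ^ (d + j)) = (1 - T ^ (d + i)) * P"
        using i Suc by (simp add: P_def prod.atLeast_Suc_atMost)
      have r: "rep_sum T d (Suc m) i = (1 - T ^ (Suc m + i + d)) * rep_quot T d m i + T ^ (Suc m - i) * rep_quot T d m i'"
        using rep_sum_Suc[OF i, of T d] Suc.IH[OF i] Suc.IH[of i'] i Suc by simp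
      have X1: "1 - T ^ Suc (m - i) \<noteq> 0" "1 - T ^ i \<noteq> 0" using T[of "Suc (m - i)"] T[of i] Suc by auto
      have qi: "qpoch T i = qpoch T i' * (1 - T ^ i)" using Suc qpoch_Suc[of T i'] by simp
      have mi: "m - i' = Suc (m - i)" using i Suc by simp
      \<comment> \<open>Every power of \<open>T\<close> in the identity is a monomial in
        \<open>a\<close>, \<open>b\<close> and \<open>T ^ d\<close>, so the induction step becomes a
        rational identity in these three.\<close>
      define a b where "a = T ^ i" and "b = T ^ Suc (m - i)"
      have ab: "T ^ Suc m = a * b" "T ^ (Suc m + i + d) = a * b * a * T ^ d" "T ^ (d + Suc m) = T ^ d * a * b"
         "T ^ (d + i) = T ^ d * a" "T ^ Suc (m - i) = b"
        using i by (simp_all add: a_def b_def power_add flip: power_Suc) (simp_all add: power_add[symmetric] algebra_simps)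
      have l: "rep_quot T d m i = qpoch T m / (qpoch T i' * (1 - a) * qpoch T (m - i)) * P"
        by (simp add: rep_quot_def P_def qi a_def)
      have l': "rep_quot T d m i' = qpoch T m / (qpoch T i' * (qpoch T (m - i) * (1 - b))) * ((1 - T ^ d * a) * P)"
        unfolding rep_quot_def P2 mi qpoch_Suc ab by simp
      have r': "rep_quot T d (Suc m) i = qpoch T m * (1 - a * b) / (qpoch T i' * (1 - a) * (qpoch T (m - i) * (1 - b))) * (P * (1 - T ^ d * a * b))"
        unfolding rep_quot_def P1 s qpoch_Suc qi ab by (simp add: a_def)
      have X1': "1 - b \<noteq> 0" "1 - a \<noteq> 0" using X1 by (simp_all add: a_def b_def)
      show ?thesis unfolding r l l' r' s ab using nz[of i'] nz[of "m - i"] X1'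
        by (simp add: divide_simps) (simp add: algebra_simps)
    qed
  qed
qed

section \<open>Characters of finite abelian groups\<close>

text \<open>Extensional functions, so that a character is determined by its values on the carrier
  and characters can be counted. The value at one excludes the zero function.\<close>

definition chars :: "('g, 'b) monoid_scheme \<Rightarrow> ('g \<Rightarrow> complex) set" where
  "chars G = {f \<in> extensional (carrier G). f \<one>\<^bsub>G\<^esub> = 1 \<and>
     (\<forall>x\<in>carrier G. \<forall>y\<in>carrier G. f (x \<otimes>\<^bsub>G\<^esub> y) = f x * f y)}"

lemma charsD:
  assumes "f \<in> chars G"
  shows "f \<in> extensional (carrier G)" "f \<one>\<^bsub>G\<^esub> = 1"
    "\<And>x y. x \<in> carrier G \<Longrightarrow> y \<in> carrier G \<Longrightarrow> f (x \<otimes>\<^bsub>G\<^esub> y) = f x * f y"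
  using assms by (auto simp: chars_def)

context group
begin

lemma chars_inv:
  assumes f: "f \<in> chars G" and x: "x \<in> carrier G"
  shows "f (inv x) = inverse (f x)" "f x \<noteq> 0"
proof -
  have e: "f (inv x) * f x = 1"
    using charsD(3)[OF f, of "inv x" x] charsD(2)[OF f] x by simp
  thus "f x \<noteq> 0" by auto
  show "f (inv x) = inverse (f x)" using e by (metis inverse_unique mult.commute)
qed

lemma chars_pow:
  assumes f: "f \<in> chars G" and x: "x \<in> carrier G"
  shows "f (x [^] (n::nat)) = f x ^ n"
  by (induction n) (simp_all add: charsD(2,3)[OF f] x)

lemma sum_char_eq_0:
  assumes fin: "finite (carrier G)" and f: "f \<in> chars G" and x: "x \<in> carrier G" "f x \<noteq> 1"
  shows "(\<Sum>y\<in>carrier G. f y) = 0"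
proof -
  have "(\<Sum>y\<in>carrier G. f y) = (\<Sum>y\<in>carrier G. f (x \<otimes> y))"
  proof (rule sum.reindex_bij_witness[of _ "\<lambda>y. x \<otimes> y" "\<lambda>y. inv x \<otimes> y"])
  qed (use x in \<open>auto simp: m_assoc[symmetric]\<close>)
  also have "\<dots> = f x * (\<Sum>y\<in>carrier G. f y)"
    unfolding sum_distrib_left by (intro sum.cong refl charsD(3)[OF f x(1)])
  finally show ?thesis using x(2) by (simp add: mult_cancel_right1)
qed

lemma finite_chars:
  assumes fin: "finite (carrier G)"
  shows "finite (chars G)"
proof -
  have pos: "Coset.order G > 0" using fin one_closed by (auto simp: Coset.order_def card_gt_0_iff)
  have "chars G \<subseteq> carrier G \<rightarrow>\<^sub>E {z. z ^ Coset.order G = 1}"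
  proof
    fix f assume f: "f \<in> chars G"
    have "f x ^ Coset.order G = 1" if x: "x \<in> carrier G" for x
      using chars_pow[OF f x, of "Coset.order G"] pow_order_eq_1[OF x] charsD(2)[OF f] by simp
    thus "f \<in> carrier G \<rightarrow>\<^sub>E {z. z ^ Coset.order G = 1}"
      using charsD(1)[OF f] by (auto simp: PiE_def)
  qed
  moreover have "finite {z::complex. z ^ Coset.order G = 1}"
    by (rule finite_roots_unity) (use pos in simp)
  ultimately show ?thesis using fin finite_PiE finite_subset by metis
qed

end

context comm_group
begin

text \<open>The extension sends \<open>h \<otimes> x [^] k\<close> to \<open>f h * z ^ k\<close>;
  the hypothesis on \<open>z\<close> is exactly its compatibility with \<open>f\<close> on
  \<open>H\<close>. Natural exponents suffice because the group is finite.\<close>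

lemma char_extend_step:
  assumes fin: "finite (carrier G)" and H: "subgroup H G" and f: "f \<in> chars (G\<lparr>carrier := H\<rparr>)"
    and x: "x \<in> carrier G" and z: "\<And>k::nat. x [^] k \<in> H \<Longrightarrow> f (x [^] k) = z ^ k"
  shows "\<exists>K g. subgroup K G \<and> H \<subseteq> K \<and> x \<in> K \<and> g \<in> chars (G\<lparr>carrier := K\<rparr>) \<and> (\<forall>h\<in>H. g h = f h) \<and> g x = z"
proof -
  have fm: "f (h \<otimes> h') = f h * f h'" if "h \<in> H" "h' \<in> H" for h h'
    using charsD(3)[OF f, of h h'] that by simp
  have f1: "f \<one> = 1" using charsD(2)[OF f] by simp
  have HG: "h \<in> H \<Longrightarrow> h \<in> carrier G" for h using subgroup.mem_carrier[OF H] .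
  define K where "K = {h \<otimes> x [^] k | h (k::nat). h \<in> H}"
  have KI: "h \<in> H \<Longrightarrow> h \<otimes> x [^] (k::nat) \<in> K" for h k unfolding K_def by blast
  have sub: "subgroup K G"
  proof (rule subgroupI)
    show "K \<subseteq> carrier G" using x HG by (auto simp: K_def)
    show "K \<noteq> {}" using subgroup.one_closed[OF H] by (auto simp: K_def)
    fix a assume "a \<in> K"
    then obtain h k where a: "a = h \<otimes> x [^] (k::nat)" "h \<in> H" by (auto simp: K_def)
    have pos: "Coset.order G > 0" using fin one_closed by (auto simp: Coset.order_def card_gt_0_iff)
    have "x [^] k \<otimes> x [^] (k * (Coset.order G - 1)) = x [^] (Coset.order G * k)"
      using x pos by (simp add: nat_pow_mult mult.commute flip: mult_Suc_right)
    also have "\<dots> = \<one>" using x pow_order_eq_1[OF x] by (simp add: nat_pow_pow[symmetric])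
    finally have "inv (x [^] k) = x [^] (k * (Coset.order G - 1))"
      using x by (metis inv_equality m_comm nat_pow_closed)
    hence "inv a = inv h \<otimes> x [^] (k * (Coset.order G - 1))"
      using a x HG by (simp add: inv_mult)
    thus "inv a \<in> K" using KI subgroup.m_inv_closed[OF H a(2)] by simp
    fix b assume "b \<in> K"
    then obtain h' k' where b: "b = h' \<otimes> x [^] (k'::nat)" "h' \<in> H" by (auto simp: K_def)
    have "a \<otimes> b = (h \<otimes> h') \<otimes> x [^] (k + k')"
      using a b HG x by (simp add: nat_pow_mult[symmetric] m_ac)
    thus "a \<otimes> b \<in> K" using KI subgroup.m_closed[OF H a(2) b(2)] by simp
  qed
  have wd_le: "f h * z ^ i = f h' * z ^ j" if h: "h \<in> H" "h' \<in> H" and e: "h \<otimes> x [^] i = h' \<otimes> x [^] j"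
    and ij: "j \<le> i" for h h' and i j :: nat
  proof -
    have "h \<otimes> x [^] (i - j) \<otimes> x [^] j = h' \<otimes> x [^] j"
      using e ij h HG x by (simp add: nat_pow_mult m_assoc)
    hence h': "h \<otimes> x [^] (i - j) = h'" using h HG x by simp
    have "x [^] (i - j) = inv h \<otimes> (h \<otimes> x [^] (i - j))" using h HG x by (simp add: m_assoc[symmetric])
    hence "x [^] (i - j) = inv h \<otimes> h'" unfolding h' .
    hence "x [^] (i - j) \<in> H" using h subgroup.m_closed[OF H] subgroup.m_inv_closed[OF H] by simp
    hence "f h' = f h * z ^ (i - j)" using fm h z h' by metis
    thus ?thesis using ij by (simp flip: power_add)
  qed
  have wd: "f h * z ^ i = f h' * z ^ j" if "h \<in> H" "h' \<in> H" "h \<otimes> x [^] i = h' \<otimes> x [^] j" for h h' and i j :: nat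
    using wd_le[of h h' i j] wd_le[of h' h j i] that by (cases "j \<le> i") auto
  \<comment> \<open>Some representation of \<open>a\<close> is chosen; \<open>wd\<close> makes the
    value independent of the choice.\<close>
  define g where "g = (\<lambda>a\<in>K. let p = SOME p. fst p \<in> H \<and> a = fst p \<otimes> x [^] (snd p :: nat) in f (fst p) * z ^ snd p)"
  have g: "g (h \<otimes> x [^] k) = f h * z ^ k" if "h \<in> H" for h and k :: nat
  proof -
    let ?P = "\<lambda>p. fst p \<in> H \<and> h \<otimes> x [^] k = fst p \<otimes> x [^] (snd p :: nat)"
    have "?P (SOME p. ?P p)" by (rule someI[of ?P "(h, k)"]) (simp add: that)
    thus ?thesis using wd[of h "fst (SOME p. ?P p)" k "snd (SOME p. ?P p)"] that KI[OF that, of k]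
      by (simp add: g_def Let_def)
  qed
  have gH: "g h = f h" if "h \<in> H" for h using g[OF that, of 0] HG[OF that] by simp
  have gx: "g x = z" using g[OF subgroup.one_closed[OF H], of 1] x f1 by simp
  have "g \<in> chars (G\<lparr>carrier := K\<rparr>)"
  proof -
    have "g (a \<otimes> b) = g a * g b" if ab: "a \<in> K" "b \<in> K" for a b
    proof -
      obtain h k h' k' where a: "a = h \<otimes> x [^] (k::nat)" "h \<in> H" and b: "b = h' \<otimes> x [^] (k'::nat)" "h' \<in> H"
        using ab by (auto simp: K_def)
      have "a \<otimes> b = (h \<otimes> h') \<otimes> x [^] (k + k')"
        using a b HG x by (simp add: nat_pow_mult[symmetric] m_ac)
      thus ?thesis using g a b fm subgroup.m_closed[OF H a(2) b(2)] by (simp add: power_add)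
    qed
    moreover have "g \<one> = 1" using gH[OF subgroup.one_closed[OF H]] f1 by simp
    ultimately show ?thesis by (simp add: chars_def g_def)
  qed
  moreover have "H \<subseteq> K" using KI[of _ 0] HG by force
  moreover have "x \<in> K" using KI[OF subgroup.one_closed[OF H], of 1] x by simp
  ultimately show ?thesis using sub gH gx by blast
qed

text \<open>\<open>n\<close> is the order of \<open>x\<close> modulo \<open>H\<close>, so
  \<open>x [^] k \<in> H\<close> forces \<open>n dvd k\<close>, and the condition at
  \<open>n\<close> implies all others.\<close>

lemma char_root_exists:
  assumes fin: "finite (carrier G)" and H: "subgroup H G" and f: "f \<in> chars (G\<lparr>carrier := H\<rparr>)"
    and x: "x \<in> carrier G" and n: "n > 0" "x [^] n \<in> H" "\<And>k::nat. 0 < k \<Longrightarrow> k < n \<Longrightarrow> x [^] k \<notin> H"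
    and z: "z ^ n = f (x [^] (n::nat))" and k: "x [^] k \<in> H"
  shows "f (x [^] (k::nat)) = z ^ k"
proof -
  interpret HG: group "G\<lparr>carrier := H\<rparr>" using subgroup_imp_group[OF H] .
  have pw: "(x [^] n) [^]\<^bsub>G\<lparr>carrier := H\<rparr>\<^esub> (j::nat) = (x [^] n) [^] j" for j
    by (simp add: nat_pow_def)
  have nd: "(x [^] n) [^] j \<in> H" for j :: nat
    using HG.nat_pow_closed[of "x [^] n" j] n(2) pw by simp
  have "x [^] k = x [^] (n * (k div n)) \<otimes> x [^] (k mod n)" using x by (simp add: nat_pow_mult)
  hence "x [^] k = (x [^] n) [^] (k div n) \<otimes> x [^] (k mod n)" using x by (simp add: nat_pow_pow)
  hence "x [^] (k mod n) = inv ((x [^] n) [^] (k div n)) \<otimes> x [^] k"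
    using x by (simp add: m_assoc[symmetric])
  hence "x [^] (k mod n) \<in> H" using nd k subgroup.m_closed[OF H] subgroup.m_inv_closed[OF H] by simp
  hence "k mod n = 0" using n(3)[of "k mod n"] n(1) by force
  hence kn: "k = n * (k div n)" by (metis add.right_neutral mult_div_mod_eq)
  have "f (x [^] k) = f ((x [^] n) [^] (k div n))" using x by (subst kn) (simp add: nat_pow_pow)
  also have "\<dots> = f (x [^] n) ^ (k div n)" using HG.chars_pow[OF f, of "x [^] n" "k div n"] n(2) pw by simp
  also have "\<dots> = z ^ k" unfolding z[symmetric] by (subst (2) kn) (simp add: power_mult)
  finally show ?thesis .
qed

text \<open>Every complex number has an \<open>n\<close>-th root, so one generator at a time can be
  adjoined to \<open>H\<close>.\<close>

lemma char_extend:
  assumes fin: "finite (carrier G)" and H: "subgroup H G" and f: "f \<in> chars (G\<lparr>carrier := H\<rparr>)"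
  shows "\<exists>g\<in>chars G. \<forall>h\<in>H. g h = f h"
  using H f
proof (induction "card (carrier G) - card H" arbitrary: H f rule: less_induct)
  case less
  show ?case
  proof (cases "H = carrier G")
    case True
    thus ?thesis using less.prems by auto
  next
    case False
    note H = less.prems(1) and f = less.prems(2)
    obtain x where x: "x \<in> carrier G" "x \<notin> H" using False subgroup.subset[OF H] by blast
    have pos: "Coset.order G > 0" using fin one_closed by (auto simp: Coset.order_def card_gt_0_iff)
    define n where "n = (LEAST n::nat. n > 0 \<and> x [^] n \<in> H)"
    have "Coset.order G > 0 \<and> x [^] Coset.order G \<in> H"
      using pos pow_order_eq_1[OF x(1)] subgroup.one_closed[OF H] by simp
    hence n: "n > 0" "x [^] n \<in> H" using LeastI[of "\<lambda>n. n > 0 \<and> x [^] n \<in> H" "Coset.order G"] unfolding n_def by blast+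
    have nmin: "x [^] k \<notin> H" if "0 < k" "k < n" for k
      using not_less_Least[of k "\<lambda>n. n > 0 \<and> x [^] n \<in> H"] that unfolding n_def by blast
    obtain z where z: "f (x [^] n) = z ^ n" using exists_complex_root[of n "f (x [^] n)"] n by auto
    obtain K g where K: "subgroup K G" "H \<subseteq> K" "x \<in> K" "g \<in> chars (G\<lparr>carrier := K\<rparr>)" "\<forall>h\<in>H. g h = f h"
      using char_extend_step[OF fin H f x(1)] char_root_exists[OF fin H f x(1) n nmin z[symmetric]] by blast
    have "card H < card K" using K x fin subgroup.subset[OF K(1)] by (metis finite_subset psubset_card_mono psubsetI)
    moreover have "card K \<le> card (carrier G)" using card_mono[OF fin subgroup.subset[OF K(1)]] .
    ultimately have "card (carrier G) - card K < card (carrier G) - card H" by linarith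
    from less.hyps[OF this K(1,4)] show ?thesis using K(2,5) by (metis subsetD)
  qed
qed

text \<open>Over the trivial subgroup the value at \<open>x\<close> may be any \<open>n\<close>-th
  root of unity, where \<open>n\<close> is the order of \<open>x\<close>. As \<open>n > 1\<close>,
  there is one different from 1.\<close>

lemma char_separates:
  assumes fin: "finite (carrier G)" and x: "x \<in> carrier G" "x \<noteq> \<one>"
  shows "\<exists>f\<in>chars G. f x \<noteq> 1"
proof -
  define H where "H = {\<one>}"
  define f where "f = (\<lambda>y\<in>H. 1 :: complex)"
  have H: "subgroup H G" unfolding H_def by (rule triv_subgroup)
  have f: "f \<in> chars (G\<lparr>carrier := H\<rparr>)" by (auto simp: f_def H_def chars_def)
  define n where "n = (LEAST n::nat. n > 0 \<and> x [^] n \<in> H)"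
  have pos: "Coset.order G > 0" using fin one_closed by (auto simp: Coset.order_def card_gt_0_iff)
  have "Coset.order G > 0 \<and> x [^] Coset.order G \<in> H"
    using pos pow_order_eq_1[OF x(1)] subgroup.one_closed[OF H] by simp
  hence n: "n > 0" "x [^] n \<in> H" using LeastI[of "\<lambda>n. n > 0 \<and> x [^] n \<in> H" "Coset.order G"] unfolding n_def by blast+
  have nmin: "x [^] k \<notin> H" if "0 < k" "k < n" for k
    using not_less_Least[of k "\<lambda>n. n > 0 \<and> x [^] n \<in> H"] that unfolding n_def by blast
  have "n \<noteq> 1" using n x by (auto simp: H_def)
  hence n2: "n > 1" using n by simp
  obtain z :: complex where z: "z ^ n = 1" "z \<noteq> 1"
  proof -
    have c: "card {z::complex. z ^ n = 1} = n" by (rule card_roots_unity_eq) (use n in simp)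
    have "\<not> {z::complex. z ^ n = 1} \<subseteq> {1}"
    proof
      assume "{z::complex. z ^ n = 1} \<subseteq> {1}"
      from card_mono[OF _ this] show False using c n2 by simp
    qed
    thus ?thesis using that by blast
  qed
  have "z ^ n = f (x [^] n)" using n z by (simp add: f_def)
  from char_extend_step[OF fin H f x(1) char_root_exists[OF fin H f x(1) n nmin this]]
  obtain K g where K: "subgroup K G" "x \<in> K" "g \<in> chars (G\<lparr>carrier := K\<rparr>)" "g x = z" by blast
  thus ?thesis using char_extend[OF fin K(1,3)] z(2) by metis
qed

lemma chars_mult:
  assumes f: "f \<in> chars G" and g: "g \<in> chars G"
  shows "(\<lambda>x\<in>carrier G. f x * g x) \<in> chars G"
  using charsD[OF f] charsD[OF g] by (auto simp: chars_def)

text \<open>The sum of \<open>f x\<close> over all \<open>f\<close> and \<open>x\<close> is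
  evaluated in both orders: over \<open>x\<close> only the trivial character survives, over
  \<open>f\<close> only \<open>x = \<one>\<close>, since multiplication by a separating character
  permutes the characters.\<close>

theorem card_chars:
  assumes fin: "finite (carrier G)"
  shows "card (chars G) = card (carrier G)"
proof -
  have triv: "(\<lambda>x\<in>carrier G. 1) \<in> chars G" by (auto simp: chars_def)
  have finc: "finite (chars G)" by (rule finite_chars[OF fin])
  have 1: "(\<Sum>x\<in>carrier G. f x) = (if f = (\<lambda>x\<in>carrier G. 1) then of_nat (card (carrier G)) else 0)"
    if f: "f \<in> chars G" for f
  proof (cases "\<exists>x\<in>carrier G. f x \<noteq> 1")
    case True thus ?thesis using sum_char_eq_0[OF fin f] by fastforce
  next
    case False
    hence "f = (\<lambda>x\<in>carrier G. 1)" using charsD(1)[OF f] by (intro extensionalityI[of f "carrier G"]) auto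
    thus ?thesis by simp
  qed
  have 2: "(\<Sum>f\<in>chars G. f x) = (if x = \<one> then of_nat (card (chars G)) else 0)" if x: "x \<in> carrier G" for x
  proof (cases "x = \<one>")
    case True
    have "(\<Sum>f\<in>chars G. f x) = (\<Sum>f\<in>chars G. 1)"
      unfolding True by (intro sum.cong refl charsD(2))
    thus ?thesis using True by simp
  next
    case False
    obtain g where g: "g \<in> chars G" "g x \<noteq> 1" using char_separates[OF fin x False] by blast
    let ?T = "\<lambda>f. \<lambda>x\<in>carrier G. g x * f x"
    have "inj_on ?T (chars G)"
    proof (rule inj_onI)
      fix f f' assume f: "f \<in> chars G" "f' \<in> chars G" "?T f = ?T f'"
      show "f = f'"
      proof (rule extensionalityI[OF charsD(1)[OF f(1)] charsD(1)[OF f(2)]])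
        fix y assume y: "y \<in> carrier G"
        have "g y * f y = g y * f' y" using fun_cong[OF f(3), of y] y by simp
        thus "f y = f' y" using chars_inv(2)[OF g(1) y] by simp
      qed
    qed
    moreover have "?T ` chars G \<subseteq> chars G" using chars_mult[OF g(1)] by blast
    ultimately have bij: "bij_betw ?T (chars G) (chars G)"
      using finc by (simp add: bij_betw_def endo_inj_surj)
    have "(\<Sum>f\<in>chars G. f x) = (\<Sum>f\<in>chars G. ?T f x)"
      by (rule sum.reindex_bij_betw[OF bij, symmetric])
    also have "\<dots> = g x * (\<Sum>f\<in>chars G. f x)" using x by (simp add: sum_distrib_left)
    finally show ?thesis using g(2) False by (simp add: mult_cancel_right1)
  qed
  have "(of_nat (card (carrier G)) :: complex) = (\<Sum>f\<in>chars G. \<Sum>x\<in>carrier G. f x)"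
    using 1 triv finc by (simp add: sum.delta' cong: sum.cong)
  also have "\<dots> = (\<Sum>x\<in>carrier G. \<Sum>f\<in>chars G. f x)" by (rule sum.swap)
  also have "\<dots> = of_nat (card (chars G))"
    using 2 fin by (simp add: sum.delta' cong: sum.cong)
  finally show ?thesis by (simp only: of_nat_eq_iff)
qed

end

text \<open>The additive group of vectors, in the same extensional encoding as the three blocks of
  \<open>group_G\<close>.\<close>

definition vec_group :: "('a, 'b) ring_scheme \<Rightarrow> 'i set \<Rightarrow> ('i \<Rightarrow> 'a) monoid" where
  "vec_group R I = \<lparr> carrier = I \<rightarrow>\<^sub>E carrier R, monoid.mult = (\<lambda>u v. \<lambda>i\<in>I. u i \<oplus>\<^bsub>R\<^esub> v i),
     one = (\<lambda>i\<in>I. \<zero>\<^bsub>R\<^esub>) \<rparr>"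

lemma vec_group_simps:
  "carrier (vec_group R I) = I \<rightarrow>\<^sub>E carrier R"
  "u \<otimes>\<^bsub>vec_group R I\<^esub> v = (\<lambda>i\<in>I. u i \<oplus>\<^bsub>R\<^esub> v i)"
  "\<one>\<^bsub>vec_group R I\<^esub> = (\<lambda>i\<in>I. \<zero>\<^bsub>R\<^esub>)"
  by (simp_all add: vec_group_def)

lemma (in ring) comm_group_vec_group: "comm_group (vec_group R I)"
proof (rule comm_groupI)
  fix u assume u: "u \<in> carrier (vec_group R I)"
  show "\<exists>v\<in>carrier (vec_group R I). v \<otimes>\<^bsub>vec_group R I\<^esub> u = \<one>\<^bsub>vec_group R I\<^esub>"
    using u by (intro bexI[of _ "\<lambda>i\<in>I. \<ominus> u i"]) (auto simp: vec_group_simps PiE_def Pi_def l_neg intro!: restrict_ext)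
  show "\<one>\<^bsub>vec_group R I\<^esub> \<otimes>\<^bsub>vec_group R I\<^esub> u = u"
    using u by (intro extensionalityI[of _ I]) (auto simp: vec_group_simps PiE_def Pi_def)
qed (auto simp: vec_group_simps PiE_def Pi_def a_ac intro!: restrict_ext)

section \<open>Irreducible representations of finite groups\<close>

lemma mat_trace_mult_commute:
  assumes "A \<in> carrier_mat k k" "B \<in> carrier_mat k k"
  shows "mat_trace (A * B) = mat_trace (B * A)"
proof -
  have "mat_trace (A * B) = (\<Sum>i<k. \<Sum>j<k. A $$ (i, j) * B $$ (j, i))"
    using assms by (auto simp: mat_trace_def scalar_prod_def lessThan_atLeast0 intro!: sum.cong)
  also have "\<dots> = (\<Sum>j<k. \<Sum>i<k. B $$ (j, i) * A $$ (i, j))"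
    by (subst sum.swap) (simp add: mult.commute)
  also have "\<dots> = mat_trace (B * A)"
    using assms by (auto simp: mat_trace_def scalar_prod_def lessThan_atLeast0 intro!: sum.cong)
  finally show ?thesis .
qed

lemma mat_trace_smult: "mat_trace (c \<cdot>\<^sub>m A) = c * mat_trace A"
  if "A \<in> carrier_mat k k"
  using that by (simp add: mat_trace_def sum_distrib_left)

lemma mat_trace_one: "mat_trace (1\<^sub>m k) = of_nat k"
  by (simp add: mat_trace_def)

lemma subspace_vecI:
  fixes W :: "complex vec set"
  assumes "W \<subseteq> carrier_vec k" "0\<^sub>v k \<in> W" "\<And>v w. v \<in> W \<Longrightarrow> w \<in> W \<Longrightarrow> v + w \<in> W"
    "\<And>c v. v \<in> W \<Longrightarrow> c \<cdot>\<^sub>v v \<in> W"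
  shows "VectorSpace.subspace class_ring W (module_vec TYPE(complex) k)"
  unfolding VectorSpace.subspace_def LinearCombinations.submodule_def
  using vec_vs[of k, where 'a = complex] vec_module[of k, where 'a = complex] assms
  by (auto simp: module_vec_simps)

lemma subspace_vecD:
  fixes W :: "complex vec set"
  assumes "VectorSpace.subspace class_ring W (module_vec TYPE(complex) k)"
  shows "W \<subseteq> carrier_vec k" "0\<^sub>v k \<in> W" "\<And>v w. v \<in> W \<Longrightarrow> w \<in> W \<Longrightarrow> v + w \<in> W"
    "\<And>c v. v \<in> W \<Longrightarrow> c \<cdot>\<^sub>v v \<in> W"
  using assms unfolding VectorSpace.subspace_def LinearCombinations.submodule_def
  by (auto simp: module_vec_simps)

lemma carrier_GL: "A \<in> carrier (GL k) \<longleftrightarrow> A \<in> carrier_mat k k \<and> (\<exists>B\<in>carrier_mat k k. B * A = 1\<^sub>m k \<and> A * B = 1\<^sub>m k)"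
  by (auto simp: GL_def units_of_def Units_def ring_mat_simps)

lemma mult_GL: "A \<otimes>\<^bsub>GL k\<^esub> B = A * B"
  by (simp add: GL_def units_of_def ring_mat_simps)

lemma group_GL: "group (GL k)"
proof -
  interpret ring "ring_mat TYPE(complex) k ()" by (rule ring_mat)
  show ?thesis unfolding GL_def by (rule units_group)
qed

lemma one_GL: "\<one>\<^bsub>GL k\<^esub> = 1\<^sub>m k"
  by (simp add: GL_def units_of_def ring_mat_simps)

section \<open>Schur's lemma, orthogonality and degrees\<close>

locale irrep = group G for G :: "('g, 'b) monoid_scheme" (structure) +
  fixes k :: nat and rho :: "'g \<Rightarrow> complex mat"
  assumes irr: "irreducible_rep G k rho"
begin

lemma k_pos: "k > 0"
  using irr by (simp add: irreducible_rep_def)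

lemma rho_hom: "rho \<in> hom G (GL k)"
  using irr by (simp add: irreducible_rep_def)

lemma rho_closed [simp]: "g \<in> carrier G \<Longrightarrow> rho g \<in> carrier_mat k k"
  using rho_hom carrier_GL by (auto simp: hom_def Pi_def)

lemma rho_dim [simp]: "g \<in> carrier G \<Longrightarrow> dim_row (rho g) = k" "g \<in> carrier G \<Longrightarrow> dim_col (rho g) = k"
  using rho_closed by blast+

lemma rho_mult: "g \<in> carrier G \<Longrightarrow> h \<in> carrier G \<Longrightarrow> rho (g \<otimes> h) = rho g * rho h"
  using hom_mult[OF rho_hom] by (simp add: mult_GL)

lemma rho_one: "rho \<one> = 1\<^sub>m k"
  using hom_one[OF rho_hom is_group group_GL] by (simp add: one_GL)

lemma rho_inv: "g \<in> carrier G \<Longrightarrow> rho g * rho (inv g) = 1\<^sub>m k"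
  using rho_mult[of g "inv g"] rho_one by simp

lemma irreducible:
  assumes "W \<subseteq> carrier_vec k" "0\<^sub>v k \<in> W" "\<And>v w. v \<in> W \<Longrightarrow> w \<in> W \<Longrightarrow> v + w \<in> W"
    "\<And>c v. v \<in> W \<Longrightarrow> c \<cdot>\<^sub>v v \<in> W" "\<And>g v. g \<in> carrier G \<Longrightarrow> v \<in> W \<Longrightarrow> rho g *\<^sub>v v \<in> W"
  shows "W = {0\<^sub>v k} \<or> W = carrier_vec k"
  using irr subspace_vecI[OF assms(1-4)] assms(5) by (auto simp: irreducible_rep_def)

lemma schur:
  assumes A: "A \<in> carrier_mat k k" and comm: "\<And>g. g \<in> carrier G \<Longrightarrow> A * rho g = rho g * A"
  shows "\<exists>c. A = c \<cdot>\<^sub>m 1\<^sub>m k"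
proof -
  have "degree (char_poly A) = k" using degree_monic_char_poly[OF A] by simp
  hence "\<not> constant (poly (char_poly A))" using k_pos constant_degree[of "char_poly A"] by simp
  then obtain c where c: "poly (char_poly A) c = 0" using fundamental_theorem_of_algebra by blast
  hence "eigenvalue A c" using eigenvalue_root_char_poly[OF A] by simp
  then obtain v where v: "v \<in> carrier_vec k" "v \<noteq> 0\<^sub>v k" "A *\<^sub>v v = c \<cdot>\<^sub>v v"
    using A by (auto simp: eigenvalue_def eigenvector_def)
  define W where "W = {w \<in> carrier_vec k. A *\<^sub>v w = c \<cdot>\<^sub>v w}"
  have "W = {0\<^sub>v k} \<or> W = carrier_vec k"
  proof (rule irreducible)
    show "W \<subseteq> carrier_vec k" by (auto simp: W_def)
    show "0\<^sub>v k \<in> W" using A by (auto simp: W_def)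
    show "\<And>v w. v \<in> W \<Longrightarrow> w \<in> W \<Longrightarrow> v + w \<in> W"
      using A by (auto simp: W_def mult_add_distrib_mat_vec smult_add_distrib_vec)
    show "\<And>a v. v \<in> W \<Longrightarrow> a \<cdot>\<^sub>v v \<in> W"
      using A by (auto simp: W_def mult_mat_vec smult_smult_assoc mult.commute)
  next
    fix g w assume g: "g \<in> carrier G" and w: "w \<in> W"
    have "A *\<^sub>v (rho g *\<^sub>v w) = (A * rho g) *\<^sub>v w"
      using A g w by (auto simp: W_def assoc_mult_mat_vec[of _ k k _ k])
    also have "\<dots> = rho g *\<^sub>v (A *\<^sub>v w)"
      using A g w comm[OF g] by (auto simp: W_def assoc_mult_mat_vec[of _ k k _ k])
    also have "\<dots> = c \<cdot>\<^sub>v (rho g *\<^sub>v w)" using g w by (auto simp: W_def mult_mat_vec)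
    finally show "rho g *\<^sub>v w \<in> W"
      using g w mult_mat_vec_carrier[OF rho_closed[OF g], of w] by (auto simp: W_def)
  qed
  moreover have "v \<in> W" using v by (simp add: W_def)
  hence "W \<noteq> {0\<^sub>v k}" using v(2) by auto
  ultimately have W: "W = carrier_vec k" by metis
  have "A = c \<cdot>\<^sub>m 1\<^sub>m k"
  proof (rule eq_matI)
    fix i j assume ij: "i < dim_row (c \<cdot>\<^sub>m 1\<^sub>m k)" "j < dim_col (c \<cdot>\<^sub>m 1\<^sub>m k)"
    have "unit_vec k j \<in> W" unfolding W by simp
    hence "A *\<^sub>v unit_vec k j = c \<cdot>\<^sub>v unit_vec k j" by (simp add: W_def)
    hence "(A *\<^sub>v unit_vec k j) $ i = (c \<cdot>\<^sub>v unit_vec k j) $ i" by simp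
    thus "A $$ (i, j) = (c \<cdot>\<^sub>m 1\<^sub>m k) $$ (i, j)" using A ij by simp
  qed (use A in auto)
  thus ?thesis ..
qed

lemma schur_orthogonality:
  assumes fin: "finite (carrier G)" and ijlm: "i < k" "j < k" "l < k" "m < k"
  shows "(\<Sum>g\<in>carrier G. rho g $$ (i, j) * rho (inv g) $$ (l, m)) =
    (if l = j \<and> i = m then of_nat (card (carrier G)) / of_nat k else 0)"
proof -
  \<comment> \<open>\<open>M\<close> is the sum of all conjugates
    \<open>rho g * E * rho (inv g)\<close> of the matrix unit \<open>E\<close> at
    \<open>(j, l)\<close>, so it commutes with the representation.\<close>
  define M where "M = mat k k (\<lambda>(i, m). \<Sum>g\<in>carrier G. rho g $$ (i, j) * rho (inv g) $$ (l, m))"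
  have M: "M \<in> carrier_mat k k" by (simp add: M_def)
  have entry: "(rho a * rho b) $$ (i, m) = (\<Sum>p<k. rho a $$ (i, p) * rho b $$ (p, m))"
    if "a \<in> carrier G" "b \<in> carrier G" "i < k" "m < k" for a b i m
    using that rho_closed[OF that(1)] rho_closed[OF that(2)]
    by (simp add: scalar_prod_def lessThan_atLeast0)
  have "M * rho h = rho h * M" if h: "h \<in> carrier G" for h
  proof (rule eq_matI)
    fix i m assume "i < dim_row (rho h * M)" "m < dim_col (rho h * M)"
    hence im: "i < k" "m < k" using h M by auto
    have "(rho h * M) $$ (i, m) = (\<Sum>p<k. rho h $$ (i, p) * (\<Sum>g\<in>carrier G. rho g $$ (p, j) * rho (inv g) $$ (l, m)))"
      using im h by (simp add: scalar_prod_def lessThan_atLeast0 M_def)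
    also have "\<dots> = (\<Sum>g\<in>carrier G. (\<Sum>p<k. rho h $$ (i, p) * rho g $$ (p, j)) * rho (inv g) $$ (l, m))"
      unfolding sum_distrib_left sum_distrib_right by (subst sum.swap) (simp add: mult.assoc)
    also have "\<dots> = (\<Sum>g\<in>carrier G. rho (h \<otimes> g) $$ (i, j) * rho (inv g) $$ (l, m))"
      using h im ijlm by (intro sum.cong refl) (simp add: rho_mult entry del: index_mult_mat)
    also have "\<dots> = (\<Sum>g\<in>carrier G. rho g $$ (i, j) * rho (inv g \<otimes> h) $$ (l, m))"
      by (rule sum.reindex_bij_witness[of _ "\<lambda>g. inv h \<otimes> g" "\<lambda>g. h \<otimes> g"])
        (use h in \<open>auto simp: m_assoc[symmetric] inv_mult_group\<close>, simp add: m_assoc)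
    also have "\<dots> = (\<Sum>g\<in>carrier G. rho g $$ (i, j) * (\<Sum>p<k. rho (inv g) $$ (l, p) * rho h $$ (p, m)))"
      using h im ijlm by (intro sum.cong refl) (simp add: rho_mult entry del: index_mult_mat)
    also have "\<dots> = (\<Sum>p<k. (\<Sum>g\<in>carrier G. rho g $$ (i, j) * rho (inv g) $$ (l, p)) * rho h $$ (p, m))"
      unfolding sum_distrib_left sum_distrib_right by (subst sum.swap) (simp add: mult.assoc)
    also have "\<dots> = (M * rho h) $$ (i, m)"
      using im h by (simp add: scalar_prod_def lessThan_atLeast0 M_def)
    finally show "(M * rho h) $$ (i, m) = (rho h * M) $$ (i, m)" by simp
  qed (use h M in auto)
  then obtain c where c: "M = c \<cdot>\<^sub>m 1\<^sub>m k" using schur[OF M] by blast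
  have Mim: "M $$ (i, m) = (if i = m then c else 0)" if "i < k" "m < k" for i m
    using that by (simp add: c)
  \<comment> \<open>The trace of \<open>M\<close> fixes the scalar, as each conjugate of
    \<open>E\<close> has the trace of \<open>E\<close>.\<close>
  have "(\<Sum>i<k. M $$ (i, i)) = (\<Sum>g\<in>carrier G. \<Sum>i<k. rho (inv g) $$ (l, i) * rho g $$ (i, j))"
    by (subst sum.swap) (simp add: M_def mult.commute)
  also have "\<dots> = (\<Sum>g\<in>carrier G. 1\<^sub>m k $$ (l, j))"
    using ijlm by (intro sum.cong refl) (simp add: entry[symmetric] rho_mult[symmetric] rho_one del: index_mult_mat)
  also have "\<dots> = (if l = j then of_nat (card (carrier G)) else 0)" using ijlm by simp
  finally have "of_nat k * c = (if l = j then of_nat (card (carrier G)) else 0)"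
    using Mim by simp
  hence c': "c = (if l = j then of_nat (card (carrier G)) else 0) / of_nat k"
    using k_pos by (simp add: nonzero_eq_divide_eq mult.commute)
  have "(\<Sum>g\<in>carrier G. rho g $$ (i, j) * rho (inv g) $$ (l, m)) = M $$ (i, m)"
    using ijlm by (simp add: M_def)
  also have "\<dots> = (if i = m then c else 0)" by (rule Mim) (use ijlm in auto)
  finally show ?thesis unfolding c' by simp
qed

text \<open>The value at \<open>inv g\<close> takes the place of the complex conjugate, which keeps
  the statement purely algebraic.\<close>

theorem character_norm:
  assumes fin: "finite (carrier G)"
  shows "(\<Sum>g\<in>carrier G. mat_trace (rho g) * mat_trace (rho (inv g))) = of_nat (card (carrier G))"
proof -
  have "(\<Sum>g\<in>carrier G. mat_trace (rho g) * mat_trace (rho (inv g))) =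
      (\<Sum>g\<in>carrier G. \<Sum>i<k. \<Sum>l<k. rho g $$ (i, i) * rho (inv g) $$ (l, l))"
    by (intro sum.cong refl) (simp add: mat_trace_def sum_product)
  also have "\<dots> = (\<Sum>i<k. \<Sum>l<k. \<Sum>g\<in>carrier G. rho g $$ (i, i) * rho (inv g) $$ (l, l))"
    by (subst sum.swap) (intro sum.cong refl sum.swap)
  also have "\<dots> = (\<Sum>i<k. \<Sum>l<k. if l = i then of_nat (card (carrier G)) / of_nat k else 0)"
    by (intro sum.cong refl) (simp add: schur_orthogonality[OF fin])
  also have "\<dots> = of_nat (card (carrier G))" using k_pos by simp
  finally show ?thesis .
qed

text \<open>Known as the centre of the character.\<close>

definition scalar_elts :: "'g set" where
  "scalar_elts = {g \<in> carrier G. \<exists>c. rho g = c \<cdot>\<^sub>m 1\<^sub>m k}"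

lemma scalar_iff_commutes:
  assumes g: "g \<in> carrier G"
  shows "g \<in> scalar_elts \<longleftrightarrow> (\<forall>h\<in>carrier G. rho g * rho h = rho h * rho g)"
proof
  assume "g \<in> scalar_elts"
  then obtain c where "rho g = c \<cdot>\<^sub>m 1\<^sub>m k" by (auto simp: scalar_elts_def)
  thus "\<forall>h\<in>carrier G. rho g * rho h = rho h * rho g"
    by (auto simp: mult_smult_assoc_mat[of _ k k _ k] mult_smult_distrib[of _ k k _ k])
next
  assume "\<forall>h\<in>carrier G. rho g * rho h = rho h * rho g"
  thus "g \<in> scalar_elts" using schur[of "rho g"] g by (auto simp: scalar_elts_def)
qed

text \<open>By Schur's lemma some \<open>h\<close> does not commute with \<open>g\<close> under
  \<open>rho\<close>, so the factor \<open>c\<close> is not 1, while the trace is unchanged by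
  conjugation with \<open>rho h\<close>.\<close>

lemma trace_zero:
  assumes g: "g \<in> carrier G" "g \<notin> scalar_elts"
    and comm: "\<And>h. h \<in> carrier G \<Longrightarrow> \<exists>c. rho g * rho h = c \<cdot>\<^sub>m (rho h * rho g)"
  shows "mat_trace (rho g) = 0"
proof -
  obtain h where h: "h \<in> carrier G" "rho g * rho h \<noteq> rho h * rho g" using g scalar_iff_commutes by blast
  then obtain c where c: "rho g * rho h = c \<cdot>\<^sub>m (rho h * rho g)" using comm by blast
  have "c \<noteq> 1"
  proof
    assume "c = 1"
    hence "c \<cdot>\<^sub>m (rho h * rho g) = rho h * rho g" by (intro eq_matI) auto
    thus False using c h by simp
  qed
  have "rho g = rho g * (rho h * rho (inv h))" using g h by (simp add: rho_inv)
  also have "\<dots> = (rho g * rho h) * rho (inv h)" using g h by (simp add: assoc_mult_mat[of _ k k _ k _ k])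
  also have "mat_trace \<dots> = c * mat_trace (rho h * rho g * rho (inv h))"
    unfolding c using g h by (subst mult_smult_assoc_mat[of _ k k _ k]) (auto intro!: mat_trace_smult)
  also have "mat_trace (rho h * rho g * rho (inv h)) = mat_trace (rho (inv h) * (rho h * rho g))"
    using g h by (intro mat_trace_mult_commute) auto
  also have "rho (inv h) * (rho h * rho g) = rho g"
    using g h by (simp add: rho_mult[symmetric] m_assoc[symmetric])
  finally show ?thesis using \<open>c \<noteq> 1\<close> by simp
qed

text \<open>In the character norm only the scalar elements contribute, each of them
  \<open>k ^ 2\<close>. This turns the degree into a count of group elements.\<close>

theorem degree_sqr:
  assumes fin: "finite (carrier G)"
    and comm: "\<And>g h. g \<in> carrier G \<Longrightarrow> h \<in> carrier G \<Longrightarrow> \<exists>c. rho g * rho h = c \<cdot>\<^sub>m (rho h * rho g)"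
  shows "k ^ 2 * card scalar_elts = card (carrier G)"
proof -
  have sub: "scalar_elts \<subseteq> carrier G" by (auto simp: scalar_elts_def)
  have one: "mat_trace (rho g) * mat_trace (rho (inv g)) = of_nat (k ^ 2)" if gs: "g \<in> scalar_elts" for g
  proof -
    obtain c where g: "g \<in> carrier G" and c: "rho g = c \<cdot>\<^sub>m 1\<^sub>m k" using gs by (auto simp: scalar_elts_def)
    have "1\<^sub>m k = c \<cdot>\<^sub>m rho (inv g)"
      using rho_inv[OF g] g unfolding c by (simp add: mult_smult_assoc_mat[of _ k k _ k])
    hence "of_nat k = c * mat_trace (rho (inv g))"
      using g mat_trace_smult[of "rho (inv g)" k c] mat_trace_one[of k] by simp
    moreover have "mat_trace (rho g) = c * of_nat k" unfolding c by (simp add: mat_trace_smult[of _ k] mat_trace_one)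
    ultimately show ?thesis by (simp add: power2_eq_square algebra_simps)
  qed
  have "of_nat (card (carrier G)) = (\<Sum>g\<in>carrier G. mat_trace (rho g) * mat_trace (rho (inv g)))"
    using character_norm[OF fin] by simp
  also have "\<dots> = (\<Sum>g\<in>scalar_elts. mat_trace (rho g) * mat_trace (rho (inv g)))"
    using fin sub trace_zero[OF _ _ comm] by (intro sum.mono_neutral_right) auto
  also have "\<dots> = of_nat (k ^ 2 * card scalar_elts)" using one by simp
  finally show ?thesis by (simp only: of_nat_eq_iff)
qed

end

section \<open>Matrices over finite chain rings\<close>

lemma card_eq_fibres:
  assumes "finite A" "\<And>x. x \<in> A \<Longrightarrow> card {y \<in> A. f y = f x} = c"
  shows "card A = c * card (f ` A)"
proof -
  have "card A = (\<Sum>y\<in>f ` A. card {x \<in> A. f x = y})"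
    using sum.image_gen[OF assms(1), of "\<lambda>_. 1::nat" f] by simp
  also have "\<dots> = (\<Sum>y\<in>f ` A. c)" using assms(2) by (intro sum.cong refl) auto
  finally show ?thesis by simp
qed

text \<open>Modelled on O/P^N, with \<open>p\<close> the image of a uniformizer and \<open>q\<close>
  the residue cardinality, expressed as an index. \<open>N = 0\<close> is the zero ring, which
  supplies the constant coefficient of the power series; there \<open>residue\<close> would force
  \<open>q = 1\<close>.\<close>

locale chain_ring = cring R for R :: "('a, 'b) ring_scheme" (structure) +
  fixes p :: 'a and N q :: nat
  assumes fin: "finite (carrier R)"
    and p_closed [simp]: "p \<in> carrier R"
    and p_pow_N: "p [^] N = \<zero>"
    and p_pow_nonzero: "\<And>k. k < N \<Longrightarrow> p [^] k \<noteq> \<zero>"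
    and unit: "\<And>x. x \<in> carrier R \<Longrightarrow> x \<notin> (\<lambda>r. p \<otimes> r) ` carrier R \<Longrightarrow> x \<in> Units R"
    and residue: "N > 0 \<Longrightarrow> card (carrier R) = q * card ((\<lambda>r. p \<otimes> r) ` carrier R)"
begin

definition pideal :: "nat \<Rightarrow> 'a set" where
  "pideal k = (\<lambda>r. p [^] k \<otimes> r) ` carrier R"

lemma pideal_carrier [simp]: "x \<in> pideal k \<Longrightarrow> x \<in> carrier R"
  by (auto simp: pideal_def)

lemma finite_pideal [simp]: "finite (pideal k)"
  using fin by (simp add: pideal_def)

lemma pideal_0: "pideal 0 = carrier R"
proof -
  have "(\<lambda>r. p [^] (0::nat) \<otimes> r) ` carrier R = (\<lambda>r. r) ` carrier R" by (intro image_cong refl) simp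
  thus ?thesis by (simp add: pideal_def)
qed

lemma pideal_zero [simp]: "\<zero> \<in> pideal k"
  unfolding pideal_def by (rule image_eqI[of _ _ \<zero>]) simp_all

lemma pideal_N: "N \<le> k \<Longrightarrow> pideal k = {\<zero>}"
proof -
  assume "N \<le> k"
  hence "p [^] k = p [^] N \<otimes> p [^] (k - N)" by (simp add: nat_pow_mult)
  hence "p [^] k = \<zero>" by (simp add: p_pow_N)
  hence "pideal k = (\<lambda>r. \<zero>) ` carrier R" unfolding pideal_def by (intro image_cong refl) simp
  thus ?thesis using zero_closed by auto
qed

lemma pideal_Suc: "pideal (Suc k) \<subseteq> pideal k"
  by (auto simp: pideal_def m_assoc)

lemma pideal_antimono: "j \<le> k \<Longrightarrow> pideal k \<subseteq> pideal j"
  by (induction rule: dec_induct) (use pideal_Suc in auto)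

lemma pideal_add: "x \<in> pideal k \<Longrightarrow> y \<in> pideal k \<Longrightarrow> x \<oplus> y \<in> pideal k"
  unfolding pideal_def by clarify (metis add.m_closed imageI nat_pow_closed p_closed r_distr)

lemma pideal_mult: "r \<in> carrier R \<Longrightarrow> x \<in> pideal k \<Longrightarrow> r \<otimes> x \<in> pideal k"
proof -
  assume r: "r \<in> carrier R" and "x \<in> pideal k"
  then obtain s where s: "s \<in> carrier R" "x = p [^] k \<otimes> s" by (auto simp: pideal_def)
  have "r \<otimes> x = p [^] k \<otimes> (r \<otimes> s)" using r s by (simp add: m_lcomm)
  thus ?thesis using r s unfolding pideal_def by blast
qed

lemma pideal_minus: "x \<in> pideal k \<Longrightarrow> y \<in> pideal k \<Longrightarrow> x \<ominus> y \<in> pideal k"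
proof -
  assume "x \<in> pideal k" "y \<in> pideal k"
  hence "x \<oplus> (\<ominus> \<one>) \<otimes> y \<in> pideal k" by (intro pideal_add pideal_mult) auto
  thus ?thesis using \<open>x \<in> pideal k\<close> \<open>y \<in> pideal k\<close> by (simp add: a_minus_def l_minus)
qed

lemma finsum_pideal:
  assumes "finite A" "\<And>i. i \<in> A \<Longrightarrow> g i \<in> pideal k"
  shows "(\<Oplus>i\<in>A. g i) \<in> pideal k"
  using assms
proof (induction A rule: finite_induct)
  case (insert x A)
  have "g \<in> A \<rightarrow> carrier R" "g x \<in> carrier R" using insert.prems pideal_carrier by blast+
  thus ?case using insert by (simp add: pideal_add)
qed simp

text \<open>An element of exact level \<open>k\<close> is \<open>p [^] k\<close> times a unit,
  because a cofactor divisible by \<open>p\<close> would raise the level.\<close>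

lemma pideal_generator:
  assumes x: "x \<in> pideal k" "x \<notin> pideal (Suc k)" and y: "y \<in> pideal k"
  shows "\<exists>r\<in>carrier R. y = r \<otimes> x"
proof -
  obtain s where s: "s \<in> carrier R" "x = p [^] k \<otimes> s" using x by (auto simp: pideal_def)
  obtain t where t: "t \<in> carrier R" "y = p [^] k \<otimes> t" using y by (auto simp: pideal_def)
  have "s \<notin> (\<lambda>r. p \<otimes> r) ` carrier R"
    using x(2) s by (auto simp: pideal_def m_assoc)
  hence u: "s \<in> Units R" using unit s by blast
  have "(t \<otimes> inv s) \<otimes> (s \<otimes> p [^] k) = t \<otimes> ((inv s \<otimes> s) \<otimes> p [^] k)"
    using t u by (simp only: m_assoc Units_inv_closed Units_closed nat_pow_closed p_closed m_closed)
  hence "y = (t \<otimes> inv s) \<otimes> x" using u t s by (simp add: m_comm)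
  thus ?thesis using t u by blast
qed

text \<open>Otherwise \<open>p [^] k\<close> would be annihilated by some
  \<open>u \<ominus> p \<otimes> r\<close>. This is a unit: else \<open>p\<close> would divide the
  unit \<open>u\<close>, but a nilpotent \<open>p\<close> is no unit.\<close>

lemma pow_notin_pideal: assumes "k < N" "u \<in> Units R" shows "p [^] k \<otimes> u \<notin> pideal (Suc k)"
proof
  assume "p [^] k \<otimes> u \<in> pideal (Suc k)"
  then obtain r where r: "r \<in> carrier R" "p [^] k \<otimes> u = p [^] Suc k \<otimes> r" by (auto simp: pideal_def)
  have u: "u \<in> carrier R" using assms by auto
  have v: "u \<ominus> p \<otimes> r \<in> carrier R" using r u by simp
  have "p [^] k \<otimes> (u \<ominus> p \<otimes> r) = p [^] k \<otimes> u \<ominus> p [^] k \<otimes> (p \<otimes> r)"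
    using r u by (simp add: a_minus_def r_distr r_minus)
  also have "p [^] k \<otimes> (p \<otimes> r) = p [^] Suc k \<otimes> r" using r by (simp add: m_assoc)
  finally have z: "p [^] k \<otimes> (u \<ominus> p \<otimes> r) = \<zero>" using r u by (simp add: a_minus_def r_neg)
  have "u \<ominus> p \<otimes> r \<in> Units R"
  proof (rule unit[OF v], rule notI)
    assume "u \<ominus> p \<otimes> r \<in> (\<lambda>r. p \<otimes> r) ` carrier R"
    then obtain s where s: "s \<in> carrier R" "u \<ominus> p \<otimes> r = p \<otimes> s" by auto
    have "u = (u \<ominus> p \<otimes> r) \<oplus> p \<otimes> r" using u r by (simp add: a_minus_def a_assoc l_neg)
    hence us: "u = p \<otimes> (s \<oplus> r)" using s r by (simp add: r_distr)
    define t where "t = (s \<oplus> r) \<otimes> inv u"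
    have t: "t \<in> carrier R" using s r assms by (simp add: t_def)
    have pt: "p \<otimes> t = \<one>" using us s r assms unfolding t_def
      by (metis Units_r_inv add.m_closed m_assoc p_closed Units_inv_closed)
    have "p [^] j \<otimes> t [^] j = \<one>" for j :: nat
      using pt t by (metis nat_pow_distrib nat_pow_one p_closed)
    from this[of N] have "\<one> = \<zero>" using p_pow_N t by simp
    thus False using p_pow_nonzero[of 0] assms(1) by simp
  qed
  hence "p [^] k = \<zero>" using z v by (metis Units_r_inv m_assoc nat_pow_closed p_closed r_one l_null Units_inv_closed)
  thus False using p_pow_nonzero assms(1) by blast
qed

text \<open>Multiplication by \<open>p [^] k\<close> maps the ring onto \<open>pideal k\<close> and
  \<open>pideal 1\<close> onto \<open>pideal (Suc k)\<close>, both times with the kernel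
  \<open>K\<close>, which lies in \<open>pideal 1\<close>. So every step of the chain has the same
  index as the first.\<close>

lemma card_pideal_Suc: assumes k: "k < N" shows "card (pideal k) = q * card (pideal (Suc k))"
proof -
  let ?f = "\<lambda>r. p [^] k \<otimes> r"
  define K where "K = {r \<in> carrier R. ?f r = \<zero>}"
  have Kc: "K \<subseteq> carrier R" by (auto simp: K_def)
  have K1: "K \<subseteq> pideal 1"
  proof
    fix r assume r: "r \<in> K"
    show "r \<in> pideal 1"
    proof (rule ccontr)
      assume "r \<notin> pideal 1"
      hence "r \<in> Units R" using unit[of r] r Kc by (auto simp: pideal_def)
      hence "?f r \<notin> pideal (Suc k)" by (rule pow_notin_pideal[OF k])
      thus False using r by (simp add: K_def)
    qed
  qed
  have fib: "card {y \<in> S. ?f y = ?f x} = card K"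
    if S: "S \<subseteq> carrier R" "K \<subseteq> S" "\<And>x y. x \<in> S \<Longrightarrow> y \<in> S \<Longrightarrow> x \<oplus> y \<in> S" "\<And>x y. x \<in> S \<Longrightarrow> y \<in> S \<Longrightarrow> x \<ominus> y \<in> S"
      and x: "x \<in> S" for S x
  proof -
    have xc: "x \<in> carrier R" using S x by auto
    have "bij_betw (\<lambda>y. x \<oplus> y) K {y \<in> S. ?f y = ?f x}"
    proof (rule bij_betw_byWitness[where f' = "\<lambda>y. y \<ominus> x"])
      show "\<forall>a\<in>K. x \<oplus> a \<ominus> x = a"
      proof
        fix a assume "a \<in> K"
        hence "a \<in> carrier R" using Kc by auto
        thus "x \<oplus> a \<ominus> x = a" using xc by (simp add: a_minus_def a_comm[of x a] a_assoc r_neg)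
      qed
      show "\<forall>a\<in>{y \<in> S. ?f y = ?f x}. x \<oplus> (a \<ominus> x) = a" using xc S(1) by (auto simp: a_minus_def a_lcomm r_neg)
      show "(\<oplus>) x ` K \<subseteq> {y \<in> S. ?f y = ?f x}" using x xc S by (auto simp: K_def r_distr)
      show "(\<lambda>y. y \<ominus> x) ` {y \<in> S. ?f y = ?f x} \<subseteq> K"
      proof
        fix z assume "z \<in> (\<lambda>y. y \<ominus> x) ` {y \<in> S. ?f y = ?f x}"
        then obtain y where y: "y \<in> S" "?f y = ?f x" "z = y \<ominus> x" by auto
        have yc: "y \<in> carrier R" using S y by auto
        have "?f z = ?f y \<ominus> ?f x" using y xc yc by (simp add: a_minus_def r_distr r_minus)
        thus "z \<in> K" using y xc yc by (simp add: K_def a_minus_def r_neg)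
      qed
    qed
    thus ?thesis by (rule bij_betw_same_card[symmetric])
  qed
  have "card (carrier R) = card K * card (?f ` carrier R)"
    by (rule card_eq_fibres[OF fin]) (rule fib, use Kc in auto)
  moreover have "card (pideal 1) = card K * card (?f ` pideal 1)"
    by (rule card_eq_fibres[OF finite_pideal]) (rule fib[OF _ K1 pideal_add pideal_minus], auto)
  moreover have "?f ` pideal 1 = pideal (Suc k)"
    unfolding pideal_def image_image by (intro image_cong refl) (simp add: m_assoc)
  moreover have "card (carrier R) = q * card (pideal 1)" using residue k by (simp add: pideal_def)
  moreover have "card K > 0"
  proof -
    have "\<zero> \<in> K" by (simp add: K_def)
    thus ?thesis using finite_subset[OF Kc fin] card_gt_0_iff by blast
  qed
  ultimately show ?thesis by (simp add: pideal_def[of k])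
qed

lemma card_pideal: "k \<le> N \<Longrightarrow> card (pideal k) = q ^ (N - k)"
proof (induction "N - k" arbitrary: k)
  case 0 thus ?case by (simp add: pideal_N)
next
  case (Suc d)
  hence "card (pideal (Suc k)) = q ^ (N - Suc k)" by (intro Suc.hyps(1)) auto
  moreover have "k < N" using Suc.hyps(2) by simp
  moreover have "N - k = Suc (N - Suc k)" using \<open>k < N\<close> by simp
  ultimately show ?case by (simp add: card_pideal_Suc)
qed

lemma card_carrier: "card (carrier R) = q ^ N"
  using card_pideal[of 0] by (simp add: pideal_0)

lemma pideal_level:
  assumes x: "x \<in> carrier R" "x \<noteq> \<zero>"
  obtains k where "k < N" "x \<in> pideal k" "x \<notin> pideal (Suc k)"
proof -
  have ex: "\<exists>j. x \<notin> pideal j" using x pideal_N[of N] by auto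
  define j where "j = (LEAST j. x \<notin> pideal j)"
  have j: "x \<notin> pideal j" using LeastI_ex[OF ex] by (simp add: j_def)
  have j0: "j \<noteq> 0" using j x by (metis pideal_0)
  have jN: "j \<le> N" unfolding j_def by (rule Least_le) (use x pideal_N[of N] in auto)
  have "x \<in> pideal (j - 1)" using not_less_Least[of "j - 1" "\<lambda>j. x \<notin> pideal j"] j0 unfolding j_def by force
  thus ?thesis using that[of "j - 1"] j j0 jN by simp
qed

text \<open>\<open>p [^] (N - 1)\<close> generates the smallest nonzero ideal. A character that is
  nontrivial there is nontrivial on every nonzero ideal, which later gives the generating
  character.\<close>

lemma socle:
  assumes x: "x \<in> carrier R" "x \<noteq> \<zero>"
  shows "\<exists>r\<in>carrier R. p [^] (N - 1) = r \<otimes> x"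
proof -
  obtain k where k: "k < N" "x \<in> pideal k" "x \<notin> pideal (Suc k)" using pideal_level[OF x] .
  have "p [^] (N - 1) \<in> pideal (N - 1)" unfolding pideal_def by (rule image_eqI[of _ _ \<one>]) simp_all
  moreover have "k \<le> N - 1" using k by simp
  ultimately have "p [^] (N - 1) \<in> pideal k" using pideal_antimono by blast
  thus ?thesis using pideal_generator[OF k(2,3)] by blast
qed

section \<open>Row spans and elimination of a pivot row\<close>

definition row_span :: "'i set \<Rightarrow> 'j set \<Rightarrow> ('i \<times> 'j \<Rightarrow> 'a) \<Rightarrow> ('j \<Rightarrow> 'a) set" where
  "row_span A B Y = (\<lambda>a. \<lambda>j\<in>B. \<Oplus>i\<in>A. a i \<otimes> Y (i, j)) ` (A \<rightarrow>\<^sub>E carrier R)"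

text \<open>The divisibility level is kept for each row separately because the elimination raises it
  one row at a time.\<close>

definition mats :: "'i set \<Rightarrow> ('i \<Rightarrow> nat) \<Rightarrow> 'j set \<Rightarrow> ('i \<times> 'j \<Rightarrow> 'a) set" where
  "mats A f B = Pi\<^sub>E (A \<times> B) (\<lambda>ij. pideal (f (fst ij)))"

lemma matsD: "Y \<in> mats A f B \<Longrightarrow> i \<in> A \<Longrightarrow> j \<in> B \<Longrightarrow> Y (i, j) \<in> pideal (f i)"
  by (auto simp: mats_def PiE_def Pi_def)

lemma finite_mats: "finite A \<Longrightarrow> finite B \<Longrightarrow> finite (mats A f B)"
  unfolding mats_def by (intro finite_PiE) auto

end

text \<open>Here \<open>n\<close> is the number of columns, \<open>b\<close> counts the rows known to have entries divisible by \<open>p\<^sup>N\<^sup>-\<^sup>d\<close>,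
  and \<open>a\<close> those by the next power of \<open>p\<close>. A row of the first kind is either of the second kind too,
  or it serves as a pivot that splits off a cyclic summand of length \<open>d\<close> and one column.\<close>

fun rec_sum :: "nat \<Rightarrow> complex \<Rightarrow> nat \<Rightarrow> nat \<Rightarrow> nat \<Rightarrow> nat \<Rightarrow> complex" where
  "rec_sum q \<omega> 0 a b n = 1"
| "rec_sum q \<omega> (Suc d) a 0 n = rec_sum q \<omega> d 0 a n"
| "rec_sum q \<omega> (Suc d) a (Suc b) n = rec_sum q \<omega> (Suc d) (Suc a) b n +
     (of_nat q ^ (Suc d * n) - of_nat q ^ (d * n)) * of_nat q ^ (d * a) * of_nat q ^ (Suc d * b) *
     \<omega> ^ Suc d * rec_sum q \<omega> (Suc d) a b (n - 1)"

context chain_ring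
begin

text \<open>The pivot row consists of multiples \<open>c l\<close> of its entry in column
  \<open>j\<close>. Subtracting \<open>c l\<close> times column \<open>j\<close> from column
  \<open>l\<close> is a shear of the row span that turns it into \<open>pideal k\<close> in column
  \<open>j\<close> times the span of \<open>Z\<close>.\<close>

lemma row_span_pivot:
  assumes A: "finite A" "i0 \<notin> A" and B: "j \<notin> B"
    and y: "y j \<in> pideal k" "y j \<notin> pideal (Suc k)"
    and c: "\<And>l. l \<in> B \<Longrightarrow> c l \<in> carrier R \<and> y l = c l \<otimes> y j"
    and t: "\<And>i. i \<in> A \<Longrightarrow> t i \<in> pideal k" and Z: "\<And>i l. i \<in> A \<Longrightarrow> l \<in> B \<Longrightarrow> Z (i, l) \<in> carrier R"
    and Y: "\<And>l. l \<in> B \<Longrightarrow> Y (i0, l) = y l" "Y (i0, j) = y j"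
      "\<And>i. i \<in> A \<Longrightarrow> Y (i, j) = t i" "\<And>i l. i \<in> A \<Longrightarrow> l \<in> B \<Longrightarrow> Y (i, l) = Z (i, l) \<oplus> c l \<otimes> t i"
  shows "card (row_span (insert i0 A) (insert j B) Y) = card (pideal k) * card (row_span A B Z)"
proof -
  define F where "F = (\<lambda>(s, z). \<lambda>l\<in>insert j B. if l = j then s else z l \<oplus> c l \<otimes> s)"
  define v where "v = (\<lambda>a l. \<Oplus>i\<in>insert i0 A. a i \<otimes> Y (i, l))"
  define z where "z = (\<lambda>a. \<lambda>l\<in>B. \<Oplus>i\<in>A. a i \<otimes> Z (i, l))"
  have yj: "y j \<in> carrier R" using y by simp
  have tc: "i \<in> A \<Longrightarrow> t i \<in> carrier R" for i using pideal_carrier[OF t] .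
  have vj: "v a j = a i0 \<otimes> y j \<oplus> (\<Oplus>i\<in>A. a i \<otimes> t i)" if a: "\<And>i. i \<in> insert i0 A \<Longrightarrow> a i \<in> carrier R" for a
  proof -
    have "v a j = a i0 \<otimes> Y (i0, j) \<oplus> (\<Oplus>i\<in>A. a i \<otimes> Y (i, j))"
      unfolding v_def using A a yj tc Y by (subst finsum_insert) (auto simp: Pi_def)
    also have "(\<Oplus>i\<in>A. a i \<otimes> Y (i, j)) = (\<Oplus>i\<in>A. a i \<otimes> t i)"
      by (rule finsum_cong') (use a tc Y in auto)
    finally show ?thesis by (simp add: Y)
  qed
  have vl: "v a l = z a l \<oplus> c l \<otimes> v a j" if a: "\<And>i. i \<in> insert i0 A \<Longrightarrow> a i \<in> carrier R" and l: "l \<in> B" for a l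
  proof -
    have cl: "c l \<in> carrier R" "y l = c l \<otimes> y j" using c l by auto
    have sZ: "(\<Oplus>i\<in>A. a i \<otimes> Z (i, l)) \<in> carrier R" by (rule finsum_closed) (use a Z l in auto)
    have sT: "(\<Oplus>i\<in>A. a i \<otimes> t i) \<in> carrier R" by (rule finsum_closed) (use a tc in auto)
    have "v a l = a i0 \<otimes> Y (i0, l) \<oplus> (\<Oplus>i\<in>A. a i \<otimes> Y (i, l))"
      unfolding v_def using A a yj tc Y Z cl l by (subst finsum_insert) (auto simp: Pi_def)
    also have "(\<Oplus>i\<in>A. a i \<otimes> Y (i, l)) = (\<Oplus>i\<in>A. a i \<otimes> Z (i, l) \<oplus> c l \<otimes> (a i \<otimes> t i))"
      by (rule finsum_cong') (use a tc Y Z cl l in \<open>auto simp: r_distr m_lcomm\<close>)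
    also have "\<dots> = (\<Oplus>i\<in>A. a i \<otimes> Z (i, l)) \<oplus> (\<Oplus>i\<in>A. c l \<otimes> (a i \<otimes> t i))"
      by (rule finsum_addf) (use a tc Z cl l in auto)
    also have "(\<Oplus>i\<in>A. c l \<otimes> (a i \<otimes> t i)) = c l \<otimes> (\<Oplus>i\<in>A. a i \<otimes> t i)"
      by (rule finsum_rdistr[symmetric]) (use A a tc cl in auto)
    finally have "v a l = a i0 \<otimes> (c l \<otimes> y j) \<oplus> ((\<Oplus>i\<in>A. a i \<otimes> Z (i, l)) \<oplus> c l \<otimes> (\<Oplus>i\<in>A. a i \<otimes> t i))"
      using Y l cl by simp
    also have "\<dots> = (\<Oplus>i\<in>A. a i \<otimes> Z (i, l)) \<oplus> c l \<otimes> (a i0 \<otimes> y j \<oplus> (\<Oplus>i\<in>A. a i \<otimes> t i))"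
      using a[of i0] cl yj sZ sT by (simp add: r_distr m_lcomm a_lcomm)
    finally show ?thesis using vj[of a] a l by (simp add: z_def)
  qed
  have zc: "z a l \<in> carrier R" if "\<And>i. i \<in> A \<Longrightarrow> a i \<in> carrier R" "l \<in> B" for a l
    unfolding z_def using that Z by (auto intro!: finsum_closed)
  have rs: "row_span A B Z = z ` (A \<rightarrow>\<^sub>E carrier R)" by (simp add: row_span_def z_def)
  have spanI: "row_span (insert i0 A) (insert j B) Y = F ` (pideal k \<times> row_span A B Z)" (is "?L = ?R")
  proof
    show "?L \<subseteq> ?R"
    proof
      fix w assume "w \<in> ?L"
      then obtain a where a: "a \<in> insert i0 A \<rightarrow>\<^sub>E carrier R" and w: "w = (\<lambda>l\<in>insert j B. v a l)"
        unfolding row_span_def v_def by blast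
      have ac: "i \<in> insert i0 A \<Longrightarrow> a i \<in> carrier R" for i using a by auto
      have vja: "v a j = a i0 \<otimes> y j \<oplus> (\<Oplus>i\<in>A. a i \<otimes> t i)" by (rule vj) (rule ac)
      have vla: "v a l = z a l \<oplus> c l \<otimes> v a j" if "l \<in> B" for l by (rule vl[OF _ that]) (rule ac)
      have "(\<Oplus>i\<in>A. a i \<otimes> t i) \<in> pideal k"
        using ac t by (intro finsum_pideal A(1) pideal_mult) auto
      hence vk: "v a j \<in> pideal k" unfolding vja using ac y by (intro pideal_add pideal_mult) auto
      have "restrict a A \<in> A \<rightarrow>\<^sub>E carrier R" using ac by auto
      moreover have "z (restrict a A) = z a"
        unfolding z_def using ac Z by (intro restrict_ext finsum_cong') auto
      ultimately have "z a \<in> row_span A B Z" unfolding rs by (metis imageI)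
      moreover have "w = F (v a j, z a)"
        unfolding w F_def using vla B by (auto intro!: restrict_ext)
      ultimately show "w \<in> ?R" using vk by blast
    qed
    show "?R \<subseteq> ?L"
    proof
      fix w assume "w \<in> ?R"
      then obtain s b where s: "s \<in> pideal k" and b: "b \<in> A \<rightarrow>\<^sub>E carrier R" and w: "w = F (s, z b)"
        unfolding row_span_def z_def by auto
      have bc: "i \<in> A \<Longrightarrow> b i \<in> carrier R" for i using b by auto
      have S: "(\<Oplus>i\<in>A. b i \<otimes> t i) \<in> pideal k"
        using bc t by (intro finsum_pideal A(1) pideal_mult) auto
      obtain r where r: "r \<in> carrier R" "s \<ominus> (\<Oplus>i\<in>A. b i \<otimes> t i) = r \<otimes> y j"
        using pideal_generator[OF y pideal_minus[OF s S]] by blast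
      \<comment> \<open>The coefficient of the pivot row is free: it adjusts the entry in column
        \<open>j\<close> to \<open>s\<close> and does not occur in \<open>z\<close>.\<close>
      define a where "a = b(i0 := r)"
      have a: "a \<in> insert i0 A \<rightarrow>\<^sub>E carrier R" using b r by (auto simp: a_def PiE_def extensional_def)
      have ac: "i \<in> insert i0 A \<Longrightarrow> a i \<in> carrier R" for i using a by auto
      have vja: "v a j = a i0 \<otimes> y j \<oplus> (\<Oplus>i\<in>A. a i \<otimes> t i)" by (rule vj) (rule ac)
      have vla: "v a l = z a l \<oplus> c l \<otimes> v a j" if "l \<in> B" for l by (rule vl[OF _ that]) (rule ac)
      have ai: "i \<in> A \<Longrightarrow> a i = b i" for i using A by (auto simp: a_def)
      have "(\<Oplus>i\<in>A. a i \<otimes> t i) = (\<Oplus>i\<in>A. b i \<otimes> t i)" by (rule finsum_cong') (use ai bc tc in auto)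
      hence "v a j = (s \<ominus> (\<Oplus>i\<in>A. b i \<otimes> t i)) \<oplus> (\<Oplus>i\<in>A. b i \<otimes> t i)"
        unfolding vja r(2) by (simp add: a_def)
      also have "\<dots> = s" using s S by (simp add: a_minus_def a_assoc l_neg)
      finally have vs: "v a j = s" .
      have "z a = z b" unfolding z_def using ai bc Z by (intro restrict_ext finsum_cong') auto
      hence "w = (\<lambda>l\<in>insert j B. v a l)"
        unfolding w F_def using vla B vs by (auto intro!: restrict_ext)
      thus "w \<in> ?L" using a unfolding row_span_def v_def by blast
    qed
  qed
  have "inj_on F (pideal k \<times> row_span A B Z)"
  proof (rule inj_onI, clarify)
    fix s z1 s' z2 assume *: "s \<in> pideal k" "s' \<in> pideal k" "z1 \<in> row_span A B Z" "z2 \<in> row_span A B Z" "F (s, z1) = F (s', z2)"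
    have ss: "s = s'" using fun_cong[OF *(5), of j] by (simp add: F_def)
    have ext: "z1 \<in> extensional B" "z2 \<in> extensional B" using * by (auto simp: row_span_def)
    have rc: "u \<in> row_span A B Z \<Longrightarrow> l \<in> B \<Longrightarrow> u l \<in> carrier R" for u l
    proof -
      assume "u \<in> row_span A B Z" "l \<in> B"
      then obtain b where "b \<in> A \<rightarrow>\<^sub>E carrier R" "u = z b" unfolding row_span_def z_def by blast
      thus ?thesis using zc[of b l] \<open>l \<in> B\<close> by auto
    qed
    have "z1 = z2"
    proof (rule extensionalityI[OF ext])
      fix l assume l: "l \<in> B"
      have "l \<noteq> j" using l B by auto
      hence "z1 l \<oplus> c l \<otimes> s = z2 l \<oplus> c l \<otimes> s" using fun_cong[OF *(5), of l] l ss by (simp add: F_def)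
      thus "z1 l = z2 l" using rc[OF *(3) l] rc[OF *(4) l] c[OF l] *(1) by simp
    qed
    thus "s = s' \<and> z1 = z2" using ss by simp
  qed
  thus ?thesis unfolding spanI by (simp add: card_image card_cartesian_product)
qed

text \<open>For a fixed pivot row the other rows are given by their entries in column
  \<open>j\<close> and by what remains after the column operation. Levels are preserved because each
  row is changed by multiples of its own entry.\<close>

lemma mats_row_bij:
  assumes i0: "i0 \<notin> A" and B: "j \<notin> B" and k: "\<And>i. i \<in> A \<Longrightarrow> k \<le> f i" "f i0 = k"
    and y: "y \<in> insert j B \<rightarrow>\<^sub>E pideal k" "y j \<notin> pideal (Suc k)"
    and c: "\<And>l. l \<in> B \<Longrightarrow> c l \<in> carrier R \<and> y l = c l \<otimes> y j"
  shows "bij_betw (\<lambda>(t, Z). \<lambda>il\<in>insert i0 A \<times> insert j B. if fst il = i0 then y (snd il) else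
       if snd il = j then t (fst il) else Z il \<oplus> c (snd il) \<otimes> t (fst il))
     (Pi\<^sub>E A (\<lambda>i. pideal (f i)) \<times> mats A f B) {Y \<in> mats (insert i0 A) f (insert j B). \<forall>l\<in>insert j B. Y (i0, l) = y l}"
    (is "bij_betw ?F ?D ?E")
proof -
  let ?G = "\<lambda>Y. (\<lambda>i\<in>A. Y (i, j), \<lambda>il\<in>A \<times> B. Y il \<ominus> c (snd il) \<otimes> Y (fst il, j))"
  have yk: "l \<in> insert j B \<Longrightarrow> y l \<in> pideal k" for l using y by auto
  show ?thesis
  proof (rule bij_betw_byWitness[where f' = ?G])
    show "\<forall>x\<in>?D. ?G (?F x) = x"
    proof
      fix x assume "x \<in> ?D"
      then obtain t Z where x: "x = (t, Z)" and t: "t \<in> Pi\<^sub>E A (\<lambda>i. pideal (f i))" and Z: "Z \<in> mats A f B" by blast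
      have tk: "i \<in> A \<Longrightarrow> t i \<in> carrier R" for i using t pideal_carrier by (meson PiE_mem)
      have Zc: "i \<in> A \<Longrightarrow> l \<in> B \<Longrightarrow> Z (i, l) \<in> carrier R" for i l by (rule pideal_carrier[OF matsD[OF Z]])
      have 1: "fst (?G (?F (t, Z))) = fst (t, Z)"
        using t i0 by (intro extensionalityI[of _ A]) (auto simp: PiE_def)
      have 2: "snd (?G (?F (t, Z))) = snd (t, Z)"
      proof (rule extensionalityI[of _ "A \<times> B"])
        show "snd (t, Z) \<in> extensional (A \<times> B)" using Z by (auto simp: mats_def PiE_def)
        fix il assume "il \<in> A \<times> B"
        then obtain i l where il: "il = (i, l)" "i \<in> A" "l \<in> B" by auto
        have "i \<noteq> i0" "l \<noteq> j" using il i0 B by auto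
        thus "snd (?G (?F (t, Z))) il = snd (t, Z) il"
          using il tk[of i] Zc[of i l] c[of l] by (simp add: a_minus_def a_assoc r_neg)
      qed simp
      show "?G (?F x) = x" unfolding x using 1 2 by (rule prod_eqI)
    qed
    show "\<forall>Y\<in>?E. ?F (?G Y) = Y"
    proof
      fix Y assume "Y \<in> ?E"
      hence Y: "Y \<in> mats (insert i0 A) f (insert j B)" "\<forall>l\<in>insert j B. Y (i0, l) = y l" by auto
      have Yc: "i \<in> insert i0 A \<Longrightarrow> l \<in> insert j B \<Longrightarrow> Y (i, l) \<in> carrier R" for i l using matsD[OF Y(1)] pideal_carrier by blast
      show "?F (?G Y) = Y"
      proof (rule extensionalityI[of _ "insert i0 A \<times> insert j B"])
        show "Y \<in> extensional (insert i0 A \<times> insert j B)" using Y by (auto simp: mats_def PiE_def)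
        fix il assume "il \<in> insert i0 A \<times> insert j B"
        then obtain i l where il: "il = (i, l)" "i \<in> insert i0 A" "l \<in> insert j B" by auto
        consider "i = i0" | "i \<noteq> i0" "l = j" | "i \<noteq> i0" "l \<noteq> j" by blast
        thus "?F (?G Y) il = Y il"
        proof cases
          case 1 thus ?thesis using il Y(2) i0 by auto
        next
          case 2 thus ?thesis using il by simp
        next
          case 3
          thus ?thesis using il Yc[of i l] Yc[of i j] c[of l] by (simp add: a_minus_def a_assoc l_neg)
        qed
      qed simp
    qed
    show "?F ` ?D \<subseteq> ?E"
    proof
      fix Y assume "Y \<in> ?F ` ?D"
      then obtain t Z where Y: "Y = ?F (t, Z)" and t: "t \<in> Pi\<^sub>E A (\<lambda>i. pideal (f i))" and Z: "Z \<in> mats A f B" by blast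
      have "?F (t, Z) \<in> mats (insert i0 A) f (insert j B)"
        unfolding mats_def
      proof (rule PiE_I)
        fix il assume "il \<in> insert i0 A \<times> insert j B"
        then obtain i l where il: "il = (i, l)" "i \<in> insert i0 A" "l \<in> insert j B" by auto
        consider "i = i0" | "i \<noteq> i0" "l = j" | "i \<noteq> i0" "l \<noteq> j" by blast
        thus "?F (t, Z) il \<in> pideal (f (fst il))"
        proof cases
          case 1 thus ?thesis using il yk[of l] k by auto
        next
          case 2 thus ?thesis using il t by auto
        next
          case 3
          hence iA: "i \<in> A" "l \<in> B" using il by auto
          have "Z (i, l) \<oplus> c l \<otimes> t i \<in> pideal (f i)"
            using matsD[OF Z iA] c[OF iA(2)] PiE_mem[OF t iA(1)] by (intro pideal_add pideal_mult) auto
          thus ?thesis using il 3 by simp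
        qed
      qed simp
      moreover have "\<forall>l\<in>insert j B. ?F (t, Z) (i0, l) = y l" by simp
      ultimately show "Y \<in> ?E" unfolding Y by blast
    qed
    show "?G ` ?E \<subseteq> ?D"
    proof
      fix x assume "x \<in> ?G ` ?E"
      then obtain Y where Y: "Y \<in> mats (insert i0 A) f (insert j B)" and x: "x = ?G Y" by auto
      have m: "i \<in> A \<Longrightarrow> l \<in> insert j B \<Longrightarrow> Y (i, l) \<in> pideal (f i)" for i l using matsD[OF Y] by auto
      have "Y (i, l) \<ominus> c l \<otimes> Y (i, j) \<in> pideal (f i)" if "i \<in> A" "l \<in> B" for i l
        using that c m by (intro pideal_minus pideal_mult) auto
      thus "x \<in> ?D" unfolding x using m by (auto simp: mats_def)
    qed
  qed
qed

text \<open>Some entry of \<open>y\<close> has exact level \<open>k\<close>, and its column serves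
  for the elimination. The result depends neither on \<open>y\<close> nor on this column, as
  \<open>C\<close> is the same for every column removed.\<close>

lemma sum_fixed_row:
  fixes w :: "nat \<Rightarrow> complex"
  assumes A: "finite A" "i0 \<notin> A" and B: "finite B"
    and k: "\<And>i. i \<in> A \<Longrightarrow> k \<le> f i" "f i0 = k"
    and w: "\<And>a b. w (a * b) = w a * w b"
    and IH: "\<And>j. j \<in> B \<Longrightarrow> (\<Sum>Y\<in>mats A f (B - {j}). w (card (row_span A (B - {j}) Y))) = C"
    and y: "y \<in> (B \<rightarrow>\<^sub>E pideal k) - (B \<rightarrow>\<^sub>E pideal (Suc k))"
  shows "(\<Sum>Y\<in>{Y \<in> mats (insert i0 A) f B. \<forall>l\<in>B. Y (i0, l) = y l}. w (card (row_span (insert i0 A) B Y))) =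
    (\<Prod>i\<in>A. of_nat (card (pideal (f i)))) * w (card (pideal k)) * C"
proof -
    let ?w = "\<lambda>Y. w (card (row_span (insert i0 A) B Y))"
    define E where "E = (\<lambda>y. {Y \<in> mats (insert i0 A) f B. \<forall>l\<in>B. Y (i0, l) = y l})"
    have "\<exists>j\<in>B. y j \<notin> pideal (Suc k)" using y by (auto simp: PiE_def)
    then obtain j where j: "j \<in> B" "y j \<notin> pideal (Suc k)" by blast
    define B' where "B' = B - {j}"
    have B': "B = insert j B'" "j \<notin> B'" using j by (auto simp: B'_def)
    have yk: "l \<in> B \<Longrightarrow> y l \<in> pideal k" for l using y by auto
    have "\<forall>l\<in>B'. \<exists>c. c \<in> carrier R \<and> y l = c \<otimes> y j"
      using pideal_generator[OF yk[OF j(1)] j(2)] yk by (auto simp: B'_def)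
    then obtain c where c: "\<And>l. l \<in> B' \<Longrightarrow> c l \<in> carrier R \<and> y l = c l \<otimes> y j" by metis
    have yP: "y \<in> insert j B' \<rightarrow>\<^sub>E pideal k" using y by (simp add: B'(1))
    let ?F = "\<lambda>(t, Z). \<lambda>il\<in>insert i0 A \<times> insert j B'. if fst il = i0 then y (snd il) else
       if snd il = j then t (fst il) else Z il \<oplus> c (snd il) \<otimes> t (fst il)"
    let ?D = "Pi\<^sub>E A (\<lambda>i. pideal (f i)) \<times> mats A f B'"
    have bij: "bij_betw ?F ?D (E y)"
      unfolding E_def B'(1) by (rule mats_row_bij[where k = k and c = c and y = y and f = f, OF A(2) B'(2) k yP j(2) c])
    have val: "?w (?F (t, Z)) = w (card (pideal k)) * w (card (row_span A B' Z))" if tZ: "(t, Z) \<in> ?D" for t Z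
    proof -
      have tk: "t i \<in> pideal k" if "i \<in> A" for i
        using tZ that pideal_antimono[OF k(1)[OF that]] by (auto simp: PiE_def Pi_def)
      have Zc: "Z (i, l) \<in> carrier R" if "i \<in> A" "l \<in> B'" for i l
        using tZ matsD[of Z A f B' i l] that by auto
      have ii: "i \<in> A \<Longrightarrow> i \<noteq> i0" "l \<in> B' \<Longrightarrow> l \<noteq> j" for i l using A B' by auto
      have "card (row_span (insert i0 A) (insert j B') (?F (t, Z))) = card (pideal k) * card (row_span A B' Z)"
        by (rule row_span_pivot[where y = y and c = c and t = t and k = k and Z = Z and j = j and A = A and B = B', OF A B'(2) yk[OF j(1)] j(2) c tk Zc]) (use ii in auto)
      thus ?thesis using w by (simp add: B'(1)[symmetric])
    qed
    have "(\<Sum>Y\<in>E y. ?w Y) = (\<Sum>x\<in>?D. ?w (?F x))"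
      by (rule sum.reindex_bij_betw[OF bij, symmetric])
    also have "\<dots> = (\<Sum>(t, Z)\<in>?D. w (card (pideal k)) * w (card (row_span A B' Z)))"
      by (rule sum.cong[OF refl]) (use val in \<open>auto simp del: restrict_apply\<close>)
    also have "\<dots> = of_nat (card (Pi\<^sub>E A (\<lambda>i. pideal (f i)))) * (w (card (pideal k)) * (\<Sum>Z\<in>mats A f B'. w (card (row_span A B' Z))))"
      by (simp add: sum.cartesian_product[symmetric] sum_distrib_left)
    also have "\<dots> = (\<Prod>i\<in>A. of_nat (card (pideal (f i)))) * w (card (pideal k)) * C"
      using IH[OF j(1)] A by (simp add: B'_def card_PiE)
    finally show ?thesis unfolding E_def .
qed

text \<open>Either row \<open>i0\<close> lies in the next ideal as a whole, which raises its level,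
  or it is one of the rows counted by the difference of the two powers, and
  \<open>sum_fixed_row\<close> applies to each of them.\<close>

lemma sum_mats_pivot:
  fixes w :: "nat \<Rightarrow> complex"
  assumes A: "finite A" "i0 \<notin> A" and B: "finite B"
    and k: "\<And>i. i \<in> A \<Longrightarrow> k \<le> f i" "f i0 = k"
    and w: "\<And>a b. w (a * b) = w a * w b"
    and IH: "\<And>j. j \<in> B \<Longrightarrow> (\<Sum>Y\<in>mats A f (B - {j}). w (card (row_span A (B - {j}) Y))) = C"
  shows "(\<Sum>Y\<in>mats (insert i0 A) f B. w (card (row_span (insert i0 A) B Y))) =
    (\<Sum>Y\<in>mats (insert i0 A) (f(i0 := Suc k)) B. w (card (row_span (insert i0 A) B Y))) +
    (of_nat (card (pideal k)) ^ card B - of_nat (card (pideal (Suc k))) ^ card B) *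
    (\<Prod>i\<in>A. of_nat (card (pideal (f i)))) * w (card (pideal k)) * C"
proof -
  let ?A = "insert i0 A"
  let ?w = "\<lambda>Y. w (card (row_span ?A B Y))"
  define S where "S = (B \<rightarrow>\<^sub>E pideal k) - (B \<rightarrow>\<^sub>E pideal (Suc k))"
  define E where "E = (\<lambda>y. {Y \<in> mats ?A f B. \<forall>l\<in>B. Y (i0, l) = y l})"
  define M1 where "M1 = mats ?A (f(i0 := Suc k)) B"
  have finS: "finite S" unfolding S_def using B by (intro finite_Diff finite_PiE) auto
  have finE: "finite (E y)" for y unfolding E_def using A B by (intro finite_subset[OF _ finite_mats[of ?A B f]]) auto
  have split: "mats ?A f B = M1 \<union> (\<Union>y\<in>S. E y)"
  proof
    show "mats ?A f B \<subseteq> M1 \<union> (\<Union>y\<in>S. E y)"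
    proof
      fix Y assume Y: "Y \<in> mats ?A f B"
      show "Y \<in> M1 \<union> (\<Union>y\<in>S. E y)"
      proof (cases "\<forall>l\<in>B. Y (i0, l) \<in> pideal (Suc k)")
        case True
        hence "Y \<in> M1" using Y by (auto simp: M1_def mats_def PiE_def Pi_def split: if_splits)
        thus ?thesis by blast
      next
        case False
        have "(\<lambda>l\<in>B. Y (i0, l)) \<in> S" using False matsD[OF Y, of i0] k by (auto simp: S_def)
        moreover have "Y \<in> E (\<lambda>l\<in>B. Y (i0, l))" using Y by (simp add: E_def)
        ultimately show ?thesis by blast
      qed
    qed
    have "M1 \<subseteq> mats ?A f B"
      unfolding M1_def mats_def by (intro PiE_mono) (use pideal_Suc[of k] k in auto)
    thus "M1 \<union> (\<Union>y\<in>S. E y) \<subseteq> mats ?A f B" by (auto simp: E_def)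
  qed
  have disj1: "M1 \<inter> (\<Union>y\<in>S. E y) = {}"
  proof -
    have False if Y: "Y \<in> M1" "y \<in> S" "Y \<in> E y" for Y y
    proof -
      have "y l \<in> pideal (Suc k)" if "l \<in> B" for l
        using matsD[of Y ?A "f(i0 := Suc k)" B i0 l] Y that by (auto simp: M1_def E_def)
      thus False using Y(2) by (auto simp: S_def PiE_def)
    qed
    thus ?thesis by blast
  qed
  have disj2: "E y \<inter> E y' = {}" if "y \<in> S" "y' \<in> S" "y \<noteq> y'" for y y'
  proof -
    have "y = y'" if Y: "Y \<in> E y" "Y \<in> E y'" for Y
      using \<open>y \<in> S\<close> \<open>y' \<in> S\<close> Y by (intro extensionalityI[of y B]) (auto simp: S_def E_def PiE_def)
    thus ?thesis using that by blast
  qed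
  have row: "(\<Sum>Y\<in>E y. ?w Y) = (\<Prod>i\<in>A. of_nat (card (pideal (f i)))) * w (card (pideal k)) * C" if y: "y \<in> S" for y
    using sum_fixed_row[of A i0 B k f w C y] A B k w IH y unfolding E_def S_def by blast
  have fM1: "finite M1" unfolding M1_def using A B by (intro finite_mats) auto
  have "(\<Sum>Y\<in>mats ?A f B. ?w Y) = (\<Sum>Y\<in>M1. ?w Y) + (\<Sum>Y\<in>(\<Union>y\<in>S. E y). ?w Y)"
    unfolding split by (rule sum.union_disjoint[OF fM1 _ disj1]) (use finS finE in blast)
  also have "(\<Sum>Y\<in>(\<Union>y\<in>S. E y). ?w Y) = (\<Sum>y\<in>S. \<Sum>Y\<in>E y. ?w Y)"
    by (rule sum.UNION_disjoint[OF finS]) (use finE disj2 in blast)+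
  also have "\<dots> = of_nat (card S) * ((\<Prod>i\<in>A. of_nat (card (pideal (f i)))) * w (card (pideal k)) * C)"
    using row by simp
  also have "(of_nat (card S) :: complex) = of_nat (card (pideal k)) ^ card B - of_nat (card (pideal (Suc k))) ^ card B"
  proof -
    have sub: "(B \<rightarrow>\<^sub>E pideal (Suc k)) \<subseteq> (B \<rightarrow>\<^sub>E pideal k)" by (intro PiE_mono) (use pideal_Suc in auto)
    have fin': "finite (B \<rightarrow>\<^sub>E pideal (Suc k))" "finite (B \<rightarrow>\<^sub>E pideal k)" using B by (auto intro!: finite_PiE)
    have "card S = card (B \<rightarrow>\<^sub>E pideal k) - card (B \<rightarrow>\<^sub>E pideal (Suc k))"
      unfolding S_def by (rule card_Diff_subset[OF fin'(1) sub])
    hence "(of_nat (card S) :: complex) = of_nat (card (B \<rightarrow>\<^sub>E pideal k)) - of_nat (card (B \<rightarrow>\<^sub>E pideal (Suc k)))"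
      using card_mono[OF fin'(2) sub] by (simp add: of_nat_diff)
    thus ?thesis using B by (simp add: card_PiE)
  qed
  finally show ?thesis by (simp add: M1_def mult.assoc)
qed

text \<open>The outer induction lowers the remaining length \<open>d\<close>, the inner one empties
  the set \<open>A2\<close> of rows still at the current level. Multiplicativity of \<open>w\<close>
  enters because a pivot splits a factor off the cardinality of the span.\<close>

theorem sum_mats_eq_rec_sum:
  fixes w :: "nat \<Rightarrow> complex"
  assumes w: "\<And>a b. w (a * b) = w a * w b" "w 1 = 1" and d: "d \<le> N"
    and fin: "finite A1" "finite A2" "finite B" and disj: "A1 \<inter> A2 = {}"
    and f: "\<And>i. i \<in> A1 \<Longrightarrow> f i = Suc (N - d)" "\<And>i. i \<in> A2 \<Longrightarrow> f i = N - d"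
  shows "(\<Sum>Y\<in>mats (A1 \<union> A2) f B. w (card (row_span (A1 \<union> A2) B Y))) =
     rec_sum q (w q) d (card A1) (card A2) (card B)"
  using d fin disj f
proof (induction d arbitrary: A1 A2 B f)
  case (0 A1 A2 B f)
  \<comment> \<open>At \<open>d = 0\<close> every ideal involved is zero, so the zero matrix is the
    only one and its span has one element.\<close>
  have f0: "pideal (f i) = {\<zero>}" if "i \<in> A1 \<union> A2" for i using "0.prems" that by (auto simp: pideal_N)
  define Z where "Z = (\<lambda>ij\<in>(A1 \<union> A2) \<times> B. \<zero>)"
  have "mats (A1 \<union> A2) f B = (A1 \<union> A2) \<times> B \<rightarrow>\<^sub>E {\<zero>}"
    unfolding mats_def using f0 by (intro PiE_cong) auto
  also have "\<dots> = {Z}" by (auto simp: Z_def PiE_def extensional_def)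
  finally have m: "mats (A1 \<union> A2) f B = {Z}" .
  have "row_span (A1 \<union> A2) B Z = {\<lambda>j\<in>B. \<zero>}"
  proof -
    have "(\<lambda>j\<in>B. \<Oplus>i\<in>A1 \<union> A2. a i \<otimes> Z (i, j)) = (\<lambda>j\<in>B. \<zero>)" if "a \<in> A1 \<union> A2 \<rightarrow>\<^sub>E carrier R" for a
    proof (rule restrict_ext)
      fix j assume j: "j \<in> B"
      have "(\<Oplus>i\<in>A1 \<union> A2. a i \<otimes> Z (i, j)) = (\<Oplus>i\<in>A1 \<union> A2. \<zero>)"
        by (rule finsum_cong') (use PiE_mem[OF that] j in \<open>auto simp: Z_def\<close>)
      thus "(\<Oplus>i\<in>A1 \<union> A2. a i \<otimes> Z (i, j)) = \<zero>" by simp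
    qed
    hence "row_span (A1 \<union> A2) B Z = (\<lambda>a. \<lambda>j\<in>B. \<zero>) ` (A1 \<union> A2 \<rightarrow>\<^sub>E carrier R)"
      unfolding row_span_def by (intro image_cong refl)
    moreover have "(\<lambda>i\<in>A1 \<union> A2. \<zero>) \<in> A1 \<union> A2 \<rightarrow>\<^sub>E carrier R" by auto
    hence "A1 \<union> A2 \<rightarrow>\<^sub>E carrier R \<noteq> {}" by (metis empty_iff)
    ultimately show ?thesis by (simp only: image_constant_conv if_False)
  qed
  thus ?case using m w by simp
next
  case (Suc d A1 A2 B f)
  note OIH = Suc.IH
  from Suc.prems show ?case
  proof (induction "card A2" arbitrary: A1 A2 B f)
  case (0 A2 A1 B f)
  \<comment> \<open>No row is left at the current level, so the rows of \<open>A1\<close> take over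
    the role of \<open>A2\<close> for \<open>d\<close>.\<close>
  have e: "A2 = {}" using 0 by simp
  have "(\<Sum>Y\<in>mats ({} \<union> A1) f B. w (card (row_span ({} \<union> A1) B Y))) = rec_sum q (w q) d (card {}) (card A1) (card B)"
    using OIH[of "{}" A1 B f] "0.prems" by (simp add: Suc_diff_Suc)
  thus ?case using e 0 by simp
next
  case (Suc b A2 A1 B f)
  note prems = Suc.prems and bA = Suc.hyps(2)
  obtain i0 where i0: "i0 \<in> A2" using bA by fastforce
  define A2' where "A2' = A2 - {i0}"
  have A2: "A2 = insert i0 A2'" "i0 \<notin> A2'" using i0 by (auto simp: A2'_def)
  have b: "b = card A2'" using bA i0 by (simp add: A2'_def)
  have A2'fin: "finite A2'" using prems by (simp add: A2'_def)
  define k where "k = N - Suc d"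
  have k: "k < N" "Suc k = N - d" "N - Suc k = d" "N - k = Suc d" using prems by (auto simp: k_def)
  let ?A = "A1 \<union> A2'"
  have U: "A1 \<union> A2 = insert i0 ?A" using A2 by auto
  have i0A: "i0 \<notin> ?A" using A2 prems by auto
  have IH2: "(\<Sum>Y\<in>mats ?A f (B - {j}). w (card (row_span ?A (B - {j}) Y))) =
      rec_sum q (w q) (Suc d) (card A1) b (card B - 1)" if "j \<in> B" for j
  proof -
    have cB: "card (B - {j}) = card B - 1" using that by simp
    show ?thesis unfolding b cB[symmetric]
      by (rule Suc.hyps(1)) (use prems A2 b in auto)
  qed
  have cA1: "Suc (card A1) = card (insert i0 A1)" using prems i0 by (subst card_insert_disjoint) auto
  have IH1: "(\<Sum>Y\<in>mats (insert i0 A1 \<union> A2') (f(i0 := Suc k)) B. w (card (row_span (insert i0 A1 \<union> A2') B Y))) =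
      rec_sum q (w q) (Suc d) (Suc (card A1)) b (card B)"
    unfolding b cA1
    by (rule Suc.hyps(1)) (use prems A2 b k i0 A2'fin in \<open>auto simp: k_def\<close>)
  have cp: "card (pideal k) = q ^ Suc d" "card (pideal (Suc k)) = q ^ d"
    using card_pideal[of k] card_pideal[of "Suc k"] k by auto
  have wq: "w (q ^ j) = w q ^ j" for j by (induction j) (simp_all add: w w(2)[unfolded One_nat_def])
  have pr: "(\<Prod>i\<in>?A. of_nat (card (pideal (f i)))) = (of_nat q ^ (d * card A1) * of_nat q ^ (Suc d * b) :: complex)"
  proof -
    have "(\<Prod>i\<in>A1. of_nat (card (pideal (f i)))) = (\<Prod>i\<in>A1. of_nat q ^ d :: complex)"
      by (intro prod.cong refl) (use prems cp k in \<open>simp add: k_def\<close>)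
    hence 1: "(\<Prod>i\<in>A1. of_nat (card (pideal (f i)))) = (of_nat q ^ (d * card A1) :: complex)"
      by (simp only: prod_constant power_mult)
    have "(\<Prod>i\<in>A2'. of_nat (card (pideal (f i)))) = (\<Prod>i\<in>A2'. of_nat q ^ Suc d :: complex)"
      by (intro prod.cong refl) (use prems cp k A2 in \<open>simp add: k_def[symmetric]\<close>)
    hence 2: "(\<Prod>i\<in>A2'. of_nat (card (pideal (f i)))) = (of_nat q ^ (Suc d * b) :: complex)"
      unfolding b by (simp only: prod_constant power_mult)
    have "A1 \<inter> A2' = {}" "finite A1" using prems A2 by auto
    thus ?thesis using A2'fin 1 2 by (simp only: prod.union_disjoint)
  qed
  have "(\<Sum>Y\<in>mats (A1 \<union> A2) f B. w (card (row_span (A1 \<union> A2) B Y))) =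
    rec_sum q (w q) (Suc d) (Suc (card A1)) b (card B) +
    (of_nat (q ^ Suc d) ^ card B - of_nat (q ^ d) ^ card B) *
    (of_nat q ^ (d * card A1) * of_nat q ^ (Suc d * b)) * w (q ^ Suc d) * rec_sum q (w q) (Suc d) (card A1) b (card B - 1)"
  proof -
    have ki: "k \<le> f i" if "i \<in> ?A" for i using that prems A2 by (auto simp: k_def)
    have ki0: "f i0 = k" using prems i0 by (simp add: k_def)
    have "insert i0 A1 \<union> A2' = insert i0 ?A" by auto
    note IH1' = IH1[unfolded this]
    show ?thesis unfolding U
      using sum_mats_pivot[OF _ i0A _ ki ki0 w(1) IH2] prems A2'fin unfolding IH1' pr cp by simp
  qed
  moreover have "rec_sum q (w q) (Suc d) (card A1) (card A2) (card B) = rec_sum q (w q) (Suc d) (card A1) (Suc b) (card B)"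
    using bA by simp
  ultimately show ?case unfolding wq of_nat_power by (simp only: rec_sum.simps power_mult[symmetric] mult.assoc)
qed
qed

corollary sum_matrices_eq_rec_sum:
  fixes w :: "nat \<Rightarrow> complex"
  assumes "\<And>a b. w (a * b) = w a * w b" "w 1 = 1" "finite A" "finite B"
  shows "(\<Sum>Y\<in>A \<times> B \<rightarrow>\<^sub>E carrier R. w (card (row_span A B Y))) = rec_sum q (w q) N 0 (card A) (card B)"
proof -
  have "mats ({} \<union> A) (\<lambda>_. 0) B = A \<times> B \<rightarrow>\<^sub>E carrier R" by (simp add: mats_def pideal_0)
  thus ?thesis using sum_mats_eq_rec_sum[of w N "{}" A B "\<lambda>_. 0"] assms by simp
qed

end

section \<open>Comparison of the two recursions\<close>

text \<open>The number of \<open>b \<times> n\<close> matrices of rank \<open>r\<close> over a field with \<open>q\<close> elements.\<close>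

fun rk :: "nat \<Rightarrow> nat \<Rightarrow> nat \<Rightarrow> nat \<Rightarrow> complex" where
  "rk q b n 0 = 1"
| "rk q 0 n (Suc r) = 0"
| "rk q (Suc b) n (Suc r) = rk q b n (Suc r) + (of_nat q ^ n - 1) * of_nat q ^ b * rk q b (n - 1) r"

lemma rk_eq_0: "b < r \<Longrightarrow> rk q b n r = 0"
proof (induction b arbitrary: n r)
  case 0 thus ?case by (cases r) auto
next
  case (Suc b) thus ?case by (cases r) auto
qed

text \<open>\<open>r\<close> is the number of pivots met at the current level. The
  \<open>(a + b) * n - (a + b - r) * (n - r)\<close> entries used up contribute \<open>q ^ d\<close>
  each beyond their residues, and the residues of the \<open>b\<close> rows are counted by
  \<open>rk\<close>.\<close>

lemma rec_sum_expand:
  "a + b \<le> n \<Longrightarrow> rec_sum q \<omega> (Suc d) a b n = (\<Sum>r\<le>b. rk q b n r * of_nat q ^ (d * ((a + b) * n - (a + b - r) * (n - r))) *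
      \<omega> ^ (Suc d * r) * rec_sum q \<omega> d 0 (a + b - r) (n - r))"
proof (induction b arbitrary: a n)
  case 0 thus ?case by simp
next
  case (Suc b)
  let ?e = "\<lambda>r. d * ((a + Suc b) * n - (a + Suc b - r) * (n - r))"
  let ?t = "\<lambda>r. of_nat q ^ ?e r * \<omega> ^ (Suc d * r) * rec_sum q \<omega> d 0 (a + Suc b - r) (n - r)"
  obtain n' where n: "n = Suc n'" using Suc.prems by (cases n) auto
  have "rec_sum q \<omega> (Suc d) (Suc a) b n = (\<Sum>r\<le>b. rk q b n r * ?t r)"
    using Suc.IH[of "Suc a" n] Suc.prems by (simp add: mult.assoc)
  also have "\<dots> = (\<Sum>r\<le>Suc b. rk q b n r * ?t r)" by (simp add: rk_eq_0)
  also have "\<dots> = ?t 0 + (\<Sum>r\<le>b. rk q b n (Suc r) * ?t (Suc r))"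
    by (subst sum.atMost_Suc_shift) simp
  finally have 1: "rec_sum q \<omega> (Suc d) (Suc a) b n = ?t 0 + (\<Sum>r\<le>b. rk q b n (Suc r) * ?t (Suc r))" .
  have "(of_nat q ^ (Suc d * n) - of_nat q ^ (d * n)) * of_nat q ^ (d * a) * of_nat q ^ (Suc d * b) *
     \<omega> ^ Suc d * rec_sum q \<omega> (Suc d) a b (n - 1) =
     (\<Sum>r\<le>b. (of_nat q ^ n - 1) * of_nat q ^ b * rk q b (n - 1) r * ?t (Suc r))"
  proof -
    have "rec_sum q \<omega> (Suc d) a b (n - 1) = (\<Sum>r\<le>b. rk q b n' r * of_nat q ^ (d * ((a + b) * n' - (a + b - r) * (n' - r))) *
      \<omega> ^ (Suc d * r) * rec_sum q \<omega> d 0 (a + b - r) (n' - r))"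
      using Suc.IH[of a n'] Suc.prems n by simp
    moreover have "(of_nat q ^ (Suc d * n) - of_nat q ^ (d * n)) * of_nat q ^ (d * a) * of_nat q ^ (Suc d * b) * \<omega> ^ Suc d *
      (rk q b n' r * of_nat q ^ (d * ((a + b) * n' - (a + b - r) * (n' - r))) * \<omega> ^ (Suc d * r) * rec_sum q \<omega> d 0 (a + b - r) (n' - r)) =
      (of_nat q ^ n - 1) * of_nat q ^ b * rk q b (n - 1) r * ?t (Suc r)" for r
    proof -
      have le: "(a + b - r) * (n' - r) \<le> (a + b) * n'" by (intro mult_le_mono) auto
      have e: "d * n + d * a + d * b + d * ((a + b) * n' - (a + b - r) * (n' - r)) = ?e (Suc r)"
        using le by (simp add: n distrib_left[symmetric] algebra_simps)
      have f: "of_nat q ^ (Suc d * n) - of_nat q ^ (d * n) = (of_nat q ^ (d * n) * (of_nat q ^ n - 1) :: complex)"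
        by (simp add: power_add algebra_simps)
      have g: "of_nat q ^ (Suc d * b) = (of_nat q ^ b * of_nat q ^ (d * b) :: complex)"
        by (simp add: power_add)
      have h: "\<omega> ^ (Suc d * Suc r) = \<omega> ^ Suc d * \<omega> ^ (Suc d * r)" by (simp add: power_add)
      have "a + Suc b - Suc r = a + b - r" "n - Suc r = n' - r" "n - 1 = n'" by (auto simp: n)
      thus ?thesis unfolding e[symmetric] f g h power_add by (simp only: mult_ac)
    qed
    ultimately show ?thesis by (simp only: sum_distrib_left)
  qed
  hence "rec_sum q \<omega> (Suc d) a (Suc b) n = ?t 0 + (\<Sum>r\<le>b. rk q b n (Suc r) * ?t (Suc r)) +
     (\<Sum>r\<le>b. (of_nat q ^ n - 1) * of_nat q ^ b * rk q b (n - 1) r * ?t (Suc r))"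
    using 1 by simp
  also have "\<dots> = ?t 0 + (\<Sum>r\<le>b. rk q (Suc b) n (Suc r) * ?t (Suc r))"
    by (simp only: rk.simps distrib_right sum.distrib add.assoc)
  also have "\<dots> = (\<Sum>r\<le>Suc b. rk q (Suc b) n r * ?t r)"
    by (subst sum.atMost_Suc_shift) simp
  finally show ?case by (simp only: mult.assoc)
qed

text \<open>Unlike the recursion used in \<open>rep_sum_closed\<close>, this one has
  \<open>Suc d\<close> in the last term. It is the one that fits \<open>rk\<close>, where dropping a
  row with or without a column changes the difference of the two sizes by zero or by one.\<close>

lemma rep_quot_shift:
  fixes T :: "'r::field"
  assumes T: "\<And>j. j \<ge> 1 \<Longrightarrow> T ^ j \<noteq> 1" and i: "i \<le> m"
  shows "rep_quot T d (Suc m) i = (1 - T ^ (Suc m + d)) * rep_quot T d m i +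
     (if i = 0 then 0 else T ^ (Suc m - i) * rep_quot T (Suc d) m (i - 1))"
proof -
  have nz: "qpoch T k \<noteq> 0" for k using T by (auto simp: qpoch_def)
  define P where "P = (\<Prod>j=Suc i..m. 1 - T ^ (d + j))"
  have P1: "(\<Prod>j=Suc i..Suc m. 1 - T ^ (d + j)) = P * (1 - T ^ (Suc m + d))" using i by (simp add: P_def add.commute)
  have s: "Suc m - i = Suc (m - i)" using i by simp
  show ?thesis
  proof (cases i)
    case 0
    thus ?thesis using nz P1 by (simp add: rep_quot_def P_def qpoch_0)
  next
    case (Suc i')
    have P2: "(\<Prod>j=Suc i'..m. 1 - T ^ (Suc d + j)) = P * (1 - T ^ (Suc m + d))"
      unfolding P1[symmetric] Suc by (subst prod.shift_bounds_cl_Suc_ivl) simp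
    have X1: "1 - T ^ Suc (m - i) \<noteq> 0" "1 - T ^ i \<noteq> 0" using T[of "Suc (m - i)"] T[of i] Suc by auto
    have qi: "qpoch T i = qpoch T i' * (1 - T ^ i)" using Suc qpoch_Suc[of T i'] by simp
    have mi: "m - i' = Suc (m - i)" using i Suc by simp
    define a b where "a = T ^ i" and "b = T ^ Suc (m - i)"
    have "a * b = T ^ (i + Suc (m - i))" unfolding a_def b_def by (rule power_add[symmetric])
    moreover have "i + Suc (m - i) = Suc m" using i by simp
    ultimately have ab: "T ^ Suc m = a * b" "T ^ Suc (m - i) = b" by (simp_all only: b_def)
    have X1': "1 - b \<noteq> 0" "1 - a \<noteq> 0" using X1 by (simp_all add: a_def b_def)
    define D where "D = 1 - T ^ (Suc m + d)"
    have l: "rep_quot T d m i = qpoch T m / (qpoch T i' * (1 - a) * qpoch T (m - i)) * P"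
      by (simp add: rep_quot_def P_def qi a_def)
    have l': "rep_quot T (Suc d) m i' = qpoch T m / (qpoch T i' * (qpoch T (m - i) * (1 - b))) * (P * D)"
      unfolding rep_quot_def P2 mi qpoch_Suc ab D_def by simp
    have r': "rep_quot T d (Suc m) i = qpoch T m * (1 - a * b) / (qpoch T i' * (1 - a) * (qpoch T (m - i) * (1 - b))) * (P * D)"
      unfolding rep_quot_def P1 s qpoch_Suc qi ab D_def by (simp add: a_def)
    have "rep_quot T d (Suc m) i = D * rep_quot T d m i + b * rep_quot T (Suc d) m i'"
      unfolding l l' r' using nz[of i'] nz[of "m - i"] X1'
      by (simp add: divide_simps) (simp add: algebra_simps)
    thus ?thesis using Suc s by (simp add: D_def b_def)
  qed
qed

lemma rep_quot_self:
  assumes "\<And>j. j \<ge> 1 \<Longrightarrow> T ^ j \<noteq> 1" shows "rep_quot T d m m = 1"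
proof -
  have "qpoch T m \<noteq> 0" using assms by (auto simp: qpoch_def)
  thus ?thesis by (simp add: rep_quot_def qpoch_0)
qed

lemma inverse_nat_power_neq_1:
  assumes "q \<ge> 2" "j \<ge> 1" shows "(1 / of_nat q :: complex) ^ j \<noteq> 1"
proof
  assume "(1 / of_nat q :: complex) ^ j = 1"
  hence "(of_nat (q ^ j) :: complex) = of_nat 1" using assms by (simp add: power_one_over field_simps)
  hence "q ^ j = 1" by (simp only: of_nat_eq_iff)
  thus False using assms by simp
qed

text \<open>The exponent \<open>r * (b + n - r)\<close> is the dimension of the variety of matrices
  of rank \<open>r\<close>. After taking it out, the count is a function of \<open>1/q\<close>, the
  same one as for the minimal representatives, with the corank \<open>b - r\<close> as
  index.\<close>

lemma rk_closed:
  assumes q: "q \<ge> 2" and "b \<le> n" "r \<le> b"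
  shows "rk q b n r = of_nat q ^ (r * (b + n - r)) * rep_quot (1 / of_nat q) (n - b) b (b - r)"
  using assms(2,3)
proof (induction b arbitrary: n r)
  case 0
  thus ?case using rep_quot_self[OF inverse_nat_power_neq_1[OF q]] by simp
next
  case (Suc b)
  note sq = inverse_nat_power_neq_1[OF q]
  define T :: complex where "T = 1 / of_nat q"
  define Q :: complex where "Q = of_nat q"
  have QT: "Q * T = 1" using q by (simp add: Q_def T_def)
  show ?case
  proof (cases r)
    case 0 thus ?thesis using rep_quot_self[OF sq] by simp
  next
    case (Suc r')
    define d where "d = n - Suc b"
    have n: "n = Suc b + d" and rb: "r' \<le> b" using Suc.prems Suc by (auto simp: d_def)
    have E: "Suc r' * (Suc b + n - Suc r') = r' * (b + (n - 1) - r') + b + n"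
    proof -
      obtain j where j: "b = r' + j" using rb le_Suc_ex by blast
      show ?thesis unfolding n j by (simp add: algebra_simps)
    qed
    have n1: "n - 1 - b = d" "b \<le> n - 1" "n - b = Suc d" "b \<le> n" using n by auto
    \<comment> \<open>For \<open>r' = b\<close> both sides vanish, the right one by the condition in
      the \<open>if\<close>.\<close>
    have t1: "rk q b n (Suc r') = Q ^ (Suc r' * (Suc b + n - Suc r')) * T ^ Suc r' * (if b - r' = 0 then 0 else rep_quot T (Suc d) b (b - r' - 1))"
    proof (cases "r' = b")
      case True thus ?thesis by (simp add: rk_eq_0)
    next
      case False
      have e: "Suc r' * (Suc b + n - Suc r') = Suc r' * (b + n - Suc r') + Suc r'"
        using rb False n by (simp add: algebra_simps Suc_diff_le)
      have "Q ^ (Suc r' * (Suc b + n - Suc r')) * T ^ Suc r' = Q ^ (Suc r' * (b + n - Suc r')) * (Q * T) ^ Suc r'"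
        unfolding e power_add power_mult_distrib by (simp only: mult_ac)
      also have "\<dots> = Q ^ (Suc r' * (b + n - Suc r'))" by (simp add: QT)
      finally have e2: "Q ^ (Suc r' * (Suc b + n - Suc r')) * T ^ Suc r' = Q ^ (Suc r' * (b + n - Suc r'))" .
      have "rk q b n (Suc r') = Q ^ (Suc r' * (b + n - Suc r')) * rep_quot T (n - b) b (b - Suc r')"
        unfolding Q_def T_def by (rule Suc.IH) (use rb False n1 in auto)
      thus ?thesis unfolding e2 n1 using False rb by simp
    qed
    have t2: "(of_nat q ^ n - 1) * of_nat q ^ b * rk q b (n - 1) r' = Q ^ (Suc r' * (Suc b + n - Suc r')) * (1 - T ^ (Suc b + d)) * rep_quot T d b (b - r')"
    proof -
      have "rk q b (n - 1) r' = Q ^ (r' * (b + (n - 1) - r')) * rep_quot T (n - 1 - b) b (b - r')"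
        unfolding Q_def T_def by (rule Suc.IH) (use rb n1 in auto)
      moreover have "Q ^ n * (1 - T ^ n) = Q ^ n - 1" using QT by (simp add: algebra_simps power_mult_distrib[symmetric])
      ultimately show ?thesis unfolding E power_add n1 n[symmetric] Q_def[symmetric] by (simp add: algebra_simps)
    qed
    have i: "Suc b - Suc r' = b - r'" "Suc b - (b - r') = Suc r'" using rb by auto
    have sh: "rep_quot T d (Suc b) (b - r') = (1 - T ^ (Suc b + d)) * rep_quot T d b (b - r') +
       (if b - r' = 0 then 0 else T ^ (Suc b - (b - r')) * rep_quot T (Suc d) b (b - r' - 1))"
      by (rule rep_quot_shift) (use sq in \<open>auto simp: T_def\<close>)
    have "rk q (Suc b) n r = Q ^ (Suc r' * (Suc b + n - Suc r')) * rep_quot T d (Suc b) (b - r')"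
      unfolding Suc rk.simps t1 t2 sh i
      by (simp add: algebra_simps)
    thus ?thesis unfolding Suc i d_def Q_def T_def by simp
  qed
qed

section \<open>Normalised sums and their generating function\<close>

text \<open>Up to a factor that does not depend on \<open>i\<close>, this is the coefficient of \<open>q_monomial\<close>.\<close>

definition mu :: "nat \<Rightarrow> nat \<Rightarrow> complex \<Rightarrow> nat \<Rightarrow> complex" where
  "mu q \<delta> \<omega> i = 1 / (of_nat q ^ (i * (i + \<delta>)) * \<omega> ^ i)"

text \<open>The factor is chosen so that the coefficients in \<open>normalized_Suc\<close> do not
  depend on \<open>d\<close>.\<close>

definition normalized :: "nat \<Rightarrow> nat \<Rightarrow> complex \<Rightarrow> complex \<Rightarrow> nat \<Rightarrow> nat \<Rightarrow> complex" where
  "normalized q \<delta> \<omega> c d i = rec_sum q \<omega> d 0 i (i + \<delta>) * (c * mu q \<delta> \<omega> i) ^ d"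

context
  fixes q \<delta> :: nat and \<omega> c :: complex
  assumes q: "q \<ge> 2" and \<omega>: "\<omega> \<noteq> 0"
begin

text \<open>\<open>rec_sum_expand\<close> is applied with all rows at the current level, and the sum
  is indexed by the corank \<open>i\<close>, for which an \<open>i\<close> by
  \<open>i + \<delta>\<close> matrix remains.\<close>

lemma normalized_Suc:
  "normalized q \<delta> \<omega> c (Suc d) m = (\<Sum>i\<le>m. rep_quot (1 / of_nat q) \<delta> m i * (c * mu q \<delta> \<omega> i) * normalized q \<delta> \<omega> c d i)"
proof -
  define Q :: complex where "Q = of_nat q"
  have Q0: "Q \<noteq> 0" using q by (simp add: Q_def)
  let ?g = "\<lambda>i. rep_quot (1 / of_nat q) \<delta> m i"
  have "rec_sum q \<omega> (Suc d) 0 m (m + \<delta>) = (\<Sum>r\<le>m. rk q m (m + \<delta>) r * of_nat q ^ (d * (m * (m + \<delta>) - (m - r) * (m + \<delta> - r))) *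
      \<omega> ^ (Suc d * r) * rec_sum q \<omega> d 0 (m - r) (m + \<delta> - r))"
    using rec_sum_expand[of 0 m "m + \<delta>" q \<omega> d] by simp
  also have "\<dots> = (\<Sum>i\<le>m. rk q m (m + \<delta>) (m - i) * of_nat q ^ (d * (m * (m + \<delta>) - i * (i + \<delta>))) *
      \<omega> ^ (Suc d * (m - i)) * rec_sum q \<omega> d 0 i (i + \<delta>))"
    by (rule sum.reindex_bij_witness[of _ "\<lambda>i. m - i" "\<lambda>i. m - i"]) auto
  also have "\<dots> = (\<Sum>i\<le>m. ?g i * (Q ^ (Suc d * (m * (m + \<delta>) - i * (i + \<delta>))) *
      \<omega> ^ (Suc d * (m - i))) * rec_sum q \<omega> d 0 i (i + \<delta>))"
  proof (intro sum.cong refl)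
    fix i assume "i \<in> {..m}"
    hence i: "i \<le> m" by simp
    then obtain j where m: "m = i + j" using le_Suc_ex by blast
    have e: "(m - i) * (m + (m + \<delta>) - (m - i)) = m * (m + \<delta>) - i * (i + \<delta>)"
      by (simp add: m algebra_simps)
    have "rk q m (m + \<delta>) (m - i) = Q ^ (m * (m + \<delta>) - i * (i + \<delta>)) * ?g i"
      using rk_closed[OF q, of m "m + \<delta>" "m - i"] i unfolding e Q_def by simp
    thus "rk q m (m + \<delta>) (m - i) * of_nat q ^ (d * (m * (m + \<delta>) - i * (i + \<delta>))) * \<omega> ^ (Suc d * (m - i)) * rec_sum q \<omega> d 0 i (i + \<delta>) =
      ?g i * (Q ^ (Suc d * (m * (m + \<delta>) - i * (i + \<delta>))) * \<omega> ^ (Suc d * (m - i))) * rec_sum q \<omega> d 0 i (i + \<delta>)"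
      unfolding Q_def[symmetric] by (simp add: power_add)
  qed
  finally have R: "rec_sum q \<omega> (Suc d) 0 m (m + \<delta>) = (\<Sum>i\<le>m. ?g i * (Q ^ (Suc d * (m * (m + \<delta>) - i * (i + \<delta>))) *
      \<omega> ^ (Suc d * (m - i))) * rec_sum q \<omega> d 0 i (i + \<delta>))" .
  \<comment> \<open>This is the \<open>Suc d\<close>-th power of the identity that expresses
    \<open>mu q \<delta> \<omega> i\<close> by \<open>mu q \<delta> \<omega> m\<close>.\<close>
  have "(Q ^ (Suc d * (m * (m + \<delta>) - i * (i + \<delta>))) * \<omega> ^ (Suc d * (m - i))) * (c * mu q \<delta> \<omega> m) ^ Suc d = (c * mu q \<delta> \<omega> i) ^ Suc d" if "i \<le> m" for i
  proof -
    have le: "i * (i + \<delta>) \<le> m * (m + \<delta>)" using that by (intro mult_le_mono) auto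
    have "Q ^ (m * (m + \<delta>) - i * (i + \<delta>)) * \<omega> ^ (m - i) * mu q \<delta> \<omega> m = mu q \<delta> \<omega> i"
      using power_diff[OF Q0 le] power_diff[OF \<omega> that] Q0 \<omega> by (simp add: mu_def Q_def[symmetric])
    hence "(Q ^ (m * (m + \<delta>) - i * (i + \<delta>)) * \<omega> ^ (m - i) * (c * mu q \<delta> \<omega> m)) ^ Suc d = (c * mu q \<delta> \<omega> i) ^ Suc d"
      by (simp only: mult.left_commute)
    thus ?thesis by (simp only: power_mult_distrib power_mult mult.commute[of "Suc d"])
  qed
  hence "?g i * (Q ^ (Suc d * (m * (m + \<delta>) - i * (i + \<delta>))) * \<omega> ^ (Suc d * (m - i))) * rec_sum q \<omega> d 0 i (i + \<delta>) * (c * mu q \<delta> \<omega> m) ^ Suc d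
      = ?g i * (c * mu q \<delta> \<omega> i) * normalized q \<delta> \<omega> c d i" if "i \<le> m" for i
  proof -
    assume *: "\<And>i. i \<le> m \<Longrightarrow> Q ^ (Suc d * (m * (m + \<delta>) - i * (i + \<delta>))) * \<omega> ^ (Suc d * (m - i)) * (c * mu q \<delta> \<omega> m) ^ Suc d = (c * mu q \<delta> \<omega> i) ^ Suc d"
    have "?g i * (Q ^ (Suc d * (m * (m + \<delta>) - i * (i + \<delta>))) * \<omega> ^ (Suc d * (m - i))) * rec_sum q \<omega> d 0 i (i + \<delta>) * (c * mu q \<delta> \<omega> m) ^ Suc d
      = ?g i * (Q ^ (Suc d * (m * (m + \<delta>) - i * (i + \<delta>))) * \<omega> ^ (Suc d * (m - i)) * (c * mu q \<delta> \<omega> m) ^ Suc d) * rec_sum q \<omega> d 0 i (i + \<delta>)"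
      by (simp only: mult_ac)
    also have "\<dots> = ?g i * (c * mu q \<delta> \<omega> i) * normalized q \<delta> \<omega> c d i"
      unfolding *[OF that] normalized_def by (simp only: power_Suc mult_ac)
    finally show ?thesis .
  qed
  thus ?thesis unfolding normalized_def[of q \<delta> \<omega> c "Suc d" m] R sum_distrib_right by (intro sum.cong refl) auto
qed

lemma rep_sum_fps_const: "rep_sum (fps_const (T :: complex)) d m i = fps_const (rep_sum T d m i)"
proof -
  have "wt (fps_const T) d m u = fps_const (wt T d m u)" for u
  proof -
    have "(- 1 :: complex fps) = fps_const (- 1)" by (simp flip: fps_const_neg)
    thus ?thesis unfolding wt_def by (simp only: fps_const_power fps_const_mult)
  qed
  moreover have "(\<Sum>u\<in>A. fps_const (f u)) = fps_const (\<Sum>u\<in>A. f u)" for f :: "(int \<Rightarrow> int) \<Rightarrow> complex" and A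
    by (induction A rule: infinite_finite_induct) simp_all
  ultimately show ?thesis by (simp add: rep_sum_def)
qed

text \<open>The generating functions solve
  \<open>F m = 1 + (\<Sum>i\<le>m. g i * M i * F i)\<close>. As \<open>g m = 1\<close>, the last
  term moves to the left as the factor \<open>1 - M m\<close>, and multiplying by the remaining
  factors gives the shape of \<open>weyl_sum_recursion\<close>.\<close>

lemma normalized_fps:
  defines "M \<equiv> \<lambda>i. fps_const (c * mu q \<delta> \<omega> i) * fps_X"
  shows "Abs_fps (\<lambda>d. normalized q \<delta> \<omega> c d m) * (\<Prod>i\<le>m. 1 - M i) = weyl_sum (fps_const (1 / of_nat q)) \<delta> m M"
proof (induction m rule: less_induct)
  case (less m)
  let ?F = "\<lambda>m. Abs_fps (\<lambda>d. normalized q \<delta> \<omega> c d m)"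
  let ?g = "\<lambda>i. fps_const (rep_quot (1 / of_nat q :: complex) \<delta> m i)"
  have "?F m = 1 + (\<Sum>i\<le>m. ?g i * M i * ?F i)"
  proof (rule fps_ext)
    fix d
    show "fps_nth (?F m) d = fps_nth (1 + (\<Sum>i\<le>m. ?g i * M i * ?F i)) d"
    proof (cases d)
      case 0
      have "fps_nth (?g i * M i * ?F i) 0 = 0" for i by (simp add: M_def)
      thus ?thesis using 0 by (simp add: fps_sum_nth normalized_def)
    next
      case (Suc d')
      have "fps_nth (?g i * M i * ?F i) (Suc d') = rep_quot (1 / of_nat q) \<delta> m i * (c * mu q \<delta> \<omega> i) * normalized q \<delta> \<omega> c d' i" for i
      proof -
        have "?g i * M i * ?F i = fps_const (rep_quot (1 / of_nat q) \<delta> m i * (c * mu q \<delta> \<omega> i)) * (fps_X * ?F i)"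
          by (simp add: M_def mult.assoc flip: fps_const_mult)
        thus ?thesis by (simp only: fps_mult_left_const_nth fps_X_mult_nth) simp
      qed
      thus ?thesis using Suc normalized_Suc[of d' m] by (simp add: fps_sum_nth)
    qed
  qed
  moreover have "?g m = 1" using rep_quot_self[OF inverse_nat_power_neq_1[OF q]] by simp
  ultimately have F: "?F m * (1 - M m) = 1 + (\<Sum>i<m. ?g i * M i * ?F i)"
    by (simp add: atMost_Suc lessThan_Suc_atMost[symmetric] lessThan_Suc algebra_simps)
  have g: "rep_sum (fps_const (1 / of_nat q)) \<delta> m i = ?g i" if "i \<le> m" for i
    unfolding rep_sum_fps_const using rep_sum_closed[OF inverse_nat_power_neq_1[OF q] that] by simp
  have "?F m * (\<Prod>i\<le>m. 1 - M i) = (?F m * (1 - M m)) * (\<Prod>i<m. 1 - M i)"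
    by (simp add: lessThan_Suc_atMost[symmetric] mult_ac)
  also have "\<dots> = (\<Prod>i<m. 1 - M i) + (\<Sum>i<m. ?g i * M i * ?F i * (\<Prod>j<m. 1 - M j))"
    unfolding F by (simp add: algebra_simps sum_distrib_left)
  also have "(\<Sum>i<m. ?g i * M i * ?F i * (\<Prod>j<m. 1 - M j)) =
      (\<Sum>i<m. rep_sum (fps_const (1 / of_nat q)) \<delta> m i * weyl_sum (fps_const (1 / of_nat q)) \<delta> i M * (M i * (\<Prod>j\<in>{i<..<m}. 1 - M j)))"
  proof (intro sum.cong refl)
    fix i assume "i \<in> {..<m}"
    hence i: "i < m" by simp
    have "{..<m} = {..i} \<union> {i<..<m}" "{..i} \<inter> {i<..<m} = {}" using i by auto
    hence "(\<Prod>j<m. 1 - M j) = (\<Prod>j\<le>i. 1 - M j) * (\<Prod>j\<in>{i<..<m}. 1 - M j)"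
      by (simp add: prod.union_disjoint)
    thus "?g i * M i * ?F i * (\<Prod>j<m. 1 - M j) = rep_sum (fps_const (1 / of_nat q)) \<delta> m i * weyl_sum (fps_const (1 / of_nat q)) \<delta> i M * (M i * (\<Prod>j\<in>{i<..<m}. 1 - M j))"
      unfolding less.IH[OF i, symmetric] g[OF less_imp_le[OF i]] by (simp only: mult_ac)
  qed
  also have "(\<Prod>i<m. 1 - M i) + \<dots> = weyl_sum (fps_const (1 / of_nat q)) \<delta> m M"
    by (rule weyl_sum_recursion[symmetric])
  finally show ?case .
qed

end

lemma wt_eq_statement:
  assumes w: "w \<in> weyl_B m" and q: "q \<ge> 2" and mn: "m \<le> n"
  shows "of_int (chi m w) * fps_const (complex_of_nat q powi (- h_stat m n w)) = wt (fps_const (1 / of_nat q)) (n - m) m w"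
proof -
  have "h_stat m n w = int (blen m w + (n - m) * neg m w)"
    using mn by (simp add: h_stat_def cox_length_eq[OF w] delta_def of_nat_diff)
  hence "complex_of_nat q powi (- h_stat m n w) = (1 / of_nat q) ^ (blen m w + (n - m) * neg m w)"
    by (simp only: power_int_minus power_int_of_nat) (simp add: power_one_over inverse_eq_divide)
  thus ?thesis by (simp add: wt_def chi_def fps_const_power)
qed

text \<open>Here \<open>abar\<close> gets its shape: \<open>m * n - i * (i + n - m)\<close> equals
  \<open>(m - i) * (n + i)\<close>, and \<open>m + n - 2 * (m - i)\<close> equals
  \<open>2 * i + n - m\<close>, where the 2 stems from the exponent
  \<open>- (s + 2)\<close>.\<close>

lemma q_monomial_eq:
  fixes s :: complex
  assumes q: "q \<ge> 2" and mn: "m \<le> n" and i: "i \<le> m"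
  defines "w \<equiv> complex_of_nat q powr (- (s + 2))"
  shows "q_monomial m n q s i = fps_const ((of_nat q ^ (m + n) * of_nat q ^ (m * n) * w ^ m) * mu q (n - m) w i) * fps_X"
proof -
  have q0: "complex_of_nat q \<noteq> 0" using q by simp
  have wn: "w ^ k = complex_of_nat q powr (of_nat k * (- (s + 2)))" for k
    using q by (induction k) (simp_all add: w_def powr_add[symmetric] algebra_simps q0)
  have qn: "complex_of_nat q ^ k = complex_of_nat q powr (of_nat k)" for k
    by (subst powr_nat') (use q in auto)
  obtain d where n: "n = m + d" using mn le_Suc_ex by blast
  have "(of_nat q ^ (m + n) * of_nat q ^ (m * n) * w ^ m) * mu q (n - m) w i =
     complex_of_nat q powr (of_nat (m + n) + of_nat (m * n) + of_nat m * (- (s + 2)) - of_nat (i * (i + (n - m))) - of_nat i * (- (s + 2)))"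
    unfolding mu_def wn qn by (simp add: powr_add powr_diff q0)
  also have "of_nat (m + n) + of_nat (m * n) + of_nat m * (- (s + 2)) - of_nat (i * (i + (n - m))) - of_nat i * (- (s + 2)) =
     of_int (abar m n i) - of_int (int m - int i) * s"
    by (simp add: abar_def delta_def n algebra_simps)
  finally show ?thesis by (simp add: q_monomial_def)
qed

theorem rec_sum_generating_function:
  assumes q: "q \<ge> 2" and mn: "m \<le> n"
  shows "Abs_fps (\<lambda>N. of_nat q ^ (N * (m + n)) * rec_sum q (complex_of_nat q powr (- (s + 2))) N 0 m n) =
           (\<Sum>w\<in>weyl_B m.
              of_int (chi m w) * fps_const (complex_of_nat q powi (- h_stat m n w)) *
              (\<Prod>i\<in>descents m w. q_monomial m n q s i)) /
           (\<Prod>i=0..m. 1 - q_monomial m n q s i)"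
proof -
  define \<omega> where "\<omega> = complex_of_nat q powr (- (s + 2))"
  \<comment> \<open>Chosen such that \<open>c * mu q (n - m) \<omega> m\<close> is
    \<open>q ^ (m + n)\<close>, the factor per level that precedes \<open>rec_sum\<close>.\<close>
  define c where "c = of_nat q ^ (m + n) * of_nat q ^ (m * n) * \<omega> ^ m"
  define M where "M = (\<lambda>i. fps_const (c * mu q (n - m) \<omega> i) * fps_X)"
  have \<omega>0: "\<omega> \<noteq> 0" using q by (simp add: \<omega>_def)
  have M: "q_monomial m n q s i = M i" if "i \<le> m" for i
    unfolding M_def c_def \<omega>_def by (rule q_monomial_eq[OF q mn that])
  have "normalized q (n - m) \<omega> c N m = of_nat q ^ (N * (m + n)) * rec_sum q \<omega> N 0 m n" for N
  proof -
    have "c * mu q (n - m) \<omega> m = of_nat q ^ (m + n)"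
      using q \<omega>0 mn by (simp add: c_def mu_def)
    thus ?thesis using mn by (simp add: normalized_def power_mult[symmetric] mult.commute)
  qed
  hence L: "Abs_fps (\<lambda>N. normalized q (n - m) \<omega> c N m) = Abs_fps (\<lambda>N. of_nat q ^ (N * (m + n)) * rec_sum q \<omega> N 0 m n)"
    by simp
  have W: "weyl_sum (fps_const (1 / of_nat q)) (n - m) m M = (\<Sum>w\<in>weyl_B m.
      of_int (chi m w) * fps_const (complex_of_nat q powi (- h_stat m n w)) * (\<Prod>i\<in>descents m w. q_monomial m n q s i))"
    unfolding weyl_sum_def
  proof (intro sum.cong refl arg_cong2[where f = "(*)"])
    fix w assume w: "w \<in> weyl_B m"
    show "wt (fps_const (1 / of_nat q)) (n - m) m w = of_int (chi m w) * fps_const (complex_of_nat q powi (- h_stat m n w))"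
      using wt_eq_statement[OF w q mn] by simp
    show "(\<Prod>k\<in>descents m w. M k) = (\<Prod>i\<in>descents m w. q_monomial m n q s i)"
      using M descents_subset[of m w] by (intro prod.cong refl) force
  qed
  define D where "D = (\<Prod>i=0..m. 1 - q_monomial m n q s i)"
  have D: "D = (\<Prod>i\<le>m. 1 - M i)" unfolding D_def atLeast0AtMost using M by (intro prod.cong refl) simp
  have "fps_nth D 0 = 1"
  proof -
    have "fps_nth (\<Prod>i\<in>A. 1 - M i) 0 = 1" for A
      by (induction A rule: infinite_finite_induct) (simp_all add: M_def)
    thus ?thesis by (simp add: D)
  qed
  hence D0: "D \<noteq> 0" by auto
  have "Abs_fps (\<lambda>N. of_nat q ^ (N * (m + n)) * rec_sum q \<omega> N 0 m n) * D = weyl_sum (fps_const (1 / of_nat q)) (n - m) m M"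
    unfolding L[symmetric] D M_def by (rule normalized_fps[OF q \<omega>0])
  hence "Abs_fps (\<lambda>N. of_nat q ^ (N * (m + n)) * rec_sum q \<omega> N 0 m n) = weyl_sum (fps_const (1 / of_nat q)) (n - m) m M / D"
    using D0 by (metis nonzero_mult_div_cancel_right)
  thus ?thesis unfolding W D_def \<omega>_def .
qed

section \<open>Irreducible characters over a finite chain ring\<close>

text \<open>Any character that is nontrivial at \<open>p [^] (N - 1)\<close> works by
  \<open>socle\<close>; in the zero ring there is nothing to separate.\<close>

lemma (in chain_ring) generating_char_exists:
  "\<exists>ch\<in>chars (add_monoid R). \<forall>x\<in>carrier R. x \<noteq> \<zero> \<longrightarrow> (\<exists>r\<in>carrier R. ch (r \<otimes> x) \<noteq> 1)"
proof (cases "N = 0")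
  case True
  hence "carrier R = {\<zero>}" using pideal_N[of 0] by (simp add: pideal_0)
  moreover have "(\<lambda>x\<in>carrier R. 1) \<in> chars (add_monoid R)" by (simp add: chars_def)
  ultimately show ?thesis by blast
next
  case False
  interpret add: comm_group "add_monoid R" by (rule a_comm_group)
  have "p [^] (N - 1) \<noteq> \<zero>" using False by (intro p_pow_nonzero) simp
  then obtain ch where ch: "ch \<in> chars (add_monoid R)" "ch (p [^] (N - 1)) \<noteq> 1"
    using add.char_separates[of "p [^] (N - 1)"] fin by auto
  have "\<exists>r\<in>carrier R. ch (r \<otimes> x) \<noteq> 1" if x: "x \<in> carrier R" "x \<noteq> \<zero>" for x
    using socle[OF x] ch(2) by metis
  thus ?thesis using ch(1) by blast
qed

section \<open>Duality by a generating character\<close>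

locale gen_chain_ring = chain_ring +
  fixes ch :: "'a \<Rightarrow> complex"
  assumes ch: "ch \<in> chars (add_monoid R)"
    and generating: "\<And>x. x \<in> carrier R \<Longrightarrow> x \<noteq> \<zero> \<Longrightarrow> \<exists>r\<in>carrier R. ch (r \<otimes> x) \<noteq> 1"
begin

definition dot :: "'i set \<Rightarrow> ('i \<Rightarrow> 'a) \<Rightarrow> ('i \<Rightarrow> 'a) \<Rightarrow> 'a" where
  "dot I u v = (\<Oplus>i\<in>I. u i \<otimes> v i)"

abbreviation V :: "'i set \<Rightarrow> ('i \<Rightarrow> 'a) set" where "V I \<equiv> I \<rightarrow>\<^sub>E carrier R"
abbreviation vadd :: "('i \<Rightarrow> 'a) \<Rightarrow> 'i set \<Rightarrow> ('i \<Rightarrow> 'a) \<Rightarrow> ('i \<Rightarrow> 'a)" where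
  "vadd u I v \<equiv> (\<lambda>i\<in>I. u i \<oplus> v i)"
abbreviation vzero :: "'i set \<Rightarrow> 'i \<Rightarrow> 'a" where "vzero I \<equiv> (\<lambda>i\<in>I. \<zero>)"

lemma ch_add: "x \<in> carrier R \<Longrightarrow> y \<in> carrier R \<Longrightarrow> ch (x \<oplus> y) = ch x * ch y"
  using charsD(3)[OF ch, of x y] by simp

lemma ch_zero: "ch \<zero> = 1"
  using charsD(2)[OF ch] by simp

lemma ch_minus: "x \<in> carrier R \<Longrightarrow> ch (\<ominus> x) * ch x = 1"
  using ch_add[of "\<ominus> x" x] ch_zero by (simp add: l_neg)

lemma ch_nonzero: "x \<in> carrier R \<Longrightarrow> ch x \<noteq> 0"
  using ch_minus[of x] by auto

lemma V_closed: "u \<in> V I \<Longrightarrow> i \<in> I \<Longrightarrow> u i \<in> carrier R"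
  by auto

lemma dot_closed: "u \<in> V I \<Longrightarrow> v \<in> V I \<Longrightarrow> dot I u v \<in> carrier R"
  unfolding dot_def by (rule finsum_closed) auto

lemma dot_add: "u \<in> V I \<Longrightarrow> v \<in> V I \<Longrightarrow> v' \<in> V I \<Longrightarrow> dot I u (vadd v I v') = dot I u v \<oplus> dot I u v'"
proof -
  assume u: "u \<in> V I" "v \<in> V I" "v' \<in> V I"
  have "dot I u (vadd v I v') = (\<Oplus>i\<in>I. u i \<otimes> v i \<oplus> u i \<otimes> v' i)"
    unfolding dot_def by (rule finsum_cong') (use V_closed[OF u(1)] V_closed[OF u(2)] V_closed[OF u(3)] in \<open>auto simp: r_distr\<close>)
  also have "\<dots> = dot I u v \<oplus> dot I u v'"
    unfolding dot_def by (rule finsum_addf) (use V_closed[OF u(1)] V_closed[OF u(2)] V_closed[OF u(3)] in auto)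
  finally show ?thesis .
qed

lemma dot_comm: "u \<in> V I \<Longrightarrow> v \<in> V I \<Longrightarrow> dot I u v = dot I v u"
  unfolding dot_def by (rule finsum_cong') (use V_closed[of u I] V_closed[of v I] in \<open>auto simp: m_comm\<close>)

lemma dot_zero: "u \<in> V I \<Longrightarrow> dot I u (vzero I) = \<zero>"
proof -
  assume "u \<in> V I"
  hence "dot I u (vzero I) = (\<Oplus>i\<in>I. \<zero>)"
    unfolding dot_def using V_closed[of u I] by (intro finsum_cong') auto
  thus ?thesis by simp
qed

lemma dot_unit:
  assumes "finite I" "i \<in> I" "u \<in> V I" "r \<in> carrier R"
  shows "dot I u (\<lambda>l\<in>I. if l = i then r else \<zero>) = u i \<otimes> r"
proof -
  have "dot I u (\<lambda>l\<in>I. if l = i then r else \<zero>) = (\<Oplus>l\<in>I. if i = l then u l \<otimes> r else \<zero>)"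
    unfolding dot_def by (rule finsum_cong') (use assms V_closed[OF assms(3)] in auto)
  also have "\<dots> = u i \<otimes> r" by (rule finsum_singleton) (use assms V_closed[OF assms(3)] in auto)
  finally show ?thesis .
qed

lemma ch_finsum: "finite I \<Longrightarrow> (\<And>i. i \<in> I \<Longrightarrow> g i \<in> carrier R) \<Longrightarrow> ch (\<Oplus>i\<in>I. g i) = (\<Prod>i\<in>I. ch (g i))"
proof (induction I rule: finite_induct)
  case (insert x I)
  have "g \<in> I \<rightarrow> carrier R" "g x \<in> carrier R" using insert.prems by auto
  hence "(\<Oplus>i\<in>I. g i) \<in> carrier R" by simp
  thus ?case using insert \<open>g \<in> I \<rightarrow> carrier R\<close> by (simp add: ch_add)
qed (simp add: ch_zero)

lemma V_zero: "vzero I \<in> V I" by auto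
lemma V_add: "u \<in> V I \<Longrightarrow> v \<in> V I \<Longrightarrow> vadd u I v \<in> V I" by auto

text \<open>Multiples of unit vectors isolate one coordinate, and a nonzero coordinate is detected
  by the generating property.\<close>

lemma dot_nondegenerate:
  assumes "finite I" "u \<in> V I" "\<And>v. v \<in> V I \<Longrightarrow> ch (dot I u v) = 1"
  shows "u = vzero I"
proof (rule extensionalityI[of _ I])
  fix i assume i: "i \<in> I"
  have "u i = \<zero>"
  proof (rule ccontr)
    assume "u i \<noteq> \<zero>"
    then obtain r where r: "r \<in> carrier R" "ch (r \<otimes> u i) \<noteq> 1" using generating assms(2) i by blast
    have "(\<lambda>l\<in>I. if l = i then r else \<zero>) \<in> V I" using r by auto
    hence "ch (u i \<otimes> r) = 1" using assms(3) dot_unit[OF assms(1) i assms(2) r(1)] by metis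
    thus False using r m_comm[OF r(1) V_closed[OF assms(2) i]] by simp
  qed
  thus "u i = vzero I i" using i by simp
qed (use assms(2) in \<open>auto simp: PiE_def\<close>)

lemma dot_char: "u \<in> V I \<Longrightarrow> (\<lambda>v\<in>V I. ch (dot I u v)) \<in> chars (vec_group R I)"
proof -
  assume u: "u \<in> V I"
  have "ch (dot I u (vadd x I y)) = ch (dot I u x) * ch (dot I u y)" if "x \<in> V I" "y \<in> V I" for x y
    unfolding dot_add[OF u that] by (intro ch_add dot_closed u that)
  thus ?thesis using dot_zero[OF u] V_zero[of I] V_add[of _ I]
    by (simp add: chars_def vec_group_simps ch_zero del: PiE_iff)
qed

lemma finite_V: "finite I \<Longrightarrow> finite (V I)"
  using fin by (intro finite_PiE) auto

lemma card_V: "finite I \<Longrightarrow> card (V I) = q ^ (N * card I)"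
  by (simp add: card_PiE card_carrier power_mult)

lemma dot_diff:
  assumes "u \<in> V I" "u' \<in> V I" "v \<in> V I"
  shows "ch (dot I (\<lambda>i\<in>I. u i \<ominus> u' i) v) * ch (dot I u' v) = ch (dot I u v)"
proof -
  have m: "(\<lambda>i\<in>I. u i \<ominus> u' i) \<in> V I" using assms by auto
  have "vadd (\<lambda>i\<in>I. u i \<ominus> u' i) I u' = u"
  proof (rule extensionalityI[of _ I])
    fix i assume "i \<in> I"
    thus "vadd (\<lambda>i\<in>I. u i \<ominus> u' i) I u' i = u i"
      using V_closed[OF assms(1)] V_closed[OF assms(2)] by (simp add: a_minus_def a_assoc l_neg)
  qed (use assms in \<open>auto simp: PiE_def\<close>)
  hence "dot I v u = dot I v (\<lambda>i\<in>I. u i \<ominus> u' i) \<oplus> dot I v u'"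
    using dot_add[OF assms(3) m assms(2)] by simp
  hence "dot I u v = dot I (\<lambda>i\<in>I. u i \<ominus> u' i) v \<oplus> dot I u' v"
    unfolding dot_comm[OF assms(3,1)] dot_comm[OF assms(3) m] dot_comm[OF assms(3,2)] .
  thus ?thesis using ch_add dot_closed assms m by metis
qed

lemma dot_char_inj: "finite I \<Longrightarrow> inj_on (\<lambda>u. \<lambda>v\<in>V I. ch (dot I u v)) (V I)"
proof (rule inj_onI)
  fix u u' assume I: "finite I" and u: "u \<in> V I" "u' \<in> V I" and e: "(\<lambda>v\<in>V I. ch (dot I u v)) = (\<lambda>v\<in>V I. ch (dot I u' v))"
  have m: "(\<lambda>i\<in>I. u i \<ominus> u' i) \<in> V I" using u by auto
  have "ch (dot I (\<lambda>i\<in>I. u i \<ominus> u' i) v) = 1" if v: "v \<in> V I" for v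
  proof -
    have "ch (dot I u v) = ch (dot I u' v)" using fun_cong[OF e, of v] v by simp
    thus ?thesis using dot_diff[OF u v] ch_nonzero[OF dot_closed[OF u(2) v]] by simp
  qed
  hence z: "(\<lambda>i\<in>I. u i \<ominus> u' i) = vzero I" by (rule dot_nondegenerate[OF I m])
  show "u = u'"
  proof (rule extensionalityI[of _ I])
    fix i assume i: "i \<in> I"
    thus "u i = u' i" using fun_cong[OF z, of i] V_closed[OF u(1) i] V_closed[OF u(2) i] by simp
  qed (use u in \<open>auto simp: PiE_def\<close>)
qed

text \<open>Nondegeneracy makes the map from vectors to characters injective, and
  \<open>card_chars\<close> leaves no room for further characters.\<close>

lemma char_eq_dot:
  assumes I: "finite I" and f: "f \<in> chars (vec_group R I)"
  shows "\<exists>u\<in>V I. f = (\<lambda>v\<in>V I. ch (dot I u v))"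
proof -
  interpret v: comm_group "vec_group R I" by (rule comm_group_vec_group)
  have fin': "finite (carrier (vec_group R I))" using finite_V[OF I] by (simp add: vec_group_simps)
  let ?F = "\<lambda>u. \<lambda>v\<in>V I. ch (dot I u v)"
  have "card (?F ` V I) = card (chars (vec_group R I))"
    using card_image[OF dot_char_inj[OF I]] v.card_chars[OF fin'] by (simp add: vec_group_simps)
  moreover have "?F ` V I \<subseteq> chars (vec_group R I)" using dot_char by blast
  ultimately have "?F ` V I = chars (vec_group R I)" using v.finite_chars[OF fin'] by (intro card_subset_eq)
  thus ?thesis using f by blast
qed

text \<open>Row combinations: this is a Y for a row vector a, and \<open>cc\<close> below is Y b for
  a column vector b.\<close>

definition rc :: "'i set \<Rightarrow> 'j set \<Rightarrow> ('i \<times> 'j \<Rightarrow> 'a) \<Rightarrow> ('i \<Rightarrow> 'a) \<Rightarrow> 'j \<Rightarrow> 'a" where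
  "rc I J Y a = (\<lambda>j\<in>J. \<Oplus>i\<in>I. a i \<otimes> Y (i, j))"

definition cc :: "'i set \<Rightarrow> 'j set \<Rightarrow> ('i \<times> 'j \<Rightarrow> 'a) \<Rightarrow> ('j \<Rightarrow> 'a) \<Rightarrow> 'i \<Rightarrow> 'a" where
  "cc I J Y b = (\<lambda>i\<in>I. \<Oplus>j\<in>J. Y (i, j) \<otimes> b j)"

definition outer :: "'i set \<Rightarrow> 'j set \<Rightarrow> ('i \<Rightarrow> 'a) \<Rightarrow> ('j \<Rightarrow> 'a) \<Rightarrow> 'i \<times> 'j \<Rightarrow> 'a" where
  "outer I J a b = (\<lambda>(i, j)\<in>I \<times> J. a i \<otimes> b j)"

lemma row_span_rc: "row_span I J Y = rc I J Y ` V I"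
  by (simp add: row_span_def rc_def)

lemma rc_closed: "Y \<in> V (I \<times> J) \<Longrightarrow> a \<in> V I \<Longrightarrow> rc I J Y a \<in> V J"
  unfolding rc_def by (auto intro!: finsum_closed)

lemma cc_closed: "Y \<in> V (I \<times> J) \<Longrightarrow> b \<in> V J \<Longrightarrow> cc I J Y b \<in> V I"
  unfolding cc_def by (auto intro!: finsum_closed)

lemma outer_closed: "a \<in> V I \<Longrightarrow> b \<in> V J \<Longrightarrow> outer I J a b \<in> V (I \<times> J)"
  unfolding outer_def by auto

lemma rc_dot:
  assumes "Y \<in> V (I \<times> J)" "a \<in> V I" "j \<in> J"
  shows "rc I J Y a j = dot I a (\<lambda>i\<in>I. Y (i, j))"
proof -
  have "(\<Oplus>i\<in>I. a i \<otimes> Y (i, j)) = (\<Oplus>i\<in>I. a i \<otimes> (\<lambda>i\<in>I. Y (i, j)) i)"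
    by (rule finsum_cong') (use V_closed[OF assms(1)] V_closed[OF assms(2)] assms(3) in auto)
  thus ?thesis using assms(3) by (simp add: rc_def dot_def)
qed

lemma rc_add:
  assumes Y: "Y \<in> V (I \<times> J)" and a: "a \<in> V I" "a' \<in> V I"
  shows "rc I J Y (vadd a I a') = vadd (rc I J Y a) J (rc I J Y a')"
proof (rule extensionalityI[of _ J])
  fix j assume j: "j \<in> J"
  have y: "(\<lambda>i\<in>I. Y (i, j)) \<in> V I" using Y j by auto
  have "rc I J Y (vadd a I a') j = dot I (\<lambda>i\<in>I. Y (i, j)) (vadd a I a')"
    unfolding rc_dot[OF Y V_add[OF a] j] by (rule dot_comm[OF V_add[OF a] y])
  also have "\<dots> = dot I (\<lambda>i\<in>I. Y (i, j)) a \<oplus> dot I (\<lambda>i\<in>I. Y (i, j)) a'" by (rule dot_add[OF y a])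
  also have "\<dots> = rc I J Y a j \<oplus> rc I J Y a' j"
    unfolding rc_dot[OF Y a(1) j] rc_dot[OF Y a(2) j] dot_comm[OF a(1) y] dot_comm[OF a(2) y] ..
  finally show "rc I J Y (vadd a I a') j = vadd (rc I J Y a) J (rc I J Y a') j" using j by simp
qed (auto simp: rc_def)

text \<open>All sides are the character at a Y b, summed in different orders. The computation takes
  place after applying \<open>ch\<close>, as a product over index pairs.\<close>

lemma ch_dot_outer:
  assumes fin': "finite I" "finite J" and Y: "Y \<in> V (I \<times> J)" and a: "a \<in> V I" and b: "b \<in> V J"
  shows "ch (dot (I \<times> J) Y (outer I J a b)) = ch (dot J (rc I J Y a) b)"
    and "ch (dot (I \<times> J) Y (outer I J a b)) = ch (dot I (cc I J Y b) a)"
proof -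
  have c: "i \<in> I \<Longrightarrow> a i \<in> carrier R" "j \<in> J \<Longrightarrow> b j \<in> carrier R" "i \<in> I \<Longrightarrow> j \<in> J \<Longrightarrow> Y (i, j) \<in> carrier R" for i j
    using a b Y by auto
  have 0: "ch (dot (I \<times> J) Y (outer I J a b)) = (\<Prod>(i, j)\<in>I \<times> J. ch (Y (i, j) \<otimes> (a i \<otimes> b j)))"
    unfolding dot_def using fin' c
    by (subst ch_finsum) (auto simp: outer_def intro!: prod.cong)
  have "ch (dot J (rc I J Y a) b) = (\<Prod>j\<in>J. ch (rc I J Y a j \<otimes> b j))"
    unfolding dot_def using V_closed[OF rc_closed[OF Y a]] c fin' by (intro ch_finsum) auto
  also have "\<dots> = (\<Prod>j\<in>J. \<Prod>i\<in>I. ch (Y (i, j) \<otimes> (a i \<otimes> b j)))"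
  proof (intro prod.cong refl)
    fix j assume j: "j \<in> J"
    have "rc I J Y a j \<otimes> b j = (\<Oplus>i\<in>I. (a i \<otimes> Y (i, j)) \<otimes> b j)"
      unfolding rc_def using j c fin' by (simp, intro finsum_ldistr) auto
    also have "ch \<dots> = (\<Prod>i\<in>I. ch ((a i \<otimes> Y (i, j)) \<otimes> b j))"
      using c j fin' by (intro ch_finsum) auto
    also have "\<dots> = (\<Prod>i\<in>I. ch (Y (i, j) \<otimes> (a i \<otimes> b j)))"
      using c j by (intro prod.cong refl) (simp add: m_ac)
    finally show "ch (rc I J Y a j \<otimes> b j) = (\<Prod>i\<in>I. ch (Y (i, j) \<otimes> (a i \<otimes> b j)))" .
  qed
  also have "\<dots> = (\<Prod>(i, j)\<in>I \<times> J. ch (Y (i, j) \<otimes> (a i \<otimes> b j)))"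
    by (subst prod.swap) (simp add: prod.cartesian_product)
  finally show "ch (dot (I \<times> J) Y (outer I J a b)) = ch (dot J (rc I J Y a) b)" using 0 by simp
  have "ch (dot I (cc I J Y b) a) = (\<Prod>i\<in>I. ch (cc I J Y b i \<otimes> a i))"
    unfolding dot_def using V_closed[OF cc_closed[OF Y b]] c fin' by (intro ch_finsum) auto
  also have "\<dots> = (\<Prod>i\<in>I. \<Prod>j\<in>J. ch (Y (i, j) \<otimes> (a i \<otimes> b j)))"
  proof (intro prod.cong refl)
    fix i assume i: "i \<in> I"
    have "cc I J Y b i \<otimes> a i = (\<Oplus>j\<in>J. (Y (i, j) \<otimes> b j) \<otimes> a i)"
      unfolding cc_def using i c fin' by (simp, intro finsum_ldistr) auto
    also have "ch \<dots> = (\<Prod>j\<in>J. ch ((Y (i, j) \<otimes> b j) \<otimes> a i))"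
      using c i fin' by (intro ch_finsum) auto
    also have "\<dots> = (\<Prod>j\<in>J. ch (Y (i, j) \<otimes> (a i \<otimes> b j)))"
      using c i by (intro prod.cong refl) (simp add: m_ac)
    finally show "ch (cc I J Y b i \<otimes> a i) = (\<Prod>j\<in>J. ch (Y (i, j) \<otimes> (a i \<otimes> b j)))" .
  qed
  also have "\<dots> = (\<Prod>(i, j)\<in>I \<times> J. ch (Y (i, j) \<otimes> (a i \<otimes> b j)))"
    by (simp add: prod.cartesian_product)
  finally show "ch (dot (I \<times> J) Y (outer I J a b)) = ch (dot I (cc I J Y b) a)" using 0 by simp
qed

definition lker :: "'i set \<Rightarrow> 'j set \<Rightarrow> ('i \<times> 'j \<Rightarrow> 'a) \<Rightarrow> ('i \<Rightarrow> 'a) set" where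
  "lker I J Y = {a \<in> V I. rc I J Y a = vzero J}"

definition rker :: "'i set \<Rightarrow> 'j set \<Rightarrow> ('i \<times> 'j \<Rightarrow> 'a) \<Rightarrow> ('j \<Rightarrow> 'a) set" where
  "rker I J Y = {b \<in> V J. cc I J Y b = vzero I}"

text \<open>The kernel is the radical of the pairing \<open>ch (a Y b)\<close>, by
  \<open>dot_nondegenerate\<close>. Commutators are evaluated by this pairing, so the kernels
  describe what acts by scalars.\<close>

lemma lker_iff:
  assumes "finite I" "finite J" "Y \<in> V (I \<times> J)" "a \<in> V I"
  shows "a \<in> lker I J Y \<longleftrightarrow> (\<forall>b\<in>V J. ch (dot (I \<times> J) Y (outer I J a b)) = 1)"
proof
  assume "a \<in> lker I J Y"
  hence a: "rc I J Y a = vzero J" by (simp add: lker_def)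
  show "\<forall>b\<in>V J. ch (dot (I \<times> J) Y (outer I J a b)) = 1"
  proof
    fix b assume b: "b \<in> V J"
    show "ch (dot (I \<times> J) Y (outer I J a b)) = 1"
      unfolding ch_dot_outer(1)[OF assms b] a using dot_comm[OF V_zero b] dot_zero[OF b] ch_zero by simp
  qed
next
  assume *: "\<forall>b\<in>V J. ch (dot (I \<times> J) Y (outer I J a b)) = 1"
  have "rc I J Y a = vzero J"
    by (rule dot_nondegenerate[OF assms(2) rc_closed[OF assms(3,4)]]) (use * ch_dot_outer(1)[OF assms] in auto)
  thus "a \<in> lker I J Y" using assms by (simp add: lker_def)
qed

lemma rker_iff:
  assumes "finite I" "finite J" "Y \<in> V (I \<times> J)" "b \<in> V J"
  shows "b \<in> rker I J Y \<longleftrightarrow> (\<forall>a\<in>V I. ch (dot (I \<times> J) Y (outer I J a b)) = 1)"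
proof
  assume "b \<in> rker I J Y"
  hence b: "cc I J Y b = vzero I" by (simp add: rker_def)
  show "\<forall>a\<in>V I. ch (dot (I \<times> J) Y (outer I J a b)) = 1"
  proof
    fix a assume a: "a \<in> V I"
    show "ch (dot (I \<times> J) Y (outer I J a b)) = 1"
      unfolding ch_dot_outer(2)[OF assms(1-3) a assms(4)] b using dot_comm[OF V_zero a] dot_zero[OF a] ch_zero by simp
  qed
next
  assume *: "\<forall>a\<in>V I. ch (dot (I \<times> J) Y (outer I J a b)) = 1"
  have "cc I J Y b = vzero I"
    by (rule dot_nondegenerate[OF assms(1) cc_closed[OF assms(3,4)]])
      (use * ch_dot_outer(2)[OF assms(1-3) _ assms(4)] in auto)
  thus "b \<in> rker I J Y" using assms by (simp add: rker_def)
qed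

end

section \<open>The scalars of an irreducible representation\<close>

context irrep
begin

text \<open>If \<open>rho g\<close> is a scalar matrix, the corner entry is the scalar, and
  \<open>k > 0\<close> makes it exist. Elsewhere the value has no meaning.\<close>

definition sc :: "'g \<Rightarrow> complex" where "sc g = rho g $$ (0, 0)"

lemma scalar_elts_carrier: "g \<in> scalar_elts \<Longrightarrow> g \<in> carrier G"
  by (simp add: scalar_elts_def)

lemma sc_unique: "rho g = c \<cdot>\<^sub>m 1\<^sub>m k \<Longrightarrow> sc g = c"
  using k_pos by (simp add: sc_def)

lemma rho_scalar: "g \<in> scalar_elts \<Longrightarrow> rho g = sc g \<cdot>\<^sub>m 1\<^sub>m k"
  using sc_unique by (auto simp: scalar_elts_def)

lemma smult_one_mult: "(c \<cdot>\<^sub>m 1\<^sub>m k) * (d \<cdot>\<^sub>m 1\<^sub>m k) = (c * d) \<cdot>\<^sub>m (1\<^sub>m k :: complex mat)"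
  by (simp add: mult_smult_assoc_mat[of _ k k _ k] mult_smult_distrib[of _ k k _ k])
    (intro eq_matI, auto)

lemma scalar_elts_mult:
  assumes "g \<in> scalar_elts" "h \<in> scalar_elts"
  shows "g \<otimes> h \<in> scalar_elts" "sc (g \<otimes> h) = sc g * sc h"
proof -
  have e: "rho (g \<otimes> h) = (sc g * sc h) \<cdot>\<^sub>m 1\<^sub>m k"
    unfolding rho_mult[OF scalar_elts_carrier[OF assms(1)] scalar_elts_carrier[OF assms(2)]]
      rho_scalar[OF assms(1)] rho_scalar[OF assms(2)] by (rule smult_one_mult)
  thus "sc (g \<otimes> h) = sc g * sc h" by (rule sc_unique)
  show "g \<otimes> h \<in> scalar_elts" using e scalar_elts_carrier[OF assms(1)] scalar_elts_carrier[OF assms(2)]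
    by (auto simp: scalar_elts_def)
qed

lemma sc_one: "sc \<one> = 1"
  using rho_one k_pos by (simp add: sc_def)

lemma trace_scalar: "g \<in> scalar_elts \<Longrightarrow> mat_trace (rho g) = of_nat k * sc g"
  by (subst rho_scalar) (simp_all add: mat_trace_smult[of _ k] mat_trace_one mult.commute)

lemma scalar_if_central:
  assumes "g \<in> carrier G" "\<And>h. h \<in> carrier G \<Longrightarrow> g \<otimes> h = h \<otimes> g"
  shows "g \<in> scalar_elts"
  unfolding scalar_iff_commutes[OF assms(1)] using assms by (metis rho_mult)

lemma smult_rho_eq:
  assumes g: "g \<in> carrier G" and e: "c \<cdot>\<^sub>m rho g = rho g" shows "c = 1"
proof (rule ccontr)
  assume "c \<noteq> 1"
  have "rho g = 0\<^sub>m k k"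
  proof (rule eq_matI)
    fix i j assume ij: "i < dim_row (0\<^sub>m k k :: complex mat)" "j < dim_col (0\<^sub>m k k :: complex mat)"
    have "(c \<cdot>\<^sub>m rho g) $$ (i, j) = rho g $$ (i, j)" using e by simp
    thus "rho g $$ (i, j) = 0\<^sub>m k k $$ (i, j)" using ij g \<open>c \<noteq> 1\<close> by simp
  qed (use g in auto)
  moreover have "0\<^sub>m k k * rho (inv g) = 0\<^sub>m k k" using g by (simp add: left_mult_zero_mat[of _ k k])
  ultimately have "1\<^sub>m k = (0\<^sub>m k k :: complex mat)" using rho_inv[OF g] by simp
  hence "(1\<^sub>m k :: complex mat) $$ (0, 0) = 0\<^sub>m k k $$ (0, 0)" by simp
  thus False using k_pos by simp
qed

end

section \<open>The shape of the irreducible characters\<close>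

locale unipotent = gen_chain_ring +
  fixes m n :: nat
begin

abbreviation I :: "nat set" where "I \<equiv> {1..m}"
abbreviation J :: "nat set" where "J \<equiv> {1..n}"
abbreviation IJ :: "(nat \<times> nat) set" where "IJ \<equiv> I \<times> J"
abbreviation G where "G \<equiv> group_G m n R"
abbreviation lk :: "(nat \<times> nat \<Rightarrow> 'a) \<Rightarrow> (nat \<Rightarrow> 'a) set" where "lk Y \<equiv> lker I J Y"
text \<open>The name \<open>rk\<close> belongs to the count of matrices by rank, so the right kernel
  carries a prime.\<close>

abbreviation rk' :: "(nat \<times> nat \<Rightarrow> 'a) \<Rightarrow> (nat \<Rightarrow> 'a) set" where "rk' Y \<equiv> rker I J Y"
abbreviation lgroup where "lgroup Y \<equiv> vec_group R I\<lparr>carrier := lk Y\<rparr>"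
abbreviation rgroup where "rgroup Y \<equiv> vec_group R J\<lparr>carrier := rk' Y\<rparr>"

text \<open>As a function of \<open>c\<close>, the central character attached to
  \<open>Y\<close>.\<close>

definition Psi :: "(nat \<times> nat \<Rightarrow> 'a) \<Rightarrow> (nat \<times> nat \<Rightarrow> 'a) \<Rightarrow> complex" where
  "Psi Y c = ch (dot IJ Y c)"

lemma carrier_G: "carrier G = V I \<times> V J \<times> V IJ"
  by (simp add: group_G_def)

lemma mult_G: "(a, b, c) \<otimes>\<^bsub>G\<^esub> (a', b', c') =
    (vadd a I a', vadd b J b', vadd (vadd c IJ c') IJ (outer I J a b'))"
  by (auto simp: group_G_def outer_def intro!: restrict_ext)

lemma one_G: "\<one>\<^bsub>G\<^esub> = (vzero I, vzero J, vzero IJ)"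
  by (simp add: group_G_def)

lemma vadd_assoc: "u \<in> V A \<Longrightarrow> v \<in> V A \<Longrightarrow> w \<in> V A \<Longrightarrow> vadd (vadd u A v) A w = vadd u A (vadd v A w)"
  by (rule restrict_ext) (use V_closed[of u A] V_closed[of v A] V_closed[of w A] in \<open>simp add: a_assoc\<close>)

lemma vadd_comm: "u \<in> V A \<Longrightarrow> v \<in> V A \<Longrightarrow> vadd u A v = vadd v A u"
  by (rule restrict_ext) (use V_closed[of u A] V_closed[of v A] in \<open>simp add: a_comm\<close>)

lemma vadd_zero: "u \<in> V A \<Longrightarrow> vadd u A (vzero A) = u" "u \<in> V A \<Longrightarrow> vadd (vzero A) A u = u"
  by (rule extensionalityI[of _ A], use V_closed[of u A] in \<open>auto simp: PiE_def\<close>)+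

lemma vadd_neg: "u \<in> V A \<Longrightarrow> vadd (\<lambda>i\<in>A. \<ominus> u i) A u = vzero A"
  by (rule restrict_ext) (use V_closed[of u A] in \<open>simp add: l_neg\<close>)

lemma vneg: "u \<in> V A \<Longrightarrow> (\<lambda>i\<in>A. \<ominus> u i) \<in> V A" by auto

lemma vadd_cancel:
  assumes "u \<in> V A" "v \<in> V A" "w \<in> V A" "vadd u A w = vadd v A w" shows "u = v"
proof (rule extensionalityI[of _ A])
  fix i assume i: "i \<in> A"
  show "u i = v i" using fun_cong[OF assms(4), of i] i V_closed[OF assms(1) i] V_closed[OF assms(2) i] V_closed[OF assms(3) i]
    by simp
qed (use assms in \<open>auto simp: PiE_def\<close>)

lemma outer_zero: "b \<in> V J \<Longrightarrow> outer I J (vzero I) b = vzero IJ" "a \<in> V I \<Longrightarrow> outer I J a (vzero J) = vzero IJ"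
  unfolding outer_def by (rule restrict_ext, use V_closed[of b J] V_closed[of a I] in auto)+

lemma outer_add:
  "a \<in> V I \<Longrightarrow> a' \<in> V I \<Longrightarrow> b \<in> V J \<Longrightarrow> outer I J (vadd a I a') b = vadd (outer I J a b) IJ (outer I J a' b)"
  "a \<in> V I \<Longrightarrow> b \<in> V J \<Longrightarrow> b' \<in> V J \<Longrightarrow> outer I J a (vadd b J b') = vadd (outer I J a b) IJ (outer I J a b')"
  unfolding outer_def
  by (rule restrict_ext, use V_closed[of a I] V_closed[of a' I] V_closed[of b J] V_closed[of b' J] in \<open>auto simp: l_distr r_distr\<close>)+

lemma group_G: "group G"
proof (rule groupI)
  show "x \<otimes>\<^bsub>G\<^esub> y \<in> carrier G" if "x \<in> carrier G" "y \<in> carrier G" for x y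
  proof -
    obtain a b c a' b' c' where "x = (a, b, c)" "y = (a', b', c')" by (metis prod_cases3)
    thus ?thesis using that unfolding carrier_G by (simp only: mult_G mem_Sigma_iff) (intro conjI V_add outer_closed, simp_all only:)
  qed
  show "\<one>\<^bsub>G\<^esub> \<in> carrier G" unfolding carrier_G one_G by (intro SigmaI V_zero)
next
  fix x y z assume xyz: "x \<in> carrier G" "y \<in> carrier G" "z \<in> carrier G"
  obtain a b c a' b' c' a'' b'' c'' where e: "x = (a, b, c)" "y = (a', b', c')" "z = (a'', b'', c'')" by (metis prod_cases3)
  have V: "a \<in> V I" "a' \<in> V I" "a'' \<in> V I" "b \<in> V J" "b' \<in> V J" "b'' \<in> V J" "c \<in> V IJ" "c' \<in> V IJ" "c'' \<in> V IJ"
    using xyz unfolding e carrier_G by (simp_all only: mem_Sigma_iff)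
  have o: "outer I J a b' \<in> V IJ" "outer I J a b'' \<in> V IJ" "outer I J a' b'' \<in> V IJ" by (intro outer_closed V)+
  have "vadd (vadd (vadd (vadd c IJ c') IJ (outer I J a b')) IJ c'') IJ (outer I J (vadd a I a') b'') =
     vadd (vadd c IJ (vadd (vadd c' IJ c'') IJ (outer I J a' b''))) IJ (outer I J a (vadd b' J b''))"
    unfolding outer_add(1)[OF V(1,2,6)] outer_add(2)[OF V(1,5,6)]
    by (rule restrict_ext) (use V_closed[OF V(7)] V_closed[OF V(8)] V_closed[OF V(9)] V_closed[OF o(1)] V_closed[OF o(2)] V_closed[OF o(3)] in \<open>simp add: a_ac\<close>)
  thus "x \<otimes>\<^bsub>G\<^esub> y \<otimes>\<^bsub>G\<^esub> z = x \<otimes>\<^bsub>G\<^esub> (y \<otimes>\<^bsub>G\<^esub> z)"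
    unfolding e mult_G vadd_assoc[OF V(1,2,3)] vadd_assoc[OF V(4,5,6)] by (simp only:)
next
  fix x assume x: "x \<in> carrier G"
  obtain a b c where e: "x = (a, b, c)" by (metis prod_cases3)
  have V: "a \<in> V I" "b \<in> V J" "c \<in> V IJ" using x unfolding e carrier_G by (simp_all only: mem_Sigma_iff)
  show "\<one>\<^bsub>G\<^esub> \<otimes>\<^bsub>G\<^esub> x = x"
    unfolding e one_G mult_G outer_zero(1)[OF V(2)] vadd_zero(2)[OF V(1)] vadd_zero(2)[OF V(2)] vadd_zero(2)[OF V(3)] vadd_zero(1)[OF V(3)] ..
  \<comment> \<open>Negating the first two coordinates creates an outer product, which the third
    coordinate has to cancel along with \<open>c\<close>.\<close>
  define c' where "c' = (\<lambda>i\<in>IJ. \<ominus> (vadd c IJ (outer I J (\<lambda>i\<in>I. \<ominus> a i) b)) i)"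
  have o: "outer I J (\<lambda>i\<in>I. \<ominus> a i) b \<in> V IJ" by (rule outer_closed[OF vneg[OF V(1)] V(2)])
  have c': "c' \<in> V IJ" unfolding c'_def by (rule vneg[OF V_add[OF V(3) o]])
  have "vadd (vadd c' IJ c) IJ (outer I J (\<lambda>i\<in>I. \<ominus> a i) b) = vzero IJ"
    unfolding vadd_assoc[OF c' V(3) o] unfolding c'_def by (rule vadd_neg[OF V_add[OF V(3) o]])
  hence "((\<lambda>i\<in>I. \<ominus> a i), (\<lambda>i\<in>J. \<ominus> b i), c') \<otimes>\<^bsub>G\<^esub> x = \<one>\<^bsub>G\<^esub>"
    unfolding e one_G mult_G vadd_neg[OF V(1)] vadd_neg[OF V(2)] by simp
  moreover have "((\<lambda>i\<in>I. \<ominus> a i), (\<lambda>i\<in>J. \<ominus> b i), c') \<in> carrier G"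
    unfolding carrier_G by (intro SigmaI vneg V c')
  ultimately show "\<exists>y\<in>carrier G. y \<otimes>\<^bsub>G\<^esub> x = \<one>\<^bsub>G\<^esub>" by blast
qed

lemma finite_G: "finite (carrier G)"
  unfolding carrier_G by (intro finite_cartesian_product finite_V) auto

lemma Psi_add: "Y \<in> V IJ \<Longrightarrow> c \<in> V IJ \<Longrightarrow> c' \<in> V IJ \<Longrightarrow> Psi Y (vadd c IJ c') = Psi Y c * Psi Y c'"
  unfolding Psi_def by (simp only: dot_add ch_add dot_closed)

lemma Psi_zero: "Y \<in> V IJ \<Longrightarrow> Psi Y (vzero IJ) = 1"
  unfolding Psi_def by (simp only: dot_zero ch_zero)

lemma Psi_nonzero: "Y \<in> V IJ \<Longrightarrow> c \<in> V IJ \<Longrightarrow> Psi Y c \<noteq> 0"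
  unfolding Psi_def by (intro ch_nonzero dot_closed)

lemma lk_iff: "Y \<in> V IJ \<Longrightarrow> a \<in> V I \<Longrightarrow> a \<in> lk Y \<longleftrightarrow> (\<forall>b\<in>V J. Psi Y (outer I J a b) = 1)"
  unfolding Psi_def by (rule lker_iff) simp_all

lemma rk_iff: "Y \<in> V IJ \<Longrightarrow> b \<in> V J \<Longrightarrow> b \<in> rk' Y \<longleftrightarrow> (\<forall>a\<in>V I. Psi Y (outer I J a b) = 1)"
  unfolding Psi_def by (rule rker_iff) simp_all

lemma lk_V: "lk Y \<subseteq> V I" and rk_V: "rk' Y \<subseteq> V J"
  by (auto simp: lker_def rker_def)

lemma lk_subgroup: assumes Y: "Y \<in> V IJ" shows "subgroup (lk Y) (vec_group R I)"
proof -
  interpret v: comm_group "vec_group R I" by (rule comm_group_vec_group)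
  have z: "vzero I \<in> lk Y"
    unfolding lk_iff[OF Y V_zero] using outer_zero(1) Psi_zero[OF Y] by simp
  show ?thesis
  proof (rule v.subgroupI)
    show "lk Y \<subseteq> carrier (vec_group R I)" using lk_V by (simp add: vec_group_simps)
    show "lk Y \<noteq> {}" using z by blast
  next
    fix a assume a: "a \<in> lk Y"
    hence aV: "a \<in> V I" using lk_V by blast
    have iV: "inv\<^bsub>vec_group R I\<^esub> a \<in> V I" using v.inv_closed[of a] aV by (simp add: vec_group_simps)
    have e: "vadd (inv\<^bsub>vec_group R I\<^esub> a) I a = vzero I"
      using v.l_inv[of a] aV by (simp only: vec_group_simps)
    have "Psi Y (outer I J (inv\<^bsub>vec_group R I\<^esub> a) b) = 1" if b: "b \<in> V J" for b
    proof -
      have "Psi Y (outer I J (inv\<^bsub>vec_group R I\<^esub> a) b) * Psi Y (outer I J a b) = Psi Y (outer I J (vadd (inv\<^bsub>vec_group R I\<^esub> a) I a) b)"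
        unfolding outer_add(1)[OF iV aV b] by (rule Psi_add[symmetric]) (intro Y outer_closed iV aV b)+
      also have "\<dots> = 1" unfolding e outer_zero(1)[OF b] by (rule Psi_zero[OF Y])
      finally show ?thesis using a b lk_iff[OF Y aV] by simp
    qed
    thus "inv\<^bsub>vec_group R I\<^esub> a \<in> lk Y" using lk_iff[OF Y iV] by blast
  next
    fix a a' assume a: "a \<in> lk Y" "a' \<in> lk Y"
    hence aV: "a \<in> V I" "a' \<in> V I" using lk_V by blast+
    have "Psi Y (outer I J (vadd a I a') b) = 1" if b: "b \<in> V J" for b
      using a b lk_iff[OF Y aV(1)] lk_iff[OF Y aV(2)] outer_add(1)[OF aV b]
        Psi_add[OF Y outer_closed[OF aV(1) b] outer_closed[OF aV(2) b]] by simp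
    thus "a \<otimes>\<^bsub>vec_group R I\<^esub> a' \<in> lk Y" unfolding vec_group_simps lk_iff[OF Y V_add[OF aV]] by blast
  qed
qed

lemma rk_subgroup: assumes Y: "Y \<in> V IJ" shows "subgroup (rk' Y) (vec_group R J)"
proof -
  interpret v: comm_group "vec_group R J" by (rule comm_group_vec_group)
  have z: "vzero J \<in> rk' Y"
    unfolding rk_iff[OF Y V_zero] using outer_zero(2) Psi_zero[OF Y] by simp
  show ?thesis
  proof (rule v.subgroupI)
    show "rk' Y \<subseteq> carrier (vec_group R J)" using rk_V by (simp add: vec_group_simps)
    show "rk' Y \<noteq> {}" using z by blast
  next
    fix b assume b: "b \<in> rk' Y"
    hence bV: "b \<in> V J" using rk_V by blast
    have iV: "inv\<^bsub>vec_group R J\<^esub> b \<in> V J" using v.inv_closed[of b] bV by (simp add: vec_group_simps)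
    have e: "vadd (inv\<^bsub>vec_group R J\<^esub> b) J b = vzero J"
      using v.l_inv[of b] bV by (simp only: vec_group_simps)
    have "Psi Y (outer I J a (inv\<^bsub>vec_group R J\<^esub> b)) = 1" if a: "a \<in> V I" for a
    proof -
      have "Psi Y (outer I J a (inv\<^bsub>vec_group R J\<^esub> b)) * Psi Y (outer I J a b) = Psi Y (outer I J a (vadd (inv\<^bsub>vec_group R J\<^esub> b) J b))"
        unfolding outer_add(2)[OF a iV bV] by (rule Psi_add[symmetric]) (intro Y outer_closed iV bV a)+
      also have "\<dots> = 1" unfolding e outer_zero(2)[OF a] by (rule Psi_zero[OF Y])
      finally show ?thesis using a b rk_iff[OF Y bV] by simp
    qed
    thus "inv\<^bsub>vec_group R J\<^esub> b \<in> rk' Y" using rk_iff[OF Y iV] by blast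
  next
    fix b b' assume b: "b \<in> rk' Y" "b' \<in> rk' Y"
    hence bV: "b \<in> V J" "b' \<in> V J" using rk_V by blast+
    have "Psi Y (outer I J a (vadd b J b')) = 1" if a: "a \<in> V I" for a
      using a b rk_iff[OF Y bV(1)] rk_iff[OF Y bV(2)] outer_add(2)[OF a bV]
        Psi_add[OF Y outer_closed[OF a bV(1)] outer_closed[OF a bV(2)]] by simp
    thus "b \<otimes>\<^bsub>vec_group R J\<^esub> b' \<in> rk' Y" unfolding vec_group_simps rk_iff[OF Y V_add[OF bV]] by blast
  qed
qed

text \<open>A linear character of the scalar elements, multiplied by \<open>k\<close> and extended
  by zero.\<close>

definition Xi :: "(nat \<times> nat \<Rightarrow> 'a) \<Rightarrow> nat \<Rightarrow> ((nat \<Rightarrow> 'a) \<Rightarrow> complex) \<Rightarrow> ((nat \<Rightarrow> 'a) \<Rightarrow> complex) \<Rightarrow>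
    (nat \<Rightarrow> 'a) \<times> (nat \<Rightarrow> 'a) \<times> (nat \<times> nat \<Rightarrow> 'a) \<Rightarrow> complex" where
  "Xi Y k \<alpha> \<beta> = (\<lambda>g\<in>carrier G. case g of (a, b, c) \<Rightarrow>
      if a \<in> lk Y \<and> b \<in> rk' Y then of_nat k * (\<alpha> a * \<beta> b * Psi Y c) else 0)"

text \<open>The kernels of \<open>Y\<close> act by scalars because their commutators with the group lie in the kernel of the
  central character; elsewhere conjugation multiplies the trace by a nontrivial scalar.\<close>

lemma irr_form:
  assumes irr: "irreducible_rep G k rho"
  obtains Y \<alpha> \<beta> where "Y \<in> V IJ" "\<alpha> \<in> chars (lgroup Y)" "\<beta> \<in> chars (rgroup Y)"
    "k ^ 2 * (card (lk Y) * card (rk' Y)) = q ^ (N * (m + n))"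
    "\<And>c. c \<in> V IJ \<Longrightarrow> rho (vzero I, vzero J, c) = Psi Y c \<cdot>\<^sub>m 1\<^sub>m k"
    "\<And>a. a \<in> lk Y \<Longrightarrow> rho (a, vzero J, vzero IJ) = \<alpha> a \<cdot>\<^sub>m 1\<^sub>m k"
    "\<And>b. b \<in> rk' Y \<Longrightarrow> rho (vzero I, b, vzero IJ) = \<beta> b \<cdot>\<^sub>m 1\<^sub>m k"
    "(\<lambda>g\<in>carrier G. mat_trace (rho g)) = Xi Y k \<alpha> \<beta>"
proof -
  interpret G: group G by (rule group_G)
  interpret r: irrep G k rho by (unfold_locales) (rule irr)
  have GI: "(a, b, c) \<in> carrier G" if "a \<in> V I" "b \<in> V J" "c \<in> V IJ" for a b c
    unfolding carrier_G by (intro SigmaI that)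
  have central: "(vzero I, vzero J, c) \<in> r.scalar_elts" if c: "c \<in> V IJ" for c
  proof (rule r.scalar_if_central)
    show "(vzero I, vzero J, c) \<in> carrier G" by (intro GI V_zero c)
    fix h assume h: "h \<in> carrier G"
    obtain a' b' c' where e: "h = (a', b', c')" by (metis prod_cases3)
    have V: "a' \<in> V I" "b' \<in> V J" "c' \<in> V IJ" using h unfolding e carrier_G by (simp_all only: mem_Sigma_iff)
    show "(vzero I, vzero J, c) \<otimes>\<^bsub>G\<^esub> h = h \<otimes>\<^bsub>G\<^esub> (vzero I, vzero J, c)"
      unfolding e mult_G vadd_zero(1)[OF V(1)] vadd_zero(2)[OF V(1)] vadd_zero(1)[OF V(2)] vadd_zero(2)[OF V(2)]
        outer_zero(1)[OF V(2)] outer_zero(2)[OF V(1)] vadd_comm[OF c V(3)] ..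
  qed
  define \<theta> where "\<theta> = (\<lambda>c\<in>V IJ. r.sc (vzero I, vzero J, c))"
  have mz: "(vzero I, vzero J, c) \<otimes>\<^bsub>G\<^esub> (vzero I, vzero J, c') = (vzero I, vzero J, vadd c IJ c')" if "c \<in> V IJ" "c' \<in> V IJ" for c c'
    unfolding mult_G vadd_zero(1)[OF V_zero] outer_zero(1)[OF V_zero] vadd_zero(1)[OF V_add[OF that]] ..
  have "\<theta> \<in> chars (vec_group R IJ)"
  proof -
    have "\<theta> (vadd c IJ c') = \<theta> c * \<theta> c'" if c: "c \<in> V IJ" "c' \<in> V IJ" for c c'
      using r.scalar_elts_mult(2)[OF central[OF c(1)] central[OF c(2)]] c V_add[OF c]
      unfolding mz[OF c] \<theta>_def by (simp del: PiE_iff)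
    moreover have "\<theta> (vzero IJ) = 1" using r.sc_one V_zero[of IJ] unfolding one_G \<theta>_def by (simp del: PiE_iff)
    ultimately show ?thesis unfolding chars_def vec_group_simps \<theta>_def mem_Collect_eq
      by (intro conjI restrict_extensional ballI) blast+
  qed
  then obtain Y where Y: "Y \<in> V IJ" and th: "\<theta> = (\<lambda>c\<in>V IJ. ch (dot IJ Y c))" using char_eq_dot[of IJ] by auto
  have scz: "r.sc (vzero I, vzero J, c) = Psi Y c" if "c \<in> V IJ" for c
    using fun_cong[OF th, of c] that unfolding \<theta>_def Psi_def by (simp del: PiE_iff)
  have rz: "rho (vzero I, vzero J, c) = Psi Y c \<cdot>\<^sub>m 1\<^sub>m k" if "c \<in> V IJ" for c
    using r.rho_scalar[OF central[OF that]] unfolding scz[OF that] .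
  have comm: "\<exists>d\<in>V IJ. Psi Y d * Psi Y (outer I J a' b) = Psi Y (outer I J a b') \<and>
      rho (a, b, c) * rho (a', b', c') = Psi Y d \<cdot>\<^sub>m (rho (a', b', c') * rho (a, b, c))"
    if V: "a \<in> V I" "b \<in> V J" "c \<in> V IJ" "a' \<in> V I" "b' \<in> V J" "c' \<in> V IJ" for a b c a' b' c'
  proof -
    have o: "outer I J a b' \<in> V IJ" "outer I J a' b \<in> V IJ" by (intro outer_closed V)+
    \<comment> \<open>\<open>(vzero I, vzero J, d)\<close> is the commutator of the two elements:
      only the outer products fail to be symmetric.\<close>
    define d where "d = vadd (outer I J a b') IJ (\<lambda>i\<in>IJ. \<ominus> outer I J a' b i)"
    have d: "d \<in> V IJ" unfolding d_def by (intro V_add vneg o)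
    have do: "vadd d IJ (outer I J a' b) = outer I J a b'"
      unfolding d_def vadd_assoc[OF o(1) vneg[OF o(2)] o(2)] vadd_neg[OF o(2)] by (rule vadd_zero(1)[OF o(1)])
    let ?g = "(a, b, c)" and ?h = "(a', b', c')" and ?z = "(vzero I, vzero J, d)"
    have G: "?g \<in> carrier G" "?h \<in> carrier G" "?z \<in> carrier G" by (intro GI V d V_zero)+
    have vc: "vadd (vadd c' IJ c) IJ (outer I J a' b) \<in> V IJ" by (intro V_add V o)
    have "vadd d IJ (vadd (vadd c' IJ c) IJ (outer I J a' b)) = vadd (vadd c IJ c') IJ (outer I J a b')"
      unfolding do[symmetric] by (rule restrict_ext)
        (use V_closed[OF V(3)] V_closed[OF V(6)] V_closed[OF d] V_closed[OF o(2)] in \<open>simp add: a_ac\<close>)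
    hence "?g \<otimes>\<^bsub>G\<^esub> ?h = ?z \<otimes>\<^bsub>G\<^esub> (?h \<otimes>\<^bsub>G\<^esub> ?g)"
      unfolding mult_G vadd_zero(2)[OF V_add[OF V(4,1)]] vadd_zero(2)[OF V_add[OF V(5,2)]]
        outer_zero(1)[OF V_add[OF V(5,2)]] vadd_zero(1)[OF V_add[OF d vc]]
      using vadd_comm[OF V(1,4)] vadd_comm[OF V(2,5)] by simp
    hence "rho ?g * rho ?h = rho ?z * (rho ?h * rho ?g)"
      using G by (simp only: r.rho_mult[symmetric] G.m_closed)
    also have "\<dots> = Psi Y d \<cdot>\<^sub>m (rho ?h * rho ?g)"
      unfolding rz[OF d] using G r.rho_closed
      by (subst mult_smult_assoc_mat[of _ k k _ k]) (auto simp: mult_carrier_mat[of _ k k])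
    finally have "rho ?g * rho ?h = Psi Y d \<cdot>\<^sub>m (rho ?h * rho ?g)" .
    moreover have "Psi Y d * Psi Y (outer I J a' b) = Psi Y (outer I J a b')"
      unfolding Psi_add[OF Y d o(2), symmetric] do ..
    ultimately show ?thesis by (intro bexI[OF _ d] conjI)
  qed
  have commute_iff: "rho (a, b, c) * rho (a', b', c') = rho (a', b', c') * rho (a, b, c) \<longleftrightarrow>
      Psi Y (outer I J a b') = Psi Y (outer I J a' b)"
    if V: "a \<in> V I" "b \<in> V J" "c \<in> V IJ" "a' \<in> V I" "b' \<in> V J" "c' \<in> V IJ" for a b c a' b' c'
  proof -
    obtain d where d: "d \<in> V IJ" "Psi Y d * Psi Y (outer I J a' b) = Psi Y (outer I J a b')"
      "rho (a, b, c) * rho (a', b', c') = Psi Y d \<cdot>\<^sub>m (rho (a', b', c') * rho (a, b, c))" using comm[OF V] by blast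
    have G: "(a, b, c) \<in> carrier G" "(a', b', c') \<in> carrier G" by (intro GI V)+
    have m: "rho (a', b', c') * rho (a, b, c) = rho ((a', b', c') \<otimes>\<^bsub>G\<^esub> (a, b, c))" using G by (simp only: r.rho_mult)
    have "Psi Y d = 1 \<longleftrightarrow> Psi Y (outer I J a b') = Psi Y (outer I J a' b)"
      using d(2) Psi_nonzero[OF Y outer_closed[OF V(4,2)]] by auto
    moreover have "rho (a, b, c) * rho (a', b', c') = rho (a', b', c') * rho (a, b, c) \<longleftrightarrow> Psi Y d = 1"
    proof
      assume "rho (a, b, c) * rho (a', b', c') = rho (a', b', c') * rho (a, b, c)"
      thus "Psi Y d = 1" using d(3) unfolding m by (intro r.smult_rho_eq[OF G.m_closed[OF G(2,1)]]) simp
    next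
      assume "Psi Y d = 1"
      thus "rho (a, b, c) * rho (a', b', c') = rho (a', b', c') * rho (a, b, c)" unfolding d(3) by (intro eq_matI) auto
    qed
    ultimately show ?thesis by simp
  qed
  have scalar: "r.scalar_elts = lk Y \<times> rk' Y \<times> V IJ"
  proof (rule Set.set_eqI)
    fix g :: "(nat \<Rightarrow> 'a) \<times> (nat \<Rightarrow> 'a) \<times> (nat \<times> nat \<Rightarrow> 'a)"
    obtain a b c where e: "g = (a, b, c)" by (metis prod_cases3)
    show "g \<in> r.scalar_elts \<longleftrightarrow> g \<in> lk Y \<times> rk' Y \<times> V IJ"
    proof
      assume g: "g \<in> r.scalar_elts"
      hence gc: "g \<in> carrier G" by (rule r.scalar_elts_carrier)
      hence V: "a \<in> V I" "b \<in> V J" "c \<in> V IJ" unfolding e carrier_G by (simp_all only: mem_Sigma_iff)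
      \<comment> \<open>The equation for all \<open>a'\<close> and \<open>b'\<close> splits:
        \<open>a' = 0\<close> puts \<open>a\<close> into the left kernel and \<open>b' = 0\<close>
        puts \<open>b\<close> into the right one.\<close>
      have *: "Psi Y (outer I J a b') = Psi Y (outer I J a' b)" if ab: "a' \<in> V I" "b' \<in> V J" for a' b'
      proof -
        have "rho (a, b, c) * rho (a', b', vzero IJ) = rho (a', b', vzero IJ) * rho (a, b, c)"
          using g r.scalar_iff_commutes[OF gc] GI[OF ab V_zero] unfolding e by blast
        thus ?thesis using commute_iff[OF V ab V_zero] by blast
      qed
      have "a \<in> lk Y" unfolding lk_iff[OF Y V(1)] using *[OF V_zero] outer_zero(1)[OF V(2)] Psi_zero[OF Y] by simp
      moreover have "b \<in> rk' Y" unfolding rk_iff[OF Y V(2)] using *[OF _ V_zero] outer_zero(2)[OF V(1)] Psi_zero[OF Y] by simp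
      ultimately show "g \<in> lk Y \<times> rk' Y \<times> V IJ" using V e by blast
    next
      assume "g \<in> lk Y \<times> rk' Y \<times> V IJ"
      hence ab: "a \<in> lk Y" "b \<in> rk' Y" and V: "a \<in> V I" "b \<in> V J" "c \<in> V IJ" unfolding e using lk_V rk_V by blast+
      have gc: "g \<in> carrier G" unfolding e by (rule GI[OF V])
      show "g \<in> r.scalar_elts"
        unfolding r.scalar_iff_commutes[OF gc]
      proof
        fix h assume h: "h \<in> carrier G"
        obtain a' b' c' where eh: "h = (a', b', c')" by (metis prod_cases3)
        have V': "a' \<in> V I" "b' \<in> V J" "c' \<in> V IJ" using h unfolding eh carrier_G by (simp_all only: mem_Sigma_iff)
        have "Psi Y (outer I J a b') = Psi Y (outer I J a' b)"
          using ab lk_iff[OF Y V(1)] rk_iff[OF Y V(2)] V' by simp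
        thus "rho g * rho h = rho h * rho g" unfolding e eh using commute_iff[OF V V'] by blast
      qed
    qed
  qed
  have comm': "\<exists>c. rho g * rho h = c \<cdot>\<^sub>m (rho h * rho g)" if "g \<in> carrier G" "h \<in> carrier G" for g h
  proof -
    obtain a b c a' b' c' where e: "g = (a, b, c)" "h = (a', b', c')" by (metis prod_cases3)
    show ?thesis using that comm[of a b c a' b' c'] unfolding e carrier_G by blast
  qed
  have cards: "k ^ 2 * (card (lk Y) * card (rk' Y)) = q ^ (N * (m + n))"
  proof -
    have pos: "card (V IJ) > 0" using finite_V[of IJ] V_zero[of IJ] by (metis card_gt_0_iff empty_iff finite_SigmaI finite_atLeastAtMost)
    have "k ^ 2 * card r.scalar_elts = card (carrier G)" by (rule r.degree_sqr[OF finite_G comm'])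
    hence "k ^ 2 * (card (lk Y) * (card (rk' Y) * card (V IJ))) = card (V I) * (card (V J) * card (V IJ))"
      unfolding scalar carrier_G card_cartesian_product .
    hence "(k ^ 2 * (card (lk Y) * card (rk' Y))) * card (V IJ) = (card (V I) * card (V J)) * card (V IJ)"
      by (simp only: mult_ac)
    hence "k ^ 2 * (card (lk Y) * card (rk' Y)) = card (V I) * card (V J)" using pos by (metis mult_right_cancel neq0_conv)
    also have "\<dots> = q ^ (N * (m + n))" 
      by (simp only: card_V[OF finite_atLeastAtMost] card_atLeastAtMost diff_Suc_1 power_add distrib_left)
    finally show ?thesis .
  qed
  define \<alpha> where "\<alpha> = (\<lambda>a\<in>lk Y. r.sc (a, vzero J, vzero IJ))"
  define \<beta> where "\<beta> = (\<lambda>b\<in>rk' Y. r.sc (vzero I, b, vzero IJ))"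
  have z: "vzero I \<in> lk Y" "vzero J \<in> rk' Y"
    using subgroup.one_closed[OF lk_subgroup[OF Y]] subgroup.one_closed[OF rk_subgroup[OF Y]] by (simp_all only: vec_group_simps)
  have sa: "(a, vzero J, vzero IJ) \<in> r.scalar_elts" if "a \<in> lk Y" for a unfolding scalar by (intro SigmaI that z V_zero)
  have sb: "(vzero I, b, vzero IJ) \<in> r.scalar_elts" if "b \<in> rk' Y" for b unfolding scalar by (intro SigmaI that z V_zero)
  have ma: "(a, vzero J, vzero IJ) \<otimes>\<^bsub>G\<^esub> (a', vzero J, vzero IJ) = (vadd a I a', vzero J, vzero IJ)" if "a \<in> V I" "a' \<in> V I" for a a'
    unfolding mult_G vadd_zero(1)[OF V_zero] outer_zero(2)[OF that(1)] ..
  have mb: "(vzero I, b, vzero IJ) \<otimes>\<^bsub>G\<^esub> (vzero I, b', vzero IJ) = (vzero I, vadd b J b', vzero IJ)" if "b \<in> V J" "b' \<in> V J" for b b'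
    unfolding mult_G vadd_zero(1)[OF V_zero] outer_zero(1)[OF that(2)] ..
  have \<alpha>: "\<alpha> \<in> chars (lgroup Y)"
  proof -
    have "\<alpha> (vadd a I a') = \<alpha> a * \<alpha> a'" if a: "a \<in> lk Y" "a' \<in> lk Y" for a a'
    proof -
      have "vadd a I a' \<in> lk Y" using subgroup.m_closed[OF lk_subgroup[OF Y] a] by (simp only: vec_group_simps)
      moreover have "r.sc (vadd a I a', vzero J, vzero IJ) = r.sc (a, vzero J, vzero IJ) * r.sc (a', vzero J, vzero IJ)"
        using r.scalar_elts_mult(2)[OF sa[OF a(1)] sa[OF a(2)]]
        unfolding ma[OF subsetD[OF lk_V a(1)] subsetD[OF lk_V a(2)]] .
      ultimately show ?thesis unfolding \<alpha>_def using a by (simp only: restrict_apply')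
    qed
    moreover have "\<alpha> (vzero I) = 1" using r.sc_one z unfolding one_G \<alpha>_def by (simp del: PiE_iff)
    ultimately show ?thesis unfolding chars_def mem_Collect_eq
      by (auto simp: vec_group_def \<alpha>_def simp del: PiE_iff)
  qed
  have \<beta>: "\<beta> \<in> chars (rgroup Y)"
  proof -
    have "\<beta> (vadd b J b') = \<beta> b * \<beta> b'" if b: "b \<in> rk' Y" "b' \<in> rk' Y" for b b'
    proof -
      have "vadd b J b' \<in> rk' Y" using subgroup.m_closed[OF rk_subgroup[OF Y] b] by (simp only: vec_group_simps)
      moreover have "r.sc (vzero I, vadd b J b', vzero IJ) = r.sc (vzero I, b, vzero IJ) * r.sc (vzero I, b', vzero IJ)"
        using r.scalar_elts_mult(2)[OF sb[OF b(1)] sb[OF b(2)]]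
        unfolding mb[OF subsetD[OF rk_V b(1)] subsetD[OF rk_V b(2)]] .
      ultimately show ?thesis unfolding \<beta>_def using b by (simp only: restrict_apply')
    qed
    moreover have "\<beta> (vzero J) = 1" using r.sc_one z unfolding one_G \<beta>_def by (simp del: PiE_iff)
    ultimately show ?thesis unfolding chars_def mem_Collect_eq
      by (auto simp: vec_group_def \<beta>_def simp del: PiE_iff)
  qed
  have tr: "(\<lambda>g\<in>carrier G. mat_trace (rho g)) = Xi Y k \<alpha> \<beta>"
    unfolding Xi_def
  proof (rule restrict_ext)
    fix g assume g: "g \<in> carrier G"
    obtain a b c where e: "g = (a, b, c)" by (metis prod_cases3)
    have V: "a \<in> V I" "b \<in> V J" "c \<in> V IJ" using g unfolding e carrier_G by (simp_all only: mem_Sigma_iff)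
    show "mat_trace (rho g) = (case g of (a, b, c) \<Rightarrow> if a \<in> lk Y \<and> b \<in> rk' Y then of_nat k * (\<alpha> a * \<beta> b * Psi Y c) else 0)"
    proof (cases "a \<in> lk Y \<and> b \<in> rk' Y")
      case True
      \<comment> \<open>The order matters: with \<open>b\<close> on the left no outer product
        arises, whereas \<open>a\<close> on the left would add one to the third coordinate.\<close>
      have "(vzero I, b, vzero IJ) \<otimes>\<^bsub>G\<^esub> ((a, vzero J, vzero IJ) \<otimes>\<^bsub>G\<^esub> (vzero I, vzero J, c)) = g"
        unfolding e mult_G vadd_zero(1)[OF V(1)] vadd_zero(2)[OF V(1)] vadd_zero(1)[OF V(2)] vadd_zero(1)[OF V_zero]
          vadd_zero(2)[OF V(3)] outer_zero(2)[OF V(1)] outer_zero(2)[OF V_zero] vadd_zero(1)[OF V(3)] vadd_zero(2)[OF V(3)] ..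
      hence "r.sc g = r.sc (vzero I, b, vzero IJ) * (r.sc (a, vzero J, vzero IJ) * r.sc (vzero I, vzero J, c))"
        using True sa sb central[OF V(3)] r.scalar_elts_mult by metis
      also have "\<dots> = \<alpha> a * \<beta> b * Psi Y c" using True scz[OF V(3)] by (simp add: \<alpha>_def \<beta>_def)
      finally show ?thesis using r.trace_scalar[of g] True V scalar e by simp
    next
      case False
      hence "g \<notin> r.scalar_elts" unfolding scalar e by blast
      hence "mat_trace (rho g) = 0" using r.trace_zero[OF g _ comm'[OF g]] by blast
      thus ?thesis unfolding e prod.case if_not_P[OF False] .
    qed
  qed
  show ?thesis
  proof (rule that[OF Y \<alpha> \<beta> cards rz _ _ tr])
    show "rho (a, vzero J, vzero IJ) = \<alpha> a \<cdot>\<^sub>m 1\<^sub>m k" if "a \<in> lk Y" for a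
      using r.rho_scalar[OF sa[OF that]] that by (simp add: \<alpha>_def)
    show "rho (vzero I, b, vzero IJ) = \<beta> b \<cdot>\<^sub>m 1\<^sub>m k" if "b \<in> rk' Y" for b
      using r.rho_scalar[OF sb[OF that]] that by (simp add: \<beta>_def)
  qed
qed

end

section \<open>Construction of the irreducible representations\<close>

lemma vec_family_sum:
  fixes U :: "complex vec set"
  assumes zero: "0\<^sub>v k \<in> U" and add: "\<And>v w. v \<in> U \<Longrightarrow> w \<in> U \<Longrightarrow> v + w \<in> U" and sub: "U \<subseteq> carrier_vec k"
    and B: "finite B" and f: "\<And>b. b \<in> B \<Longrightarrow> f b \<in> U"
  shows "\<exists>u\<in>U. \<forall>x<k. vec_index u x = (\<Sum>b\<in>B. vec_index (f b) x)"
  using B f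
proof (induction B rule: finite_induct)
  case empty
  thus ?case using zero by (intro bexI[of _ "0\<^sub>v k"]) auto
next
  case (insert b B)
  then obtain u where u: "u \<in> U" "\<forall>x<k. vec_index u x = (\<Sum>b\<in>B. vec_index (f b) x)" by auto
  have fb: "f b \<in> U" using insert.prems by simp
  have "vec_index (f b + u) x = (\<Sum>b\<in>insert b B. vec_index (f b) x)" if "x < k" for x
  proof -
    have "u \<in> carrier_vec k" using u(1) sub by blast
    hence "vec_index (f b + u) x = vec_index (f b) x + vec_index u x" using that by simp
    thus ?thesis using u(2) that insert.hyps by simp
  qed
  thus ?case using add[OF fb u(1)] by blast
qed

context unipotent
begin

lemma group_cong_chars_I: "\<alpha> \<in> chars (vec_group R I) \<Longrightarrow> a \<in> V I \<Longrightarrow> a' \<in> V I \<Longrightarrow> \<alpha> (vadd a I a') = \<alpha> a * \<alpha> a'"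
  using charsD(3)[of \<alpha> "vec_group R I" a a'] by (simp only: vec_group_simps)

lemma group_cong_chars_J: "\<beta> \<in> chars (vec_group R J) \<Longrightarrow> b \<in> V J \<Longrightarrow> b' \<in> V J \<Longrightarrow> \<beta> (vadd b J b') = \<beta> b * \<beta> b'"
  using charsD(3)[of \<beta> "vec_group R J" b b'] by (simp only: vec_group_simps)

lemma chars_zero_I: "\<alpha> \<in> chars (vec_group R I) \<Longrightarrow> \<alpha> (vzero I) = 1"
  using charsD(2)[of \<alpha> "vec_group R I"] by (simp only: vec_group_simps)

lemma chars_zero_J: "\<beta> \<in> chars (vec_group R J) \<Longrightarrow> \<beta> (vzero J) = 1"
  using charsD(2)[of \<beta> "vec_group R J"] by (simp only: vec_group_simps)

lemma rc_V: "Y \<in> V IJ \<Longrightarrow> a \<in> V I \<Longrightarrow> rc I J Y a \<in> V J"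
  by (rule rc_closed)

lemma rc_zero: assumes Y: "Y \<in> V IJ" shows "rc I J Y (vzero I) = vzero J"
proof (rule vadd_cancel[OF rc_V[OF Y V_zero] V_zero rc_V[OF Y V_zero]])
  have "rc I J Y (vzero I) = rc I J Y (vadd (vzero I) I (vzero I))" unfolding vadd_zero(1)[OF V_zero] ..
  thus "vadd (rc I J Y (vzero I)) J (rc I J Y (vzero I)) = vadd (vzero J) J (rc I J Y (vzero I))"
    unfolding rc_add[OF Y V_zero V_zero] vadd_zero(2)[OF rc_V[OF Y V_zero]] by (rule sym)
qed

lemma ch_dot_add_l: "u \<in> V J \<Longrightarrow> v \<in> V J \<Longrightarrow> b \<in> V J \<Longrightarrow> ch (dot J (vadd u J v) b) = ch (dot J u b) * ch (dot J v b)"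
  unfolding dot_comm[OF V_add[of u J v], of b] dot_add[of b J u v] dot_comm[of u J b] dot_comm[of v J b]
  by (intro ch_add dot_closed)

lemma ch_dot_add_r: "u \<in> V J \<Longrightarrow> b \<in> V J \<Longrightarrow> b' \<in> V J \<Longrightarrow> ch (dot J u (vadd b J b')) = ch (dot J u b) * ch (dot J u b')"
  unfolding dot_add[of u J b b'] by (intro ch_add dot_closed)

lemma ch_dot_zero_r: "u \<in> V J \<Longrightarrow> ch (dot J u (vzero J)) = 1"
  by (simp only: dot_zero ch_zero)

lemma ch_dot_rc: "Y \<in> V IJ \<Longrightarrow> a \<in> V I \<Longrightarrow> b \<in> V J \<Longrightarrow> ch (dot J (rc I J Y a) b) = Psi Y (outer I J a b)"
  unfolding Psi_def by (rule ch_dot_outer(1)[symmetric]) simp_all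

text \<open>The representation space consists of the functions on the row span of \<open>Y\<close>: up to scalars, \<open>a\<close>
  translates by the corresponding combination of rows, and \<open>b\<close> multiplies by the character
  that it defines on the row span.\<close>

lemma irr_exists:
  assumes Y: "Y \<in> V IJ" and \<alpha>: "\<alpha> \<in> chars (vec_group R I)" and \<beta>: "\<beta> \<in> chars (vec_group R J)"
  defines "k \<equiv> card (row_span I J Y)"
  shows "\<exists>rho. irreducible_rep G k rho \<and> (\<forall>c\<in>V IJ. rho (vzero I, vzero J, c) = Psi Y c \<cdot>\<^sub>m 1\<^sub>m k) \<and>
     (\<forall>a\<in>lk Y. rho (a, vzero J, vzero IJ) = \<alpha> a \<cdot>\<^sub>m 1\<^sub>m k) \<and>
     (\<forall>b\<in>rk' Y. rho (vzero I, b, vzero IJ) = \<beta> b \<cdot>\<^sub>m 1\<^sub>m k)"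
proof -
  interpret G: group G by (rule group_G)
  let ?W = "row_span I J Y"
  let ?rc = "rc I J Y"
  have W: "?W = ?rc ` V I" by (rule row_span_rc)
  have finW: "finite ?W" unfolding W by (intro finite_imageI finite_V) simp
  \<comment> \<open>\<open>e\<close> numbers the row span, so that functions on it become vectors of
    length \<open>k\<close>.\<close>
  obtain e where e: "bij_betw e {0..<k} ?W" using ex_bij_betw_nat_finite[OF finW] k_def by blast
  have eW: "x < k \<Longrightarrow> e x \<in> ?W" for x using bij_betwE[OF e] by simp
  have eV: "e x \<in> V J" if xk: "x < k" for x
  proof -
    obtain a where "a \<in> V I" "e x = ?rc a" using eW[OF xk] unfolding W by blast
    thus ?thesis using rc_V[OF Y] by simp
  qed
  have e_inj: "x < k \<Longrightarrow> y < k \<Longrightarrow> e x = e y \<Longrightarrow> x = y" for x y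
    using bij_betw_imp_inj_on[OF e] by (auto dest: inj_onD)
  have e_surj: "\<exists>x<k. e x = w" if "w \<in> ?W" for w
  proof -
    have "w \<in> e ` {0..<k}" using bij_betw_imp_surj_on[OF e] that by simp
    thus ?thesis by auto
  qed
  have W_add: "vadd w J (?rc a) \<in> ?W" if wa: "w \<in> ?W" "a \<in> V I" for w a
  proof -
    obtain a' where a': "a' \<in> V I" "w = ?rc a'" using wa(1) unfolding W by blast
    have "vadd w J (?rc a) = ?rc (vadd a' I a)" unfolding a'(2) by (rule rc_add[OF Y a'(1) wa(2), symmetric])
    thus ?thesis unfolding W using V_add[OF a'(1) wa(2)] by blast
  qed
  have k0: "k > 0"
  proof -
    have "?rc (vzero I) \<in> ?W" unfolding W by (rule imageI[OF V_zero])
    thus ?thesis unfolding k_def using finW card_gt_0_iff by blast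
  qed
  define s where "s = (\<lambda>a b c u. \<alpha> a * \<beta> b * Psi Y c * ch (dot J u b))"
  define rho where "rho = (\<lambda>(a, b, c). mat k k (\<lambda>(x, y). if e y = vadd (e x) J (?rc a) then s a b c (e x) else 0))"
  have rho_entry: "rho (a, b, c) $$ (x, y) = (if e y = vadd (e x) J (?rc a) then s a b c (e x) else 0)"
    if "x < k" "y < k" for a b c x y using that by (simp add: rho_def)
  have rho_carrier: "rho g \<in> carrier_mat k k" for g by (cases g) (simp add: rho_def)
  have rd: "dim_row (rho g) = k" "dim_col (rho g) = k" for g using carrier_matD[OF rho_carrier[of g]] by simp_all
  have rho_row: "\<exists>z0<k. (\<forall>z<k. e z = vadd (e x) J (?rc a) \<longleftrightarrow> z = z0) \<and> e z0 = vadd (e x) J (?rc a)"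
    if xa: "x < k" "a \<in> V I" for x a
  proof -
    obtain z0 where z0: "z0 < k" "e z0 = vadd (e x) J (?rc a)" using e_surj[OF W_add[OF eW[OF xa(1)] xa(2)]] by blast
    thus ?thesis using e_inj by metis
  qed
  have mult: "rho ((a, b, c) \<otimes>\<^bsub>G\<^esub> (a', b', c')) = rho (a, b, c) * rho (a', b', c')"
    if V: "a \<in> V I" "b \<in> V J" "c \<in> V IJ" "a' \<in> V I" "b' \<in> V J" "c' \<in> V IJ" for a b c a' b' c'
  proof (rule eq_matI)
    fix x y assume "x < dim_row (rho (a, b, c) * rho (a', b', c'))" "y < dim_col (rho (a, b, c) * rho (a', b', c'))"
    hence xy: "x < k" "y < k" using rho_carrier[of "(a, b, c)"] rho_carrier[of "(a', b', c')"] by auto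
    obtain z0 where z0: "z0 < k" "\<And>z. z < k \<Longrightarrow> e z = vadd (e x) J (?rc a) \<longleftrightarrow> z = z0" "e z0 = vadd (e x) J (?rc a)"
      using rho_row[OF xy(1) V(1)] by blast
    have "(rho (a, b, c) * rho (a', b', c')) $$ (x, y) = (\<Sum>z<k. rho (a, b, c) $$ (x, z) * rho (a', b', c') $$ (z, y))"
      using xy rho_carrier[of "(a, b, c)"] rho_carrier[of "(a', b', c')"] by (simp add: scalar_prod_def lessThan_atLeast0)
    also have "\<dots> = (\<Sum>z<k. if z = z0 then s a b c (e x) * rho (a', b', c') $$ (z, y) else 0)"
      using xy z0(2) by (intro sum.cong refl) (simp add: rho_entry)
    also have "\<dots> = s a b c (e x) * rho (a', b', c') $$ (z0, y)" using z0(1) by simp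
    also have "\<dots> = (if e y = vadd (e z0) J (?rc a') then s a b c (e x) * s a' b' c' (e z0) else 0)"
      unfolding rho_entry[OF z0(1) xy(2)] by simp
    also have "vadd (e z0) J (?rc a') = vadd (e x) J (?rc (vadd a I a'))"
      unfolding z0(3) rc_add[OF Y V(1,4)] by (rule vadd_assoc) (intro eV xy rc_V Y V)+
    \<comment> \<open>The base point of the second factor is moved by \<open>?rc a\<close>, and the
      resulting \<open>ch (dot J (?rc a) b')\<close> equals \<open>Psi Y (outer I J a b')\<close>,
      the correction in the group law.\<close>
    also have "s a b c (e x) * s a' b' c' (e z0) = s (vadd a I a') (vadd b J b') (vadd (vadd c IJ c') IJ (outer I J a b')) (e x)"
      unfolding s_def z0(3) group_cong_chars_I[OF \<alpha> V(1,4)] group_cong_chars_J[OF \<beta> V(2,5)]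
        Psi_add[OF Y V_add[OF V(3,6)] outer_closed[OF V(1,5)]] Psi_add[OF Y V(3,6)]
        ch_dot_add_l[OF eV[OF xy(1)] rc_V[OF Y V(1)] V(5)] ch_dot_add_r[OF eV[OF xy(1)] V(2,5)] ch_dot_rc[OF Y V(1,5)]
      by (simp only: mult_ac)
    finally have fin: "(rho (a, b, c) * rho (a', b', c')) $$ (x, y) = (if e y = vadd (e x) J (?rc (vadd a I a')) then
      s (vadd a I a') (vadd b J b') (vadd (vadd c IJ c') IJ (outer I J a b')) (e x) else 0)" .
    show "rho ((a, b, c) \<otimes>\<^bsub>G\<^esub> (a', b', c')) $$ (x, y) = (rho (a, b, c) * rho (a', b', c')) $$ (x, y)"
      unfolding mult_G rho_entry[OF xy] by (rule fin[symmetric])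
  qed (simp_all add: rd)
  have one: "rho \<one>\<^bsub>G\<^esub> = 1\<^sub>m k"
  proof (rule eq_matI)
    fix x y assume "x < dim_row (1\<^sub>m k :: complex mat)" "y < dim_col (1\<^sub>m k :: complex mat)"
    hence xy: "x < k" "y < k" by auto
    have "s (vzero I) (vzero J) (vzero IJ) (e x) = 1"
      unfolding s_def chars_zero_I[OF \<alpha>] chars_zero_J[OF \<beta>] Psi_zero[OF Y] ch_dot_zero_r[OF eV[OF xy(1)]] by simp
    thus "rho \<one>\<^bsub>G\<^esub> $$ (x, y) = 1\<^sub>m k $$ (x, y)"
      unfolding one_G rho_entry[OF xy] rc_zero[OF Y] vadd_zero(1)[OF eV[OF xy(1)]] using xy e_inj[of x y] by auto
  qed (simp_all add: rd)
  have mult': "rho (g \<otimes>\<^bsub>G\<^esub> h) = rho g * rho h" if "g \<in> carrier G" "h \<in> carrier G" for g h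
  proof -
    obtain a b c a' b' c' where eq: "g = (a, b, c)" "h = (a', b', c')" by (metis prod_cases3)
    show ?thesis using that unfolding eq carrier_G mem_Sigma_iff by (intro mult) simp_all
  qed
  have hom: "rho \<in> hom G (GL k)"
  proof (rule homI)
    fix g assume g: "g \<in> carrier G"
    have "rho (inv\<^bsub>G\<^esub> g) * rho g = 1\<^sub>m k" "rho g * rho (inv\<^bsub>G\<^esub> g) = 1\<^sub>m k"
      using mult'[OF G.inv_closed[OF g] g] mult'[OF g G.inv_closed[OF g]] g one by simp_all
    thus "rho g \<in> carrier (GL k)" unfolding carrier_GL using rho_carrier by blast
  qed (simp add: mult_GL mult')
  have rho_b: "vec_index (rho (vzero I, b, vzero IJ) *\<^sub>v v) x = \<beta> b * ch (dot J (e x) b) * vec_index v x"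
    if "b \<in> V J" "v \<in> carrier_vec k" "x < k" for b v x
  proof -
    have "vec_index (rho (vzero I, b, vzero IJ) *\<^sub>v v) x = (\<Sum>y<k. rho (vzero I, b, vzero IJ) $$ (x, y) * vec_index v y)"
      using that rho_carrier[of "(vzero I, b, vzero IJ)"] by (simp add: scalar_prod_def lessThan_atLeast0)
    also have "\<dots> = (\<Sum>y<k. if y = x then s (vzero I) b (vzero IJ) (e x) * vec_index v y else 0)"
    proof (intro sum.cong refl)
      fix y assume "y \<in> {..<k}"
      hence y: "y < k" by simp
      show "rho (vzero I, b, vzero IJ) $$ (x, y) * vec_index v y = (if y = x then s (vzero I) b (vzero IJ) (e x) * vec_index v y else 0)"
        unfolding rho_entry[OF that(3) y] rc_zero[OF Y] vadd_zero(1)[OF eV[OF that(3)]] using e_inj[OF y that(3)] by auto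
    qed
    also have "\<dots> = s (vzero I) b (vzero IJ) (e x) * vec_index v x" using that by simp
    finally show ?thesis unfolding s_def chars_zero_I[OF \<alpha>] Psi_zero[OF Y] by simp
  qed
  have irr: "irreducible_rep G k rho"
    unfolding irreducible_rep_def
  proof (intro conjI k0 hom allI impI, elim conjE)
    fix U assume sU: "VectorSpace.subspace class_ring U (module_vec TYPE(complex) k)"
      and inv: "\<forall>g\<in>carrier G. \<forall>v\<in>U. rho g *\<^sub>v v \<in> U"
    note U = subspace_vecD[OF sU]
    show "U = {0\<^sub>v k} \<or> U = carrier_vec k"
    proof (cases "U = {0\<^sub>v k}")
      case False
      then obtain v where v: "v \<in> U" "v \<noteq> 0\<^sub>v k" using U(2) by blast
      have vk: "v \<in> carrier_vec k" using v U(1) by blast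
      obtain x0 where x0: "x0 < k" "vec_index v x0 \<noteq> 0"
      proof -
        have "\<exists>x<k. vec_index v x \<noteq> 0"
        proof (rule ccontr)
          assume "\<not> ?thesis"
          hence "v = 0\<^sub>v k" using vk by (intro eq_vecI) auto
          thus False using v by simp
        qed
        thus ?thesis using that by blast
      qed
      have bG: "(vzero I, b, vzero IJ) \<in> carrier G" if "b \<in> V J" for b
        unfolding carrier_G by (intro SigmaI V_zero that)
      have aG: "(a, vzero J, vzero IJ) \<in> carrier G" if "a \<in> V I" for a
        unfolding carrier_G by (intro SigmaI V_zero that)
      interpret vJ: comm_group "vec_group R J" by (rule comm_group_vec_group)
      have \<beta>0: "\<beta> b \<noteq> 0" if "b \<in> V J" for b
        using vJ.chars_inv(2)[OF \<beta>, of b] that by (simp only: vec_group_simps simp_thms)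
      \<comment> \<open>Scaled so that all \<open>f b\<close> have the same entry at
        \<open>x0\<close>. Their sum over \<open>b\<close> projects to that coordinate, because at
        \<open>x \<noteq> x0\<close> the factors form a nontrivial character of \<open>b\<close>,
        given by the difference of \<open>e x\<close> and \<open>e x0\<close>.\<close>
      define f where "f = (\<lambda>b. (1 / (\<beta> b * ch (dot J (e x0) b))) \<cdot>\<^sub>v (rho (vzero I, b, vzero IJ) *\<^sub>v v))"
      have fU: "f b \<in> U" if "b \<in> V J" for b unfolding f_def using inv bG[OF that] v(1) U(4) by blast
      have fx: "vec_index (f b) x = ch (dot J (\<lambda>j\<in>J. e x j \<ominus> e x0 j) b) * vec_index v x" if "b \<in> V J" "x < k" for b x
      proof -
        have nz: "ch (dot J (e x0) b) \<noteq> 0" using ch_nonzero[OF dot_closed[OF eV[OF x0(1)] that(1)]] .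
        have "vec_index (f b) x = (1 / (\<beta> b * ch (dot J (e x0) b))) * vec_index (rho (vzero I, b, vzero IJ) *\<^sub>v v) x"
          using that rho_carrier[of "(vzero I, b, vzero IJ)"] by (simp add: f_def)
        also have "\<dots> = ch (dot J (e x) b) / ch (dot J (e x0) b) * vec_index v x"
          unfolding rho_b[OF that(1) vk that(2)] using \<beta>0[OF that(1)] nz by (simp add: field_simps)
        also have "ch (dot J (e x) b) / ch (dot J (e x0) b) = ch (dot J (\<lambda>j\<in>J. e x j \<ominus> e x0 j) b)"
          unfolding dot_diff[OF eV[OF that(2)] eV[OF x0(1)] that(1), symmetric] using nz by simp
        finally show ?thesis .
      qed
      have finJ: "finite (V J)" by (rule finite_V) simp
      obtain u where u: "u \<in> U" "\<forall>x<k. vec_index u x = (\<Sum>b\<in>V J. vec_index (f b) x)"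
      proof -
        have "\<exists>u\<in>U. \<forall>x<k. vec_index u x = (\<Sum>b\<in>V J. vec_index (f b) x)"
          by (rule vec_family_sum) (fact U finJ fU)+
        thus ?thesis using that by blast
      qed
      have ux: "vec_index u x = (if x = x0 then of_nat (card (V J)) * vec_index v x0 else 0)" if x: "x < k" for x
      proof -
        let ?d = "\<lambda>j\<in>J. e x j \<ominus> e x0 j"
        have dV: "?d \<in> V J" using V_closed[OF eV[OF x]] V_closed[OF eV[OF x0(1)]] by auto
        have "vec_index u x = (\<Sum>b\<in>V J. ch (dot J ?d b)) * vec_index v x"
          using u(2) x fx[OF _ x] by (simp add: sum_distrib_right cong: sum.cong)
        also have "(\<Sum>b\<in>V J. ch (dot J ?d b)) = (if x = x0 then of_nat (card (V J)) else 0)"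
        proof (cases "x = x0")
          case True
          have "?d = vzero J" using V_closed[OF eV[OF x]] True by (intro restrict_ext) (simp add: a_minus_def r_neg)
          hence "ch (dot J ?d b) = 1" if "b \<in> V J" for b
            using dot_comm[OF V_zero that] dot_zero[OF that] ch_zero by simp
          thus ?thesis using True by simp
        next
          case False
          have "?d \<noteq> vzero J"
          proof
            assume *: "?d = vzero J"
            have "e x = e x0"
            proof (rule extensionalityI[of _ J])
              fix j assume j: "j \<in> J"
              show "e x j = e x0 j" using fun_cong[OF *, of j] j V_closed[OF eV[OF x] j] V_closed[OF eV[OF x0(1)] j] by simp
            qed (use eV[OF x] eV[OF x0(1)] in \<open>simp_all only: PiE_iff\<close>)
            thus False using e_inj[OF x x0(1)] False by simp
          qed
          then obtain b where b: "b \<in> V J" "ch (dot J ?d b) \<noteq> 1" using dot_nondegenerate[OF _ dV] by blast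
          have "(\<Sum>b\<in>carrier (vec_group R J). (\<lambda>v\<in>V J. ch (dot J ?d v)) b) = 0"
            by (rule vJ.sum_char_eq_0[OF _ dot_char[OF dV], of b]) (use finJ b in \<open>simp_all only: vec_group_simps restrict_apply' not_False_eq_True\<close>)
          thus ?thesis using False by (simp add: vec_group_simps cong: sum.cong)
        qed
        finally show ?thesis by simp
      qed
      have cV: "card (V J) > 0" using finJ V_zero[of J] by (metis card_gt_0_iff empty_iff)
      have unit0: "unit_vec k x0 \<in> U"
      proof -
        have "(1 / (of_nat (card (V J)) * vec_index v x0)) \<cdot>\<^sub>v u = unit_vec k x0"
        proof (rule eq_vecI)
          fix x assume "x < dim_vec (unit_vec k x0 :: complex vec)"
          hence x: "x < k" by simp
          have "u \<in> carrier_vec k" using u(1) U(1) by blast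
          thus "vec_index ((1 / (of_nat (card (V J)) * vec_index v x0)) \<cdot>\<^sub>v u) x = vec_index (unit_vec k x0) x"
            using x ux[OF x] x0 cV by simp
        qed (use u(1) U(1) in auto)
        thus ?thesis using U(4)[OF u(1)] by metis
      qed
      \<comment> \<open>Translation by a suitable row combination carries the coordinate
        \<open>x0\<close> to \<open>y\<close>.\<close>
      have unit: "unit_vec k y \<in> U" if y: "y < k" for y
      proof -
        obtain a1 a2 where a: "a1 \<in> V I" "e x0 = ?rc a1" "a2 \<in> V I" "e y = ?rc a2"
          using eW[OF x0(1)] eW[OF y] unfolding W by blast
        define a where "a = vadd a1 I (\<lambda>i\<in>I. \<ominus> a2 i)"
        have aV: "a \<in> V I" unfolding a_def by (intro V_add vneg a)
        have "vadd a2 I a = a1"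
          unfolding vadd_comm[OF a(3) aV] unfolding a_def vadd_assoc[OF a(1) vneg[OF a(3)] a(3)] vadd_neg[OF a(3)]
          by (rule vadd_zero(1)[OF a(1)])
        hence ey: "vadd (e y) J (?rc a) = e x0" unfolding a(2,4) rc_add[OF Y a(3) aV, symmetric] by simp
        have "rho (a, vzero J, vzero IJ) *\<^sub>v unit_vec k x0 = \<alpha> a \<cdot>\<^sub>v unit_vec k y"
        proof (rule eq_vecI)
          fix x assume "x < dim_vec (\<alpha> a \<cdot>\<^sub>v unit_vec k y)"
          hence x: "x < k" by simp
          have "vec_index (rho (a, vzero J, vzero IJ) *\<^sub>v unit_vec k x0) x = rho (a, vzero J, vzero IJ) $$ (x, x0)"
            using x x0 rho_carrier[of "(a, vzero J, vzero IJ)"] by simp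
          also have "\<dots> = (if e x0 = vadd (e x) J (?rc a) then \<alpha> a else 0)"
            unfolding rho_entry[OF x x0(1)] s_def chars_zero_J[OF \<beta>] Psi_zero[OF Y] ch_dot_zero_r[OF eV[OF x]] by simp
          also have "e x0 = vadd (e x) J (?rc a) \<longleftrightarrow> x = y"
            using ey vadd_cancel[OF eV[OF x] eV[OF y] rc_V[OF Y aV]] e_inj[OF x y] by auto
          finally have l: "vec_index (rho (a, vzero J, vzero IJ) *\<^sub>v unit_vec k x0) x = (if x = y then \<alpha> a else 0)" .
          have r: "vec_index (\<alpha> a \<cdot>\<^sub>v unit_vec k y) x = (if x = y then \<alpha> a else 0)" using x y by simp
          show "vec_index (rho (a, vzero J, vzero IJ) *\<^sub>v unit_vec k x0) x = vec_index (\<alpha> a \<cdot>\<^sub>v unit_vec k y) x"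
            unfolding l r ..
        qed (use rho_carrier[of "(a, vzero J, vzero IJ)"] in auto)
        hence m: "\<alpha> a \<cdot>\<^sub>v unit_vec k y \<in> U" using inv aG[OF aV] unit0 by metis
        interpret vI: comm_group "vec_group R I" by (rule comm_group_vec_group)
        have "\<alpha> a \<noteq> 0" using vI.chars_inv(2)[OF \<alpha>, of a] aV by (simp only: vec_group_simps simp_thms)
        hence "(1 / \<alpha> a) \<cdot>\<^sub>v (\<alpha> a \<cdot>\<^sub>v unit_vec k y) = unit_vec k y" by (simp add: smult_smult_assoc)
        thus ?thesis using U(4)[OF m] by metis
      qed
      have "w \<in> U" if w: "w \<in> carrier_vec k" for w
      proof -
        have scU: "\<And>y. y \<in> {..<k} \<Longrightarrow> vec_index w y \<cdot>\<^sub>v unit_vec k y \<in> U" using unit U(4) by simp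
        have "\<exists>t\<in>U. \<forall>x<k. vec_index t x = (\<Sum>y<k. vec_index (vec_index w y \<cdot>\<^sub>v unit_vec k y) x)"
          by (rule vec_family_sum) (fact U finite_lessThan scU)+
        then obtain t where t: "t \<in> U" "\<forall>x<k. vec_index t x = (\<Sum>y<k. vec_index (vec_index w y \<cdot>\<^sub>v unit_vec k y) x)" by blast
        have "t = w"
        proof (rule eq_vecI)
          fix x assume "x < dim_vec w"
          hence x: "x < k" using w by simp
          have "vec_index t x = (\<Sum>y<k. if y = x then vec_index w y else 0)"
            unfolding t(2)[rule_format, OF x] using x by (intro sum.cong refl) auto
          thus "vec_index t x = vec_index w x" using x by simp
        qed (use t(1) U(1) w in auto)
        thus ?thesis using t(1) by simp
      qed
      thus ?thesis using U(1) by blast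
    qed simp
  qed
  have smult_one: "mat k k (\<lambda>(x, y). if y = x then d else 0) = d \<cdot>\<^sub>m (1\<^sub>m k :: complex mat)" for d
    by (intro eq_matI) auto
  have rho_scalar: "rho (a, b, c) = d \<cdot>\<^sub>m 1\<^sub>m k" if "?rc a = vzero J" "\<And>x. x < k \<Longrightarrow> s a b c (e x) = d" for a b c d
  proof (rule eq_matI)
    fix x y assume "x < dim_row (d \<cdot>\<^sub>m 1\<^sub>m k)" "y < dim_col (d \<cdot>\<^sub>m 1\<^sub>m k)"
    hence xy: "x < k" "y < k" by auto
    show "rho (a, b, c) $$ (x, y) = (d \<cdot>\<^sub>m 1\<^sub>m k) $$ (x, y)"
      unfolding rho_entry[OF xy] that(1) vadd_zero(1)[OF eV[OF xy(1)]] that(2)[OF xy(1)] using xy e_inj[OF xy] by auto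
  qed (use rho_carrier[of "(a, b, c)"] in auto)
  have "rho (vzero I, vzero J, c) = Psi Y c \<cdot>\<^sub>m 1\<^sub>m k" if "c \<in> V IJ" for c
  proof (rule rho_scalar[OF rc_zero[OF Y]])
    fix x assume x: "x < k"
    show "s (vzero I) (vzero J) c (e x) = Psi Y c"
      unfolding s_def chars_zero_I[OF \<alpha>] chars_zero_J[OF \<beta>] ch_dot_zero_r[OF eV[OF x]] by simp
  qed
  moreover have "rho (a, vzero J, vzero IJ) = \<alpha> a \<cdot>\<^sub>m 1\<^sub>m k" if a: "a \<in> lk Y" for a
  proof (rule rho_scalar)
    show "?rc a = vzero J" using a by (simp add: lker_def)
    fix x assume x: "x < k"
    show "s a (vzero J) (vzero IJ) (e x) = \<alpha> a"
      unfolding s_def chars_zero_J[OF \<beta>] Psi_zero[OF Y] ch_dot_zero_r[OF eV[OF x]] by simp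
  qed
  moreover have "rho (vzero I, b, vzero IJ) = \<beta> b \<cdot>\<^sub>m 1\<^sub>m k" if b: "b \<in> rk' Y" for b
  proof (rule rho_scalar[OF rc_zero[OF Y]])
    fix x assume x: "x < k"
    obtain a where a: "a \<in> V I" "e x = ?rc a" using eW[OF x] unfolding W by blast
    have bV: "b \<in> V J" using b rk_V by blast
    have "ch (dot J (e x) b) = 1" unfolding a(2) ch_dot_rc[OF Y a(1) bV] using b rk_iff[OF Y bV] a(1) by blast
    thus "s (vzero I) b (vzero IJ) (e x) = \<beta> b"
      unfolding s_def chars_zero_I[OF \<alpha>] Psi_zero[OF Y] by simp
  qed
  ultimately show ?thesis using irr by blast
qed

end

section \<open>Counting the irreducible characters\<close>

context unipotent begin

lemma Psi_inj:
  assumes "Y \<in> V IJ" "Y' \<in> V IJ" "\<And>c. c \<in> V IJ \<Longrightarrow> Psi Y c = Psi Y' c"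
  shows "Y = Y'"
proof (rule inj_onD[OF dot_char_inj[of IJ]])
  show "(\<lambda>v\<in>V IJ. ch (dot IJ Y v)) = (\<lambda>v\<in>V IJ. ch (dot IJ Y' v))"
    by (rule restrict_ext) (use assms(3) in \<open>simp only: Psi_def\<close>)
qed (simp, fact assms, fact assms)

lemma scalar_mat_eqD: "c \<cdot>\<^sub>m 1\<^sub>m k = d \<cdot>\<^sub>m (1\<^sub>m k :: complex mat) \<Longrightarrow> k > 0 \<Longrightarrow> c = d"
  by (drule arg_cong[of _ _ "\<lambda>A. A $$ (0, 0)"]) simp

lemma trivial_char: "(\<lambda>v\<in>carrier H. 1) \<in> chars H" if "group H" for H :: "('c, 'd) monoid_scheme"
proof -
  interpret group H by fact
  show ?thesis by (auto simp: chars_def)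
qed

lemma row_span_pos: "card (row_span I J Y) > 0"
  unfolding row_span_rc card_gt_0_iff using imageI[OF V_zero[of I], of "rc I J Y"] finite_V[of I] by blast

lemma irr_form_ex:
  assumes "irreducible_rep G k rho"
  shows "\<exists>Y \<alpha> \<beta>. Y \<in> V IJ \<and> \<alpha> \<in> chars (lgroup Y) \<and> \<beta> \<in> chars (rgroup Y) \<and>
    k ^ 2 * (card (lk Y) * card (rk' Y)) = q ^ (N * (m + n)) \<and>
    (\<forall>c\<in>V IJ. rho (vzero I, vzero J, c) = Psi Y c \<cdot>\<^sub>m 1\<^sub>m k) \<and>
    (\<forall>a\<in>lk Y. rho (a, vzero J, vzero IJ) = \<alpha> a \<cdot>\<^sub>m 1\<^sub>m k) \<and>
    (\<forall>b\<in>rk' Y. rho (vzero I, b, vzero IJ) = \<beta> b \<cdot>\<^sub>m 1\<^sub>m k) \<and>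
    (\<lambda>g\<in>carrier G. mat_trace (rho g)) = Xi Y k \<alpha> \<beta>"
proof (rule irr_form[OF assms], goal_cases)
  case (1 Y \<alpha> \<beta>)
  show ?case by (intro exI[of _ Y] exI[of _ \<alpha>] exI[of _ \<beta>] conjI ballI 1)
qed

text \<open>\<open>\<alpha>\<close> and \<open>\<beta>\<close> are extended to the full vector
  groups to apply \<open>irr_exists\<close>. The trace is not computed from the matrices:
  \<open>irr_form\<close> provides parameters, and the scalars on the three kinds of elements
  identify them with \<open>Y\<close>, \<open>\<alpha>\<close>, \<open>\<beta>\<close>.\<close>

lemma irr_realise:
  assumes Y: "Y \<in> V IJ" and \<alpha>: "\<alpha> \<in> chars (lgroup Y)" and \<beta>: "\<beta> \<in> chars (rgroup Y)"
  shows "Xi Y (card (row_span I J Y)) \<alpha> \<beta> \<in> irr_characters G (card (row_span I J Y))"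
    and "card (row_span I J Y) ^ 2 * (card (lk Y) * card (rk' Y)) = q ^ (N * (m + n))"
proof -
  let ?k = "card (row_span I J Y)"
  interpret vI: comm_group "vec_group R I" by (rule comm_group_vec_group)
  interpret vJ: comm_group "vec_group R J" by (rule comm_group_vec_group)
  have fI: "finite (carrier (vec_group R I))" and fJ: "finite (carrier (vec_group R J))"
    by (simp_all only: vec_group_simps) (rule finite_V, simp)+
  obtain A where A: "A \<in> chars (vec_group R I)" "\<forall>a\<in>lk Y. A a = \<alpha> a"
    using vI.char_extend[OF fI lk_subgroup[OF Y] \<alpha>] by blast
  obtain B where B: "B \<in> chars (vec_group R J)" "\<forall>b\<in>rk' Y. B b = \<beta> b"
    using vJ.char_extend[OF fJ rk_subgroup[OF Y] \<beta>] by blast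
  obtain rho where rho: "irreducible_rep G ?k rho"
    "\<forall>c\<in>V IJ. rho (vzero I, vzero J, c) = Psi Y c \<cdot>\<^sub>m 1\<^sub>m ?k"
    "\<forall>a\<in>lk Y. rho (a, vzero J, vzero IJ) = A a \<cdot>\<^sub>m 1\<^sub>m ?k"
    "\<forall>b\<in>rk' Y. rho (vzero I, b, vzero IJ) = B b \<cdot>\<^sub>m 1\<^sub>m ?k"
    using irr_exists[OF Y A(1) B(1)] by blast
  have kpos: "?k > 0" by (rule row_span_pos)
  obtain Y' \<alpha>' \<beta>' where Y': "Y' \<in> V IJ" "\<alpha>' \<in> chars (lgroup Y')" "\<beta>' \<in> chars (rgroup Y')"
    "?k ^ 2 * (card (lk Y') * card (rk' Y')) = q ^ (N * (m + n))"
    "\<forall>c\<in>V IJ. rho (vzero I, vzero J, c) = Psi Y' c \<cdot>\<^sub>m 1\<^sub>m ?k"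
    "\<forall>a\<in>lk Y'. rho (a, vzero J, vzero IJ) = \<alpha>' a \<cdot>\<^sub>m 1\<^sub>m ?k"
    "\<forall>b\<in>rk' Y'. rho (vzero I, b, vzero IJ) = \<beta>' b \<cdot>\<^sub>m 1\<^sub>m ?k"
    "(\<lambda>g\<in>carrier G. mat_trace (rho g)) = Xi Y' ?k \<alpha>' \<beta>'"
    using irr_form_ex[OF rho(1)] by (elim exE conjE)
  have eq: "Y' = Y"
  proof (rule Psi_inj[OF Y'(1) Y])
    fix c assume c: "c \<in> V IJ"
    show "Psi Y' c = Psi Y c"
      by (rule scalar_mat_eqD[OF _ kpos]) (simp only: Y'(5)[rule_format, OF c, symmetric] rho(2)[rule_format, OF c])
  qed
  have "\<alpha>' = \<alpha>"
  proof (rule extensionalityI[of _ "lk Y"])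
    fix a assume a: "a \<in> lk Y"
    have "\<alpha>' a = A a"
      by (rule scalar_mat_eqD[OF _ kpos]) (simp only: Y'(6)[unfolded eq, rule_format, OF a, symmetric] rho(3)[rule_format, OF a])
    thus "\<alpha>' a = \<alpha> a" using A(2) a by simp
  qed (use charsD(1)[OF Y'(2)] charsD(1)[OF \<alpha>] eq in simp_all)
  moreover have "\<beta>' = \<beta>"
  proof (rule extensionalityI[of _ "rk' Y"])
    fix b assume b: "b \<in> rk' Y"
    have "\<beta>' b = B b"
      by (rule scalar_mat_eqD[OF _ kpos]) (simp only: Y'(7)[unfolded eq, rule_format, OF b, symmetric] rho(4)[rule_format, OF b])
    thus "\<beta>' b = \<beta> b" using B(2) b by simp
  qed (use charsD(1)[OF Y'(3)] charsD(1)[OF \<beta>] eq in simp_all)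
  ultimately have "(\<lambda>g\<in>carrier G. mat_trace (rho g)) = Xi Y ?k \<alpha> \<beta>" using Y'(8) eq by simp
  thus "Xi Y ?k \<alpha> \<beta> \<in> irr_characters G ?k" unfolding irr_characters_def using rho(1) by (metis (mono_tags, lifting) mem_Collect_eq)
  show "?k ^ 2 * (card (lk Y) * card (rk' Y)) = q ^ (N * (m + n))" using Y'(4) eq by simp
qed

text \<open>The degree is determined by \<open>Y\<close>: \<open>irr_form\<close> and
  \<open>irr_realise\<close> give two equations with the same kernels, one with \<open>k\<close> and
  one with the size of the row span.\<close>

lemma irr_span:
  assumes "irreducible_rep G k rho"
  obtains Y \<alpha> \<beta> where "Y \<in> V IJ" "card (row_span I J Y) = k" "\<alpha> \<in> chars (lgroup Y)" "\<beta> \<in> chars (rgroup Y)"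
    "(\<lambda>g\<in>carrier G. mat_trace (rho g)) = Xi Y k \<alpha> \<beta>"
proof -
  obtain Y \<alpha> \<beta> where Y: "Y \<in> V IJ" "\<alpha> \<in> chars (lgroup Y)" "\<beta> \<in> chars (rgroup Y)"
    "k ^ 2 * (card (lk Y) * card (rk' Y)) = q ^ (N * (m + n))"
    "(\<lambda>g\<in>carrier G. mat_trace (rho g)) = Xi Y k \<alpha> \<beta>"
    using irr_form_ex[OF assms] by (elim exE conjE)
  have e: "k ^ 2 * (card (lk Y) * card (rk' Y)) = card (row_span I J Y) ^ 2 * (card (lk Y) * card (rk' Y))"
    using Y(4) irr_realise(2)[OF Y(1-3)] by simp
  have "card (V {1..m + n}) > 0"
    unfolding card_gt_0_iff using finite_V[of "{1..m + n}"] V_zero[of "{1..m + n}"] by blast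
  hence "q ^ (N * (m + n)) > 0" using card_V[of "{1..m + n}"] by simp
  hence "card (lk Y) * card (rk' Y) \<noteq> 0" using Y(4) by (metis mult_0_right less_irrefl)
  hence "k ^ 2 = card (row_span I J Y) ^ 2" using e by (metis mult_cancel2)
  hence "card (row_span I J Y) = k" by simp
  thus ?thesis using Y(5) by (intro that[OF Y(1) _ Y(2,3)])
qed

definition params :: "nat \<Rightarrow> ((nat \<times> nat \<Rightarrow> 'a) \<times> ((nat \<Rightarrow> 'a) \<Rightarrow> complex) \<times> ((nat \<Rightarrow> 'a) \<Rightarrow> complex)) set" where
  "params k = (SIGMA Y:{Y \<in> V IJ. card (row_span I J Y) = k}. chars (lgroup Y) \<times> chars (rgroup Y))"

lemma irr_characters_eq: "irr_characters G k = (\<lambda>(Y, \<alpha>, \<beta>). Xi Y k \<alpha> \<beta>) ` params k"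
proof
  show "irr_characters G k \<subseteq> (\<lambda>(Y, \<alpha>, \<beta>). Xi Y k \<alpha> \<beta>) ` params k"
  proof
    fix f assume "f \<in> irr_characters G k"
    then obtain rho where rho: "irreducible_rep G k rho" "f = (\<lambda>g\<in>carrier G. mat_trace (rho g))"
      by (auto simp only: irr_characters_def mem_Collect_eq)
    obtain Y \<alpha> \<beta> where Y: "Y \<in> V IJ" "card (row_span I J Y) = k" "\<alpha> \<in> chars (lgroup Y)" "\<beta> \<in> chars (rgroup Y)"
      "(\<lambda>g\<in>carrier G. mat_trace (rho g)) = Xi Y k \<alpha> \<beta>" by (rule irr_span[OF rho(1)])
    have "(Y, \<alpha>, \<beta>) \<in> params k" unfolding params_def using Y by (intro SigmaI CollectI conjI)
    from imageI[OF this, of "\<lambda>(Y, \<alpha>, \<beta>). Xi Y k \<alpha> \<beta>"] show "f \<in> (\<lambda>(Y, \<alpha>, \<beta>). Xi Y k \<alpha> \<beta>) ` params k"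
      using rho(2) Y(5) by (simp only: prod.case)
  qed
  show "(\<lambda>(Y, \<alpha>, \<beta>). Xi Y k \<alpha> \<beta>) ` params k \<subseteq> irr_characters G k"
  proof (rule image_subsetI)
    fix x assume "x \<in> params k"
    then obtain Y \<alpha> \<beta> where x: "x = (Y, \<alpha>, \<beta>)" "Y \<in> V IJ" "card (row_span I J Y) = k" "\<alpha> \<in> chars (lgroup Y)" "\<beta> \<in> chars (rgroup Y)"
      unfolding params_def by (elim SigmaE CollectE conjE) simp
    show "(case x of (Y, \<alpha>, \<beta>) \<Rightarrow> Xi Y k \<alpha> \<beta>) \<in> irr_characters G k"
      unfolding x(1) prod.case using irr_realise(1)[OF x(2,4,5)] by (simp only: x(3))
  qed
qed

lemma Xi_apply:
  "a \<in> V I \<Longrightarrow> b \<in> V J \<Longrightarrow> c \<in> V IJ \<Longrightarrow>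
    Xi Y k \<alpha> \<beta> (a, b, c) = (if a \<in> lk Y \<and> b \<in> rk' Y then of_nat k * (\<alpha> a * \<beta> b * Psi Y c) else 0)"
  unfolding Xi_def carrier_G by (simp only: restrict_apply' SigmaI prod.case)

lemma lgroup_zero: assumes "Y \<in> V IJ" shows "vzero I \<in> lk Y" "\<alpha> \<in> chars (lgroup Y) \<Longrightarrow> \<alpha> (vzero I) = 1"
  using subgroup.one_closed[OF lk_subgroup[OF assms]] charsD(2)[of \<alpha> "lgroup Y"] by (simp_all add: vec_group_simps)

lemma rgroup_zero: assumes "Y \<in> V IJ" shows "vzero J \<in> rk' Y" "\<beta> \<in> chars (rgroup Y) \<Longrightarrow> \<beta> (vzero J) = 1"
  using subgroup.one_closed[OF rk_subgroup[OF assms]] charsD(2)[of \<beta> "rgroup Y"] by (simp_all add: vec_group_simps)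

lemma Xi_values:
  assumes Y: "Y \<in> V IJ" and \<alpha>: "\<alpha> \<in> chars (lgroup Y)" and \<beta>: "\<beta> \<in> chars (rgroup Y)"
  shows "c \<in> V IJ \<Longrightarrow> Xi Y k \<alpha> \<beta> (vzero I, vzero J, c) = of_nat k * Psi Y c"
    and "a \<in> lk Y \<Longrightarrow> Xi Y k \<alpha> \<beta> (a, vzero J, vzero IJ) = of_nat k * \<alpha> a"
    and "b \<in> rk' Y \<Longrightarrow> Xi Y k \<alpha> \<beta> (vzero I, b, vzero IJ) = of_nat k * \<beta> b"
  using lgroup_zero(1)[OF Y] rgroup_zero(1)[OF Y] lgroup_zero(2)[OF Y \<alpha>] rgroup_zero(2)[OF Y \<beta>] Psi_zero[OF Y] subsetD[OF lk_V, of a Y] subsetD[OF rk_V, of b Y]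
  by (simp_all only: Xi_apply V_zero simp_thms if_True mult_1 mult_1_right)

text \<open>The values on the three coordinate subgroups of scalar elements recover
  \<open>Psi Y\<close>, \<open>\<alpha>\<close> and \<open>\<beta>\<close> in turn.\<close>

lemma Xi_inj: assumes k: "k > 0" shows "inj_on (\<lambda>(Y, \<alpha>, \<beta>). Xi Y k \<alpha> \<beta>) (params k)"
proof (rule inj_onI)
  fix x x' assume "x \<in> params k" "x' \<in> params k" and e: "(case x of (Y, \<alpha>, \<beta>) \<Rightarrow> Xi Y k \<alpha> \<beta>) = (case x' of (Y, \<alpha>, \<beta>) \<Rightarrow> Xi Y k \<alpha> \<beta>)"
  then obtain Y \<alpha> \<beta> Y' \<alpha>' \<beta>' where x: "x = (Y, \<alpha>, \<beta>)" "Y \<in> V IJ" "\<alpha> \<in> chars (lgroup Y)" "\<beta> \<in> chars (rgroup Y)"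
    and x': "x' = (Y', \<alpha>', \<beta>')" "Y' \<in> V IJ" "\<alpha>' \<in> chars (lgroup Y')" "\<beta>' \<in> chars (rgroup Y')"
    unfolding params_def by (elim SigmaE CollectE conjE) simp
  have e: "Xi Y k \<alpha> \<beta> g = Xi Y' k \<alpha>' \<beta>' g" for g using e unfolding x(1) x'(1) prod.case by simp
  have YY: "Y' = Y"
  proof (rule Psi_inj[OF x'(2) x(2)])
    fix c assume c: "c \<in> V IJ"
    have "of_nat k * Psi Y c = of_nat k * Psi Y' c"
      using e[of "(vzero I, vzero J, c)"] unfolding Xi_values(1)[OF x(2-4) c] Xi_values(1)[OF x'(2-4) c] .
    thus "Psi Y' c = Psi Y c" using k by simp
  qed
  have "\<alpha>' = \<alpha>"
  proof (rule extensionalityI[of _ "lk Y"])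
    fix a assume a: "a \<in> lk Y"
    have "of_nat k * \<alpha> a = of_nat k * \<alpha>' a"
      using e[of "(a, vzero J, vzero IJ)"] unfolding Xi_values(2)[OF x(2-4) a] Xi_values(2)[OF x'(2-4)[unfolded YY] a] YY .
    thus "\<alpha>' a = \<alpha> a" using k by simp
  qed (use charsD(1)[OF x(3)] charsD(1)[OF x'(3)] YY in simp_all)
  moreover have "\<beta>' = \<beta>"
  proof (rule extensionalityI[of _ "rk' Y"])
    fix b assume b: "b \<in> rk' Y"
    have "of_nat k * \<beta> b = of_nat k * \<beta>' b"
      using e[of "(vzero I, b, vzero IJ)"] unfolding Xi_values(3)[OF x(2-4) b] Xi_values(3)[OF x'(2-4)[unfolded YY] b] YY .
    thus "\<beta>' b = \<beta> b" using k by simp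
  qed (use charsD(1)[OF x(4)] charsD(1)[OF x'(4)] YY in simp_all)
  ultimately show "x = x'" using x(1) x'(1) YY by simp
qed

lemma card_chars_subgroup:
  assumes "comm_group H" "finite (carrier H)" "subgroup K H"
  shows "card (chars (H\<lparr>carrier := K\<rparr>)) = card K"
proof -
  interpret H: comm_group H by fact
  interpret k: group "H\<lparr>carrier := K\<rparr>" by (rule H.subgroup_imp_group[OF assms(3)])
  have "comm_group (H\<lparr>carrier := K\<rparr>)"
    by (rule k.group_comm_groupI) (use subgroup.mem_carrier[OF assms(3)] H.m_comm in simp)
  moreover have "finite (carrier (H\<lparr>carrier := K\<rparr>))" using finite_subset[OF subgroup.subset[OF assms(3)] assms(2)] by simp
  ultimately show ?thesis using comm_group.card_chars by fastforce
qed

text \<open>The number of characters for one \<open>Y\<close> is the product of the sizes of its two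
  kernels, which is \<open>q ^ (N * (m + n)) / k ^ 2\<close> by the degree formula. The factor
  \<open>k ^ 2\<close> stays on the left to remain in the natural numbers.\<close>

lemma num_irr_G:
  assumes k: "k > 0"
  shows "num_irr G k * k ^ 2 = q ^ (N * (m + n)) * card {Y \<in> V IJ. card (row_span I J Y) = k}"
proof -
  let ?D = "{Y \<in> V IJ. card (row_span I J Y) = k}"
  have finVI: "finite (carrier (vec_group R I))" "finite (carrier (vec_group R J))" 
    by (simp_all only: vec_group_simps) (rule finite_V, simp)+
  have D: "finite ?D" using finite_V[of IJ] by simp
  have cl: "card (chars (lgroup Y)) = card (lk Y)" and cr: "card (chars (rgroup Y)) = card (rk' Y)" if "Y \<in> V IJ" for Y
    using card_chars_subgroup[OF comm_group_vec_group finVI(1) lk_subgroup[OF that]]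
      card_chars_subgroup[OF comm_group_vec_group finVI(2) rk_subgroup[OF that]] by blast+
  have pos: "card (lk Y) > 0" "card (rk' Y) > 0" if "Y \<in> V IJ" for Y
    using lgroup_zero(1)[OF that] rgroup_zero(1)[OF that] finite_subset[OF lk_V finite_V, of Y] finite_subset[OF rk_V finite_V, of Y]
    by (simp_all add: card_gt_0_iff) blast+
  have fin': "finite (chars (lgroup Y))" "finite (chars (rgroup Y))" if "Y \<in> V IJ" for Y
    using cl[OF that] cr[OF that] pos[OF that] by (metis card.infinite less_irrefl)+
  have "num_irr G k = card (params k)"
    unfolding num_irr_def irr_characters_eq by (rule card_image[OF Xi_inj[OF k]])
  also have "\<dots> = (\<Sum>Y\<in>?D. card (chars (lgroup Y) \<times> chars (rgroup Y)))"
    unfolding params_def using D fin' by (intro card_SigmaI) simp_all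
  also have "\<dots> = (\<Sum>Y\<in>?D. card (lk Y) * card (rk' Y))"
    by (rule sum.cong[OF refl]) (simp only: card_cartesian_product mem_Collect_eq cl cr)
  finally have "num_irr G k * k ^ 2 = (\<Sum>Y\<in>?D. k ^ 2 * (card (lk Y) * card (rk' Y)))"
    by (simp add: sum_distrib_left mult.commute)
  also have "\<dots> = (\<Sum>Y\<in>?D. q ^ (N * (m + n)))"
  proof (intro sum.cong refl)
    fix Y assume Y: "Y \<in> ?D"
    hence Y': "Y \<in> V IJ" by blast
    \<comment> \<open>\<open>irr_realise\<close> asks for some pair of characters of the kernels;
      the trivial ones are supplied.\<close>
    have "group (lgroup Y)" "group (rgroup Y)"
      by (rule group.subgroup_imp_group[OF comm_group.axioms(2)[OF comm_group_vec_group]], rule lk_subgroup[OF Y'] rk_subgroup[OF Y'])+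
    note trivial_char[OF this(1)] trivial_char[OF this(2)]
    thus "k ^ 2 * (card (lk Y) * card (rk' Y)) = q ^ (N * (m + n))" using irr_realise(2)[of Y] Y by blast
  qed
  finally show ?thesis by simp
qed

text \<open>The division by \<open>k ^ 2\<close> in the count shifts the exponent from
  \<open>- s\<close> to \<open>- (s + 2)\<close>.\<close>

lemma zeta_irr_G:
  "zeta_irr G s = of_nat q ^ (N * (m + n)) * rec_sum q (complex_of_nat q powr (- (s + 2))) N 0 m n"
proof -
  let ?w = "\<lambda>k::nat. complex_of_nat k powr (- (s + 2))"
  let ?c = "\<lambda>Y. card (row_span I J Y)"
  \<comment> \<open>\<open>zeta_irr\<close> numbers the degrees by \<open>Suc k\<close>, hence the
    shift by one; row spans are nonempty, so nothing is lost. Outside the finite set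
    \<open>F\<close> all terms vanish.\<close>
  define F where "F = (\<lambda>Y. ?c Y - 1) ` V IJ"
  have fV: "finite (V IJ)" by (rule finite_V) simp
  have F: "finite F" unfolding F_def by (rule finite_imageI[OF fV])
  have tm: "of_nat (num_irr G (Suc k)) * complex_of_nat (Suc k) powr (- s) =
      (\<Sum>Y\<in>{Y \<in> V IJ. ?c Y - 1 = k}. of_nat q ^ (N * (m + n)) * ?w (?c Y))" for k
  proof -
    have D: "{Y \<in> V IJ. ?c Y - 1 = k} = {Y \<in> V IJ. ?c Y = Suc k}"
      using row_span_pos by fastforce
    have p: "complex_of_nat (Suc k) powr (- s) = ?w (Suc k) * of_nat (Suc k) ^ 2"
      using powr_add[of "complex_of_nat (Suc k)" "- (s + 2)" 2] by simp
    have "of_nat (num_irr G (Suc k)) * complex_of_nat (Suc k) ^ 2 = of_nat (num_irr G (Suc k) * Suc k ^ 2)" by simp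
    also have "\<dots> = of_nat q ^ (N * (m + n)) * of_nat (card {Y \<in> V IJ. ?c Y = Suc k})" 
      unfolding num_irr_G[OF zero_less_Suc] by simp
    finally have "of_nat (num_irr G (Suc k)) * complex_of_nat (Suc k) powr (- s) =
       of_nat q ^ (N * (m + n)) * of_nat (card {Y \<in> V IJ. ?c Y = Suc k}) * ?w (Suc k)"
      unfolding p by (simp add: mult.assoc mult.left_commute mult.commute)
    also have "\<dots> = (\<Sum>Y\<in>{Y \<in> V IJ. ?c Y = Suc k}. of_nat q ^ (N * (m + n)) * ?w (?c Y))"
      by (subst sum.cong[OF refl, of _ _ "\<lambda>Y. of_nat q ^ (N * (m + n)) * ?w (Suc k)"]) simp_all
    finally show ?thesis unfolding D .
  qed
  have "zeta_irr G s = (\<Sum>k\<in>F. of_nat (num_irr G (Suc k)) * complex_of_nat (Suc k) powr (- s))"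
    unfolding zeta_irr_def
  proof (rule suminf_finite[OF F])
    fix k assume "k \<notin> F"
    hence "{Y \<in> V IJ. ?c Y - 1 = k} = {}" unfolding F_def by blast
    thus "of_nat (num_irr G (Suc k)) * complex_of_nat (Suc k) powr (- s) = 0" unfolding tm by (simp only: sum.empty)
  qed
  also have "\<dots> = (\<Sum>Y\<in>V IJ. of_nat q ^ (N * (m + n)) * ?w (?c Y))"
    unfolding tm by (rule sum.group[OF fV F]) (simp only: F_def subset_refl)
  also have "\<dots> = of_nat q ^ (N * (m + n)) * (\<Sum>Y\<in>V IJ. ?w (?c Y))" by (simp only: sum_distrib_left)
  also have "(\<Sum>Y\<in>V IJ. ?w (?c Y)) = rec_sum q (?w q) N 0 (card I) (card J)"
  proof (rule sum_matrices_eq_rec_sum)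
    fix a b :: nat
    show "?w (a * b) = ?w a * ?w b" unfolding of_nat_mult by (rule powr_times_real) simp_all
  qed simp_all
  finally show ?thesis by simp
qed

end

section \<open>Quotients by powers of a locally principal prime\<close>

lemma ideal_power_0: "ideal_power R P 0 = carrier R"
  by (simp add: ideal_power_def ideals_set_def nat_pow_def)

lemma ideal_power_Suc: "ideal_power R P (Suc k) = ideal_prod R (ideal_power R P k) P"
  by (simp add: ideal_power_def ideals_set_def nat_pow_def)

text \<open>The element \<open>pi\<close> generates \<open>P\<close> only after localisation; the denominators are avoided by
  multiplying with a fixed \<open>u \<notin> P\<close>.\<close>

locale local_data = domain R for R :: "('a, 'b) ring_scheme" (structure) +
  fixes P :: "'a set" and pi u p0 :: 'a and T :: "'a set"
  assumes prime: "primeideal P R"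
    and pi: "pi \<in> P" "pi \<noteq> \<zero>"
    and u: "u \<in> carrier R" "u \<notin> P"
    and divisible: "\<And>x. x \<in> P \<Longrightarrow> \<exists>y\<in>carrier R. u \<otimes> x = pi \<otimes> y"
    and p0: "p0 \<in> P"
    and T: "finite T" "T \<subseteq> carrier R"
    and reps: "\<And>y. y \<in> carrier R \<Longrightarrow> \<exists>t\<in>T. \<exists>z\<in>carrier R. y = t \<oplus> p0 \<otimes> z"
begin

abbreviation J :: "nat \<Rightarrow> 'a set" where "J k \<equiv> ideal_power R P k"

lemma ideal_P: "ideal P R"
  using prime by (rule primeideal.axioms)

lemma P_carrier: "x \<in> P \<Longrightarrow> x \<in> carrier R"
  using ideal.Icarr[OF ideal_P] .

lemma pi_carrier: "pi \<in> carrier R" and p0_carrier: "p0 \<in> carrier R"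
  using pi p0 P_carrier by auto

lemma ideal_J: "ideal (J k) R"
proof (induction k)
  case 0 thus ?case by (simp add: ideal_power_0 oneideal)
next
  case (Suc k) thus ?case unfolding ideal_power_Suc by (rule ideal_prod_is_ideal[OF _ ideal_P])
qed

lemma J_carrier: "x \<in> J k \<Longrightarrow> x \<in> carrier R"
  using ideal.Icarr[OF ideal_J] .

lemma J_mult: "x \<in> J k \<Longrightarrow> r \<in> carrier R \<Longrightarrow> r \<otimes> x \<in> J k"
  using ideal.I_l_closed[OF ideal_J] .

lemma J_neg: "x \<in> J k \<Longrightarrow> \<ominus> x \<in> J k"
  using additive_subgroup.a_inv_closed[OF ideal.axioms(1)[OF ideal_J]] .

lemma J_prod: "x \<in> J k \<Longrightarrow> y \<in> P \<Longrightarrow> x \<otimes> y \<in> J (Suc k)"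
  unfolding ideal_power_Suc by (rule ideal_prod.prod)

lemma J_1: "J (Suc 0) = P"
  unfolding ideal_power_Suc ideal_power_0 
  using ideal_prod_one[OF ideal_P] ideal_prod_commute[OF oneideal ideal_P] by simp

lemma J_Suc_subset: "J (Suc k) \<subseteq> J k"
  unfolding ideal_power_Suc using ideal_prod_inter[OF ideal_J ideal_P] by blast

lemma J_antimono: "j \<le> k \<Longrightarrow> J k \<subseteq> J j"
  by (induction rule: dec_induct) (use J_Suc_subset in auto)

lemma pow_J: "x \<in> P \<Longrightarrow> x [^] (k::nat) \<in> J k"
proof (induction k)
  case 0 thus ?case by (simp add: ideal_power_0)
next
  case (Suc k) thus ?case using J_prod by simp
qed

lemma pow_notin_P: "x \<in> carrier R \<Longrightarrow> x \<notin> P \<Longrightarrow> x [^] (k::nat) \<notin> P"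
proof (induction k)
  case 0
  have "\<one> \<notin> P" using ideal.one_imp_carrier[OF ideal_P] primeideal.I_notcarr[OF prime] by blast
  thus ?case by simp
next
  case (Suc k) thus ?case using primeideal.I_prime[OF prime, of "x [^] k" x] by auto
qed

lemma u_pow_J: "x \<in> J k \<Longrightarrow> \<exists>y\<in>carrier R. u [^] k \<otimes> x = pi [^] k \<otimes> y"
proof (induction k arbitrary: x)
  case 0 thus ?case by (auto simp: ideal_power_0)
next
  case (Suc k)
  from Suc.prems show ?case unfolding ideal_power_Suc
  proof (induction x rule: ideal_prod.induct)
    case (prod i j)
    obtain y y' where y: "y \<in> carrier R" "u [^] k \<otimes> i = pi [^] k \<otimes> y" "y' \<in> carrier R" "u \<otimes> j = pi \<otimes> y'"
      using Suc.IH[OF prod(1)] divisible[OF prod(2)] by blast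
    have c: "i \<in> carrier R" "j \<in> carrier R" using prod J_carrier P_carrier by auto
    have "u [^] Suc k \<otimes> (i \<otimes> j) = (u [^] k \<otimes> i) \<otimes> (u \<otimes> j)" using c u by (simp add: m_ac)
    also have "\<dots> = pi [^] Suc k \<otimes> (y \<otimes> y')" unfolding y using y pi_carrier by (simp add: m_ac)
    finally show ?case using y by blast
  next
    case (sum s1 s2)
    obtain y y' where y: "y \<in> carrier R" "u [^] Suc k \<otimes> s1 = pi [^] Suc k \<otimes> y" "y' \<in> carrier R" "u [^] Suc k \<otimes> s2 = pi [^] Suc k \<otimes> y'"
      using sum by blast
    have c: "s1 \<in> carrier R" "s2 \<in> carrier R" using sum J_carrier[of _ "Suc k"] by (auto simp: ideal_power_Suc)
    have "u [^] Suc k \<otimes> (s1 \<oplus> s2) = pi [^] Suc k \<otimes> (y \<oplus> y')"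
      using c u y pi_carrier by (simp add: r_distr del: nat_pow_Suc)
    thus ?case using y by blast
  qed
qed

text \<open>With one power of \<open>u\<close> fewer than in \<open>u_pow_J\<close> the last factor
  from \<open>P\<close> is kept undivided, so the cofactor stays in \<open>P\<close>.\<close>

lemma u_pow_J_Suc: "x \<in> J (Suc k) \<Longrightarrow> \<exists>y\<in>P. u [^] k \<otimes> x = pi [^] k \<otimes> y"
  unfolding ideal_power_Suc
proof (induction x rule: ideal_prod.induct)
  case (prod i j)
  obtain y where y: "y \<in> carrier R" "u [^] k \<otimes> i = pi [^] k \<otimes> y" using u_pow_J[OF prod(1)] by blast
  have c: "i \<in> carrier R" "j \<in> carrier R" using prod J_carrier P_carrier by auto
  have "u [^] k \<otimes> (i \<otimes> j) = (u [^] k \<otimes> i) \<otimes> j" using c u by (simp add: m_assoc)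
  also have "\<dots> = pi [^] k \<otimes> (y \<otimes> j)" unfolding y using y c pi_carrier by (simp add: m_assoc)
  finally show ?case using ideal.I_l_closed[OF ideal_P prod(2) y(1)] by blast
next
  case (sum s1 s2)
  obtain y y' where y: "y \<in> P" "u [^] k \<otimes> s1 = pi [^] k \<otimes> y" "y' \<in> P" "u [^] k \<otimes> s2 = pi [^] k \<otimes> y'"
    using sum by blast
  have c: "s1 \<in> carrier R" "s2 \<in> carrier R" using sum J_carrier[of _ "Suc k"] by (auto simp: ideal_power_Suc)
  have "u [^] k \<otimes> (s1 \<oplus> s2) = pi [^] k \<otimes> (y \<oplus> y')"
    using c u y pi_carrier P_carrier by (simp add: r_distr)
  thus ?case using additive_subgroup.a_closed[OF ideal.axioms(1)[OF ideal_P] y(1,3)] by blast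
qed

lemma pi_pow_nonzero: "pi [^] (k::nat) \<noteq> \<zero>"
  by (induction k) (use pi pi_carrier integral in auto)

text \<open>Otherwise \<open>u_pow_J_Suc\<close> and cancellation of \<open>pi [^] k\<close> would
  give \<open>u [^] k \<in> P\<close>, against primality.\<close>

lemma pi_pow_notin: "pi [^] k \<notin> J (Suc k)"
proof
  assume "pi [^] k \<in> J (Suc k)"
  then obtain y where y: "y \<in> P" "u [^] k \<otimes> pi [^] k = pi [^] k \<otimes> y" using u_pow_J_Suc by blast
  have "pi [^] k \<otimes> u [^] k = pi [^] k \<otimes> y" using y u pi_carrier by (simp add: m_comm)
  hence "u [^] k = y" using m_lcancel[OF pi_pow_nonzero] u pi_carrier P_carrier[OF y(1)] by simp
  thus False using pow_notin_P[OF u, of k] y by simp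
qed

text \<open>An expansion in powers of \<open>p0\<close> with digits in \<open>T\<close>. As
  \<open>p0 [^] k \<in> J k\<close>, this gives finite quotients.\<close>

lemma sum_reps:
  "\<exists>S. finite S \<and> S \<subseteq> carrier R \<and> (\<forall>y\<in>carrier R. \<exists>t\<in>S. \<exists>z\<in>carrier R. y = t \<oplus> p0 [^] (k::nat) \<otimes> z)"
proof (induction k)
  case 0
  have "y = \<zero> \<oplus> p0 [^] (0::nat) \<otimes> y" if "y \<in> carrier R" for y using that by simp
  thus ?case by (intro exI[of _ "{\<zero>}"]) auto
next
  case (Suc k)
  then obtain S where S: "finite S" "S \<subseteq> carrier R" "\<And>y. y \<in> carrier R \<Longrightarrow> \<exists>t\<in>S. \<exists>z\<in>carrier R. y = t \<oplus> p0 [^] k \<otimes> z" by blast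
  define S' where "S' = (\<lambda>(t, t'). t \<oplus> p0 [^] k \<otimes> t') ` (S \<times> T)"
  have "\<exists>t\<in>S'. \<exists>z\<in>carrier R. y = t \<oplus> p0 [^] Suc k \<otimes> z" if y: "y \<in> carrier R" for y
  proof -
    obtain t z where t: "t \<in> S" "z \<in> carrier R" "y = t \<oplus> p0 [^] k \<otimes> z" using S(3)[OF y] by blast
    obtain t' z' where t': "t' \<in> T" "z' \<in> carrier R" "z = t' \<oplus> p0 \<otimes> z'" using reps[OF t(2)] by blast
    have c: "t \<in> carrier R" "t' \<in> carrier R" using t t' S T by auto
    have "y = (t \<oplus> p0 [^] k \<otimes> t') \<oplus> p0 [^] Suc k \<otimes> z'"
      unfolding t(3) t'(3) using c t' p0_carrier by (simp add: r_distr a_assoc m_assoc)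
    moreover have "t \<oplus> p0 [^] k \<otimes> t' \<in> S'" using t t' by (auto simp: S'_def)
    ultimately show ?thesis using t'(2) by blast
  qed
  moreover have "finite S'" "S' \<subseteq> carrier R" using S(1) T(1) subsetD[OF S(2)] subsetD[OF T(2)] p0_carrier by (auto simp: S'_def)
  ultimately show ?case by blast
qed

text \<open>Two powers of \<open>x\<close> agree modulo \<open>p0\<close>, hence modulo
  \<open>P\<close>; cancelling the smaller one, which is not in \<open>P\<close>, leaves an
  inverse.\<close>

lemma unit_mod_P: assumes x: "x \<in> carrier R" "x \<notin> P" shows "\<exists>v\<in>carrier R. x \<otimes> v \<ominus> \<one> \<in> P"
proof -
  have pc: "p0 \<otimes> z \<in> P" if "z \<in> carrier R" for z using ideal.I_r_closed[OF ideal_P p0 that] .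
  define f where "f = (\<lambda>i::nat. SOME t. t \<in> T \<and> (\<exists>z\<in>carrier R. x [^] i = t \<oplus> p0 \<otimes> z))"
  have f: "f i \<in> T \<and> (\<exists>z\<in>carrier R. x [^] i = f i \<oplus> p0 \<otimes> z)" for i
    unfolding f_def by (rule someI_ex) (use reps[of "x [^] i"] x in blast)
  have "\<not> inj f"
  proof
    assume "inj f"
    moreover have "finite (range f)" using f T(1) by (meson finite_subset image_subsetI)
    ultimately show False using finite_imageD infinite_UNIV_nat by blast
  qed
  then obtain i j where ij: "f i = f j" "i \<noteq> j" by (auto simp: inj_def)
  have main: "\<exists>v\<in>carrier R. x \<otimes> v \<ominus> \<one> \<in> P" if fij: "f i = f j" "j < i" for i j
  proof -
    obtain z z' where z: "z \<in> carrier R" "z' \<in> carrier R" "x [^] i = f i \<oplus> p0 \<otimes> z" "x [^] j = f i \<oplus> p0 \<otimes> z'"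
      using f[of i] f[of j] unfolding fij(1)[symmetric] by blast
    have fc: "f i \<in> carrier R" using f[of i] T by auto
    have "x [^] i \<ominus> x [^] j = p0 \<otimes> (z \<ominus> z')"
    proof -
      have "x [^] i \<ominus> x [^] j = (p0 \<otimes> z \<oplus> f i) \<oplus> (\<ominus> (f i) \<oplus> \<ominus> (p0 \<otimes> z'))"
        unfolding z using z fc p0_carrier by (simp add: a_minus_def minus_add a_comm)
      also have "\<dots> = p0 \<otimes> z \<oplus> (f i \<oplus> \<ominus> (f i)) \<oplus> \<ominus> (p0 \<otimes> z')"
        using z fc p0_carrier by (simp only: a_assoc a_inv_closed m_closed a_closed)
      also have "\<dots> = p0 \<otimes> (z \<ominus> z')" using z fc p0_carrier by (simp add: r_neg a_minus_def r_distr r_minus)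
      finally show ?thesis .
    qed
    hence d: "x [^] i \<ominus> x [^] j \<in> P" using pc[of "z \<ominus> z'"] z by simp
    obtain n where n: "i = j + Suc n" using \<open>j < i\<close> by (metis less_iff_Suc_add add_Suc_right)
    have "x [^] i \<ominus> x [^] j = x [^] j \<otimes> (x \<otimes> x [^] n \<ominus> \<one>)"
      unfolding n using x by (simp add: nat_pow_mult[symmetric] a_minus_def r_distr r_minus m_ac)
    hence "x [^] j \<otimes> (x \<otimes> x [^] n \<ominus> \<one>) \<in> P" using d by simp
    hence "x \<otimes> x [^] n \<ominus> \<one> \<in> P"
      using primeideal.I_prime[OF prime, of "x [^] j" "x \<otimes> x [^] n \<ominus> \<one>"] pow_notin_P[OF x] x by auto
    thus ?thesis using x by blast
  qed
  show ?thesis using main[of i j] main[of j i] ij by (cases "j < i") auto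
qed

text \<open>Inverses are lifted by multiplying errors: \<open>(x v - 1) (x w - 1) = 1 - x t\<close>
  for the new approximation \<open>t\<close>, and the second error lies in \<open>P\<close>.\<close>

lemma unit_mod_J: assumes x: "x \<in> carrier R" "x \<notin> P" shows "\<exists>v\<in>carrier R. x \<otimes> v \<ominus> \<one> \<in> J k"
proof (induction k)
  case 0 thus ?case using x by (auto simp: ideal_power_0)
next
  case (Suc k)
  obtain v where v: "v \<in> carrier R" "x \<otimes> v \<ominus> \<one> \<in> J k" using Suc by blast
  obtain w where w: "w \<in> carrier R" "x \<otimes> w \<ominus> \<one> \<in> P" using unit_mod_P[OF x] by blast
  let ?t = "v \<oplus> w \<ominus> x \<otimes> (v \<otimes> w)"
  have "\<ominus> ((x \<otimes> v \<ominus> \<one>) \<otimes> (x \<otimes> w \<ominus> \<one>)) \<in> J (Suc k)" by (intro J_neg J_prod v w)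
  also have "\<ominus> ((x \<otimes> v \<ominus> \<one>) \<otimes> (x \<otimes> w \<ominus> \<one>)) = x \<otimes> ?t \<ominus> \<one>"
    using x v(1) w(1) by algebra
  finally show ?case using x v w by blast
qed

text \<open>\<open>u\<close> is invertible modulo \<open>J N\<close>, so it can be removed from
  \<open>divisible\<close>: modulo \<open>J N\<close> the prime is generated by
  \<open>pi\<close>.\<close>

lemma P_eq: assumes x: "x \<in> P" shows "\<exists>r\<in>carrier R. \<exists>e\<in>J N. x = pi \<otimes> r \<oplus> e"
proof -
  obtain v where v: "v \<in> carrier R" "u \<otimes> v \<ominus> \<one> \<in> J N" using unit_mod_J[OF u] by blast
  obtain y where y: "y \<in> carrier R" "u \<otimes> x = pi \<otimes> y" using divisible[OF x] by blast
  have xc: "x \<in> carrier R" using P_carrier[OF x] .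
  have e: "\<ominus> (x \<otimes> (u \<otimes> v \<ominus> \<one>)) \<in> J N" by (intro J_neg J_mult v xc)
  have "x = (u \<otimes> x) \<otimes> v \<oplus> \<ominus> (x \<otimes> (u \<otimes> v \<ominus> \<one>))" using xc u v(1) by algebra
  also have "(u \<otimes> x) \<otimes> v = pi \<otimes> (y \<otimes> v)" unfolding y using y v pi_carrier by (simp add: m_assoc)
  finally show ?thesis using e y v by blast
qed

section \<open>The quotient ring\<close>

abbreviation Q :: "nat \<Rightarrow> 'a set ring" where "Q N \<equiv> R Quot J N"

lemma Q_carrier: "carrier (Q N) = (\<lambda>x. J N +> x) ` carrier R"
  by (auto simp: FactRing_def A_RCOSETS_defs a_r_coset_def)

lemma coset_eq_iff:
  assumes "x \<in> carrier R" "y \<in> carrier R"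
  shows "J N +> x = J N +> y \<longleftrightarrow> x \<ominus> y \<in> J N"
  using quotient_eq_iff_same_a_r_cos[OF ideal_J assms] by blast

lemma coset_mult: "x \<in> carrier R \<Longrightarrow> y \<in> carrier R \<Longrightarrow> (J N +> x) \<otimes>\<^bsub>Q N\<^esub> (J N +> y) = J N +> (x \<otimes> y)"
  by (simp add: FactRing_def ideal.rcoset_mult_add[OF ideal_J])

lemma coset_add: "x \<in> carrier R \<Longrightarrow> y \<in> carrier R \<Longrightarrow> (J N +> x) \<oplus>\<^bsub>Q N\<^esub> (J N +> y) = J N +> (x \<oplus> y)"
proof -
  interpret J: ideal "J N" R by (rule ideal_J)
  assume "x \<in> carrier R" "y \<in> carrier R"
  thus ?thesis by (simp add: FactRing_def J.a_rcos_sum)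
qed

lemma coset_one: "\<one>\<^bsub>Q N\<^esub> = J N +> \<one>"
  by (simp add: FactRing_def)

lemma coset_zero: "\<zero>\<^bsub>Q N\<^esub> = J N +> \<zero>"
  using J_carrier by (force simp: FactRing_def a_r_coset_def' )

lemma cring_Q: "cring (Q N)"
  by (rule ideal.quotient_is_cring[OF ideal_J is_cring])

lemma coset_pow: "x \<in> carrier R \<Longrightarrow> (J N +> x) [^]\<^bsub>Q N\<^esub> (k::nat) = J N +> (x [^] k)"
proof (induction k)
  case 0
  interpret Q: cring "Q N" by (rule cring_Q)
  show ?case by (simp add: coset_one)
next
  case (Suc k)
  interpret Q: cring "Q N" by (rule cring_Q)
  show ?case using Suc by (simp add: coset_mult)
qed

lemma coset_eq_zero: "x \<in> carrier R \<Longrightarrow> J N +> x = \<zero>\<^bsub>Q N\<^esub> \<longleftrightarrow> x \<in> J N"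
  unfolding coset_zero using coset_eq_iff[of x \<zero> N] by (simp add: a_minus_def)

theorem chain_ring_Q: "chain_ring (Q N) (J N +> pi) N (card (carrier (R Quot P)))"
proof -
  interpret Q: cring "Q N" by (rule cring_Q)
  have mem: "J N +> x \<in> carrier (Q N)" if "x \<in> carrier R" for x unfolding Q_carrier using that by blast
  have fin: "finite (carrier (Q N))"
  proof -
    obtain S where S: "finite S" "S \<subseteq> carrier R" "\<And>y. y \<in> carrier R \<Longrightarrow> \<exists>t\<in>S. \<exists>z\<in>carrier R. y = t \<oplus> p0 [^] N \<otimes> z"
      using sum_reps[of N] by blast
    have "carrier (Q N) \<subseteq> (\<lambda>x. J N +> x) ` S"
    proof
      fix C assume "C \<in> carrier (Q N)"
      then obtain y where y: "y \<in> carrier R" "C = J N +> y" unfolding Q_carrier by blast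
      obtain t z where t: "t \<in> S" "z \<in> carrier R" "y = t \<oplus> p0 [^] N \<otimes> z" using S(3)[OF y(1)] by blast
      have tc: "t \<in> carrier R" using t S by auto
      have "y \<ominus> t = z \<otimes> p0 [^] N" unfolding t(3) using tc t(2) p0_carrier nat_pow_closed[OF p0_carrier, of N] by algebra
      hence "y \<ominus> t \<in> J N" using J_mult[OF pow_J[OF p0] t(2)] by simp
      hence "J N +> y = J N +> t" using coset_eq_iff y(1) tc by blast
      thus "C \<in> (\<lambda>x. J N +> x) ` S" using y t by blast
    qed
    thus ?thesis using S(1) finite_surj by blast
  qed
  have pR: "(\<lambda>C. (J N +> pi) \<otimes>\<^bsub>Q N\<^esub> C) ` carrier (Q N) = (\<lambda>x. J N +> x) ` (if N = 0 then carrier R else P)" (is "?L = ?R")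
  proof
    have pP: "pi \<otimes> r \<in> (if N = 0 then carrier R else P)" if "r \<in> carrier R" for r
      using ideal.I_r_closed[OF ideal_P pi(1) that] pi_carrier that by simp
    show "?L \<subseteq> ?R"
    proof
      fix C assume "C \<in> ?L"
      then obtain r where r: "r \<in> carrier R" "C = (J N +> pi) \<otimes>\<^bsub>Q N\<^esub> (J N +> r)" unfolding Q_carrier by blast
      hence "C = J N +> (pi \<otimes> r)" using coset_mult pi_carrier by simp
      thus "C \<in> ?R" using pP[OF r(1)] by blast
    qed
    show "?R \<subseteq> ?L"
    proof
      fix C assume "C \<in> ?R"
      then obtain x where x: "x \<in> (if N = 0 then carrier R else P)" "C = J N +> x" by blast
      have xc: "x \<in> carrier R" using x P_carrier by (auto split: if_splits)
      have "\<exists>r\<in>carrier R. \<exists>e\<in>J N. x = pi \<otimes> r \<oplus> e"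
      proof (cases "N = 0")
        case True
        have "x = pi \<otimes> \<zero> \<oplus> x" using xc pi_carrier by simp
        moreover have "x \<in> J N" using True xc by (simp add: ideal_power_0)
        ultimately show ?thesis by blast
      next
        case False thus ?thesis using P_eq x by simp
      qed
      then obtain r e where r: "r \<in> carrier R" "e \<in> J N" "x = pi \<otimes> r \<oplus> e" by blast
      have ec: "e \<in> carrier R" using J_carrier r by blast
      have "x \<ominus> pi \<otimes> r = e" unfolding r(3) using r(1) ec pi_carrier by algebra
      hence "C = J N +> (pi \<otimes> r)" using x(2) coset_eq_iff[of x "pi \<otimes> r" N] xc r pi_carrier by simp
      hence "C = (J N +> pi) \<otimes>\<^bsub>Q N\<^esub> (J N +> r)" using coset_mult pi_carrier r by simp
      thus "C \<in> ?L" using mem[OF r(1)] by blast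
    qed
  qed
  show ?thesis
  proof (unfold_locales)
    show "finite (carrier (Q N))" by (rule fin)
    show "J N +> pi \<in> carrier (Q N)" by (rule mem[OF pi_carrier])
    show "(J N +> pi) [^]\<^bsub>Q N\<^esub> N = \<zero>\<^bsub>Q N\<^esub>"
      unfolding coset_pow[OF pi_carrier] using coset_eq_zero[of "pi [^] N" N] pow_J[OF pi(1), of N] pi_carrier by simp
    show "(J N +> pi) [^]\<^bsub>Q N\<^esub> k \<noteq> \<zero>\<^bsub>Q N\<^esub>" if "k < N" for k
      unfolding coset_pow[OF pi_carrier] using coset_eq_zero[of "pi [^] k" N] pi_pow_notin[of k] J_antimono[of "Suc k" N] that pi_carrier
      by auto
    show "C \<in> Units (Q N)" if C: "C \<in> carrier (Q N)" "C \<notin> (\<lambda>C. (J N +> pi) \<otimes>\<^bsub>Q N\<^esub> C) ` carrier (Q N)" for C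
    proof -
      obtain x where x: "x \<in> carrier R" "C = J N +> x" using C(1) unfolding Q_carrier by blast
      have "x \<notin> P" using C(2) x unfolding pR by auto
      then obtain v where v: "v \<in> carrier R" "x \<otimes> v \<ominus> \<one> \<in> J N" using unit_mod_J[OF x(1)] by blast
      have "C \<otimes>\<^bsub>Q N\<^esub> (J N +> v) = \<one>\<^bsub>Q N\<^esub>"
        unfolding x(2) coset_mult[OF x(1) v(1)] coset_one using coset_eq_iff[of "x \<otimes> v" \<one> N] v x by simp
      moreover from this have "(J N +> v) \<otimes>\<^bsub>Q N\<^esub> C = \<one>\<^bsub>Q N\<^esub>"
        unfolding Q.m_comm[OF mem[OF v(1)] C(1)] .
      ultimately show ?thesis unfolding Units_def using C(1) mem[OF v(1)] by blast
    qed
    assume N: "N > 0"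
    have JP: "J N \<subseteq> P" using J_antimono[of "Suc 0" N] N J_1 by simp
    have fP: "P +> x = P +> y \<longleftrightarrow> x \<ominus> y \<in> P" if "x \<in> carrier R" "y \<in> carrier R" for x y
      using quotient_eq_iff_same_a_r_cos[OF ideal_P that] by blast
    \<comment> \<open>\<open>f\<close> is the projection onto the quotient by \<open>P\<close>. Its
      fibres are the cosets of the ideal generated by \<open>pi\<close>, which gives the index
      required by \<open>residue\<close>.\<close>
    define f where "f = (\<lambda>C. P +> (SOME x. x \<in> carrier R \<and> C = J N +> x))"
    have f: "f (J N +> x) = P +> x" if x: "x \<in> carrier R" for x
    proof -
      let ?y = "SOME y. y \<in> carrier R \<and> J N +> x = J N +> y"
      have y: "?y \<in> carrier R \<and> J N +> x = J N +> ?y" by (rule someI[of _ x]) (simp add: x)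
      hence "x \<ominus> ?y \<in> P" using coset_eq_iff[OF x, of ?y N] JP by blast
      thus ?thesis unfolding f_def using fP[OF x, of ?y] y by simp
    qed
    have img: "f ` carrier (Q N) = carrier (R Quot P)"
    proof -
      have "f ` carrier (Q N) = (\<lambda>x. P +> x) ` carrier R" unfolding Q_carrier image_image using f by (intro image_cong refl)
      also have "\<dots> = carrier (R Quot P)" by (auto simp: FactRing_def A_RCOSETS_defs a_r_coset_def)
      finally show ?thesis .
    qed
    let ?pR = "(\<lambda>C. (J N +> pi) \<otimes>\<^bsub>Q N\<^esub> C) ` carrier (Q N)"
    have pR': "?pR = (\<lambda>x. J N +> x) ` P" using pR N by simp
    have "card (carrier (Q N)) = card ?pR * card (f ` carrier (Q N))"
    proof (rule card_eq_fibres[OF fin])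
      fix C assume "C \<in> carrier (Q N)"
      then obtain x where x: "x \<in> carrier R" "C = J N +> x" unfolding Q_carrier by blast
      have Cc: "C \<in> carrier (Q N)" using mem x by simp
      have sub: "?pR \<subseteq> carrier (Q N)" unfolding pR' using mem P_carrier by blast
      have "inj_on (\<lambda>D. C \<oplus>\<^bsub>Q N\<^esub> D) ?pR"
        by (rule inj_onI) (use sub Cc Q.add.l_cancel in \<open>meson subsetD\<close>)
      moreover have img_eq: "(\<lambda>D. C \<oplus>\<^bsub>Q N\<^esub> D) ` ?pR = {D \<in> carrier (Q N). f D = f C}"
      proof
        show "(\<lambda>D. C \<oplus>\<^bsub>Q N\<^esub> D) ` ?pR \<subseteq> {D \<in> carrier (Q N). f D = f C}"
        proof
          fix D assume "D \<in> (\<lambda>D. C \<oplus>\<^bsub>Q N\<^esub> D) ` ?pR"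
          then obtain y where y: "y \<in> P" "D = C \<oplus>\<^bsub>Q N\<^esub> (J N +> y)" unfolding pR' by blast
          have yc: "y \<in> carrier R" using P_carrier y by blast
          have D: "D = J N +> (x \<oplus> y)" unfolding y x(2) by (rule coset_add[OF x(1) yc])
          have "(x \<oplus> y) \<ominus> x = y" using x yc by algebra
          thus "D \<in> {D \<in> carrier (Q N). f D = f C}"
            using D mem[of "x \<oplus> y"] f[of "x \<oplus> y"] f[OF x(1)] fP[of "x \<oplus> y" x] x y yc by simp
        qed
        show "{D \<in> carrier (Q N). f D = f C} \<subseteq> (\<lambda>D. C \<oplus>\<^bsub>Q N\<^esub> D) ` ?pR"
        proof
          fix D assume "D \<in> {D \<in> carrier (Q N). f D = f C}"
          then obtain y where y: "y \<in> carrier R" "D = J N +> y" "f D = f C" unfolding Q_carrier by blast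
          have "y \<ominus> x \<in> P" using y f[OF y(1)] f[OF x(1)] fP[OF y(1) x(1)] x(2) by simp
          moreover have "x \<oplus> (y \<ominus> x) = y" using x y(1) by algebra
          hence "D = C \<oplus>\<^bsub>Q N\<^esub> (J N +> (y \<ominus> x))" unfolding y x(2) using coset_add[OF x(1), of "y \<ominus> x" N] y(1) x(1) by simp
          ultimately show "D \<in> (\<lambda>D. C \<oplus>\<^bsub>Q N\<^esub> D) ` ?pR" unfolding pR' by blast
        qed
      qed
      ultimately show "card {D \<in> carrier (Q N). f D = f C} = card ?pR" unfolding img_eq[symmetric] by (intro card_image)
    qed
    thus "card (carrier (Q N)) = card (carrier (R Quot P)) * card ?pR" unfolding img by (simp only: mult.commute)
  qed
qed

end

section \<open>Primes of a ring of integers\<close>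

locale num_field = field K for K :: "('a, 'b) ring_scheme" (structure) +
  assumes char0: "\<And>k::nat. k > 0 \<Longrightarrow> add_pow K k \<one> \<noteq> \<zero>"
    and findim: "finite_dimension (generate_field K {}) (carrier K)"
begin

text \<open>The canonical map from the integers, injective in characteristic zero; its range holds
  the coefficients in \<open>integral_element\<close>.\<close>

definition \<iota> :: "int \<Rightarrow> 'a" where "\<iota> z = add_pow K z \<one>"

lemma \<iota>_closed [simp]: "\<iota> z \<in> carrier K"
  by (simp add: \<iota>_def)

lemma \<iota>_0 [simp]: "\<iota> 0 = \<zero>" and \<iota>_1 [simp]: "\<iota> 1 = \<one>"
  by (simp_all add: \<iota>_def add_pow_int_ge)

lemma \<iota>_add: "\<iota> (a + b) = \<iota> a \<oplus> \<iota> b"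
  by (simp add: \<iota>_def add.int_pow_mult)

lemma \<iota>_mult: "\<iota> (a * b) = \<iota> a \<otimes> \<iota> b"
proof -
  have "\<iota> a \<otimes> \<iota> b = add_pow K a (\<one> \<otimes> \<iota> b)"
    unfolding \<iota>_def[of a] by (rule add_pow_ldistr_int) simp_all
  also have "\<dots> = \<iota> (b * a)" by (simp add: \<iota>_def add.int_pow_pow)
  finally show ?thesis by (simp add: mult.commute)
qed

lemma \<iota>_neg: "\<iota> (- a) = \<ominus> \<iota> a"
proof (rule minus_equality[symmetric])
  show "\<iota> (- a) \<oplus> \<iota> a = \<zero>" unfolding \<iota>_add[symmetric] by simp
qed simp_all

lemma \<iota>_eq_0: "\<iota> z = \<zero> \<longleftrightarrow> z = 0"
proof
  assume z: "\<iota> z = \<zero>"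
  have nat: "\<iota> (int n) = add_pow K n \<one>" for n by (simp add: \<iota>_def add_pow_int_ge)
  show "z = 0"
  proof (rule ccontr)
    assume "z \<noteq> 0"
    hence pos: "nat \<bar>z\<bar> > 0" by simp
    have "\<iota> \<bar>z\<bar> = \<zero>" using z by (cases "z \<ge> 0") (simp_all add: \<iota>_neg)
    hence "add_pow K (nat \<bar>z\<bar>) \<one> = \<zero>" using nat[of "nat \<bar>z\<bar>"] by simp
    thus False using char0[OF pos] by simp
  qed
qed simp

lemma \<iota>_inj: "\<iota> a = \<iota> b \<longleftrightarrow> a = b"
proof
  assume "\<iota> a = \<iota> b"
  hence "\<iota> (a + - b) = \<zero>" unfolding \<iota>_add \<iota>_neg by (simp add: r_neg)
  thus "a = b" by (simp add: \<iota>_eq_0)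
qed simp

section \<open>Integral elements through integer polynomials\<close>

definition evl :: "'a \<Rightarrow> int list \<Rightarrow> 'a" where
  "evl x zs = foldr (\<lambda>a b. \<iota> a \<oplus> x \<otimes> b) zs \<zero>"

text \<open>Polynomials of type \<open>int poly\<close> bring composition and degrees;
  \<open>integral_iff\<close> connects them with the coefficient lists of
  \<open>integral_element\<close>, whose order is reversed.\<close>

definition ev :: "'a \<Rightarrow> int poly \<Rightarrow> 'a" where
  "ev x p = evl x (coeffs p)"

lemma evl_closed [simp]: "x \<in> carrier K \<Longrightarrow> evl x zs \<in> carrier K"
  by (induction zs) (simp_all add: evl_def)

lemma ev_closed [simp]: "x \<in> carrier K \<Longrightarrow> ev x p \<in> carrier K"
  by (simp add: ev_def)

lemma ev_0 [simp]: "ev x 0 = \<zero>"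
  by (simp add: ev_def evl_def)

lemma ev_pCons: "x \<in> carrier K \<Longrightarrow> ev x (pCons a p) = \<iota> a \<oplus> x \<otimes> ev x p"
  by (cases "p = 0 \<and> a = 0") (auto simp: ev_def evl_def coeffs_pCons_eq_cCons cCons_def)

lemma ev_add: "x \<in> carrier K \<Longrightarrow> ev x (p + r) = ev x p \<oplus> ev x r"
proof (induction p r rule: poly_induct2)
  case (pCons a p b r)
  have "ev x (p + r) = ev x p \<oplus> ev x r" using pCons by simp
  thus ?case using pCons.prems ev_closed[OF pCons.prems, of p] ev_closed[OF pCons.prems, of r] \<iota>_closed[of a] \<iota>_closed[of b]
    unfolding add_pCons ev_pCons[OF pCons.prems] \<iota>_add by (simp add: r_distr a_ac)
qed simp

lemma ev_smult: "x \<in> carrier K \<Longrightarrow> ev x (Polynomial.smult a p) = \<iota> a \<otimes> ev x p"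
  by (induction p) (simp_all add: ev_pCons \<iota>_mult r_distr m_lcomm)

lemma ev_mult: "x \<in> carrier K \<Longrightarrow> ev x (p * r) = ev x p \<otimes> ev x r"
proof (induction p)
  case (pCons a p)
  hence IH: "ev x (p * r) = ev x p \<otimes> ev x r" by simp
  show ?case using pCons.prems
    unfolding mult_pCons_left ev_add[OF pCons.prems] ev_smult[OF pCons.prems] ev_pCons[OF pCons.prems] IH
    by (simp add: l_distr m_assoc)
qed simp

lemma ev_pcompose: "x \<in> carrier K \<Longrightarrow> ev x (pcompose p r) = ev (ev x r) p"
  by (induction p) (simp_all add: pcompose_pCons ev_add ev_mult ev_pCons)

lemma ev_monom: "x \<in> carrier K \<Longrightarrow> ev x (Polynomial.monom 1 n) = x [^] n"
  by (induction n) (simp_all add: monom_0 monom_Suc ev_pCons m_comm)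

lemma evl_snoc: "x \<in> carrier K \<Longrightarrow> evl x (zs @ [a]) = evl x zs \<oplus> \<iota> a \<otimes> x [^] length zs"
proof (induction zs)
  case Nil thus ?case by (simp add: evl_def)
next
  case (Cons z zs)
  have "evl x ((z # zs) @ [a]) = \<iota> z \<oplus> x \<otimes> evl x (zs @ [a])" by (simp add: evl_def)
  also have "\<dots> = (\<iota> z \<oplus> x \<otimes> evl x zs) \<oplus> \<iota> a \<otimes> (x [^] length zs \<otimes> x)"
    unfolding Cons.IH[OF Cons.prems] using Cons.prems by (simp add: r_distr a_assoc m_ac)
  also have "\<iota> z \<oplus> x \<otimes> evl x zs = evl x (z # zs)" by (simp add: evl_def)
  finally show ?case by simp
qed

lemma eval_map_\<iota>: "x \<in> carrier K \<Longrightarrow> eval (map \<iota> zs) x = evl x (rev zs)"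
proof (induction zs)
  case Nil thus ?case by (simp add: evl_def)
next
  case (Cons z zs)
  thus ?case by (simp add: evl_snoc a_comm)
qed

lemma integral_iff:
  assumes x: "x \<in> carrier K"
  shows "integral_element K x \<longleftrightarrow> (\<exists>p. Polynomial.lead_coeff p = 1 \<and> ev x p = \<zero>)"
proof
  assume "integral_element K x"
  then obtain l where l: "l \<noteq> []" "hd l = \<one>" "set l \<subseteq> range \<iota>" "eval l x = \<zero>"
    unfolding integral_element_def \<iota>_def by auto
  obtain zs where zs: "l = map \<iota> zs" using l(3) by (metis ex_map_conv subsetD rangeE)
  obtain z zs' where z: "zs = z # zs'" using l(1) zs by (cases zs) auto
  have "\<iota> z = \<iota> 1" using l(2) zs z by simp
  hence z1: "z = 1" by (simp only: \<iota>_inj)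
  define p where "p = Poly (rev zs' @ [1])"
  have c: "coeffs p = rev zs' @ [1]" by (simp add: p_def)
  have "ev x p = \<zero>" unfolding ev_def c using l(4) eval_map_\<iota>[OF x, of zs] by (simp add: zs z z1)
  moreover have "Polynomial.lead_coeff p = 1"
    using last_coeffs_eq_coeff_degree[of p] c by (metis append_is_Nil_conv coeffs_eq_Nil last_snoc not_Cons_self2)
  ultimately show "\<exists>p. Polynomial.lead_coeff p = 1 \<and> ev x p = \<zero>" by blast
next
  assume "\<exists>p. Polynomial.lead_coeff p = 1 \<and> ev x p = \<zero>"
  then obtain p where p: "Polynomial.lead_coeff p = 1" "ev x p = \<zero>" by blast
  have p0: "p \<noteq> 0" using p by auto
  define l where "l = map \<iota> (rev (coeffs p))"
  have "l \<noteq> []" using p0 by (simp add: l_def)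
  moreover have "hd l = \<one>"
  proof -
    have "hd l = \<iota> (last (coeffs p))" using p0 by (simp add: l_def hd_map hd_rev)
    thus ?thesis using last_coeffs_eq_coeff_degree[OF p0] p by simp
  qed
  moreover have "set l \<subseteq> range \<iota>" by (auto simp: l_def)
  moreover have "eval l x = \<zero>" using eval_map_\<iota>[OF x, of "rev (coeffs p)"] p by (simp add: l_def ev_def)
  ultimately show "integral_element K x" unfolding integral_element_def \<iota>_def by blast
qed

text \<open>If \<open>p\<close> is monic and kills \<open>x [^] i \<ominus> x [^] j\<close>, then
  its composition with \<open>X^i - X^j\<close> is monic and kills \<open>x\<close>.\<close>

lemma integral_power_diff:
  assumes x: "x \<in> carrier K" and ij: "j < i" and o: "integral_element K (x [^] (i::nat) \<ominus> x [^] (j::nat))"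
  shows "integral_element K x"
proof -
  define r :: "int poly" where "r = Polynomial.monom 1 i - Polynomial.monom 1 j"
  have "ev x r \<oplus> x [^] j = x [^] i" using ev_add[OF x, of r "Polynomial.monom 1 j"] by (simp add: r_def ev_monom[OF x])
  hence r: "ev x r = x [^] i \<ominus> x [^] j"
    using x by (metis add.inv_solve_right ev_closed minus_eq nat_pow_closed)
  obtain p where p: "Polynomial.lead_coeff p = 1" "ev (x [^] i \<ominus> x [^] j) p = \<zero>"
    using o integral_iff[of "x [^] i \<ominus> x [^] j"] x by auto
  have deg: "Polynomial.degree r = i"
  proof -
    have "Polynomial.degree (- Polynomial.monom 1 j :: int poly) < Polynomial.degree (Polynomial.monom 1 i :: int poly)"
      using ij by (simp add: degree_monom_eq)
    from degree_add_eq_left[OF this] show ?thesis by (simp add: r_def degree_monom_eq)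
  qed
  have "Polynomial.lead_coeff r = 1" unfolding deg using ij by (simp add: r_def)
  hence "Polynomial.lead_coeff (pcompose p r) = 1"
    using lead_coeff_comp[of r p] deg ij p by simp
  moreover have "ev x (pcompose p r) = \<zero>" unfolding ev_pcompose[OF x] r by (rule p(2))
  ultimately show ?thesis using integral_iff[OF x] by blast
qed

section \<open>Linear dependence over the integers\<close>

lemma fraction: "x \<in> generate_field K {} \<Longrightarrow> \<exists>a b. b \<noteq> 0 \<and> \<iota> b \<otimes> x = \<iota> a"
proof (induction rule: generate_field.induct)
  case one
  have "\<iota> 1 \<otimes> \<one> = \<iota> 1" by simp
  thus ?case by (metis zero_neq_one)
next
  case (a_inv h)
  have h: "h \<in> carrier K" using a_inv generate_field_in_carrier[of "{}"] by auto
  obtain a b where ab: "b \<noteq> 0" "\<iota> b \<otimes> h = \<iota> a" using a_inv by blast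
  have "\<iota> b \<otimes> (\<ominus> h) = \<iota> (- a)" using h ab by (simp add: r_minus \<iota>_neg)
  thus ?case using ab by blast
next
  case (m_inv h)
  have h: "h \<in> carrier K" using m_inv generate_field_in_carrier[of "{}"] by auto
  obtain a b where ab: "b \<noteq> 0" "\<iota> b \<otimes> h = \<iota> a" using m_inv by blast
  have u: "h \<in> Units K" using h m_inv field_Units by blast
  have "a \<noteq> 0"
  proof
    assume "a = 0"
    hence "\<iota> b = \<zero> \<or> h = \<zero>" using ab h integral[of "\<iota> b" h] by simp
    thus False using ab m_inv \<iota>_eq_0 by simp
  qed
  moreover have "\<iota> a \<otimes> inv h = \<iota> b" unfolding ab(2)[symmetric] using h u by (simp add: m_assoc)
  ultimately show ?case by blast
next
  case (eng_add h1 h2)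
  have h: "h1 \<in> carrier K" "h2 \<in> carrier K" using eng_add generate_field_in_carrier[of "{}"] by auto
  obtain a b a' b' where ab: "b \<noteq> 0" "\<iota> b \<otimes> h1 = \<iota> a" "b' \<noteq> 0" "\<iota> b' \<otimes> h2 = \<iota> a'" using eng_add by blast
  have "\<iota> (b * b') \<otimes> (h1 \<oplus> h2) = \<iota> b' \<otimes> (\<iota> b \<otimes> h1) \<oplus> \<iota> b \<otimes> (\<iota> b' \<otimes> h2)"
    using h by (simp add: \<iota>_mult r_distr m_ac)
  also have "\<dots> = \<iota> (b' * a + b * a')" unfolding ab by (simp add: \<iota>_mult \<iota>_add)
  finally show ?case using ab by (metis mult_eq_0_iff)
next
  case (eng_mult h1 h2)
  have h: "h1 \<in> carrier K" "h2 \<in> carrier K" using eng_mult generate_field_in_carrier[of "{}"] by auto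
  obtain a b a' b' where ab: "b \<noteq> 0" "\<iota> b \<otimes> h1 = \<iota> a" "b' \<noteq> 0" "\<iota> b' \<otimes> h2 = \<iota> a'" using eng_mult by blast
  have "\<iota> (b * b') \<otimes> (h1 \<otimes> h2) = (\<iota> b \<otimes> h1) \<otimes> (\<iota> b' \<otimes> h2)"
    using h by (simp add: \<iota>_mult m_ac)
  also have "\<dots> = \<iota> (a * a')" unfolding ab by (simp add: \<iota>_mult)
  finally show ?case using ab by (metis mult_eq_0_iff)
qed simp

lemma clear_denominators:
  "set Ks \<subseteq> generate_field K {} \<Longrightarrow> \<exists>b zs. b \<noteq> 0 \<and> map (\<lambda>k. \<iota> b \<otimes> k) Ks = map \<iota> zs"
proof (induction Ks)
  case Nil
  have "map (\<lambda>k. \<iota> 1 \<otimes> k) [] = map \<iota> []" by simp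
  thus ?case by (metis zero_neq_one)
next
  case (Cons k Ks)
  obtain b zs where b: "b \<noteq> 0" "map (\<lambda>k. \<iota> b \<otimes> k) Ks = map \<iota> zs" using Cons by auto
  obtain a c where c: "c \<noteq> 0" "\<iota> c \<otimes> k = \<iota> a" using fraction[of k] Cons.prems by auto
  have cK: "set (k # Ks) \<subseteq> carrier K" using Cons.prems generate_field_in_carrier[of "{}"] by auto
  have "map (\<lambda>k. \<iota> (c * b) \<otimes> k) Ks = map (\<lambda>k. \<iota> c \<otimes> k) (map (\<lambda>k. \<iota> b \<otimes> k) Ks)"
    using cK by (auto simp: \<iota>_mult m_assoc)
  also have "\<dots> = map \<iota> (map (\<lambda>z. c * z) zs)" unfolding b by (simp add: \<iota>_mult)
  finally have "map (\<lambda>k. \<iota> (c * b) \<otimes> k) (k # Ks) = map \<iota> (b * a # map (\<lambda>z. c * z) zs)"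
    using cK c(2)[symmetric] by (simp add: \<iota>_mult m_ac)
  thus ?case using b(1) c(1) by (metis mult_eq_0_iff)
qed

lemma combine_scale:
  "c \<in> carrier K \<Longrightarrow> set Ks \<subseteq> carrier K \<Longrightarrow> set Us \<subseteq> carrier K \<Longrightarrow> length Ks = length Us \<Longrightarrow>
    combine (map (\<lambda>k. c \<otimes> k) Ks) Us = c \<otimes> combine Ks Us"
proof (induction Ks arbitrary: Us)
  case (Cons k Ks)
  then obtain u Us' where U: "Us = u # Us'" by (cases Us) auto
  have cl: "combine Ks Us' \<in> carrier K" using Cons.prems U combine_in_carrier by auto
  show ?case using Cons U cl by (simp add: r_distr m_assoc)
qed simp

text \<open>A dependence over the prime field exists by dimension; \<open>clear_denominators\<close>
  scales its coefficients into the image of the integers.\<close>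

lemma integer_dependence:
  "\<exists>d. \<forall>xs. set xs \<subseteq> carrier K \<longrightarrow> length xs > d \<longrightarrow>
     (\<exists>zs. length zs = length xs \<and> combine (map \<iota> zs) xs = \<zero> \<and> (\<exists>z\<in>set zs. z \<noteq> 0))"
proof -
  let ?F = "generate_field K {}"
  have sf: "subfield ?F K" by (rule generate_field_is_subfield) simp
  obtain d where d: "dimension d ?F (carrier K)" using findim by (auto simp: finite_dimension_def)
  have "\<exists>zs. length zs = length xs \<and> combine (map \<iota> zs) xs = \<zero> \<and> (\<exists>z\<in>set zs. z \<noteq> 0)"
    if xs: "set xs \<subseteq> carrier K" "length xs > d" for xs
  proof -
    have "dependent ?F xs" using independent_length_le_dimension[OF sf d _ xs(1)] xs(2) by force
    then obtain Ks where Ks: "length Ks = length xs" "combine Ks xs = \<zero>" "set Ks \<subseteq> ?F" "set Ks \<noteq> {\<zero>}"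
      using dependent_imp_non_trivial_combine[OF sf xs(1)] by blast
    have KsC: "set Ks \<subseteq> carrier K" using Ks(3) generate_field_in_carrier[of "{}"] by auto
    obtain b zs where b: "b \<noteq> 0" "map (\<lambda>k. \<iota> b \<otimes> k) Ks = map \<iota> zs" using clear_denominators[OF Ks(3)] by blast
    have len: "length zs = length xs" using b(2) Ks(1) by (metis length_map)
    have "combine (map \<iota> zs) xs = \<zero>" unfolding b(2)[symmetric] combine_scale[OF \<iota>_closed KsC xs(1) Ks(1)] Ks(2) by simp
    moreover have "\<exists>z\<in>set zs. z \<noteq> 0"
    proof -
      have "Ks \<noteq> []" using Ks(1) xs(2) by auto
      then obtain k where k: "k \<in> set Ks" "k \<noteq> \<zero>" using Ks(4) by (metis last_in_set empty_iff insert_iff set_empty subsetI subset_singletonD)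
      have "\<iota> b \<otimes> k \<in> set (map \<iota> zs)" unfolding b(2)[symmetric] using k by simp
      then obtain z where z: "z \<in> set zs" "\<iota> b \<otimes> k = \<iota> z" by auto
      have "z \<noteq> 0"
      proof
        assume "z = 0"
        hence "\<iota> b = \<zero> \<or> k = \<zero>" using z integral[of "\<iota> b" k] k KsC by auto
        thus False using k b \<iota>_eq_0 by simp
      qed
      thus ?thesis using z by blast
    qed
    ultimately show ?thesis using len by blast
  qed
  thus ?thesis by blast
qed

lemma combine_linear:
  "length zs = length xs \<Longrightarrow> set xs \<subseteq> carrier K \<Longrightarrow>
    combine (map (\<lambda>z. \<iota> (f z + c * g z)) zs) xs = combine (map (\<lambda>z. \<iota> (f z)) zs) xs \<oplus> \<iota> c \<otimes> combine (map (\<lambda>z. \<iota> (g z)) zs) xs"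
proof (induction zs arbitrary: xs)
  case (Cons z zs)
  then obtain u xs' where U: "xs = u # xs'" by (cases xs) auto
  have cl: "combine (map (\<lambda>z. \<iota> (f z)) zs) xs' \<in> carrier K" "combine (map (\<lambda>z. \<iota> (g z)) zs) xs' \<in> carrier K"
    using Cons.prems U by (auto intro!: combine_in_carrier)
  have u: "u \<in> carrier K" using Cons.prems U by simp
  have IH: "combine (map (\<lambda>z. \<iota> (f z + c * g z)) zs) xs' = combine (map (\<lambda>z. \<iota> (f z)) zs) xs' \<oplus> \<iota> c \<otimes> combine (map (\<lambda>z. \<iota> (g z)) zs) xs'"
    using Cons U by simp
  show ?case unfolding U using u cl IH by (simp add: \<iota>_add \<iota>_mult l_distr r_distr a_ac m_assoc)
qed simp

end

section \<open>The prime ideal and a rational prime in it\<close>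

locale num_field_prime = num_field +
  fixes P :: "'a set"
  assumes prime: "primeideal P (ring_of_integers K)" and P_nonzero: "P \<noteq> {\<zero>}"
begin

abbreviation S :: "'a set" where "S \<equiv> carrier (ring_of_integers K)"

lemma ops [simp]:
  "add (ring_of_integers K) = add K" "mult (ring_of_integers K) = mult K"
  "one (ring_of_integers K) = one K" "ring.zero (ring_of_integers K) = ring.zero K"
  by (simp_all add: ring_of_integers_def)

lemma S_def': "S = {x \<in> carrier K. integral_element K x}"
  by (simp add: ring_of_integers_def)

lemma cring_O: "cring (ring_of_integers K)"
  using prime by (rule primeideal.axioms)

lemma ideal_P: "ideal P (ring_of_integers K)"
  using prime by (rule primeideal.axioms)

lemma S_carrier: "x \<in> S \<Longrightarrow> x \<in> carrier K"
  by (simp add: S_def')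

lemma S_add: "x \<in> S \<Longrightarrow> y \<in> S \<Longrightarrow> x \<oplus> y \<in> S"
  using abelian_monoid.a_closed[OF ring.is_abelian_group[OF cring.axioms(1)[OF cring_O], THEN abelian_group.axioms(1)], of x y] by simp

lemma S_mult: "x \<in> S \<Longrightarrow> y \<in> S \<Longrightarrow> x \<otimes> y \<in> S"
  using monoid.m_closed[OF ring.is_monoid[OF cring.axioms(1)[OF cring_O]], of x y] by simp

lemma S_\<iota>: "\<iota> z \<in> S"
proof -
  have "ev (\<iota> z) [:- z, 1:] = \<zero>" by (simp add: ev_pCons \<iota>_neg l_neg)
  moreover have "Polynomial.lead_coeff [:- z, 1:] = 1" by simp
  ultimately show ?thesis using integral_iff[OF \<iota>_closed, of z] by (auto simp: S_def')
qed

lemma S_one: "\<one> \<in> S" and S_zero: "\<zero> \<in> S"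
  using S_\<iota>[of 1] S_\<iota>[of 0] by simp_all

lemma S_neg: "x \<in> S \<Longrightarrow> \<ominus> x \<in> S"
  using S_mult[OF S_\<iota>[of "- 1"], of x] S_carrier[of x] by (simp add: \<iota>_neg l_minus)

lemma S_minus: "x \<in> S \<Longrightarrow> y \<in> S \<Longrightarrow> x \<ominus> y \<in> S"
  using S_add S_neg by (simp add: a_minus_def)

lemma S_pow: "x \<in> S \<Longrightarrow> x [^] (n::nat) \<in> S"
  by (induction n) (simp_all add: S_one S_mult)

lemma P_S: "x \<in> P \<Longrightarrow> x \<in> S"
  using ideal.Icarr[OF ideal_P] .

lemma P_add: "x \<in> P \<Longrightarrow> y \<in> P \<Longrightarrow> x \<oplus> y \<in> P"
  using additive_subgroup.a_closed[OF ideal.axioms(1)[OF ideal_P], of x y] by simp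

lemma P_mult: "x \<in> P \<Longrightarrow> r \<in> S \<Longrightarrow> r \<otimes> x \<in> P"
  using ideal.I_l_closed[OF ideal_P, of x r] by simp

lemma P_zero: "\<zero> \<in> P"
  using additive_subgroup.zero_closed[OF ideal.axioms(1)[OF ideal_P]] by simp

lemma P_neg: "x \<in> P \<Longrightarrow> \<ominus> x \<in> P"
  using P_mult[OF _ S_\<iota>[of "- 1"], of x] S_carrier[OF P_S[of x]] by (simp add: \<iota>_neg l_minus)

lemma P_prime: "a \<in> S \<Longrightarrow> b \<in> S \<Longrightarrow> a \<otimes> b \<in> P \<Longrightarrow> a \<in> P \<or> b \<in> P"
  using primeideal.I_prime[OF prime, of a b] by simp

lemma one_notin_P: "\<one> \<notin> P"
  using ideal.one_imp_carrier[OF ideal_P] primeideal.I_notcarr[OF prime] by auto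

lemma ev_S: "x \<in> S \<Longrightarrow> ev x p \<in> S"
  by (induction p) (simp_all add: ev_pCons S_carrier S_zero S_add S_mult S_\<iota>)

text \<open>The lowest nonzero coefficient of an integral equation for \<open>x \<in> P\<close> lies
  in \<open>P\<close>; zero coefficients below it are removed by cancelling
  \<open>x \<noteq> \<zero>\<close>.\<close>

lemma integer_in_P: "\<exists>n::int. n \<noteq> 0 \<and> \<iota> n \<in> P"
proof -
  obtain x where x: "x \<in> P" "x \<noteq> \<zero>" using P_nonzero P_zero by blast
  have xS: "x \<in> S" and xK: "x \<in> carrier K" using P_S x S_carrier by auto
  obtain p where p: "Polynomial.lead_coeff p = 1" "ev x p = \<zero>" using xS integral_iff[OF xK] by (auto simp: S_def')
  have "p \<noteq> 0 \<Longrightarrow> ev x p = \<zero> \<Longrightarrow> ?thesis" for p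
  proof (induction p)
    case (pCons a p)
    have e: "\<iota> a \<oplus> x \<otimes> ev x p = \<zero>" using pCons.prems by (simp add: ev_pCons[OF xK])
    show ?case
    proof (cases "a = 0")
      case True
      hence "x \<otimes> ev x p = \<zero>" using e xK by simp
      hence "ev x p = \<zero>" using integral[of x "ev x p"] xK x by auto
      thus ?thesis using pCons True by auto
    next
      case False
      have "x \<otimes> ev x p \<in> P" using P_mult[OF x(1) ev_S[OF xS, of p]] xK by (simp add: m_comm)
      moreover have "\<iota> a = \<ominus> (x \<otimes> ev x p)" using e xK by (metis \<iota>_closed ev_closed m_closed minus_equality minus_minus)
      ultimately show ?thesis using False P_neg by metis
    qed
  qed simp
  moreover have "p \<noteq> 0" using p by auto
  ultimately show ?thesis using p by blast
qed

lemma prime_in_P: "\<exists>p::nat. Factorial_Ring.prime p \<and> \<iota> (int p) \<in> P"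
proof -
  obtain n where n: "n \<noteq> 0" "\<iota> n \<in> P" using integer_in_P by blast
  have "\<iota> \<bar>n\<bar> \<in> P" using n P_neg[OF n(2)] by (cases "n \<ge> 0") (simp_all add: \<iota>_neg)
  hence m: "nat \<bar>n\<bar> > 0" "\<iota> (int (nat \<bar>n\<bar>)) \<in> P" using n by simp_all
  have "m > 0 \<Longrightarrow> \<iota> (int m) \<in> P \<Longrightarrow> ?thesis" for m :: nat
  proof (induction m rule: less_induct)
    case (less m)
    show ?case
    proof (cases "m = 1")
      case True thus ?thesis using less.prems one_notin_P by simp
    next
      case False
      then obtain r where r: "Factorial_Ring.prime r" "r dvd m" using prime_factor_nat by blast
      then obtain l where l: "m = r * l" by blast
      have "\<iota> (int r) \<in> P \<or> \<iota> (int l) \<in> P"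
        using P_prime[OF S_\<iota> S_\<iota>, of "int r" "int l"] less.prems unfolding l by (simp add: \<iota>_mult)
      moreover have "l < m" "l > 0" using l less.prems prime_gt_1_nat[OF r(1)] by auto
      ultimately show ?thesis using r less.IH[of l] by blast
    qed
  qed
  thus ?thesis using m by blast
qed

end

context num_field_prime begin

lemma domain_O: "domain (ring_of_integers K)"
proof -
  have "\<And>a b. a \<otimes> b = \<zero> \<Longrightarrow> a \<in> S \<Longrightarrow> b \<in> S \<Longrightarrow> a = \<zero> \<or> b = \<zero>"
    using integral S_carrier by blast
  thus ?thesis unfolding domain_def domain_axioms_def using cring_O one_not_zero by simp
qed

lemma diff_diff_cancel: "a \<in> carrier K \<Longrightarrow> b \<in> carrier K \<Longrightarrow> a \<oplus> \<ominus> (a \<ominus> b) = b"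
  by (simp add: a_minus_def minus_add a_assoc[symmetric] r_neg)

lemma diff_triangle:
  "a \<in> carrier K \<Longrightarrow> b \<in> carrier K \<Longrightarrow> t \<in> carrier K \<Longrightarrow> (a \<ominus> t) \<oplus> \<ominus> (b \<ominus> t) = a \<ominus> b"
  by (simp add: a_minus_def minus_add a_comm[of "\<ominus> b" t] a_assoc r_neg1)

lemma combine_S: "set xs \<subseteq> S \<Longrightarrow> combine (map \<iota> zs) xs \<in> S"
proof (induction zs arbitrary: xs)
  case (Cons z zs)
  thus ?case by (cases xs) (simp_all add: S_zero S_add S_mult S_\<iota>)
qed (simp add: S_zero)

end

section \<open>Finiteness modulo p and a local generator\<close>

locale num_field_residue = num_field_prime +
  fixes p :: nat
  assumes p_prime: "Factorial_Ring.prime p" and p_in_P: "\<iota> (int p) \<in> P"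
begin

definition pO :: "'a set" where "pO = (\<lambda>y. \<iota> (int p) \<otimes> y) ` S"

lemma pO_S: "x \<in> pO \<Longrightarrow> x \<in> S"
  by (auto simp: pO_def intro!: S_mult S_\<iota>)

lemma pO_carrier: "x \<in> pO \<Longrightarrow> x \<in> carrier K"
  by (intro S_carrier pO_S)

lemma pO_I: "y \<in> S \<Longrightarrow> \<iota> (int p) \<otimes> y \<in> pO"
  by (auto simp: pO_def)

lemma pO_P: "x \<in> pO \<Longrightarrow> x \<in> P"
proof -
  assume "x \<in> pO"
  then obtain y where y: "y \<in> S" "x = \<iota> (int p) \<otimes> y" by (auto simp: pO_def)
  show "x \<in> P" using P_mult[OF p_in_P y(1)] y S_carrier[OF y(1)] by (simp add: m_comm)
qed

lemma pO_add: "x \<in> pO \<Longrightarrow> y \<in> pO \<Longrightarrow> x \<oplus> y \<in> pO"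
proof -
  assume "x \<in> pO" "y \<in> pO"
  then obtain x' y' where xy: "x' \<in> S" "x = \<iota> (int p) \<otimes> x'" "y' \<in> S" "y = \<iota> (int p) \<otimes> y'" by (auto simp: pO_def)
  have "x \<oplus> y = \<iota> (int p) \<otimes> (x' \<oplus> y')" using xy S_carrier by (simp add: r_distr)
  thus "x \<oplus> y \<in> pO" using pO_I[OF S_add[OF xy(1,3)]] by simp
qed

lemma pO_mult: "x \<in> pO \<Longrightarrow> r \<in> S \<Longrightarrow> r \<otimes> x \<in> pO"
proof -
  assume "x \<in> pO" and r: "r \<in> S"
  then obtain x' where x: "x' \<in> S" "x = \<iota> (int p) \<otimes> x'" by (auto simp: pO_def)
  have "r \<otimes> x = \<iota> (int p) \<otimes> (r \<otimes> x')" using x r S_carrier by (simp add: m_lcomm)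
  thus "r \<otimes> x \<in> pO" using pO_I[OF S_mult[OF r x(1)]] by simp
qed

lemma pO_neg: "x \<in> pO \<Longrightarrow> \<ominus> x \<in> pO"
  using pO_mult[OF _ S_\<iota>[of "- 1"], of x] pO_carrier[of x] by (simp add: \<iota>_neg l_minus)

lemma pO_zero: "\<zero> \<in> pO"
  using pO_I[OF S_zero] by simp

lemma p_nonzero: "\<iota> (int p) \<noteq> \<zero>"
  using p_prime by (simp add: \<iota>_eq_0 prime_gt_0_nat)

text \<open>Linear independence over the prime field in \<open>\<O>/p\<O>\<close>.\<close>

definition pind :: "'a list \<Rightarrow> bool" where
  "pind xs \<longleftrightarrow> set xs \<subseteq> S \<and>
     (\<forall>zs. length zs = length xs \<longrightarrow> combine (map \<iota> zs) xs \<in> pO \<longrightarrow> (\<forall>z\<in>set zs. int p dvd z))"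

text \<open>All coefficients are divisible by \<open>p\<close>, and cancelling \<open>p\<close>
  leaves a relation of the same kind, so the argument repeats.\<close>

lemma pind_power_dvd:
  assumes "pind xs" "length zs = length xs" "combine (map \<iota> zs) xs = \<zero>" "z \<in> set zs"
  shows "int p ^ k dvd z"
  using assms(2-)
proof (induction k arbitrary: zs z)
  case (Suc k)
  have xs: "set xs \<subseteq> carrier K" using assms(1) S_carrier by (auto simp: pind_def)
  have dvd: "\<forall>z\<in>set zs. int p dvd z" using assms(1) Suc.prems pO_zero unfolding pind_def by metis
  define zs' where "zs' = map (\<lambda>z. z div int p) zs"
  have zs: "zs = map (\<lambda>z. int p * z) zs'" unfolding zs'_def map_map using dvd by (intro map_idI[symmetric]) auto
  have len: "length zs' = length xs" using Suc.prems by (simp add: zs'_def)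
  have "map \<iota> zs = map (\<lambda>k. \<iota> (int p) \<otimes> k) (map \<iota> zs')" unfolding zs by (simp add: \<iota>_mult)
  hence "\<iota> (int p) \<otimes> combine (map \<iota> zs') xs = \<zero>"
    using combine_scale[of "\<iota> (int p)" "map \<iota> zs'" xs] xs len Suc.prems by (simp add: image_subset_iff)
  moreover have "combine (map \<iota> zs') xs \<in> carrier K" using xs by (intro combine_in_carrier) auto
  ultimately have "combine (map \<iota> zs') xs = \<zero>" using integral[of "\<iota> (int p)"] p_nonzero by auto
  moreover have "z div int p \<in> set zs'" using Suc.prems by (simp add: zs'_def)
  ultimately have "int p ^ k dvd z div int p" using Suc.IH[OF len] by blast
  moreover have "z = int p * (z div int p)" using dvd Suc.prems by simp
  ultimately show ?case by (metis mult_dvd_mono dvd_refl power_Suc)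
qed simp

text \<open>A longer list has an integer relation with a coefficient \<open>z \<noteq> 0\<close>,
  which would be divisible by every power of \<open>p\<close>.\<close>

lemma pind_length_bounded: "\<exists>d. \<forall>xs. pind xs \<longrightarrow> length xs \<le> d"
proof -
  obtain d where d: "\<forall>xs. set xs \<subseteq> carrier K \<longrightarrow> length xs > d \<longrightarrow>
     (\<exists>zs. length zs = length xs \<and> combine (map \<iota> zs) xs = \<zero> \<and> (\<exists>z\<in>set zs. z \<noteq> 0))"
    using integer_dependence by blast
  have "length xs \<le> d" if xs: "pind xs" for xs
  proof (rule ccontr)
    assume "\<not> length xs \<le> d"
    hence len: "length xs > d" by simp
    have "set xs \<subseteq> carrier K" using xs S_carrier by (auto simp: pind_def)
    from d[rule_format, OF this len] obtain zs z where z: "length zs = length xs" "combine (map \<iota> zs) xs = \<zero>" "z \<in> set zs" "z \<noteq> 0"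
      by blast
    \<comment> \<open>The exponent is large enough, as 2 to the power \<open>\<bar>z\<bar>\<close>
      exceeds \<open>\<bar>z\<bar>\<close>.\<close>
    have "int p ^ nat \<bar>z\<bar> \<le> \<bar>z\<bar>" using dvd_imp_le_int[OF z(4) pind_power_dvd[OF xs z(1-3), of "nat \<bar>z\<bar>"]] by simp
    moreover have "(2::int) ^ nat \<bar>z\<bar> \<le> int p ^ nat \<bar>z\<bar>" using prime_ge_2_nat[OF p_prime] by (intro power_mono) auto
    moreover have "\<bar>z\<bar> < 2 ^ nat \<bar>z\<bar>" using of_nat_less_two_power[of "nat \<bar>z\<bar>", where ?'a = int] by simp
    ultimately show False by linarith
  qed
  thus ?thesis by blast
qed

text \<open>A longest list that is independent modulo \<open>p\<close> plays the role of a basis of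
  O/pO; the representatives are its combinations with coefficients from 0 to
  \<open>p - 1\<close>.\<close>

lemma finite_reps: "\<exists>T. finite T \<and> T \<subseteq> S \<and> (\<forall>y\<in>S. \<exists>t\<in>T. y \<ominus> t \<in> pO)"
proof -
  obtain d where d: "\<And>xs. pind xs \<Longrightarrow> length xs \<le> d" using pind_length_bounded by blast
  have "pind []" by (simp add: pind_def)
  hence "\<exists>xs. pind xs \<and> (\<forall>ys. pind ys \<longrightarrow> length ys \<le> length xs)"
    by (rule ex_has_greatest_nat[where b = "Suc d"]) (use d in \<open>simp add: less_Suc_eq_le\<close>)
  then obtain xs where xs: "pind xs" and max: "\<And>ys. pind ys \<Longrightarrow> length ys \<le> length xs" by blast
  have xsS: "set xs \<subseteq> S" and xsK: "set xs \<subseteq> carrier K" using xs S_carrier by (auto simp: pind_def)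
  define T where "T = (\<lambda>zs. combine (map \<iota> zs) xs) ` {zs. set zs \<subseteq> {0..<int p} \<and> length zs = length xs}"
  have "finite T" unfolding T_def by (intro finite_imageI finite_lists_length_eq) simp
  moreover have "T \<subseteq> S" unfolding T_def using combine_S[OF xsS] by auto
  moreover have "\<exists>t\<in>T. y \<ominus> t \<in> pO" if y: "y \<in> S" for y
  proof -
    have yK: "y \<in> carrier K" by (rule S_carrier[OF y])
    have "\<not> pind (y # xs)" using max[of "y # xs"] by auto
    then obtain ws where ws: "length ws = Suc (length xs)" "combine (map \<iota> ws) (y # xs) \<in> pO" "\<exists>z\<in>set ws. \<not> int p dvd z"
      using y xsS unfolding pind_def by auto
    then obtain z0 zs where z: "ws = z0 # zs" by (cases ws) auto
    have len: "length zs = length xs" using ws z by simp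
    define c where "c = combine (map \<iota> zs) xs"
    have cS: "c \<in> S" unfolding c_def by (rule combine_S[OF xsS])
    have cK: "c \<in> carrier K" by (rule S_carrier[OF cS])
    have rel: "\<iota> z0 \<otimes> y \<oplus> c \<in> pO" using ws z by (simp add: c_def)
    \<comment> \<open>Otherwise the relation would reduce to one for \<open>xs\<close> alone,
      against its independence; so \<open>z0\<close> can be inverted modulo
      \<open>p\<close>.\<close>
    have "\<not> int p dvd z0"
    proof
      assume "int p dvd z0"
      then obtain l where l: "z0 = int p * l" by blast
      have "\<iota> z0 \<otimes> y = \<iota> (int p) \<otimes> (\<iota> l \<otimes> y)" using yK by (simp add: l \<iota>_mult m_assoc)
      hence "\<iota> z0 \<otimes> y \<in> pO" using pO_I[OF S_mult[OF S_\<iota> y]] by simp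
      from pO_add[OF pO_neg[OF this] rel] have "c \<in> pO" using yK cK by (simp add: a_assoc[symmetric] l_neg)
      hence "\<forall>z\<in>set zs. int p dvd z" using xs len unfolding pind_def c_def by blast
      thus False using ws(3) z \<open>int p dvd z0\<close> by auto
    qed
    hence "coprime (int p) z0" using p_prime by (intro prime_imp_coprime) auto
    hence "gcd (int p) z0 = 1" by simp
    then obtain l v where "l * int p + v * z0 = 1" using bezout_int[of "int p" z0] by auto
    hence lv: "int p * l + v * z0 = 1" by (simp add: mult.commute)
    have "\<iota> (int p * l + v * z0) \<otimes> y = \<iota> (int p) \<otimes> (\<iota> l \<otimes> y) \<oplus> \<iota> v \<otimes> (\<iota> z0 \<otimes> y)"
      using yK by (simp add: \<iota>_add \<iota>_mult l_distr m_assoc)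
    hence y_eq: "y = \<iota> (int p) \<otimes> (\<iota> l \<otimes> y) \<oplus> \<iota> v \<otimes> (\<iota> z0 \<otimes> y)"
      unfolding lv using yK by simp
    have "y \<oplus> \<iota> v \<otimes> c = (\<iota> (int p) \<otimes> (\<iota> l \<otimes> y) \<oplus> \<iota> v \<otimes> (\<iota> z0 \<otimes> y)) \<oplus> \<iota> v \<otimes> c" using y_eq by simp
    also have "\<dots> = \<iota> (int p) \<otimes> (\<iota> l \<otimes> y) \<oplus> \<iota> v \<otimes> (\<iota> z0 \<otimes> y \<oplus> c)" using yK cK by (simp add: r_distr a_assoc)
    also have "\<dots> \<in> pO" by (intro pO_add pO_I pO_mult S_mult S_\<iota> y rel)
    finally have y1: "y \<oplus> \<iota> v \<otimes> c \<in> pO" .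
    \<comment> \<open>The coefficients of \<open>\<iota> (- v) \<otimes> c\<close> are reduced
      modulo \<open>p\<close>; the quotients collect in \<open>e\<close>, and
      \<open>\<iota> (int p) \<otimes> e\<close> lies in \<open>pO\<close>.\<close>
    define t where "t = combine (map \<iota> (map (\<lambda>z. (- v * z) mod int p) zs)) xs"
    define e where "e = combine (map \<iota> (map (\<lambda>z. (- v * z) div int p) zs)) xs"
    have eS: "e \<in> S" unfolding e_def by (rule combine_S[OF xsS])
    have tS: "t \<in> S" unfolding t_def by (rule combine_S[OF xsS])
    have "combine (map \<iota> (map (\<lambda>z. - v * z) zs)) xs = \<iota> (- v) \<otimes> c"
      using combine_scale[of "\<iota> (- v)" "map \<iota> zs" xs] xsK len by (simp add: c_def image_subset_iff comp_def \<iota>_mult[symmetric])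
    moreover have "combine (map (\<lambda>z. \<iota> ((- v * z) mod int p + int p * ((- v * z) div int p))) zs) xs = t \<oplus> \<iota> (int p) \<otimes> e"
      using combine_linear[OF len xsK, of "\<lambda>z. (- v * z) mod int p" "int p" "\<lambda>z. (- v * z) div int p"]
      by (simp only: t_def e_def map_map comp_def)
    ultimately have te: "\<iota> (- v) \<otimes> c = t \<oplus> \<iota> (int p) \<otimes> e" by (simp only: mod_mult_div_eq map_map comp_def)
    have "y \<ominus> t = y \<oplus> \<iota> v \<otimes> c \<oplus> \<iota> (int p) \<otimes> e"
    proof -
      have "\<iota> v \<otimes> c \<oplus> (t \<oplus> \<iota> (int p) \<otimes> e) = \<zero>" unfolding te[symmetric] using cK by (simp add: \<iota>_neg l_minus r_neg)
      hence "t \<oplus> (\<iota> v \<otimes> c \<oplus> \<iota> (int p) \<otimes> e) = \<zero>" using cK S_carrier[OF eS] S_carrier[OF tS] by (simp add: a_ac)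
      hence "\<ominus> t = \<iota> v \<otimes> c \<oplus> \<iota> (int p) \<otimes> e"
        using cK S_carrier[OF eS] S_carrier[OF tS] by (intro sum_zero_eq_neg[symmetric]) (simp_all add: a_comm)
      thus ?thesis using cK yK S_carrier[OF eS] by (simp add: a_minus_def a_assoc)
    qed
    hence "y \<ominus> t \<in> pO" using pO_add[OF y1 pO_I[OF eS]] by simp
    moreover have "t \<in> T" unfolding T_def t_def
      using len prime_gt_0_nat[OF p_prime] by (intro imageI) auto
    ultimately show ?thesis by blast
  qed
  ultimately show ?thesis by blast
qed

lemma pO_triangle:
  assumes "a \<in> S" "b \<in> S" "t \<in> S" "a \<ominus> t \<in> pO" "b \<ominus> t \<in> pO"
  shows "a \<ominus> b \<in> pO"
proof -
  have "a \<ominus> b = (a \<ominus> t) \<oplus> \<ominus> (b \<ominus> t)"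
    using diff_triangle assms(1-3)[THEN S_carrier] by simp
  thus ?thesis using pO_add[OF assms(4) pO_neg[OF assms(5)]] by simp
qed

lemma pigeonhole_pO:
  fixes y :: "nat \<Rightarrow> 'a"
  assumes y: "\<And>i. y i \<in> S"
  shows "\<exists>i j. j < i \<and> y i \<ominus> y j \<in> pO"
proof -
  obtain T where T: "finite T" "T \<subseteq> S" "\<forall>y\<in>S. \<exists>t\<in>T. y \<ominus> t \<in> pO" using finite_reps by blast
  have "\<forall>i. \<exists>t. t \<in> T \<and> y i \<ominus> t \<in> pO" using T(3) y by blast
  then obtain f where f: "\<And>i. f i \<in> T \<and> y i \<ominus> f i \<in> pO" by metis
  have "\<not> inj f"
  proof
    assume "inj f"
    moreover have "finite (range f)" using T(1) f by (meson finite_subset image_subsetI)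
    ultimately show False using finite_imageD[of f UNIV] by simp
  qed
  then obtain i j where ij: "i \<noteq> j" "f i = f j" by (auto simp: inj_def)
  have fS: "f i \<in> S" using f[of i] T(2) by blast
  have fi: "y i \<ominus> f i \<in> pO" and fj: "y j \<ominus> f i \<in> pO" using f[of i] f[of j] unfolding ij(2) by blast+
  have "y i \<ominus> y j \<in> pO" "y j \<ominus> y i \<in> pO"
    using pO_triangle[OF y y fS fi fj] pO_triangle[OF y y fS fj fi] .
  moreover have "i < j \<or> j < i" using ij(1) by linarith
  ultimately show ?thesis by blast
qed

text \<open>Two powers of \<open>x\<close> agree modulo \<open>pO\<close>, so \<open>x [^] j\<close>
  times \<open>x [^] (i - j) \<ominus> \<one>\<close> lies there, and the second factor is not in
  \<open>P\<close> because \<open>x\<close> is.\<close>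

lemma P_power_annihilator:
  assumes x: "x \<in> P"
  shows "\<exists>s\<in>S. s \<notin> P \<and> (\<exists>j::nat. s \<otimes> x [^] j \<in> pO)"
proof -
  have xS: "x \<in> S" and xK: "x \<in> carrier K" using x P_S S_carrier by auto
  obtain i j :: nat where ij: "j < i" "x [^] i \<ominus> x [^] j \<in> pO" using pigeonhole_pO[of "\<lambda>i. x [^] i"] S_pow[OF xS] by blast
  define s where "s = x [^] (i - j) \<ominus> \<one>"
  have sS: "s \<in> S" unfolding s_def by (intro S_minus S_pow xS S_one)
  obtain r where r: "i - j = Suc r" using ij by (cases "i - j") auto
  have xP: "x [^] (i - j) \<in> P" unfolding r using P_mult[OF x S_pow[OF xS]] by simp
  have "s \<notin> P"
  proof
    assume "s \<in> P"
    from P_add[OF xP P_neg[OF this]] have "\<one> \<in> P" using xK by (simp add: s_def diff_diff_cancel)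
    thus False using one_notin_P by simp
  qed
  moreover have "s \<otimes> x [^] j = x [^] i \<ominus> x [^] j"
    using xK ij(1) by (simp add: s_def a_minus_def l_distr l_minus nat_pow_mult)
  ultimately show ?thesis using ij sS by (intro bexI[of _ s] conjI exI[of _ j]) simp_all
qed

lemma annihilator_start:
  assumes "finite Y" "Y \<subseteq> P"
  shows "\<exists>s\<in>S. s \<notin> P \<and> (\<forall>x\<in>Y. \<exists>j::nat. s \<otimes> x [^] j \<in> pO)"
  using assms
proof (induction Y rule: finite_induct)
  case empty
  show ?case using S_one one_notin_P by auto
next
  case (insert x Y)
  then obtain s where s: "s \<in> S" "s \<notin> P" "\<forall>x\<in>Y. \<exists>j::nat. s \<otimes> x [^] j \<in> pO" by auto
  obtain s' j where s': "s' \<in> S" "s' \<notin> P" "s' \<otimes> x [^] (j::nat) \<in> pO" using P_power_annihilator[of x] insert.prems by auto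
  have K: "s \<in> carrier K" "s' \<in> carrier K" "x \<in> carrier K"
    using s s' insert.prems P_S S_carrier by auto
  have "s \<otimes> s' \<notin> P" using P_prime[OF s(1) s'(1)] s s' by blast
  moreover have "\<exists>j::nat. (s \<otimes> s') \<otimes> z [^] j \<in> pO" if z: "z \<in> insert x Y" for z
  proof (cases "z = x")
    case True
    have "(s \<otimes> s') \<otimes> x [^] j = s \<otimes> (s' \<otimes> x [^] j)" using K by (simp add: m_assoc)
    thus ?thesis using pO_mult[OF s'(3) s(1)] True by metis
  next
    case False
    hence zY: "z \<in> Y" using z by simp
    have zK: "z \<in> carrier K" using insert.prems P_S S_carrier z by auto
    obtain l :: nat where l: "s \<otimes> z [^] l \<in> pO" using s(3) zY by blast
    have "(s \<otimes> s') \<otimes> z [^] l = s' \<otimes> (s \<otimes> z [^] l)" using K zK by (simp add: m_ac)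
    thus ?thesis using pO_mult[OF l s'(1)] by metis
  qed
  ultimately show ?case using S_mult[OF s(1) s'(1)] by blast
qed

text \<open>The elements of \<open>Y\<close> are treated in turn: \<open>b\<close> is replaced by a
  \<open>b \<otimes> x [^] l\<close> that is still outside \<open>pO\<close> while its product with
  \<open>x\<close> is not. The condition on powers over all of \<open>Z\<close> provides the
  exponents and survives each replacement.\<close>

lemma annihilator_finite:
  assumes Z: "finite Z" "Z \<subseteq> P" and "finite Y" "Y \<subseteq> Z"
  shows "\<exists>b\<in>S. b \<notin> pO \<and> (\<forall>x\<in>Z. \<exists>j::nat. b \<otimes> x [^] j \<in> pO) \<and> (\<forall>x\<in>Y. b \<otimes> x \<in> pO)"
  using assms(3,4)
proof (induction Y rule: finite_induct)
  case empty
  show ?case using annihilator_start[OF Z] pO_P by auto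
next
  case (insert x Y)
  then obtain b where b: "b \<in> S" "b \<notin> pO" "\<forall>x\<in>Z. \<exists>j::nat. b \<otimes> x [^] j \<in> pO" "\<forall>x\<in>Y. b \<otimes> x \<in> pO" by auto
  have bK: "b \<in> carrier K" using b S_carrier by simp
  have xX: "x \<in> Z" and xS: "x \<in> S" and xK: "x \<in> carrier K" using insert.prems Z P_S S_carrier by auto
  define j where "j = (LEAST j::nat. b \<otimes> x [^] j \<in> pO)"
  have j: "b \<otimes> x [^] j \<in> pO" unfolding j_def using b(3) xX by (auto intro: LeastI_ex)
  have "j \<noteq> 0" using j b(2) bK by (metis nat_pow_0 r_one)
  then obtain l where l: "j = Suc l" by (cases j) auto
  have xl: "x [^] l \<in> S" by (rule S_pow[OF xS])
  have xlK: "x [^] l \<in> carrier K" using xK by simp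
  have nonp: "b \<otimes> x [^] l \<notin> pO" using not_less_Least[of l "\<lambda>j. b \<otimes> x [^] j \<in> pO"] l j_def by simp
  have "(b \<otimes> x [^] l) \<otimes> w = x [^] l \<otimes> (b \<otimes> w)" if "w \<in> carrier K" for w
    using bK xlK that by (simp add: m_ac)
  note shift = this
  have "\<exists>j::nat. (b \<otimes> x [^] l) \<otimes> z [^] j \<in> pO" if z: "z \<in> Z" for z
  proof -
    have zK: "z \<in> carrier K" using z Z P_S S_carrier by auto
    obtain i :: nat where i: "b \<otimes> z [^] i \<in> pO" using b(3) z by blast
    have "(b \<otimes> x [^] l) \<otimes> z [^] i \<in> pO" unfolding shift[OF nat_pow_closed[OF zK]] by (rule pO_mult[OF i xl])
    thus ?thesis ..
  qed
  moreover have "(b \<otimes> x [^] l) \<otimes> z \<in> pO" if z: "z \<in> insert x Y" for z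
  proof (cases "z = x")
    case True
    have "(b \<otimes> x [^] l) \<otimes> x = b \<otimes> x [^] j" using bK xK by (simp add: l m_assoc)
    thus ?thesis using j True by simp
  next
    case False
    have zK: "z \<in> carrier K" using z insert.prems Z P_S S_carrier by auto
    show ?thesis unfolding shift[OF zK] using False z b(4) by (intro pO_mult[OF _ xl]) auto
  qed
  ultimately show ?case using S_mult[OF b(1) xl] nonp by blast
qed

text \<open>Modulo \<open>pO\<close>, which lies in \<open>P\<close>, the ideal \<open>P\<close> is
  represented by the finite set \<open>T \<inter> P\<close>, to which
  \<open>annihilator_finite\<close> applies.\<close>

lemma annihilator: "\<exists>b\<in>S. b \<notin> pO \<and> (\<forall>x\<in>P. b \<otimes> x \<in> pO)"
proof -
  obtain T where T: "finite T" "T \<subseteq> S" "\<forall>y\<in>S. \<exists>t\<in>T. y \<ominus> t \<in> pO" using finite_reps by blast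
  obtain b where b: "b \<in> S" "b \<notin> pO" "\<forall>x\<in>T \<inter> P. b \<otimes> x \<in> pO"
    using annihilator_finite[of "T \<inter> P" "T \<inter> P"] T(1) by auto
  have "b \<otimes> x \<in> pO" if x: "x \<in> P" for x
  proof -
    obtain t where t: "t \<in> T" "x \<ominus> t \<in> pO" using T(3) P_S[OF x] by blast
    have K: "x \<in> carrier K" "t \<in> carrier K" "b \<in> carrier K" using P_S[OF x] T(2) t(1) b(1) S_carrier by auto
    have "t = x \<oplus> \<ominus> (x \<ominus> t)" using K by (simp add: diff_diff_cancel)
    hence "t \<in> P" using P_add[OF x P_neg[OF pO_P[OF t(2)]]] by simp
    hence bt: "b \<otimes> t \<in> pO" using b t by blast
    have "b \<otimes> x = b \<otimes> (x \<ominus> t) \<oplus> b \<otimes> t" using K by (simp add: a_minus_def r_distr r_minus a_assoc l_neg)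
    thus ?thesis using pO_add[OF pO_mult[OF t(2) b(1)] bt] by simp
  qed
  thus ?thesis using b by blast
qed

lemma uniformizer: "\<exists>pi u. pi \<in> P \<and> pi \<noteq> \<zero> \<and> u \<in> S \<and> u \<notin> P \<and> (\<forall>x\<in>P. \<exists>y\<in>S. u \<otimes> x = pi \<otimes> y)"
proof -
  obtain b where b: "b \<in> S" "b \<notin> pO" "\<forall>x\<in>P. b \<otimes> x \<in> pO" using annihilator by blast
  let ?p = "\<iota> (int p)"
  have bK: "b \<in> carrier K" using b S_carrier by simp
  have pU: "?p \<in> Units K" using p_nonzero field_Units by simp
  define g where "g = b \<otimes> inv ?p"
  have gK: "g \<in> carrier K" unfolding g_def using bK pU by simp
  have pg: "?p \<otimes> g = b" unfolding g_def using bK pU Units_r_inv[OF pU] by (simp add: m_lcomm)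
  have gS: "g \<notin> S" using pO_I[of g] pg b(2) by auto
  have cancel: "x = y" if "?p \<otimes> x = ?p \<otimes> y" "x \<in> carrier K" "y \<in> carrier K" for x y
    using m_lcancel[OF p_nonzero, of x y] that by simp
  have gP: "g \<otimes> x \<in> S" if x: "x \<in> P" for x
  proof -
    have xK: "x \<in> carrier K" using P_S S_carrier x by simp
    obtain y where y: "y \<in> S" "b \<otimes> x = ?p \<otimes> y" using b(3) x by (auto simp: pO_def)
    have "g \<otimes> x = y" by (rule cancel) (use y gK xK S_carrier pg in \<open>simp_all add: m_assoc[symmetric]\<close>)
    thus ?thesis using y by simp
  qed
  have "\<exists>pi\<in>P. g \<otimes> pi \<notin> P"
  proof (rule ccontr)
    assume "\<not> ?thesis"
    hence gPP: "\<And>x. x \<in> P \<Longrightarrow> g \<otimes> x \<in> P" by blast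
    \<comment> \<open>If \<open>g\<close> mapped \<open>P\<close> into itself, all
      \<open>g [^] k \<otimes> ?p\<close> would lie in \<open>S\<close>. Two of them agree modulo
      \<open>pO\<close>, and cancelling \<open>?p\<close> makes
      \<open>g [^] i \<ominus> g [^] j\<close> integral, hence \<open>g\<close> as well by
      \<open>integral_power_diff\<close>.\<close>
    have "g [^] k \<otimes> ?p \<in> P" for k :: nat
    proof (induction k)
      case 0 thus ?case using p_in_P by simp
    next
      case (Suc k)
      have "g [^] Suc k \<otimes> ?p = g \<otimes> (g [^] k \<otimes> ?p)" using gK by (simp add: m_ac)
      thus ?case using gPP[OF Suc] by simp
    qed
    hence "\<And>k::nat. g [^] k \<otimes> ?p \<in> S" using P_S by blast
    from pigeonhole_pO[OF this] obtain i j :: nat where ij: "j < i" "g [^] i \<otimes> ?p \<ominus> g [^] j \<otimes> ?p \<in> pO" by blast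
    then obtain w where w: "w \<in> S" "g [^] i \<otimes> ?p \<ominus> g [^] j \<otimes> ?p = ?p \<otimes> w" by (auto simp: pO_def)
    have "g [^] i \<ominus> g [^] j = w"
    proof (rule cancel)
      show "?p \<otimes> (g [^] i \<ominus> g [^] j) = ?p \<otimes> w"
        unfolding w(2)[symmetric] using gK by (simp add: a_minus_def r_distr r_minus m_comm)
    qed (use gK w S_carrier in simp_all)
    hence "integral_element K (g [^] i \<ominus> g [^] j)" using w by (simp add: S_def')
    from integral_power_diff[OF gK ij(1) this] have "g \<in> S" using gK by (simp add: S_def')
    thus False using gS by simp
  qed
  then obtain pi where pi: "pi \<in> P" "g \<otimes> pi \<notin> P" by blast
  have piK: "pi \<in> carrier K" using pi P_S S_carrier by simp
  have "pi \<noteq> \<zero>" using pi(2) P_zero gK by auto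
  \<comment> \<open>This is the required divisibility for \<open>u = g \<otimes> pi\<close>, since
    \<open>g \<otimes> x\<close> is integral.\<close>
  moreover have "(g \<otimes> pi) \<otimes> x = pi \<otimes> (g \<otimes> x)" if "x \<in> P" for x
    using gK piK S_carrier[OF P_S[OF that]] by (simp add: m_ac)
  ultimately show ?thesis using pi gP by blast
qed

lemma local_data_O: "\<exists>pi u T. local_data (ring_of_integers K) P pi u (\<iota> (int p)) T"
proof -
  obtain pi u where pu: "pi \<in> P" "pi \<noteq> \<zero>" "u \<in> S" "u \<notin> P" "\<forall>x\<in>P. \<exists>y\<in>S. u \<otimes> x = pi \<otimes> y"
    using uniformizer by blast
  obtain T where T: "finite T" "T \<subseteq> S" "\<forall>y\<in>S. \<exists>t\<in>T. y \<ominus> t \<in> pO" using finite_reps by blast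
  have reps: "\<exists>t\<in>T. \<exists>z\<in>S. y = t \<oplus> \<iota> (int p) \<otimes> z" if y: "y \<in> S" for y
  proof -
    obtain t where t: "t \<in> T" "y \<ominus> t \<in> pO" using T(3) y by blast
    then obtain z where z: "z \<in> S" "y \<ominus> t = \<iota> (int p) \<otimes> z" by (auto simp: pO_def)
    have tK: "t \<in> carrier K" and yK: "y \<in> carrier K" using y t T(2) S_carrier by auto
    have "y = (y \<ominus> t) \<oplus> t" using yK tK by (simp add: a_minus_def a_assoc l_neg)
    hence "y = t \<oplus> (y \<ominus> t)" using yK tK by (simp add: a_comm)
    thus ?thesis using z t by auto
  qed
  have "local_data (ring_of_integers K) P pi u (\<iota> (int p)) T"
    by (intro local_data.intro domain_O local_data_axioms.intro prime) (use pu T p_in_P reps in \<open>simp_all only: ops simp_thms\<close>)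
  thus ?thesis by blast
qed

end

theorem (in num_field_prime) quotient_chain_ring:
  "\<exists>pi. chain_ring (ring_of_integers K Quot ideal_power (ring_of_integers K) P N) pi N
     (card (carrier (ring_of_integers K Quot P)))"
proof -
  obtain p where p: "Factorial_Ring.prime p" "\<iota> (int p) \<in> P" using prime_in_P by blast
  interpret num_field_residue K P p by unfold_locales (fact p)+
  obtain pi u T where "local_data (ring_of_integers K) P pi u (\<iota> (int p)) T" using local_data_O by blast
  from local_data.chain_ring_Q[OF this] show ?thesis by blast
qed

lemma (in chain_ring) zeta_irr_group_G:
  "zeta_irr (group_G m n R) s = of_nat q ^ (N * (m + n)) * rec_sum q (complex_of_nat q powr (- (s + 2))) N 0 m n"
proof -
  obtain ch where ch: "ch \<in> chars (add_monoid R)" "\<forall>x\<in>carrier R. x \<noteq> \<zero> \<longrightarrow> (\<exists>r\<in>carrier R. ch (r \<otimes> x) \<noteq> 1)"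
    using generating_char_exists by blast
  interpret unipotent R p N q ch m n
    by unfold_locales (use ch in blast)+
  show ?thesis by (rule zeta_irr_G)
qed

theorem corollary1p12:
  fixes K :: "('a, 'b) ring_scheme"
    and P :: "'a set"
    and m n q :: nat
    and s\<^sub>1 :: complex
  assumes "m \<ge> 1" and "n \<ge> 1" and "m \<le> n"
    and "number_field K"
    and "primeideal P (ring_of_integers K)"
    and "P \<noteq> {\<zero>\<^bsub>K\<^esub>}"
    and "q = card (carrier (ring_of_integers K Quot P))"
  shows "bivariate_zeta_irr m n (ring_of_integers K) P s\<^sub>1 =
           (\<Sum>w\<in>weyl_B m.
              of_int (chi m w) * fps_const (complex_of_nat q powi (- h_stat m n w)) *
              (\<Prod>i\<in>descents m w. q_monomial m n q s\<^sub>1 i)) /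
           (\<Prod>i=0..m. 1 - q_monomial m n q s\<^sub>1 i)"
proof -
  let ?Q = "\<lambda>N. ring_of_integers K Quot ideal_power (ring_of_integers K) P N"
  have "num_field K"
    using assms(4) unfolding number_field_def num_field_def num_field_axioms_def by blast
  then interpret num_field_prime K P
    using assms(5,6) by (intro num_field_prime.intro num_field_prime_axioms.intro)
  have chain: "\<exists>pi. chain_ring (?Q N) pi N q" for N
    using quotient_chain_ring[of N] unfolding assms(7) .
  have zeta: "zeta_irr (group_G m n (?Q N)) s\<^sub>1 =
      of_nat q ^ (N * (m + n)) * rec_sum q (complex_of_nat q powr (- (s\<^sub>1 + 2))) N 0 m n" for N
  proof -
    obtain pi where "chain_ring (?Q N) pi N q" using chain by blast
    from chain_ring.zeta_irr_group_G[OF this] show ?thesis .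
  qed
  \<comment> \<open>The quotient by the first power of \<open>P\<close> is a chain ring with
    \<open>N = 1\<close>; \<open>p_pow_nonzero\<close> at exponent 0 says that it is not the zero
    ring.\<close>
  have "q \<ge> 2"
  proof -
    obtain pi where "chain_ring (?Q 1) pi 1 q" using chain by blast
    then interpret c: chain_ring "?Q 1" pi 1 q .
    have "\<one>\<^bsub>?Q 1\<^esub> \<noteq> \<zero>\<^bsub>?Q 1\<^esub>" using c.p_pow_nonzero[of 0] by simp
    hence "card {\<one>\<^bsub>?Q 1\<^esub>, \<zero>\<^bsub>?Q 1\<^esub>} = 2" by simp
    moreover have "card {\<one>\<^bsub>?Q 1\<^esub>, \<zero>\<^bsub>?Q 1\<^esub>} \<le> card (carrier (?Q 1))"
      by (rule card_mono[OF c.fin]) (intro insert_subsetI c.one_closed c.zero_closed empty_subsetI)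
    moreover have "card (carrier (?Q 1)) = q" using c.card_carrier by simp
    ultimately show ?thesis by linarith
  qed
  thus ?thesis unfolding bivariate_zeta_irr_def zeta by (rule rec_sum_generating_function[OF _ assms(3)])
qed

end
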